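(* The abstract commensurator $\mathrm{Com}(F)$ of Thompson's group $F$ is isomorphic to the relative commensurator $\mathrm{Com}_P(F)$ of $F$ in $P$. Moreover, $\mathrm{Com}_P(F)$ consists of all eventually integrally periodically affine elements of $P$.
   Context: $P$ denotes the group (under composition) of all homeomorphisms $f$ from $\mathbb{R}$ to itself that (1) are piecewise linear with a discrete, possibly infinite, set of breakpoints (discontinuities of the derivative), with finitely many breakpoints in every bounded interval; (2) use only slopes that are, up to sign, integral powers of $2$ (so orientation-reversing maps are allowed); (3) have all breakpoints in $\mathbb{Z}[\frac12]$; (4) satisfy $f(\mathbb{Z}[\frac12])\subset\mathbb{Z}[\frac12]$. $P_+$ is the index-two subgroup of order-preserving elements of $P$. Thompson's group $F$ is regarded as the subgroup of $P_+$ consisting of all eventually integrally affine elements, i.e. those $f\in P_+$ for which there exist $l,r\in\mathbb{Z}$ and $M>0$ with $f(t)=t+r$ for all $t>M$ and $f(t)=t+l$ for all $t<-M$. An element $f\in P$ is eventually integrally periodically affine if there exist non-zero integers $p,q,p',q'$ and a real $M>0$ such that $f(t+p)=f(t)+q$ for all $t>M$ and $f(t+p')=f(t)+q'$ for all $t<-M$ (the pairs $(p,q)$ and $(p',q')$ may differ). A commensuration of a group $G$ is an isomorphism $\alpha\colon A\to B$ between subgroups $A,B$ of finite index in $G$. Two commensurations are equivalent if they agree on some subgroup of finite index in $G$. The product $\beta\circ\alpha$ of $\alpha\colon A\to B$ and $\beta\colon C\to D$ is defined on $\alpha^{-1}(B\cap C)$. The equivalence classes of commensurations with this product form the group $\mathrm{Com}(G)$,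 the (abstract) commensurator of $G$. If $G$ is a subgroup of $H$, then $\mathrm{Com}_H(G)$ is the group of all $h\in H$ such that $G\cap G^h$ has finite index in both $G$ and $G^h$, where $G^h=h^{-1}Gh$. *)

theory Defs
  imports "HOL-Analysis.Analysis" "HOL-Algebra.Coset"
begin

definition finite_index_subgroup :: "('a, 'b) monoid_scheme \<Rightarrow> 'a set \<Rightarrow> bool" where
  "finite_index_subgroup G A \<longleftrightarrow> subgroup A G \<and> finite (rcosets\<^bsub>G\<^esub> A)"

(* A triple (A, \<alpha>, B) stands for a map \<alpha> from A to B.  The values of \<alpha> outside A are
   not constrained: they are invisible to commens_rel below, so they do not affect the classes. *)

type_synonym 'a commensuration = "'a set \<times> ('a \<Rightarrow> 'a) \<times> 'a set"

definition commensurations :: "('a, 'b) monoid_scheme \<Rightarrow> 'a commensuration set" where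
  "commensurations G =
     {(A, \<alpha>, B). finite_index_subgroup G A \<and> finite_index_subgroup G B \<and>
                 \<alpha> \<in> iso (G\<lparr>carrier := A\<rparr>) (G\<lparr>carrier := B\<rparr>)}"

definition commens_rel :: "('a, 'b) monoid_scheme \<Rightarrow> ('a commensuration \<times> 'a commensuration) set" where
  "commens_rel G =
     {((A, \<alpha>, B), (A', \<alpha>', B')).
        (A, \<alpha>, B) \<in> commensurations G \<and> (A', \<alpha>', B') \<in> commensurations G \<and>
        (\<exists>K. finite_index_subgroup G K \<and> K \<subseteq> A \<inter> A' \<and> (\<forall>x\<in>K. \<alpha> x = \<alpha>' x))}"

(* \<beta> after \<alpha>, an isomorphism from the \<alpha>-preimage of B \<inter> C onto the \<beta>-image of B \<inter> C *)
fun commens_comp :: "'a commensuration \<Rightarrow> 'a commensuration \<Rightarrow> 'a commensuration" where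
  "commens_comp (C, \<beta>, D) (A, \<alpha>, B) = ({x \<in> A. \<alpha> x \<in> B \<inter> C}, \<beta> \<circ> \<alpha>, \<beta> ` (B \<inter> C))"

definition abstract_commensurator :: "('a, 'b) monoid_scheme \<Rightarrow> 'a commensuration set monoid" where
  "abstract_commensurator G =
     \<lparr>carrier = commensurations G // commens_rel G,
      mult = (\<lambda>Y X. \<Union>b\<in>Y. \<Union>a\<in>X. commens_rel G `` {commens_comp b a}),
      one = commens_rel G `` {(carrier G, id, carrier G)}\<rparr>"

definition conj_subgroup :: "('a, 'b) monoid_scheme \<Rightarrow> 'a set \<Rightarrow> 'a \<Rightarrow> 'a set" where
  "conj_subgroup H G h = (\<lambda>g. inv\<^bsub>H\<^esub> h \<otimes>\<^bsub>H\<^esub> g \<otimes>\<^bsub>H\<^esub> h) ` G"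

definition relative_commensurator :: "('a, 'b) monoid_scheme \<Rightarrow> 'a set \<Rightarrow> 'a set" where
  "relative_commensurator H G =
     {h \<in> carrier H.
        finite_index_subgroup (H\<lparr>carrier := G\<rparr>) (G \<inter> conj_subgroup H G h) \<and>
        finite_index_subgroup (H\<lparr>carrier := conj_subgroup H G h\<rparr>) (G \<inter> conj_subgroup H G h)}"

definition dyadic :: "real set" where
  "dyadic = {of_int a / 2 ^ n | (a::int) (n::nat). True}"

definition breakpoints :: "(real \<Rightarrow> real) \<Rightarrow> real set" where
  "breakpoints f = {x. \<not> (f differentiable (at x) \<and> isCont (deriv f) x)}"

definition piecewise_linear :: "(real \<Rightarrow> real) \<Rightarrow> bool" where
  "piecewise_linear f \<longleftrightarrow>
     (\<forall>a b. finite (breakpoints f \<inter> {a..b})) \<and>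
     (\<forall>a b. {a<..<b} \<inter> breakpoints f = {} \<longrightarrow> (\<exists>m c. \<forall>x\<in>{a<..<b}. f x = m * x + c))"

definition P_set :: "(real \<Rightarrow> real) set" where
  "P_set =
     {f. (\<exists>g. homeomorphism UNIV UNIV f g) \<and>
         piecewise_linear f \<and>
         (\<forall>x. x \<notin> breakpoints f \<longrightarrow> (\<exists>k::int. \<bar>deriv f x\<bar> = 2 powi k)) \<and>
         breakpoints f \<subseteq> dyadic \<and>
         f ` dyadic \<subseteq> dyadic}"

definition P_group :: "(real \<Rightarrow> real) monoid" where
  "P_group = \<lparr>carrier = P_set, mult = (\<circ>), one = id\<rparr>"

definition P_plus :: "(real \<Rightarrow> real) set" where
  "P_plus = {f \<in> P_set. strict_mono f}"

definition thompson_F :: "(real \<Rightarrow> real) set" where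
  "thompson_F =
     {f \<in> P_plus. \<exists>(l::int) (r::int). \<exists>M>0.
        (\<forall>t>M. f t = t + of_int r) \<and> (\<forall>t. t < - M \<longrightarrow> f t = t + of_int l)}"

definition eventually_integrally_periodically_affine :: "(real \<Rightarrow> real) \<Rightarrow> bool" where
  "eventually_integrally_periodically_affine f \<longleftrightarrow>
     (\<exists>(p::int) (q::int) (p'::int) (q'::int). \<exists>M>0.
        p \<noteq> 0 \<and> q \<noteq> 0 \<and> p' \<noteq> 0 \<and> q' \<noteq> 0 \<and>
        (\<forall>t>M. f (t + of_int p) = f t + of_int q) \<and>
        (\<forall>t. t < - M \<longrightarrow> f (t + of_int p') = f t + of_int q'))"

end

(* Let Fc be the group of compactly supported elements of F.  Modulo a finite-index normal subgroup
   containing a translation any two elements of Fc commute, since one of them can be translated off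
   the support of the other; as Fc is perfect, it lies in every subgroup of finite index, and it is
   in fact the intersection of these.  A commensuration of F therefore restricts to an automorphism
   of Fc.  For enough elements, centralizers in Fc detect nested and disjoint supports, so this
   automorphism is conjugation by a homeomorphism h of the line.

   To see that h lies in P, blow h up at a dyadic point to an increasing bijection phi that commutes
   with doubling and normalizes Fc.  The map A = phi (phi^-1 + 1) lies in P.  If phi and (hence)
   phi^-1 are not linear, comparing 2-adic denominators of consecutive breakpoints of A shows that
   these denominators grow strictly in one direction, whereas infinitely many breakpoints of A have
   the same denominator.  So h has one-sided slopes at dyadic points, and hence everywhere because
   Fc moves any point into an interval on which h is affine.

   Since nothing but the identity centralizes Fc, h is unique and conjugates all of the domain of
   the commensuration.  Conjugating a translation by h shows that h is periodically affine near
   both ends. *)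
theory Submission
  imports Defs
begin

section \<open>Piecewise linear homeomorphisms with dyadic breakpoints\<close>

text \<open>The germ of \<open>h\<close> at a dyadic point is the obstacle. Conjugation only shows
  that it commutes with doubling, and so does \<open>x\<close> times any function of period 1 in the
  binary logarithm of \<open>x\<close>, as long as the product increases. What excludes these is
  that \<open>\<phi>\<close> must respect two structures on the half line at once: it commutes with
  doubling and conjugates the addition of 1 into a map \<open>A\<close> with locally finitely many
  breaks. A break of \<open>A\<close> at \<open>\<phi> x\<close> records that the germs of
  \<open>\<phi>\<close> at \<open>x\<close> and \<open>x + 1\<close> differ by more than powers of
  two. Seen from the inverse \<open>\<psi>\<close>, an unbroken point \<open>y\<close> of
  \<open>A\<close> relates the germs of \<open>\<psi>\<close> at \<open>y\<close> and
  \<open>y + s\<close>, where \<open>s\<close> is constant along each affine piece; comparing the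
  denominator of \<open>s\<close> with those of the ends of the piece is what makes denominators
  propagate. Perfectness is verified by evaluating a homomorphism to an abelian group on maps that
  rearrange intervals of power-of-two lengths. Such values do not change under scaling, and this
  makes the value of swapping the lengths 1 and 2 equal to its own square.\<close>

definition pow2 :: "real set" where
  "pow2 = range (\<lambda>k::int. 2 powi k)"

lemma pow2_powi [intro]: "2 powi k \<in> pow2"
  by (auto simp: pow2_def)

lemma pow2_pos: "x \<in> pow2 \<Longrightarrow> x > 0"
  by (auto simp: pow2_def)

lemma pow2_mult [intro]: "x \<in> pow2 \<Longrightarrow> y \<in> pow2 \<Longrightarrow> x * y \<in> pow2"
  unfolding pow2_def by (auto simp: power_int_add [symmetric])

lemma pow2_inverse [intro]: "x \<in> pow2 \<Longrightarrow> inverse x \<in> pow2"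
  unfolding pow2_def by (auto simp: power_int_minus [symmetric])

lemma pow2_divide [intro]: "x \<in> pow2 \<Longrightarrow> y \<in> pow2 \<Longrightarrow> x / y \<in> pow2"
  by (simp add: divide_inverse pow2_inverse pow2_mult)

lemma pow2_1 [simp, intro]: "1 \<in> pow2"
  using pow2_powi[of 0] by simp

lemma pow2_2 [simp, intro]: "2 \<in> pow2"
  using pow2_powi[of 1] by simp

lemma pow2_half [simp, intro]: "1 / 2 \<in> pow2"
  by (intro pow2_divide) auto

lemma pow2_power [simp, intro]: "2 ^ n \<in> pow2"
  using pow2_powi[of "int n"] by simp

lemma dyadic_iff: "x \<in> dyadic \<longleftrightarrow> (\<exists>n::nat. 2 ^ n * x \<in> \<int>)"
proof
  assume "\<exists>n::nat. 2 ^ n * x \<in> \<int>"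
  then obtain n a where "2 ^ n * x = of_int a" by (auto elim!: Ints_cases)
  then have "x = of_int a / 2 ^ n" by (simp add: field_simps)
  then show "x \<in> dyadic" by (auto simp: dyadic_def)
next
  assume "x \<in> dyadic"
  then obtain a :: int and n :: nat where "x = of_int a / 2 ^ n" by (auto simp: dyadic_def)
  then have "2 ^ n * x = of_int a" by simp
  then show "\<exists>n::nat. 2 ^ n * x \<in> \<int>" by (metis Ints_of_int)
qed

lemma dyadic_add [intro]: "x \<in> dyadic \<Longrightarrow> y \<in> dyadic \<Longrightarrow> x + y \<in> dyadic"
proof -
  assume "x \<in> dyadic" "y \<in> dyadic"
  then obtain n m where *: "2 ^ n * x \<in> \<int>" "2 ^ m * y \<in> \<int>" by (auto simp: dyadic_iff)
  have "2 ^ m * (2 ^ n * x) \<in> \<int>" "2 ^ n * (2 ^ m * y) \<in> \<int>"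
    using * by (auto intro: Ints_mult)
  then have "2 ^ m * (2 ^ n * x) + 2 ^ n * (2 ^ m * y) \<in> \<int>"
    by (rule Ints_add)
  then have "2 ^ (n + m) * (x + y) \<in> \<int>" by (simp add: power_add algebra_simps)
  then show ?thesis by (auto simp only: dyadic_iff)
qed

lemma dyadic_mult [intro]: "x \<in> dyadic \<Longrightarrow> y \<in> dyadic \<Longrightarrow> x * y \<in> dyadic"
proof -
  assume "x \<in> dyadic" "y \<in> dyadic"
  then obtain n m where *: "2 ^ n * x \<in> \<int>" "2 ^ m * y \<in> \<int>" by (auto simp: dyadic_iff)
  have "(2 ^ n * x) * (2 ^ m * y) \<in> \<int>" using * by (rule Ints_mult)
  then have "2 ^ (n + m) * (x * y) \<in> \<int>" by (simp add: power_add algebra_simps)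
  then show ?thesis by (auto simp only: dyadic_iff)
qed

lemma dyadic_uminus [intro]: "x \<in> dyadic \<Longrightarrow> - x \<in> dyadic"
  by (auto simp: dyadic_iff)

lemma dyadic_diff [intro]: "x \<in> dyadic \<Longrightarrow> y \<in> dyadic \<Longrightarrow> x - y \<in> dyadic"
  using dyadic_add[of x "- y"] by auto

lemma dyadic_of_int [simp, intro]: "of_int k \<in> dyadic"
  unfolding dyadic_iff by (rule exI[of _ 0]) auto

lemma dyadic_0 [simp, intro]: "0 \<in> dyadic"
  using dyadic_of_int[of 0] by simp

lemma dyadic_1 [simp, intro]: "1 \<in> dyadic"
  using dyadic_of_int[of 1] by simp

lemma dyadic_Ints: "x \<in> \<int> \<Longrightarrow> x \<in> dyadic"
  by (auto elim!: Ints_cases)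

lemma dyadic_pow2 [intro]: "x \<in> pow2 \<Longrightarrow> x \<in> dyadic"
proof -
  assume "x \<in> pow2"
  then obtain k where k: "x = 2 powi k" by (auto simp: pow2_def)
  have "2 ^ nat (- k) * x \<in> \<int>"
    by (cases "k \<ge> 0") (auto simp: k power_int_def power_mult_distrib [symmetric])
  then show ?thesis by (auto simp only: dyadic_iff)
qed

lemma dyadic_divide_pow2 [intro]: "x \<in> dyadic \<Longrightarrow> y \<in> pow2 \<Longrightarrow> x / y \<in> dyadic"
  by (simp add: divide_inverse dyadic_mult dyadic_pow2 pow2_inverse)

lemma dyadic_numeral [simp, intro]: "numeral n \<in> dyadic"
  using dyadic_of_int[of "numeral n"] by simp

lemma dyadic_abs_pow2: "\<bar>a\<bar> \<in> pow2 \<Longrightarrow> a \<in> dyadic"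
  using dyadic_pow2[of "\<bar>a\<bar>"] dyadic_uminus[of "\<bar>a\<bar>"] by (cases "a \<ge> 0") auto

lemma dyadic_mult_pow2_iff: "c \<in> pow2 \<Longrightarrow> c * x \<in> dyadic \<longleftrightarrow> x \<in> dyadic"
  using dyadic_divide_pow2[of "c * x" c] pow2_pos[of c] by (auto intro: dyadic_pow2)

lemma dyadic_add_iff: "d \<in> dyadic \<Longrightarrow> x + d \<in> dyadic \<longleftrightarrow> x \<in> dyadic"
  using dyadic_diff[of "x + d" d] by auto

lemma pow2_small: assumes "e > 0" shows "\<exists>n::nat. 1 / 2 ^ n < (e::real)"
proof -
  obtain n where "1 / e < 2 ^ n" using real_arch_pow[of 2 "1 / e"] by auto
  then show ?thesis using assms by (auto simp: field_simps)
qed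

lemma dyadic_dense: assumes "a < (b::real)" shows "\<exists>d\<in>dyadic. a < d \<and> d < b"
proof -
  obtain n where n: "1 / 2 ^ n < b - a" using pow2_small[of "b - a"] assms by auto
  define d :: real where "d = of_int (floor (a * 2 ^ n) + 1) / 2 ^ n"
  have "d \<in> dyadic" unfolding d_def dyadic_def by blast
  moreover have "a * 2 ^ n < of_int (floor (a * 2 ^ n) + 1)" by linarith
  then have "a < d" unfolding d_def by (simp add: field_simps)
  moreover have "of_int (floor (a * 2 ^ n) + 1) \<le> a * 2 ^ n + 1" by linarith
  then have "d \<le> a + 1 / 2 ^ n" unfolding d_def by (simp add: field_simps)
  ultimately show ?thesis using n by force
qed

text \<open>Germs are recorded exactly, not as limits: \<open>a\<close> is the slope to the right of
  \<open>z\<close> and \<open>b\<close> the one to the left, both valid on an actual interval.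
  Composition and inversion become arithmetic with slopes, and \<open>z\<close> is a breakpoint
  exactly when \<open>a\<close> and \<open>b\<close> differ.\<close>

definition has_slopes :: "(real \<Rightarrow> real) \<Rightarrow> real \<Rightarrow> real \<Rightarrow> real \<Rightarrow> bool" where
  "has_slopes f z a b \<longleftrightarrow>
     (\<exists>e>0. \<forall>u. 0 \<le> u \<and> u < e \<longrightarrow> f (z + u) = f z + a * u \<and> f (z - u) = f z - b * u)"

text \<open>A condition on germs at single points. The finiteness of breakpoints on bounded
  intervals follows from it by compactness in \<open>P_setI\<close>, so maps obtained by gluing or
  conjugation are checked against this form.\<close>

definition locally_PL_dyadic :: "(real \<Rightarrow> real) \<Rightarrow> bool" where
  "locally_PL_dyadic f \<longleftrightarrow>
     (\<forall>z. \<exists>a b. has_slopes f z a b \<and> \<bar>a\<bar> \<in> pow2 \<and> \<bar>b\<bar> \<in> pow2 \<and> (z \<notin> dyadic \<longrightarrow> a = b))"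

lemma has_slopesE:
  assumes "has_slopes f z a b"
  obtains e where "e > 0" "\<And>u. 0 \<le> u \<Longrightarrow> u < e \<Longrightarrow> f (z + u) = f z + a * u"
    "\<And>u. 0 \<le> u \<Longrightarrow> u < e \<Longrightarrow> f (z - u) = f z - b * u"
  using assms unfolding has_slopes_def by blast

lemma has_slopes_eq_interval:
  assumes "has_slopes f z a a"
  obtains e where "e > 0" "\<And>x. \<bar>x - z\<bar> < e \<Longrightarrow> f x = f z + a * (x - z)"
proof -
  obtain e where e: "e > 0" "\<And>u. 0 \<le> u \<Longrightarrow> u < e \<Longrightarrow> f (z + u) = f z + a * u"
    "\<And>u. 0 \<le> u \<Longrightarrow> u < e \<Longrightarrow> f (z - u) = f z - a * u"
    using has_slopesE[OF assms] by blast
  have "f x = f z + a * (x - z)" if "\<bar>x - z\<bar> < e" for x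
    using e(2)[of "x - z"] e(3)[of "z - x"] that by (cases "x \<ge> z") (auto simp: algebra_simps)
  with e(1) show thesis by (rule that)
qed

lemma has_slopes_isCont: assumes "has_slopes f z a b" shows "isCont f z"
proof -
  obtain e where e: "e > 0" "\<And>u. 0 \<le> u \<Longrightarrow> u < e \<Longrightarrow> f (z + u) = f z + a * u"
    "\<And>u. 0 \<le> u \<Longrightarrow> u < e \<Longrightarrow> f (z - u) = f z - b * u"
    using has_slopesE[OF assms] by blast
  define C where "C = \<bar>a\<bar> + \<bar>b\<bar> + 1"
  have C: "C > 0" "\<bar>a\<bar> \<le> C" "\<bar>b\<bar> \<le> C" unfolding C_def by auto
  have bound: "\<bar>f x - f z\<bar> \<le> C * \<bar>x - z\<bar>" if "\<bar>x - z\<bar> < e" for x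
  proof (cases "x \<ge> z")
    case True
    then have "\<bar>f x - f z\<bar> = \<bar>a\<bar> * \<bar>x - z\<bar>"
      using e(2)[of "x - z"] that by (auto simp: abs_mult)
    then show ?thesis using C mult_right_mono[of "\<bar>a\<bar>" C "\<bar>x - z\<bar>"] by auto
  next
    case False
    then have "\<bar>f x - f z\<bar> = \<bar>b\<bar> * \<bar>x - z\<bar>"
      using e(3)[of "z - x"] that by (auto simp: abs_mult)
    then show ?thesis using C mult_right_mono[of "\<bar>b\<bar>" C "\<bar>x - z\<bar>"] by auto
  qed
  show ?thesis unfolding continuous_at_eps_delta
  proof (intro allI impI)
    fix r :: real assume r: "r > 0"
    have "\<bar>f x - f z\<bar> < r" if "\<bar>x - z\<bar> < min e (r / C)" for x
    proof -
      have "C * \<bar>x - z\<bar> < r" using that C by (auto simp: field_simps)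
      then show ?thesis using bound[of x] that by auto
    qed
    then show "\<exists>d>0. \<forall>x'. dist x' z < d \<longrightarrow> dist (f x') (f z) < r"
      using e(1) r C by (intro exI[of _ "min e (r / C)"]) (auto simp: dist_real_def)
  qed
qed

lemma has_slopes_deriv:
  assumes "has_slopes f z a b" "(f has_field_derivative d) (at z)"
  shows "a = d" "b = d"
proof -
  obtain e where e: "e > 0" "\<And>u. 0 \<le> u \<Longrightarrow> u < e \<Longrightarrow> f (z + u) = f z + a * u"
    "\<And>u. 0 \<le> u \<Longrightarrow> u < e \<Longrightarrow> f (z - u) = f z - b * u"
    using has_slopesE[OF assms(1)] by blast
  have lim: "((\<lambda>h. (f (z + h) - f z) / h) \<longlongrightarrow> d) (at 0)"
    using assms(2) by (simp add: DERIV_def)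
  have r: "((\<lambda>h. (f (z + h) - f z) / h) \<longlongrightarrow> a) (at_right 0)"
  proof (rule tendsto_eventually)
    show "\<forall>\<^sub>F h in at_right 0. (f (z + h) - f z) / h = a"
      using e(1,2) by (intro eventually_at_rightI[of 0 e]) auto
  qed
  have l: "((\<lambda>h. (f (z + h) - f z) / h) \<longlongrightarrow> b) (at_left 0)"
  proof (rule tendsto_eventually)
    have "(f (z + h) - f z) / h = b" if "h \<in> {- e<..<0}" for h
      using e(3)[of "- h"] that by auto
    then show "\<forall>\<^sub>F h in at_left 0. (f (z + h) - f z) / h = b"
      using e(1) by (intro eventually_at_leftI[of "- e" 0]) auto
  qed
  show "a = d" using tendsto_unique[OF _ r] lim by (auto simp: filterlim_at_split)
  show "b = d" using tendsto_unique[OF _ l] lim by (auto simp: filterlim_at_split)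
qed

text \<open>The derivative is locally constant on a connected interval, hence constant, and
  subtracting the corresponding linear map leaves derivative zero.\<close>

lemma locally_affine_imp_affine:
  fixes f :: "real \<Rightarrow> real"
  assumes "\<And>z. z \<in> {p<..<q} \<Longrightarrow> \<exists>e>0. \<exists>m. \<forall>x. \<bar>x - z\<bar> < e \<longrightarrow> f x = f z + m * (x - z)"
  shows "\<exists>m c. \<forall>x\<in>{p<..<q}. f x = m * x + c"
proof -
  have loc: "\<exists>e>0. \<exists>m. \<forall>x. \<bar>x - z\<bar> < e \<longrightarrow> (f has_field_derivative m) (at x)"
    if z: "z \<in> {p<..<q}" for z
  proof -
    obtain e m where e: "e > 0" "\<And>x. \<bar>x - z\<bar> < e \<Longrightarrow> f x = f z + m * (x - z)"
      using assms[OF z] by blast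
    have "(f has_field_derivative m) (at x)" if x: "\<bar>x - z\<bar> < e" for x
    proof (rule has_field_derivative_transform_within_open[of "\<lambda>x. f z + m * (x - z)" _ _ "ball z e"])
      show "((\<lambda>x. f z + m * (x - z)) has_field_derivative m) (at x)"
        by (auto intro!: derivative_eq_intros)
      show "f z + m * (y - z) = f y" if "y \<in> ball z e" for y
        using e(2)[of y] that by (simp add: dist_real_def abs_minus_commute)
    qed (use x in \<open>auto simp: dist_real_def abs_minus_commute\<close>)
    then show ?thesis using e(1) by blast
  qed
  have "deriv f constant_on {p<..<q}"
  proof (rule locally_constant_imp_constant)
    show "connected {p<..<q}" by simp
    fix z assume z: "z \<in> {p<..<q}"
    obtain e m where e: "e > 0" "\<And>x. \<bar>x - z\<bar> < e \<Longrightarrow> (f has_field_derivative m) (at x)"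
      using loc[OF z] by blast
    have "deriv f x = m" if "\<bar>x - z\<bar> < e" for x
      using e(2)[OF that] by (rule DERIV_imp_deriv)
    then show "\<exists>T. openin (top_of_set {p<..<q}) T \<and> z \<in> T \<and> (\<forall>x\<in>T. deriv f x = deriv f z)"
      using e(1) z by (intro exI[of _ "{p<..<q} \<inter> ball z e"])
        (auto simp: dist_real_def abs_minus_commute)
  qed
  then obtain m where m: "\<And>x. x \<in> {p<..<q} \<Longrightarrow> deriv f x = m" by (auto simp: constant_on_def)
  have d: "(f has_field_derivative m) (at x)" if x: "x \<in> {p<..<q}" for x
  proof -
    obtain e m' where "e > 0" "\<And>y. \<bar>y - x\<bar> < e \<Longrightarrow> (f has_field_derivative m') (at y)"
      using loc[OF x] by blast
    then have "(f has_field_derivative m') (at x)" by auto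
    then show ?thesis using m[OF x] DERIV_imp_deriv by blast
  qed
  have "\<exists>c. \<forall>x\<in>{p<..<q}. f x - m * x = c"
  proof (rule has_field_derivative_zero_constant)
    fix x assume x: "x \<in> {p<..<q}"
    show "((\<lambda>x. f x - m * x) has_field_derivative 0) (at x within {p<..<q})"
      by (rule has_field_derivative_at_within) (auto intro!: derivative_eq_intros d[OF x])
  qed simp
  then obtain c where "\<And>x. x \<in> {p<..<q} \<Longrightarrow> f x - m * x = c" by blast
  then show ?thesis by (intro exI[of _ m] exI[of _ c]) (auto simp: algebra_simps)
qed

lemma isCont_affine_right:
  fixes f :: "real \<Rightarrow> real"
  assumes "isCont f z" "e > 0" "\<And>x. x \<in> {z<..<z + e} \<Longrightarrow> f x = m * x + c"
  shows "f z = m * z + c"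
proof -
  have 1: "(f \<longlongrightarrow> f z) (at_right z)"
    using assms(1) by (auto simp: isCont_def filterlim_at_split)
  have 2: "(f \<longlongrightarrow> m * z + c) (at_right z)"
  proof (rule Lim_transform_eventually)
    show "((\<lambda>x. m * x + c) \<longlongrightarrow> m * z + c) (at_right z)" by (intro tendsto_intros)
    show "\<forall>\<^sub>F x in at_right z. m * x + c = f x"
      using assms(2,3) by (intro eventually_at_rightI[of z "z + e"]) auto
  qed
  show ?thesis using tendsto_unique[OF _ 1 2] by auto
qed

lemma isCont_affine_left:
  fixes f :: "real \<Rightarrow> real"
  assumes "isCont f z" "e > 0" "\<And>x. x \<in> {z - e<..<z} \<Longrightarrow> f x = m * x + c"
  shows "f z = m * z + c"
proof -
  have 1: "(f \<longlongrightarrow> f z) (at_left z)"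
    using assms(1) by (auto simp: isCont_def filterlim_at_split)
  have 2: "(f \<longlongrightarrow> m * z + c) (at_left z)"
  proof (rule Lim_transform_eventually)
    show "((\<lambda>x. m * x + c) \<longlongrightarrow> m * z + c) (at_left z)" by (intro tendsto_intros)
    show "\<forall>\<^sub>F x in at_left z. m * x + c = f x"
      using assms(2,3) by (intro eventually_at_leftI[of "z - e" z]) auto
  qed
  show ?thesis using tendsto_unique[OF _ 1 2] by auto
qed

lemma locally_PL_dyadic_not_breakpoint:
  assumes "has_slopes f z a a"
  shows "z \<notin> breakpoints f"
proof -
  obtain e where e: "e > 0" "\<And>x. \<bar>x - z\<bar> < e \<Longrightarrow> f x = f z + a * (x - z)"
    using has_slopes_eq_interval[OF assms] by blast
  have d: "(f has_field_derivative a) (at x)" if x: "\<bar>x - z\<bar> < e" for x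
  proof (rule has_field_derivative_transform_within_open[of "\<lambda>x. f z + a * (x - z)" _ _ "ball z e"])
    show "((\<lambda>x. f z + a * (x - z)) has_field_derivative a) (at x)"
      by (auto intro!: derivative_eq_intros)
    show "f z + a * (y - z) = f y" if "y \<in> ball z e" for y
      using e(2)[of y] that by (simp add: dist_real_def abs_minus_commute)
  qed (use x in \<open>auto simp: dist_real_def abs_minus_commute\<close>)
  have "f differentiable (at z)"
    using d[of z] e(1) by (auto simp: real_differentiable_def)
  moreover have "isCont (deriv f) z"
  proof -
    have "\<forall>\<^sub>F x in nhds z. deriv f x = a"
      unfolding eventually_nhds_metric using e(1) d
      by (auto simp: dist_real_def intro!: exI[of _ e] DERIV_imp_deriv)
    then have "isCont (deriv f) z = isCont (\<lambda>_. a) z" by (rule isCont_cong)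
    then show ?thesis by simp
  qed
  ultimately show ?thesis by (simp add: breakpoints_def)
qed

lemma locally_PL_dyadic_breakpoint_iff:
  assumes "has_slopes f z a b"
  shows "z \<in> breakpoints f \<longleftrightarrow> a \<noteq> b"
proof
  assume "z \<in> breakpoints f"
  then show "a \<noteq> b" using locally_PL_dyadic_not_breakpoint assms by blast
next
  assume ab: "a \<noteq> b"
  show "z \<in> breakpoints f"
  proof (rule ccontr)
    assume "z \<notin> breakpoints f"
    then obtain d where "(f has_field_derivative d) (at z)"
      by (auto simp: breakpoints_def real_differentiable_def)
    then show False using has_slopes_deriv[OF assms] ab by auto
  qed
qed

text \<open>There are finitely many breakpoints near \<open>z\<close>, so a punctured neighbourhood
  is free of them. The affine formulas on its two halves are joined at \<open>z\<close> by
  continuity, and each slope is read off from the derivative at a midpoint.\<close>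

lemma P_set_imp_locally_PL2:
  assumes f: "f \<in> P_set"
  shows "bij f" "locally_PL_dyadic f" "f ` dyadic \<subseteq> dyadic"
proof -
  obtain g where g: "homeomorphism UNIV UNIV f g" using f by (auto simp: P_set_def)
  show "bij f" using g by (metis bij_betw_def homeomorphism_def inj_on_inverseI UNIV_I)
  show "f ` dyadic \<subseteq> dyadic" using f by (auto simp: P_set_def)
  have cont: "isCont f z" for z
    using g by (auto simp: homeomorphism_def continuous_on_eq_continuous_at)
  have fin: "finite (breakpoints f \<inter> {a..b})" for a b
    using f by (auto simp: P_set_def piecewise_linear_def)
  have aff: "{a<..<b} \<inter> breakpoints f = {} \<Longrightarrow> \<exists>m c. \<forall>x\<in>{a<..<b}. f x = m * x + c" for a b
    using f unfolding P_set_def piecewise_linear_def by blast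
  have sl: "x \<notin> breakpoints f \<Longrightarrow> \<exists>k::int. \<bar>deriv f x\<bar> = 2 powi k" for x
    using f unfolding P_set_def by blast
  have bd: "breakpoints f \<subseteq> dyadic"
    using f unfolding P_set_def by blast
  have slope: "\<bar>m\<bar> \<in> pow2"
    if "a < b" "{a<..<b} \<inter> breakpoints f = {}" and m: "\<forall>x\<in>{a<..<b}. f x = m * x + c" for a b m c
  proof -
    define x where "x = (a + b) / 2"
    have x: "x \<in> {a<..<b}" using that(1) by (auto simp: x_def)
    have "(f has_field_derivative m) (at x)"
    proof (rule has_field_derivative_transform_within_open[of "\<lambda>x. m * x + c" _ _ "{a<..<b}"])
      show "((\<lambda>x. m * x + c) has_field_derivative m) (at x)"
        by (auto intro!: derivative_eq_intros)
    qed (use x m in auto)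
    then have "deriv f x = m" by (rule DERIV_imp_deriv)
    moreover have "x \<notin> breakpoints f" using that(2) x by blast
    ultimately obtain k :: int where "\<bar>m\<bar> = 2 powi k" using sl[of x] by auto
    then show ?thesis by (auto simp: pow2_def)
  qed
  show "locally_PL_dyadic f" unfolding locally_PL_dyadic_def
  proof
    fix z
    obtain e where e: "e > 0" "\<forall>x\<in>breakpoints f \<inter> {z - 1..z + 1}. x \<noteq> z \<longrightarrow> e \<le> dist z x"
      using finite_set_avoid[OF fin[of "z - 1" "z + 1"], of z] by blast
    define d where "d = min e 1"
    have d: "d > 0" "d \<le> 1" "d \<le> e" using e(1) by (auto simp: d_def)
    have nb: "x \<notin> breakpoints f" if "\<bar>x - z\<bar> < d" "x \<noteq> z" for x
    proof
      assume "x \<in> breakpoints f"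
      then have "e \<le> dist z x" using e(2) that d by (auto simp: abs_if split: if_splits)
      then show False using that d by (auto simp: dist_real_def abs_minus_commute)
    qed
    have nbr: "{z<..<z + d} \<inter> breakpoints f = {}" using nb by fastforce
    have nbl: "{z - d<..<z} \<inter> breakpoints f = {}" using nb by fastforce
    obtain a c where ac: "\<forall>x\<in>{z<..<z + d}. f x = a * x + c" using aff[OF nbr] by blast
    obtain b c' where bc: "\<forall>x\<in>{z - d<..<z}. f x = b * x + c'" using aff[OF nbl] by blast
    have fz1: "f z = a * z + c" using isCont_affine_right[OF cont d(1)] ac by blast
    have fz2: "f z = b * z + c'" using isCont_affine_left[OF cont d(1)] bc by blast
    have hs: "has_slopes f z a b" unfolding has_slopes_def
    proof (intro exI[of _ d] conjI allI impI d(1))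
      fix u assume u: "0 \<le> u \<and> u < d"
      show "f (z + u) = f z + a * u" using ac fz1 u by (cases "u = 0") (auto simp: algebra_simps)
      show "f (z - u) = f z - b * u" using bc fz2 u by (cases "u = 0") (auto simp: algebra_simps)
    qed
    have "\<bar>a\<bar> \<in> pow2" using slope[OF _ nbr ac] d(1) by auto
    moreover have "\<bar>b\<bar> \<in> pow2" using slope[OF _ nbl bc] d(1) by auto
    moreover have "a = b" if "z \<notin> dyadic"
      using locally_PL_dyadic_breakpoint_iff[OF hs] bd that by blast
    ultimately show "\<exists>a b. has_slopes f z a b \<and> \<bar>a\<bar> \<in> pow2 \<and> \<bar>b\<bar> \<in> pow2 \<and> (z \<notin> dyadic \<longrightarrow> a = b)"
      using hs by blast
  qed
qed

lemma locally_PL_dyadic_continuous: "locally_PL_dyadic f \<Longrightarrow> continuous_on A f"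
  unfolding locally_PL_dyadic_def
  by (meson has_slopes_isCont continuous_at_imp_continuous_on)

lemma P_setI:
  assumes "bij f" "locally_PL_dyadic f" "f ` dyadic \<subseteq> dyadic"
  shows "f \<in> P_set"
proof -
  have sl: "\<exists>a b. has_slopes f z a b \<and> \<bar>a\<bar> \<in> pow2 \<and> \<bar>b\<bar> \<in> pow2 \<and> (z \<notin> dyadic \<longrightarrow> a = b)" for z
    using assms(2) by (auto simp: locally_PL_dyadic_def)
  have hom: "\<exists>g. homeomorphism UNIV UNIV f g"
    using homeomorphism_into_1d[of UNIV f UNIV] locally_PL_dyadic_continuous[OF assms(2)] assms(1)
    by (auto simp: bij_def path_connected_UNIV)
  have bd: "breakpoints f \<subseteq> dyadic"
    using sl locally_PL_dyadic_breakpoint_iff by blast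
  have der: "\<exists>k::int. \<bar>deriv f x\<bar> = 2 powi k" if "x \<notin> breakpoints f" for x
  proof -
    obtain a b where ab: "has_slopes f x a b" "\<bar>a\<bar> \<in> pow2" using sl[of x] by blast
    have "f differentiable (at x)" using that by (simp add: breakpoints_def)
    then obtain d where "(f has_field_derivative d) (at x)" by (auto simp: real_differentiable_def)
    then have "deriv f x = a" using has_slopes_deriv[OF ab(1)] DERIV_imp_deriv by metis
    then show ?thesis using ab(2) by (auto simp: pow2_def)
  qed
  \<comment> \<open>An accumulation point of breakpoints would itself have one-sided affine germs,
    and these leave no break at the points near it.\<close>
  have fin: "finite (breakpoints f \<inter> {p..q})" for p q
  proof (rule ccontr)
    assume "infinite (breakpoints f \<inter> {p..q})"
    then obtain z where z: "z islimpt (breakpoints f \<inter> {p..q})"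
      using Heine_Borel_imp_Bolzano_Weierstrass[of "{p..q}"] by auto
    obtain a b where "has_slopes f z a b" using sl[of z] by blast
    then obtain e where e: "e > 0" "\<And>u. 0 \<le> u \<Longrightarrow> u < e \<Longrightarrow> f (z + u) = f z + a * u"
      "\<And>u. 0 \<le> u \<Longrightarrow> u < e \<Longrightarrow> f (z - u) = f z - b * u"
      using has_slopesE by blast
    obtain x where x: "x \<in> breakpoints f" "x \<noteq> z" "\<bar>x - z\<bar> < e"
      using z e(1) unfolding islimpt_approachable by (auto simp: dist_real_def)
    \<comment> \<open>A radius that keeps \<open>x + u\<close> and \<open>x - u\<close> on the same
      side of \<open>z\<close> and inside the interval of its germ.\<close>
    define d where "d = min \<bar>x - z\<bar> (e - \<bar>x - z\<bar>)"
    have d: "d > 0" "d \<le> \<bar>x - z\<bar>" "d \<le> e - \<bar>x - z\<bar>" using x by (auto simp: d_def)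
    define m where "m = (if x > z then a else b)"
    have "has_slopes f x m m" unfolding has_slopes_def
    proof (intro exI[of _ d] conjI allI impI d(1))
      fix u assume u: "0 \<le> u \<and> u < d"
      show "f (x + u) = f x + m * u"
      proof (cases "x > z")
        case True
        then show ?thesis using e(2)[of "x - z"] e(2)[of "x - z + u"] u d x
          by (auto simp: m_def algebra_simps)
      next
        case False
        then show ?thesis using e(3)[of "z - x"] e(3)[of "z - x - u"] u d x
          by (auto simp: m_def algebra_simps)
      qed
      show "f (x - u) = f x - m * u"
      proof (cases "x > z")
        case True
        then show ?thesis using e(2)[of "x - z"] e(2)[of "x - z - u"] u d x
          by (auto simp: m_def algebra_simps)
      next
        case False
        then show ?thesis using e(3)[of "z - x"] e(3)[of "z - x + u"] u d x
          by (auto simp: m_def algebra_simps)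
      qed
    qed
    then show False using locally_PL_dyadic_not_breakpoint x(1) by blast
  qed
  have aff: "\<exists>m c. \<forall>x\<in>{p<..<q}. f x = m * x + c" if "{p<..<q} \<inter> breakpoints f = {}" for p q
  proof (rule locally_affine_imp_affine)
    fix z assume z: "z \<in> {p<..<q}"
    obtain a b where ab: "has_slopes f z a b" using sl[of z] by blast
    then have "a = b" using locally_PL_dyadic_breakpoint_iff[OF ab] that z by blast
    then obtain e where "e > 0" "\<And>x. \<bar>x - z\<bar> < e \<Longrightarrow> f x = f z + a * (x - z)"
      using has_slopes_eq_interval ab by blast
    then show "\<exists>e>0. \<exists>m. \<forall>x. \<bar>x - z\<bar> < e \<longrightarrow> f x = f z + m * (x - z)" by blast
  qed
  show ?thesis using hom fin aff der bd assms(3) by (auto simp: P_set_def piecewise_linear_def)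
qed

theorem P_set_iff: "f \<in> P_set \<longleftrightarrow> bij f \<and> locally_PL_dyadic f \<and> f ` dyadic \<subseteq> dyadic"
  using P_set_imp_locally_PL2 P_setI by blast

section \<open>The group structure of \<open>P\<close>\<close>

abbreviation finv :: "(real \<Rightarrow> real) \<Rightarrow> real \<Rightarrow> real" where
  "finv \<equiv> inv_into UNIV"

lemma continuous_inj_cases:
  fixes f :: "real \<Rightarrow> real"
  assumes "continuous_on UNIV f" "inj f"
  shows "strict_mono f \<or> strict_antimono_on UNIV f"
  using injective_eq_monotone_map[of UNIV f] assms by (auto simp: is_interval_univ)

lemma has_slopes_comp_pos:
  assumes "has_slopes f z a b" "has_slopes g (f z) c d" "a > 0" "b > 0"
  shows "has_slopes (g \<circ> f) z (c * a) (d * b)"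
proof -
  obtain e where e: "e > 0" "\<And>u. 0 \<le> u \<Longrightarrow> u < e \<Longrightarrow> f (z + u) = f z + a * u"
    "\<And>u. 0 \<le> u \<Longrightarrow> u < e \<Longrightarrow> f (z - u) = f z - b * u"
    using has_slopesE[OF assms(1)] by blast
  obtain e' where e': "e' > 0" "\<And>u. 0 \<le> u \<Longrightarrow> u < e' \<Longrightarrow> g (f z + u) = g (f z) + c * u"
    "\<And>u. 0 \<le> u \<Longrightarrow> u < e' \<Longrightarrow> g (f z - u) = g (f z) - d * u"
    using has_slopesE[OF assms(2)] by blast
  show ?thesis unfolding has_slopes_def
  proof (intro exI[of _ "min e (min (e' / a) (e' / b))"] conjI allI impI)
    fix u assume u: "0 \<le> u \<and> u < min e (min (e' / a) (e' / b))"
    then have "u < e" "a * u < e'" "b * u < e'" using assms(3,4) by (auto simp: field_simps)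
    then show "(g \<circ> f) (z + u) = (g \<circ> f) z + c * a * u" "(g \<circ> f) (z - u) = (g \<circ> f) z - d * b * u"
      using e e' u assms(3,4) by auto
  qed (use e(1) e'(1) assms(3,4) in auto)
qed

text \<open>A decreasing \<open>f\<close> carries the right side of \<open>z\<close> to the left
  side of \<open>f z\<close>, so the right slope of the composite is built from the left slope
  \<open>d\<close> of \<open>g\<close>, and conversely.\<close>

lemma has_slopes_comp_neg:
  assumes "has_slopes f z a b" "has_slopes g (f z) c d" "a < 0" "b < 0"
  shows "has_slopes (g \<circ> f) z (d * a) (c * b)"
proof -
  obtain e where e: "e > 0" "\<And>u. 0 \<le> u \<Longrightarrow> u < e \<Longrightarrow> f (z + u) = f z + a * u"
    "\<And>u. 0 \<le> u \<Longrightarrow> u < e \<Longrightarrow> f (z - u) = f z - b * u"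
    using has_slopesE[OF assms(1)] by blast
  obtain e' where e': "e' > 0" "\<And>u. 0 \<le> u \<Longrightarrow> u < e' \<Longrightarrow> g (f z + u) = g (f z) + c * u"
    "\<And>u. 0 \<le> u \<Longrightarrow> u < e' \<Longrightarrow> g (f z - u) = g (f z) - d * u"
    using has_slopesE[OF assms(2)] by blast
  show ?thesis unfolding has_slopes_def
  proof (intro exI[of _ "min e (min (e' / - a) (e' / - b))"] conjI allI impI)
    fix u assume u: "0 \<le> u \<and> u < min e (min (e' / - a) (e' / - b))"
    then have *: "u < e" "(- a) * u < e'" "(- b) * u < e'"
      using assms(3,4) by (auto simp: field_simps)
    have **: "0 \<le> (- a) * u" "0 \<le> (- b) * u" using u assms(3,4) by (auto simp: mult_nonpos_nonneg)
    show "(g \<circ> f) (z + u) = (g \<circ> f) z + d * a * u"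
      using e(2)[of u] e'(3)[of "(- a) * u"] * ** u by auto
    show "(g \<circ> f) (z - u) = (g \<circ> f) z - c * b * u"
      using e(3)[of u] e'(2)[of "(- b) * u"] * ** u by auto
  next
    have "e' / - a > 0" "e' / - b > 0" using e'(1) assms(3,4) by (auto simp: divide_pos_neg)
    then show "0 < min e (min (e' / - a) (e' / - b))" using e(1) by simp
  qed
qed

lemma has_slopes_inv_pos:
  assumes "bij f" "has_slopes f z a b" "a > 0" "b > 0"
  shows "has_slopes (finv f) (f z) (1 / a) (1 / b)"
proof -
  obtain e where e: "e > 0" "\<And>u. 0 \<le> u \<Longrightarrow> u < e \<Longrightarrow> f (z + u) = f z + a * u"
    "\<And>u. 0 \<le> u \<Longrightarrow> u < e \<Longrightarrow> f (z - u) = f z - b * u"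
    using has_slopesE[OF assms(2)] by blast
  have i: "finv f (f x) = x" for x using assms(1) by (simp add: bij_is_inj)
  show ?thesis unfolding has_slopes_def
  proof (intro exI[of _ "min (a * e) (b * e)"] conjI allI impI)
    fix v assume v: "0 \<le> v \<and> v < min (a * e) (b * e)"
    then have "v / a < e" "v / b < e" using assms(3,4) by (auto simp: field_simps)
    then have "f (z + v / a) = f z + v" "f (z - v / b) = f z - v"
      using e(2)[of "v / a"] e(3)[of "v / b"] v assms(3,4) by auto
    then show "finv f (f z + v) = finv f (f z) + 1 / a * v" "finv f (f z - v) = finv f (f z) - 1 / b * v"
      using i[of "z + v / a"] i[of "z - v / b"] by (simp_all add: i)
  qed (use e(1) assms(3,4) in auto)
qed

lemma has_slopes_inv_neg:
  assumes "bij f" "has_slopes f z a b" "a < 0" "b < 0"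
  shows "has_slopes (finv f) (f z) (1 / b) (1 / a)"
proof -
  obtain e where e: "e > 0" "\<And>u. 0 \<le> u \<Longrightarrow> u < e \<Longrightarrow> f (z + u) = f z + a * u"
    "\<And>u. 0 \<le> u \<Longrightarrow> u < e \<Longrightarrow> f (z - u) = f z - b * u"
    using has_slopesE[OF assms(2)] by blast
  have i: "finv f (f x) = x" for x using assms(1) by (simp add: bij_is_inj)
  show ?thesis unfolding has_slopes_def
  proof (intro exI[of _ "min (- a * e) (- b * e)"] conjI allI impI)
    fix v assume v: "0 \<le> v \<and> v < min (- a * e) (- b * e)"
    then have "v / - a < e" "v / - b < e" "0 \<le> v / - a" "0 \<le> v / - b"
      using assms(3,4) by (auto simp: field_simps divide_nonneg_neg)
    then have "f (z + v / - a) = f z - v" "f (z - v / - b) = f z + v"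
      using e(2)[of "v / - a"] e(3)[of "v / - b"] v assms(3,4) by auto
    then show "finv f (f z + v) = finv f (f z) + 1 / b * v" "finv f (f z - v) = finv f (f z) - 1 / a * v"
      using i[of "z + v / - a"] i[of "z - v / - b"] by (simp_all add: i)
  qed (use e(1) assms(3,4) in \<open>auto simp: mult_neg_pos\<close>)
qed

lemma has_slopes_strict_mono:
  assumes "has_slopes f z a b" "strict_mono f"
  shows "a > 0" "b > 0"
proof -
  obtain e where e: "e > 0" "\<And>u. 0 \<le> u \<Longrightarrow> u < e \<Longrightarrow> f (z + u) = f z + a * u"
    "\<And>u. 0 \<le> u \<Longrightarrow> u < e \<Longrightarrow> f (z - u) = f z - b * u"
    using has_slopesE[OF assms(1)] by blast
  have "f z < f (z + e / 2)" "f (z - e / 2) < f z"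
    using e(1) assms(2) by (auto simp: strict_mono_def)
  then have "0 < a * (e / 2)" "0 < b * (e / 2)" using e(2)[of "e / 2"] e(3)[of "e / 2"] e(1) by auto
  then show "a > 0" "b > 0" using e(1) by (auto simp: zero_less_mult_iff)
qed

lemma has_slopes_strict_antimono:
  assumes "has_slopes f z a b" "strict_antimono_on UNIV f"
  shows "a < 0" "b < 0"
proof -
  obtain e where e: "e > 0" "\<And>u. 0 \<le> u \<Longrightarrow> u < e \<Longrightarrow> f (z + u) = f z + a * u"
    "\<And>u. 0 \<le> u \<Longrightarrow> u < e \<Longrightarrow> f (z - u) = f z - b * u"
    using has_slopesE[OF assms(1)] by blast
  have "f z > f (z + e / 2)" "f (z - e / 2) > f z"
    using e(1) assms(2) by (auto simp: monotone_on_def)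
  then have "0 > a * (e / 2)" "0 > b * (e / 2)" using e(2)[of "e / 2"] e(3)[of "e / 2"] e(1) by auto
  then show "a < 0" "b < 0" using e(1) by (auto simp: mult_less_0_iff)
qed

lemma P_setE:
  assumes "f \<in> P_set"
  obtains a b where "has_slopes f z a b" "\<bar>a\<bar> \<in> pow2" "\<bar>b\<bar> \<in> pow2" "z \<notin> dyadic \<longrightarrow> a = b"
  using assms unfolding P_set_iff locally_PL_dyadic_def by blast

lemma P_set_bij: "f \<in> P_set \<Longrightarrow> bij f"
  by (simp add: P_set_iff)

lemma P_set_dyadic: "f \<in> P_set \<Longrightarrow> x \<in> dyadic \<Longrightarrow> f x \<in> dyadic"
  by (auto simp: P_set_iff)

lemma P_set_cases:
  assumes "f \<in> P_set"
  shows "strict_mono f \<or> strict_antimono_on UNIV f"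
  using assms by (intro continuous_inj_cases) (auto simp: P_set_iff locally_PL_dyadic_continuous bij_is_inj)

text \<open>Only an inclusion of images is part of the definition of \<open>P_set\<close>. Near a
  non-dyadic \<open>x\<close>, however, the map is affine with slope a signed power of two; if
  \<open>f x\<close> were dyadic, comparison with the value at a nearby dyadic \<open>d\<close>
  would make \<open>d - x\<close> dyadic. This is what closes \<open>P_set\<close> under
  inverses.\<close>

lemma P_set_dyadic_iff:
  assumes f: "f \<in> P_set"
  shows "f x \<in> dyadic \<longleftrightarrow> x \<in> dyadic"
proof
  assume fx: "f x \<in> dyadic"
  show "x \<in> dyadic"
  proof (rule ccontr)
    assume "x \<notin> dyadic"
    obtain a b where "has_slopes f x a b" "\<bar>a\<bar> \<in> pow2" "x \<notin> dyadic \<longrightarrow> a = b"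
      using P_setE[OF f] by blast
    then have a: "has_slopes f x a a" "\<bar>a\<bar> \<in> pow2" using \<open>x \<notin> dyadic\<close> by auto
    obtain e where e: "e > 0" "\<And>y. \<bar>y - x\<bar> < e \<Longrightarrow> f y = f x + a * (y - x)"
      using has_slopes_eq_interval[OF a(1)] by blast
    obtain d where d: "d \<in> dyadic" "x < d" "d < x + e" using dyadic_dense[of x "x + e"] e(1) by auto
    have fd: "f d = f x + a * (d - x)" using e(2)[of d] d by auto
    have a0: "a \<noteq> 0" using a(2) pow2_pos by force
    have "a * (d - x) \<in> dyadic" using fd P_set_dyadic[OF f d(1)] fx dyadic_diff
      by (metis add_diff_cancel_left')
    moreover have "\<bar>a\<bar> * (d - x) = a * (d - x) \<or> \<bar>a\<bar> * (d - x) = - (a * (d - x))" by (auto simp: abs_if)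
    ultimately have "\<bar>a\<bar> * (d - x) \<in> dyadic" by (metis dyadic_uminus)
    then have "d - x \<in> dyadic" using dyadic_mult_pow2_iff[OF a(2)] by auto
    then have "d - (d - x) \<in> dyadic" by (rule dyadic_diff[OF d(1)])
    then show False using \<open>x \<notin> dyadic\<close> by simp
  qed
qed (rule P_set_dyadic[OF f])

lemma P_set_comp:
  assumes f: "f \<in> P_set" and g: "g \<in> P_set"
  shows "g \<circ> f \<in> P_set"
proof (rule P_setI)
  show "bij (g \<circ> f)" using f g by (auto intro: bij_comp P_set_bij)
  show "(g \<circ> f) ` dyadic \<subseteq> dyadic" using f g by (auto simp: P_set_dyadic)
  show "locally_PL_dyadic (g \<circ> f)" unfolding locally_PL_dyadic_def
  proof
    fix z
    obtain a b where ab: "has_slopes f z a b" "\<bar>a\<bar> \<in> pow2" "\<bar>b\<bar> \<in> pow2" "z \<notin> dyadic \<longrightarrow> a = b"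
      using P_setE[OF f] .
    obtain c d where cd: "has_slopes g (f z) c d" "\<bar>c\<bar> \<in> pow2" "\<bar>d\<bar> \<in> pow2" "f z \<notin> dyadic \<longrightarrow> c = d"
      using P_setE[OF g] .
    have m: "\<bar>x * y\<bar> \<in> pow2" if "\<bar>x\<bar> \<in> pow2" "\<bar>y\<bar> \<in> pow2" for x y :: real
      using that by (simp add: abs_mult pow2_mult)
    have imp: "z \<notin> dyadic \<longrightarrow> c * a = d * b \<and> d * a = c * b"
      using ab(4) cd(4) P_set_dyadic_iff[OF f, of z] by auto
    show "\<exists>a b. has_slopes (g \<circ> f) z a b \<and> \<bar>a\<bar> \<in> pow2 \<and> \<bar>b\<bar> \<in> pow2 \<and> (z \<notin> dyadic \<longrightarrow> a = b)"
      using P_set_cases[OF f]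
    proof
      assume "strict_mono f"
      then have "has_slopes (g \<circ> f) z (c * a) (d * b)"
        using has_slopes_comp_pos[OF ab(1) cd(1)] has_slopes_strict_mono[OF ab(1)] by simp
      then show ?thesis using m[OF cd(2) ab(2)] m[OF cd(3) ab(3)] imp
        by (intro exI[of _ "c * a"] exI[of _ "d * b"] conjI) simp_all
    next
      assume "strict_antimono_on UNIV f"
      then have "has_slopes (g \<circ> f) z (d * a) (c * b)"
        using has_slopes_comp_neg[OF ab(1) cd(1)] has_slopes_strict_antimono[OF ab(1)] by simp
      then show ?thesis using m[OF cd(3) ab(2)] m[OF cd(2) ab(3)] imp
        by (intro exI[of _ "d * a"] exI[of _ "c * b"] conjI) simp_all
    qed
  qed
qed

lemma P_set_inv:
  assumes f: "f \<in> P_set"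
  shows "finv f \<in> P_set"
proof (rule P_setI)
  have bf: "bij f" using f by (rule P_set_bij)
  show "bij (finv f)" using bf by (rule bij_imp_bij_inv)
  have fi: "f (finv f y) = y" for y using bf by (simp add: bij_is_surj surj_f_inv_f)
  have "finv f y \<in> dyadic \<longleftrightarrow> y \<in> dyadic" for y using P_set_dyadic_iff[OF f, of "finv f y"] by (simp add: fi)
  then show "finv f ` dyadic \<subseteq> dyadic" by auto
  show "locally_PL_dyadic (finv f)" unfolding locally_PL_dyadic_def
  proof
    fix y
    define z where "z = finv f y"
    have y: "y = f z" by (simp add: z_def fi)
    obtain a b where ab: "has_slopes f z a b" "\<bar>a\<bar> \<in> pow2" "\<bar>b\<bar> \<in> pow2" "z \<notin> dyadic \<longrightarrow> a = b"
      using P_setE[OF f] .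
    have p: "\<bar>1 / a\<bar> \<in> pow2" "\<bar>1 / b\<bar> \<in> pow2"
      using pow2_inverse[OF ab(2)] pow2_inverse[OF ab(3)] by (simp_all add: divide_inverse)
    have imp: "y \<notin> dyadic \<longrightarrow> 1 / a = 1 / b"
      using ab(4) P_set_dyadic_iff[OF f, of z] by (simp add: y)
    show "\<exists>a b. has_slopes (finv f) y a b \<and> \<bar>a\<bar> \<in> pow2 \<and> \<bar>b\<bar> \<in> pow2 \<and> (y \<notin> dyadic \<longrightarrow> a = b)"
      using P_set_cases[OF f]
    proof
      assume "strict_mono f"
      then have "has_slopes (finv f) y (1 / a) (1 / b)"
        using has_slopes_inv_pos[OF bf ab(1)] has_slopes_strict_mono[OF ab(1)] by (simp add: y)
      then show ?thesis using p imp
        by (intro exI[of _ "1 / a"] exI[of _ "1 / b"] conjI) simp_all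
    next
      assume "strict_antimono_on UNIV f"
      then have "has_slopes (finv f) y (1 / b) (1 / a)"
        using has_slopes_inv_neg[OF bf ab(1)] has_slopes_strict_antimono[OF ab(1)] by (simp add: y)
      then show ?thesis using p imp
        by (intro exI[of _ "1 / b"] exI[of _ "1 / a"] conjI) simp_all
    qed
  qed
qed

lemma has_slopes_affine: "has_slopes (\<lambda>x. c * x + d) z c c"
  unfolding has_slopes_def by (intro exI[of _ 1]) (auto simp: algebra_simps)

lemma affine_in_P_set:
  assumes "\<bar>c\<bar> \<in> pow2" "d \<in> dyadic"
  shows "(\<lambda>x. c * x + d) \<in> P_set"
proof (rule P_setI)
  have c0: "c \<noteq> 0" using assms(1) pow2_pos by force
  show "bij (\<lambda>x. c * x + d)"
    by (rule o_bij[of "\<lambda>y. (y - d) / c"]) (use c0 in \<open>auto simp: fun_eq_iff field_simps\<close>)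
  show "(\<lambda>x. c * x + d) ` dyadic \<subseteq> dyadic"
    using dyadic_abs_pow2[OF assms(1)] assms(2) by auto
  show "locally_PL_dyadic (\<lambda>x. c * x + d)" unfolding locally_PL_dyadic_def
    using has_slopes_affine assms(1) by blast
qed

lemma id_in_P_set: "id \<in> P_set"
  using affine_in_P_set[of 1 0] by (simp add: id_def)

lemma uminus_in_P_set: "uminus \<in> P_set"
  using affine_in_P_set[of "-1" 0] by simp

lemma P_group_sel [simp]: "carrier P_group = P_set" "mult P_group = (\<circ>)" "one P_group = id"
  by (simp_all add: P_group_def)

lemma bij_inv_left [simp]: "bij f \<Longrightarrow> finv f \<circ> f = id"
  by (simp add: bij_is_inj)

lemma bij_inv_right [simp]: "bij f \<Longrightarrow> f \<circ> finv f = id"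
  by (metis bij_is_surj surj_iff)

lemma group_P_group: "group P_group"
proof (rule groupI)
  fix f assume "f \<in> carrier P_group"
  then show "\<exists>g\<in>carrier P_group. g \<otimes>\<^bsub>P_group\<^esub> f = \<one>\<^bsub>P_group\<^esub>"
    by (intro bexI[of _ "finv f"]) (auto simp: P_set_inv P_set_bij)
qed (auto simp: P_set_comp id_in_P_set comp_assoc)

interpretation P: group P_group
  by (rule group_P_group)

lemma P_group_inv: "f \<in> P_set \<Longrightarrow> inv\<^bsub>P_group\<^esub> f = finv f"
  by (rule P.inv_equality) (auto simp: P_set_inv P_set_bij)

lemma P_plus_P_set: "f \<in> P_plus \<Longrightarrow> f \<in> P_set"
  by (simp add: P_plus_def)

lemma P_plus_strict_mono: "f \<in> P_plus \<Longrightarrow> strict_mono f"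
  by (simp add: P_plus_def)

lemma P_plus_less_iff: "f \<in> P_plus \<Longrightarrow> f x < f y \<longleftrightarrow> x < y"
  by (simp add: P_plus_def strict_mono_less)

lemma P_plus_le_iff: "f \<in> P_plus \<Longrightarrow> f x \<le> f y \<longleftrightarrow> x \<le> y"
  by (simp add: P_plus_def strict_mono_less_eq)

lemma P_plus_comp: "f \<in> P_plus \<Longrightarrow> g \<in> P_plus \<Longrightarrow> g \<circ> f \<in> P_plus"
  by (auto simp: P_plus_def P_set_comp strict_mono_def)

lemma strict_mono_inv:
  fixes f :: "real \<Rightarrow> real"
  assumes "strict_mono f" "bij f" shows "strict_mono (finv f)"
proof (rule strict_monoI)
  fix x y :: real assume xy: "x < y"
  have "f (finv f x) = x" "f (finv f y) = y" using assms(2) by (simp_all add: bij_is_surj surj_f_inv_f)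
  then show "finv f x < finv f y" using strict_mono_less[OF assms(1), of "finv f x" "finv f y"] xy by simp
qed

lemma P_plus_inv: "f \<in> P_plus \<Longrightarrow> finv f \<in> P_plus"
  by (auto simp: P_plus_def P_set_inv P_set_bij strict_mono_inv)

lemma P_plusE:
  assumes "f \<in> P_plus"
  obtains a b where "has_slopes f z a b" "a \<in> pow2" "b \<in> pow2" "z \<notin> dyadic \<longrightarrow> a = b"
proof -
  obtain a b where ab: "has_slopes f z a b" "\<bar>a\<bar> \<in> pow2" "\<bar>b\<bar> \<in> pow2" "z \<notin> dyadic \<longrightarrow> a = b"
    using P_setE[OF P_plus_P_set[OF assms]] .
  then show thesis using that has_slopes_strict_mono[OF ab(1) P_plus_strict_mono[OF assms]] by auto
qed

lemma affine_in_P_plus: "c \<in> pow2 \<Longrightarrow> d \<in> dyadic \<Longrightarrow> (\<lambda>x. c * x + d) \<in> P_plus"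
  using pow2_pos[of c] by (auto simp: P_plus_def intro!: affine_in_P_set strict_monoI)

lemma affine_in_P_plus':
  assumes "c \<in> pow2" "d \<in> dyadic" "p \<in> dyadic" shows "(\<lambda>x. d + c * (x - p)) \<in> P_plus"
proof -
  have "(\<lambda>x. d + c * (x - p)) = (\<lambda>x. c * x + (d - c * p))" by (auto simp: algebra_simps)
  then show ?thesis using affine_in_P_plus[of c "d - c * p"] assms by auto
qed

lemma id_in_P_plus: "id \<in> P_plus"
  using affine_in_P_plus[of 1 0] by (simp add: id_def)

section \<open>Gluing at dyadic points\<close>

definition glue :: "real \<Rightarrow> (real \<Rightarrow> real) \<Rightarrow> (real \<Rightarrow> real) \<Rightarrow> real \<Rightarrow> real" where
  "glue c f g x = (if x < c then f x else g x)"

lemma glue_in_P_plus: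
  assumes f: "f \<in> P_plus" and g: "g \<in> P_plus" and c: "c \<in> dyadic" and eq: "f c = g c"
  shows "glue c f g \<in> P_plus"
proof -
  have mono: "strict_mono (glue c f g)"
  proof (rule strict_monoI)
    fix x y :: real assume xy: "x < y"
    have "f x < g y" if "x < c" "c \<le> y"
    proof -
      have "f x < f c" using that f by (simp add: P_plus_less_iff)
      also have "f c \<le> g y" using that g by (simp add: eq P_plus_le_iff)
      finally show ?thesis .
    qed
    then show "glue c f g x < glue c f g y"
      using xy f g by (auto simp: glue_def P_plus_less_iff)
  qed
  have bf: "bij f" and bg: "bij g" using f g by (auto simp: P_plus_def P_set_bij)
  have "y \<in> range (glue c f g)" for y
  proof (cases "y < f c")
    case True
    have fi: "f (finv f y) = y" using bf by (simp add: bij_is_surj surj_f_inv_f)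
    then have "finv f y < c" using P_plus_less_iff[OF f, of "finv f y" c] True by simp
    then show ?thesis using fi by (intro image_eqI[of _ _ "finv f y"]) (auto simp: glue_def)
  next
    case False
    have gi: "g (finv g y) = y" using bg by (simp add: bij_is_surj surj_f_inv_f)
    then have "\<not> finv g y < c" using P_plus_less_iff[OF g, of "finv g y" c] False eq by simp
    then show ?thesis using gi by (intro image_eqI[of _ _ "finv g y"]) (auto simp: glue_def)
  qed
  then have "bij (glue c f g)" using strict_mono_imp_inj_on[OF mono] by (auto simp: bij_def)
  moreover have "glue c f g ` dyadic \<subseteq> dyadic"
    using f g by (auto simp: glue_def P_plus_def P_set_dyadic)
  moreover have "locally_PL_dyadic (glue c f g)" unfolding locally_PL_dyadic_def
  proof
    fix z
    obtain a b where ab: "has_slopes f z a b" "a \<in> pow2" "b \<in> pow2" "z \<notin> dyadic \<longrightarrow> a = b"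
      using P_plusE[OF f] .
    obtain a' b' where ab': "has_slopes g z a' b'" "a' \<in> pow2" "b' \<in> pow2" "z \<notin> dyadic \<longrightarrow> a' = b'"
      using P_plusE[OF g] .
    obtain e where e: "e > 0" "\<And>u. 0 \<le> u \<Longrightarrow> u < e \<Longrightarrow> f (z + u) = f z + a * u"
      "\<And>u. 0 \<le> u \<Longrightarrow> u < e \<Longrightarrow> f (z - u) = f z - b * u"
      using has_slopesE[OF ab(1)] by blast
    obtain e' where e': "e' > 0" "\<And>u. 0 \<le> u \<Longrightarrow> u < e' \<Longrightarrow> g (z + u) = g z + a' * u"
      "\<And>u. 0 \<le> u \<Longrightarrow> u < e' \<Longrightarrow> g (z - u) = g z - b' * u"
      using has_slopesE[OF ab'(1)] by blast
    \<comment> \<open>At \<open>z = c\<close> the right germ comes from \<open>g\<close> and the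
      left germ from \<open>f\<close>, hence the strict test here and the non-strict one for
      \<open>t\<close>.\<close>
    define s where "s = (if z < c then a else a')"
    define t where "t = (if z \<le> c then b else b')"
    \<comment> \<open>Away from \<open>c\<close> the radius must not reach across \<open>c\<close>;
      at \<open>c\<close> itself the value 1 stands for no restriction.\<close>
    define d where "d = min (min e e') (if z = c then 1 else \<bar>z - c\<bar>)"
    have d: "d > 0" "d \<le> e" "d \<le> e'" "z \<noteq> c \<longrightarrow> d \<le> \<bar>z - c\<bar>"
      using e(1) e'(1) by (auto simp: d_def)
    have "has_slopes (glue c f g) z s t" unfolding has_slopes_def
    proof (intro exI[of _ d] conjI allI impI d(1))
      fix u assume u: "0 \<le> u \<and> u < d"
      show "glue c f g (z + u) = glue c f g z + s * u"
        using u d e(2)[of u] e'(2)[of u] by (auto simp: glue_def s_def abs_if split: if_splits)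
      show "glue c f g (z - u) = glue c f g z - t * u"
        using u d e(3)[of u] e'(3)[of u] eq by (cases "u = 0") (auto simp: glue_def t_def abs_if split: if_splits)
    qed
    moreover have "s \<in> pow2" "t \<in> pow2" using ab ab' by (auto simp: s_def t_def)
    moreover have "z \<notin> dyadic \<longrightarrow> s = t" using ab ab' c by (auto simp: s_def t_def)
    ultimately show "\<exists>a b. has_slopes (glue c f g) z a b \<and> \<bar>a\<bar> \<in> pow2 \<and> \<bar>b\<bar> \<in> pow2 \<and> (z \<notin> dyadic \<longrightarrow> a = b)"
      using pow2_pos[of s] pow2_pos[of t] by (intro exI[of _ s] exI[of _ t]) auto
  qed
  ultimately show ?thesis using mono by (simp add: P_plus_def P_setI)
qed

section \<open>Compactly supported elements\<close>

definition Fc :: "(real \<Rightarrow> real) set" where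
  "Fc = {f \<in> P_plus. \<exists>M. \<forall>t. \<bar>t\<bar> > M \<longrightarrow> f t = t}"

lemma Fc_P_plus: "f \<in> Fc \<Longrightarrow> f \<in> P_plus"
  by (simp add: Fc_def)

lemma Fc_P_set: "f \<in> Fc \<Longrightarrow> f \<in> P_set"
  by (simp add: Fc_def P_plus_def)

lemma Fc_bij: "f \<in> Fc \<Longrightarrow> bij f"
  by (simp add: Fc_P_set P_set_bij)

lemma FcI: "f \<in> P_plus \<Longrightarrow> (\<And>t. \<bar>t\<bar> > M \<Longrightarrow> f t = t) \<Longrightarrow> f \<in> Fc"
  by (auto simp: Fc_def)

lemma id_in_Fc: "id \<in> Fc"
  by (auto simp: Fc_def id_in_P_plus)

lemma Fc_comp: assumes "f \<in> Fc" "g \<in> Fc" shows "g \<circ> f \<in> Fc"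
proof -
  obtain M N where "\<And>t. \<bar>t\<bar> > M \<Longrightarrow> f t = t" "\<And>t. \<bar>t\<bar> > N \<Longrightarrow> g t = t"
    using assms by (auto simp: Fc_def)
  then show ?thesis using assms
    by (intro FcI[of _ "max M N"] P_plus_comp) (auto simp: Fc_P_plus)
qed

text \<open>Conjugation by a decreasing \<open>p\<close> reverses the order twice, so the result is
  increasing in either case. Its support is the image of that of \<open>f\<close>, between
  \<open>p M\<close> and \<open>p (- M)\<close>.\<close>

lemma Fc_conj:
  assumes f: "f \<in> Fc" and p: "p \<in> P_set"
  shows "p \<circ> f \<circ> finv p \<in> Fc"
proof -
  obtain M where M: "\<And>t. \<bar>t\<bar> > M \<Longrightarrow> f t = t" using f by (auto simp: Fc_def)
  have bp: "bij p" using p by (rule P_set_bij)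
  have pi: "p (finv p y) = y" for y using bp by (simp add: bij_is_surj surj_f_inv_f)
  have mono: "strict_mono (p \<circ> f \<circ> finv p)"
    using P_set_cases[OF p]
  proof
    assume "strict_mono p"
    then show ?thesis using strict_mono_inv[OF _ bp] P_plus_strict_mono[OF Fc_P_plus[OF f]]
      by (simp add: strict_mono_def)
  next
    assume a: "strict_antimono_on UNIV p"
    then have p_less: "x < y \<Longrightarrow> p y < p x" for x y by (simp add: monotone_on_def)
    have i: "finv p y < finv p x" if "x < y" for x y
      using p_less[of "finv p x" "finv p y"] that pi[of x] pi[of y] by (cases "finv p x" "finv p y" rule: linorder_cases) auto
    show ?thesis using i p_less P_plus_strict_mono[OF Fc_P_plus[OF f]] by (simp add: strict_mono_def)
  qed
  have "(p \<circ> f \<circ> finv p) t = t" if t: "\<bar>t\<bar> > max \<bar>p M\<bar> \<bar>p (- M)\<bar>" for t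
  proof -
    have "\<bar>finv p t\<bar> > M"
    proof (rule ccontr)
      assume "\<not> \<bar>finv p t\<bar> > M"
      then have "- M \<le> finv p t" "finv p t \<le> M" by auto
      have "p (- M) \<le> t \<and> t \<le> p M \<or> p M \<le> t \<and> t \<le> p (- M)"
        using P_set_cases[OF p]
      proof
        assume "strict_mono p"
        then show ?thesis using strict_mono_less_eq[of p] pi[of t] \<open>- M \<le> finv p t\<close> \<open>finv p t \<le> M\<close> by metis
      next
        assume "strict_antimono_on UNIV p"
        then have "x \<le> y \<Longrightarrow> p y \<le> p x" for x y by (cases "x = y") (auto simp: monotone_on_def less_le)
        then show ?thesis using pi[of t] \<open>- M \<le> finv p t\<close> \<open>finv p t \<le> M\<close> by metis
      qed
      then show False using t by auto
    qed
    then show ?thesis by (simp add: M pi)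
  qed
  moreover have "p \<circ> f \<circ> finv p \<in> P_plus"
    using mono P_set_comp P_set_inv[OF p] Fc_P_set[OF f] p by (auto simp: P_plus_def)
  ultimately show ?thesis by (rule FcI[rotated])
qed

lemma Fc_inv: assumes "f \<in> Fc" shows "finv f \<in> Fc"
proof -
  obtain M where M: "\<And>t. \<bar>t\<bar> > M \<Longrightarrow> f t = t" using assms by (auto simp: Fc_def)
  then have "finv f t = t" if "\<bar>t\<bar> > M" for t using that Fc_bij[OF assms] by (metis bij_inv_eq_iff)
  then show ?thesis using assms by (auto simp: Fc_P_plus intro!: FcI P_plus_inv)
qed

text \<open>For \<open>y \<ge> b\<close> the line of slope 1/2 through the point with coordinates
  \<open>b\<close> and \<open>y\<close> meets the diagonal at \<open>2 * y - b\<close>; for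
  \<open>y < b\<close> the line of slope 2 meets it at \<open>2 * b - y\<close>. From there on the
  identity takes over.\<close>

lemma connect_right:
  assumes "b \<in> dyadic" "y \<in> dyadic"
  shows "\<exists>g\<in>P_plus. g b = y \<and> (\<exists>M. \<forall>x>M. g x = x)"
proof (cases "y \<ge> b")
  case True
  let ?g = "glue (2 * y - b) (\<lambda>x. y + 1 / 2 * (x - b)) id"
  have "?g \<in> P_plus" using assms
    by (intro glue_in_P_plus affine_in_P_plus' id_in_P_plus) auto
  moreover have "?g b = y" using True by (auto simp: glue_def)
  moreover have "\<forall>x>2 * y - b. ?g x = x" by (auto simp: glue_def)
  ultimately show ?thesis by blast
next
  case False
  let ?g = "glue (2 * b - y) (\<lambda>x. y + 2 * (x - b)) id"
  have "?g \<in> P_plus" using assms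
    by (intro glue_in_P_plus affine_in_P_plus' id_in_P_plus) auto
  moreover have "?g b = y" using False by (auto simp: glue_def)
  moreover have "\<forall>x>2 * b - y. ?g x = x" by (auto simp: glue_def)
  ultimately show ?thesis by blast
qed

lemma connect_left:
  assumes "b \<in> dyadic" "y \<in> dyadic"
  shows "\<exists>g\<in>P_plus. g b = y \<and> (\<exists>M. \<forall>x<M. g x = x)"
proof (cases "y \<le> b")
  case True
  let ?g = "glue (2 * y - b) id (\<lambda>x. y + 1 / 2 * (x - b))"
  have "?g \<in> P_plus" using assms
    by (intro glue_in_P_plus affine_in_P_plus' id_in_P_plus) auto
  moreover have "?g b = y" using True by (auto simp: glue_def)
  moreover have "\<forall>x<2 * y - b. ?g x = x" by (auto simp: glue_def)
  ultimately show ?thesis by blast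
next
  case False
  let ?g = "glue (2 * b - y) id (\<lambda>x. y + 2 * (x - b))"
  have "?g \<in> P_plus" using assms
    by (intro glue_in_P_plus affine_in_P_plus' id_in_P_plus) auto
  moreover have "?g b = y" using False by (auto simp: glue_def)
  moreover have "\<forall>x<2 * b - y. ?g x = x" by (auto simp: glue_def)
  ultimately show ?thesis by blast
qed

text \<open>Both ends are connected to the identity by pieces of slope 2 or 1/2. This lets
  translations and scalings be imitated inside \<open>Fc\<close> on any bounded interval.\<close>

lemma Fc_extension:
  assumes f: "f \<in> P_plus" and a: "a \<in> dyadic" and b: "b \<in> dyadic" and "a \<le> b"
  shows "\<exists>g\<in>Fc. \<forall>x. a \<le> x \<and> x \<le> b \<longrightarrow> g x = f x"
proof -
  have fd: "f a \<in> dyadic" "f b \<in> dyadic" using f a b by (auto simp: P_plus_def P_set_dyadic)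
  obtain r M where r: "r \<in> P_plus" "r b = f b" "\<And>x. x > M \<Longrightarrow> r x = x"
    using connect_right[OF b fd(2)] by blast
  obtain l N where l: "l \<in> P_plus" "l a = f a" "\<And>x. x < N \<Longrightarrow> l x = x"
    using connect_left[OF a fd(1)] by blast
  let ?g = "glue a l (glue b f r)"
  have P: "?g \<in> P_plus"
    using f r l a b \<open>a \<le> b\<close> by (intro glue_in_P_plus) (auto simp: glue_def)
  have "?g \<in> Fc"
  proof (rule FcI[OF P])
    fix t :: real assume "\<bar>t\<bar> > \<bar>M\<bar> + \<bar>N\<bar> + \<bar>a\<bar> + \<bar>b\<bar>"
    then have "t > M \<and> t \<ge> a \<and> t \<ge> b \<or> t < N \<and> t < a" by linarith
    then show "?g t = t" using r(3) l(3) by (auto simp: glue_def)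
  qed
  moreover have "\<forall>x. a \<le> x \<and> x \<le> b \<longrightarrow> ?g x = f x" using r(2) by (auto simp: glue_def)
  ultimately show ?thesis by blast
qed

text \<open>Slopes 2, 1 and 1/2 on consecutive pieces of lengths \<open>s\<close>, \<open>s\<close>
  and \<open>2 * s\<close>, where \<open>s\<close> is a quarter of the interval; the middle piece is
  the translation by \<open>s\<close>.\<close>

lemma bump_exists:
  assumes a: "a \<in> dyadic" and d: "d \<in> dyadic" and "a < d"
  shows "\<exists>f\<in>Fc. (\<forall>x. a < x \<and> x < d \<longrightarrow> x < f x) \<and> (\<forall>x. x \<le> a \<or> d \<le> x \<longrightarrow> f x = x)"
proof -
  define s where "s = (d - a) / 4"
  have "4 \<in> pow2" using pow2_power[of 2] by simp
  then have s: "s \<in> dyadic" "s > 0" "d = a + 4 * s"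
    using a d \<open>a < d\<close> by (auto simp: s_def field_simps intro: dyadic_divide_pow2)
  let ?f = "glue a id (glue (a + s) (\<lambda>x. a + 2 * (x - a)) (glue (d - 2 * s) (\<lambda>x. s + 1 * (x - 0)) (glue d (\<lambda>x. d + 1 / 2 * (x - d)) id)))"
  have P: "?f \<in> P_plus"
    using a d s by (intro glue_in_P_plus affine_in_P_plus' id_in_P_plus) (auto simp: glue_def)
  have "?f \<in> Fc"
    by (rule FcI[OF P, of "\<bar>a\<bar> + \<bar>d\<bar>"]) (use s in \<open>auto simp: glue_def\<close>)
  moreover have "\<forall>x. a < x \<and> x < d \<longrightarrow> x < ?f x" using s by (auto simp: glue_def field_simps)
  moreover have "\<forall>x. x \<le> a \<or> d \<le> x \<longrightarrow> ?f x = x" using s by (auto simp: glue_def)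
  ultimately show ?thesis by blast
qed

section \<open>Powers of two and maps encoded by lists of interval lengths\<close>

lemma pow2_ge_1: assumes "x \<in> pow2" "x \<ge> 1" shows "\<exists>k::nat. x = 2 ^ k"
proof -
  obtain k :: int where k: "x = 2 powi k" using assms(1) by (auto simp: pow2_def)
  have "k \<ge> 0"
  proof (rule ccontr)
    assume "\<not> k \<ge> 0"
    then have "x = (1 / 2) ^ nat (- k)" "nat (- k) \<noteq> 0"
      by (auto simp: k power_int_def field_simps)
    then have "x < 1" using power_less_one_iff[of "1 / 2 :: real" "nat (- k)"] by simp
    then show False using assms(2) by simp
  qed
  then show ?thesis by (intro exI[of _ "nat k"]) (auto simp: k power_int_def)
qed

lemma pow2_less_imp_double: assumes "x \<in> pow2" "y \<in> pow2" "x < y" shows "2 * x \<le> y"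
proof -
  have x: "x > 0" using assms(1) by (rule pow2_pos)
  have "y / x \<in> pow2" "y / x \<ge> 1" using assms x by (auto simp: field_simps)
  then obtain k :: nat where k: "y / x = 2 ^ k" using pow2_ge_1 by blast
  then have "k \<noteq> 0" using assms x by (auto intro: ccontr)
  then have "2 ^ 1 \<le> (2::real) ^ k" by (intro power_increasing) auto
  then have "2 \<le> y / x" using k by simp
  then show ?thesis using x by (simp add: field_simps)
qed

text \<open>Continuity extends the affine formula to the closed interval, so that the end points may
  be breakpoints. The slope is recognised as a power of two by comparison with the germ at the
  midpoint.\<close>

lemma P_plus_affine_piece:
  assumes f: "f \<in> P_plus" and yz: "y < z" and nb: "{y<..<z} \<inter> breakpoints f = {}"
  shows "\<exists>m\<in>pow2. \<forall>x. y \<le> x \<and> x \<le> z \<longrightarrow> f x = f y + m * (x - y)"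
proof -
  have "\<exists>m c. \<forall>x\<in>{y<..<z}. f x = m * x + c"
    using P_plus_P_set[OF f] nb by (simp add: P_set_def piecewise_linear_def)
  then obtain m c where mc: "\<And>x. x \<in> {y<..<z} \<Longrightarrow> f x = m * x + c" by blast
  have cont: "isCont f x" for x
    using P_plusE[OF f] has_slopes_isCont by metis
  have fy: "f y = m * y + c"
    by (rule isCont_affine_right[OF cont, of "z - y"]) (use mc yz in auto)
  have fz: "f z = m * z + c"
    by (rule isCont_affine_left[OF cont, of "z - y"]) (use mc yz in auto)
  have all: "f x = f y + m * (x - y)" if "y \<le> x" "x \<le> z" for x
  proof -
    have "f x = m * x + c" using that mc[of x] fy fz by (cases "x = y \<or> x = z") auto
    then show ?thesis by (simp add: fy algebra_simps)
  qed
  define w where "w = (y + z) / 2"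
  have w: "y < w" "w < z" using yz by (auto simp: w_def)
  obtain a b where ab: "has_slopes f w a b" "a \<in> pow2" using P_plusE[OF f, of w] by blast
  obtain e where e: "e > 0" "\<And>u. 0 \<le> u \<Longrightarrow> u < e \<Longrightarrow> f (w + u) = f w + a * u"
    using has_slopesE[OF ab(1)] by blast
  define u where "u = min (e / 2) (z - w)"
  have u: "u > 0" "u < e" "w + u \<le> z" using e(1) w by (auto simp: u_def)
  have "f w + a * u = f w + m * u"
    using e(2)[of u] all[of w] all[of "w + u"] u w by (auto simp: algebra_simps)
  then have "m \<in> pow2" using ab(2) u(1) by auto
  then show ?thesis using all by blast
qed

text \<open>\<open>piece_map p q a b\<close> maps the consecutive intervals of lengths \<open>a\<close> starting at \<open>p\<close> affinely to
  those of lengths \<open>b\<close> starting at \<open>q\<close>, and is a translation outside.\<close>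

fun piece_map :: "real \<Rightarrow> real \<Rightarrow> real list \<Rightarrow> real list \<Rightarrow> real \<Rightarrow> real" where
  "piece_map p q (s # a) (t # b) x =
     (if x < p then x - p + q else if x < p + s then q + (t / s) * (x - p) else piece_map (p + s) (q + t) a b x)"
| "piece_map p q _ _ x = x - p + q"

definition pow2s :: "real list \<Rightarrow> bool" where
  "pow2s a \<longleftrightarrow> set a \<subseteq> pow2"

lemma pow2s_simps [simp]: "pow2s []" "pow2s (s # a) \<longleftrightarrow> s \<in> pow2 \<and> pow2s a" "pow2s (a @ b) \<longleftrightarrow> pow2s a \<and> pow2s b"
  by (auto simp: pow2s_def)

lemma pow2s_replicate [simp]: "u \<in> pow2 \<Longrightarrow> pow2s (replicate n u)"
  by (auto simp: pow2s_def)

lemma pow2s_map: "pow2s a \<Longrightarrow> c \<in> pow2 \<Longrightarrow> pow2s (map ((*) c) a)"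
  by (auto simp: pow2s_def)

lemma pow2s_sum_nonneg: "pow2s a \<Longrightarrow> 0 \<le> sum_list a"
  by (induct a) (auto simp: less_imp_le pow2_pos add_nonneg_nonneg)

lemma piece_map_left: "pow2s a \<Longrightarrow> x \<le> p \<Longrightarrow> piece_map p q a b x = x - p + q"
  by (cases a; cases b) (auto dest: pow2_pos)

lemma piece_map_ge: "length a = length b \<Longrightarrow> pow2s a \<Longrightarrow> pow2s b \<Longrightarrow> p \<le> x \<Longrightarrow> q \<le> piece_map p q a b x"
proof (induct a b arbitrary: p q rule: list_induct2)
  case (Cons s a t b)
  have st: "s > 0" "t > 0" using Cons by (auto intro: pow2_pos)
  show ?case
  proof (cases "x < p + s")
    case False
    then have "q + t \<le> piece_map (p + s) (q + t) a b x" using Cons(2)[of "p + s" "q + t"] Cons(3-) by auto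
    then show ?thesis using False Cons(5) st by auto
  next
    case True
    then show ?thesis using Cons(5) st by auto
  qed
qed auto

lemma piece_map_right:
  "length a = length b \<Longrightarrow> pow2s a \<Longrightarrow> pow2s b \<Longrightarrow> p + sum_list a \<le> x \<Longrightarrow>
    piece_map p q a b x = x - (p + sum_list a) + (q + sum_list b)"
proof (induct a b arbitrary: p q rule: list_induct2)
  case (Cons s a t b)
  have "s > 0" "0 \<le> sum_list a" using Cons by (auto intro: pow2_pos pow2s_sum_nonneg)
  then show ?case using Cons(2)[of "p + s" "q + t"] Cons(3-) by auto
qed auto

text \<open>Maps encoded by pairs of lists compose by cancelling the middle list, like arrows of a
  groupoid whose objects are lists: on matching intervals the slopes \<open>t / s\<close> and
  \<open>w / t\<close> multiply to \<open>w / s\<close>.\<close>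

lemma piece_map_comp:
  "length a = length b \<Longrightarrow> length b = length c \<Longrightarrow> pow2s a \<Longrightarrow> pow2s b \<Longrightarrow> pow2s c \<Longrightarrow>
    piece_map q r b c (piece_map p q a b x) = piece_map p r a c x"
proof (induct a b c arbitrary: p q r rule: list_induct3)
  case (Cons s a t b w c)
  have pos: "s > 0" "t > 0" "w > 0" using Cons by (auto intro: pow2_pos)
  consider "x < p" | "p \<le> x" "x < p + s" | "p + s \<le> x" by linarith
  then show ?case
  proof cases
    case 2
    define y where "y = q + (t / s) * (x - p)"
    have "(t / s) * (x - p) < (t / s) * s" using 2 pos by (intro mult_strict_left_mono) auto
    then have y: "q \<le> y" "y < q + t" using 2 pos by (auto simp: y_def)
    have "piece_map q r (t # b) (w # c) y = r + (w / t) * (y - q)" using y by simp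
    also have "\<dots> = r + (w / s) * (x - p)" using pos by (simp add: y_def)
    finally show ?thesis using 2 by (simp add: y_def)
  next
    case 3
    have "q + t \<le> piece_map (p + s) (q + t) a b x" using Cons 3 by (intro piece_map_ge) auto
    then have "\<not> piece_map (p + s) (q + t) a b x < q" "\<not> piece_map (p + s) (q + t) a b x < q + t" using pos by auto
    then show ?thesis using 3 pos Cons by auto
  qed auto
qed auto

lemma piece_map_refl: "pow2s a \<Longrightarrow> piece_map p q a a x = x - p + q"
proof (induct a arbitrary: p q)
  case (Cons s a)
  then have "s > 0" by (auto intro: pow2_pos)
  then show ?case using Cons by auto
qed auto

lemma piece_map_append_left:
  "pow2s c \<Longrightarrow> pow2s a \<Longrightarrow> length a = length b \<Longrightarrow>
    piece_map p q (c @ a) (c @ b) x = piece_map (p + sum_list c) (q + sum_list c) a b x"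
proof (induct c arbitrary: p q)
  case (Cons s c)
  have pos: "s > 0" "sum_list c \<ge> 0" using Cons by (auto intro: pow2_pos pow2s_sum_nonneg)
  show ?case
  proof (cases "x < p + s")
    case True
    then have "piece_map (p + sum_list (s # c)) (q + sum_list (s # c)) a b x = x - p + q"
      using Cons pos by (subst piece_map_left) auto
    then show ?thesis using True pos by (auto simp: algebra_simps)
  next
    case False
    then show ?thesis using Cons pos by (auto simp: algebra_simps)
  qed
qed auto

text \<open>A common tail only continues the translation by which \<open>piece_map\<close> acts to
  the right of its last interval.\<close>

lemma piece_map_append_right:
  "length a = length b \<Longrightarrow> pow2s c \<Longrightarrow> piece_map p q (a @ c) (b @ c) x = piece_map p q a b x"
  by (induct a b arbitrary: p q rule: list_induct2) (auto simp: piece_map_refl)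

lemma piece_map_scale:
  "length a = length b \<Longrightarrow> k > 0 \<Longrightarrow>
    piece_map (k * p + c) (k * q + d) (map ((*) k) a) (map ((*) k) b) (k * x + c) = k * piece_map p q a b x + d"
proof (induct a b arbitrary: p q rule: list_induct2)
  case (Cons s a t b)
  have 1: "k * x + c < k * p + c \<longleftrightarrow> x < p" using Cons(3) by simp
  have 2: "k * x + c < k * p + c + k * s \<longleftrightarrow> x < p + s"
    using Cons(3) mult_less_cancel_left_pos[of k x "p + s"] by (simp add: algebra_simps)
  have 3: "piece_map (k * p + c + k * s) (k * q + d + k * t) (map ((*) k) a) (map ((*) k) b) (k * x + c) =
      k * piece_map (p + s) (q + t) a b x + d"
    using Cons(2)[of "p + s" "q + t"] Cons(3) by (simp add: distrib_left add_ac)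
  have 4: "k * t / (k * s) * (k * x + c - (k * p + c)) = k * (t / s * (x - p))"
    using Cons(3) by (simp add: field_simps)
  show ?case by (simp only: piece_map.simps list.map 1 2 3 4) (simp add: algebra_simps)
qed (auto simp: algebra_simps)

lemma piece_map_halve: "s > 0 \<Longrightarrow> piece_map p q (s # a) (t # b) x = piece_map p q (s / 2 # s / 2 # a) (t / 2 # t / 2 # b) x"
proof -
  assume s: "s > 0"
  have e: "p + s / 2 + s / 2 = p + s" "q + t / 2 + t / 2 = q + t" by simp_all
  have m: "t / 2 / (s / 2) * (x - p) = t / s * (x - p)"
    "q + t / 2 + t / 2 / (s / 2) * (x - (p + s / 2)) = q + t / s * (x - p)"
    using s by (simp_all add: field_simps)
  show ?thesis using s unfolding piece_map.simps m e by auto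
qed

lemma piece_map_P_plus:
  "length a = length b \<Longrightarrow> pow2s a \<Longrightarrow> pow2s b \<Longrightarrow> p \<in> dyadic \<Longrightarrow> q \<in> dyadic \<Longrightarrow> piece_map p q a b \<in> P_plus"
proof (induct a b arbitrary: p q rule: list_induct2)
  case Nil
  have "piece_map p q [] [] = (\<lambda>x. 1 * x + (q - p))" by (auto simp: fun_eq_iff)
  then show ?case using affine_in_P_plus[of 1 "q - p"] Nil by auto
next
  case (Cons s a t b)
  have st: "s \<in> pow2" "t \<in> pow2" "s > 0" using Cons by (auto intro: pow2_pos)
  have "piece_map p q (s # a) (t # b) =
      glue p (\<lambda>x. 1 * x + (q - p)) (glue (p + s) (\<lambda>x. q + (t / s) * (x - p)) (piece_map (p + s) (q + t) a b))"
    by (auto simp: fun_eq_iff glue_def)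
  moreover have "\<dots> \<in> P_plus"
    using Cons st dyadic_pow2[of s] dyadic_pow2[of t] piece_map_left[of a "p + s" "p + s" "q + t" b]
    by (intro glue_in_P_plus affine_in_P_plus affine_in_P_plus' Cons) (auto simp: glue_def)
  ultimately show ?case by simp
qed

text \<open>Equal total length makes the map the identity on both sides of its intervals when the
  base points \<open>p\<close> and \<open>q\<close> agree.\<close>

definition balanced :: "real list \<Rightarrow> real list \<Rightarrow> bool" where
  "balanced a b \<longleftrightarrow> length a = length b \<and> pow2s a \<and> pow2s b \<and> sum_list a = sum_list b"

lemma piece_map_Fc: assumes "balanced a b" "p \<in> dyadic" shows "piece_map p p a b \<in> Fc"
proof (rule FcI)
  show "piece_map p p a b \<in> P_plus" using assms by (auto simp: balanced_def intro: piece_map_P_plus)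
  fix t assume "\<bar>t\<bar> > \<bar>p\<bar> + \<bar>sum_list a\<bar>"
  then have "t \<le> p \<or> p + sum_list a \<le> t" by linarith
  then show "piece_map p p a b t = t" using assms by (auto simp: balanced_def piece_map_left piece_map_right)
qed

primrec incs :: "(real \<Rightarrow> real) \<Rightarrow> real \<Rightarrow> nat \<Rightarrow> real \<Rightarrow> real list" where
  "incs f u 0 p = []"
| "incs f u (Suc n) p = (f (p + u) - f p) # incs f u n (p + u)"

lemma length_incs [simp]: "length (incs f u n p) = n"
  by (induct n arbitrary: p) auto

lemma sum_incs: "sum_list (incs f u n p) = f (p + n * u) - f p"
  by (induct n arbitrary: p) (auto simp: algebra_simps)

lemma piece_map_incs:
  assumes "u > 0" "\<And>i x. i < n \<Longrightarrow> p + i * u \<le> x \<Longrightarrow> x \<le> p + (real i + 1) * u \<Longrightarrow>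
      f x = f (p + i * u) + (f (p + (real i + 1) * u) - f (p + i * u)) / u * (x - (p + i * u))"
    "p \<le> x" "x \<le> p + n * u"
  shows "piece_map p (f p) (replicate n u) (incs f u n p) x = f x"
  using assms
proof (induct n arbitrary: p)
  case (Suc n)
  show ?case
  proof (cases "x < p + u")
    case True
    then show ?thesis using Suc(3)[of 0 x] Suc(4) by auto
  next
    case False
    have "piece_map (p + u) (f (p + u)) (replicate n u) (incs f u n (p + u)) x = f x"
    proof (rule Suc(1)[OF Suc(2)])
      fix i y assume "i < n" "p + u + real i * u \<le> y" "y \<le> p + u + (real i + 1) * u"
      then show "f y = f (p + u + real i * u) + (f (p + u + (real i + 1) * u) - f (p + u + real i * u)) / u * (y - (p + u + real i * u))"
        using Suc(3)[of "Suc i" y] by (simp add: algebra_simps)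
    qed (use False Suc in \<open>auto simp: algebra_simps\<close>)
    then show ?thesis using False Suc(2,4) by simp
  qed
qed auto

lemma finite_dyadic_common:
  "finite S \<Longrightarrow> S \<subseteq> dyadic \<Longrightarrow> \<exists>m::nat. \<forall>x\<in>S. 2 ^ m * x \<in> \<int>"
proof (induct S rule: finite_induct)
  case (insert x S)
  then obtain m where m: "\<And>y. y \<in> S \<Longrightarrow> 2 ^ m * y \<in> \<int>" by auto
  obtain k where k: "2 ^ k * x \<in> \<int>" using insert by (auto simp: dyadic_iff)
  have "2 ^ (m + k) * y \<in> \<int>" if "y \<in> insert x S" for y
  proof (cases "y = x")
    case True
    have "2 ^ m * (2 ^ k * x) \<in> \<int>" by (rule Ints_mult[OF _ k]) simp
    then show ?thesis using True by (simp add: power_add mult.assoc)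
  next
    case False
    then have y: "2 ^ m * y \<in> \<int>" using m that by auto
    have "2 ^ k * (2 ^ m * y) \<in> \<int>" by (rule Ints_mult[OF _ y]) simp
    then show ?thesis by (simp add: power_add algebra_simps)
  qed
  then show ?case by blast
qed auto

text \<open>A uniform grid of mesh \<open>1 / 2 ^ m\<close> that contains the finitely many
  breakpoints between \<open>- N\<close> and \<open>N\<close> serves as the source list. On each
  cell the slope is a power of two, so the target lengths are powers of two as well.\<close>

lemma Fc_as_lm:
  assumes f: "f \<in> Fc"
  shows "\<exists>p\<in>dyadic. \<exists>n. \<exists>u\<in>pow2. \<exists>b. balanced (replicate n u) b \<and> f = piece_map p p (replicate n u) b"
proof -
  have fP: "f \<in> P_plus" using f by (rule Fc_P_plus)
  obtain M where M: "\<And>t. \<bar>t\<bar> > M \<Longrightarrow> f t = t" using f by (auto simp: Fc_def)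
  obtain N :: nat where N: "\<bar>M\<bar> < N" using reals_Archimedean2 by blast
  have "finite (breakpoints f \<inter> {- real N..real N})" "breakpoints f \<subseteq> dyadic"
    using Fc_P_set[OF f] by (auto simp: P_set_def piecewise_linear_def)
  then obtain m :: nat where m: "\<And>x. x \<in> breakpoints f \<inter> {- real N..real N} \<Longrightarrow> 2 ^ m * x \<in> \<int>"
    using finite_dyadic_common[of "breakpoints f \<inter> {- real N..real N}"] by blast
  define u :: real where "u = 1 / 2 ^ m"
  define p :: real where "p = - real N"
  define n :: nat where "n = 2 * N * 2 ^ m"
  have u: "u \<in> pow2" "u > 0" by (auto simp: u_def)
  have nu: "n * u = 2 * N" by (simp add: n_def u_def)
  have p: "p \<in> dyadic" unfolding p_def using dyadic_of_int[of "- int N"] by simp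
  have fp: "f p = p" using M[of p] N by (simp add: p_def)
  have fq: "f (p + n * u) = p + n * u" using M[of "p + n * u"] N by (simp add: nu p_def)
  have piece: "\<exists>m\<in>pow2. \<forall>x. p + i * u \<le> x \<and> x \<le> p + (real i + 1) * u \<longrightarrow> f x = f (p + i * u) + m * (x - (p + i * u))"
    if i: "i < n" for i :: nat
  proof (rule P_plus_affine_piece[OF fP])
    show "p + i * u < p + (real i + 1) * u" using u by simp
    have "(real i + 1) * u \<le> n * u" using i u(2) by (intro mult_right_mono) auto
    then have ub: "p + (real i + 1) * u \<le> real N" by (simp add: nu p_def)
    have lb: "- real N \<le> p + i * u" using u by (simp add: p_def)
    show "{p + i * u<..<p + (real i + 1) * u} \<inter> breakpoints f = {}"
    proof (rule ccontr)
      assume "{p + i * u<..<p + (real i + 1) * u} \<inter> breakpoints f \<noteq> {}"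
      then obtain x where x: "p + i * u < x" "x < p + (real i + 1) * u" "x \<in> breakpoints f" by auto
      then have "2 ^ m * x \<in> \<int>" using ub lb by (intro m) auto
      \<comment> \<open>After multiplication by \<open>2 ^ m\<close> a break inside a cell would be
        an integer strictly between consecutive integers.\<close>
      then obtain k where k: "2 ^ m * x = of_int k" by (auto elim: Ints_cases)
      have "2 ^ m * (p + i * u) < 2 ^ m * x" "2 ^ m * x < 2 ^ m * (p + (real i + 1) * u)" using x by simp_all
      moreover have "2 ^ m * (p + i * u) = of_int (int i - int N * 2 ^ m)"
        "2 ^ m * (p + (real i + 1) * u) = of_int (int i + 1 - int N * 2 ^ m)"
        by (simp_all add: p_def u_def field_simps)
      ultimately have "int i - int N * 2 ^ m < k" "k < int i + 1 - int N * 2 ^ m"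
        unfolding k by (simp_all only: of_int_less_iff)
      then show False by linarith
    qed
  qed
  have diff: "f x = f (p + i * u) + (f (p + (real i + 1) * u) - f (p + i * u)) / u * (x - (p + i * u))"
    and inc: "f (p + (real i + 1) * u) - f (p + i * u) \<in> pow2"
    if i: "i < n" and x: "p + i * u \<le> x" "x \<le> p + (real i + 1) * u" for i :: nat and x
  proof -
    obtain m where m: "m \<in> pow2"
      "\<And>x. p + i * u \<le> x \<Longrightarrow> x \<le> p + (real i + 1) * u \<Longrightarrow> f x = f (p + i * u) + m * (x - (p + i * u))"
      using piece[OF i] by blast
    have "f (p + (real i + 1) * u) = f (p + i * u) + m * u"
      using m(2)[of "p + (real i + 1) * u"] u by (simp add: algebra_simps)
    then have d: "f (p + (real i + 1) * u) - f (p + i * u) = m * u" by simp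
    show "f (p + (real i + 1) * u) - f (p + i * u) \<in> pow2" using d m(1) u(1) by auto
    have "(f (p + (real i + 1) * u) - f (p + i * u)) / u = m" using d u(2) by simp
    then show "f x = f (p + i * u) + (f (p + (real i + 1) * u) - f (p + i * u)) / u * (x - (p + i * u))"
      using m(2)[OF x] by simp
  qed
  have plb: "(\<And>i. i < k \<Longrightarrow> f (r + (real i + 1) * u) - f (r + real i * u) \<in> pow2) \<Longrightarrow> pow2s (incs f u k r)" for k r
  proof (induct k arbitrary: r)
    case (Suc k)
    have "pow2s (incs f u k (r + u))"
    proof (rule Suc(1))
      fix i assume "i < k"
      then show "f (r + u + (real i + 1) * u) - f (r + u + real i * u) \<in> pow2"
        using Suc(2)[of "Suc i"] by (simp add: algebra_simps)
    qed
    then show ?case using Suc(2)[of 0] by auto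
  qed simp
  have pow2s: "pow2s (incs f u n p)"
  proof (rule plb)
    fix i assume "i < n"
    then show "f (p + (real i + 1) * u) - f (p + real i * u) \<in> pow2"
      using inc[of i "p + i * u"] u(2) by simp
  qed
  have sum: "sum_list (replicate n u) = sum_list (incs f u n p)"
    using fp fq by (simp add: sum_incs sum_list_replicate)
  have bal: "balanced (replicate n u) (incs f u n p)"
    using pow2s u sum by (simp add: balanced_def)
  have "f x = piece_map p p (replicate n u) (incs f u n p) x" for x
  proof -
    consider "x \<le> p" | "p \<le> x" "x \<le> p + n * u" | "p + n * u \<le> x" by linarith
    then show ?thesis
    proof cases
      case 1
      then have "f x = x" using M[of x] N fp by (cases "x = p") (auto simp: p_def)
      then show ?thesis using 1 u by (simp add: piece_map_left)
    next
      case 2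
      have "piece_map p (f p) (replicate n u) (incs f u n p) x = f x"
      proof (rule piece_map_incs[OF u(2)])
        fix i y assume "i < n" "p + real i * u \<le> y" "y \<le> p + (real i + 1) * u"
        then show "f y = f (p + real i * u) + (f (p + (real i + 1) * u) - f (p + real i * u)) / u * (y - (p + real i * u))"
          by (rule diff)
      qed (use 2 in auto)
      then show ?thesis by (simp add: fp)
    next
      case 3
      have "f x = x"
      proof (cases "x = p + n * u")
        case False
        then have "\<bar>x\<bar> > M" using 3 N by (simp add: nu p_def)
        then show ?thesis by (rule M)
      qed (simp add: fq)
      moreover have "piece_map p p (replicate n u) (incs f u n p) x =
          x - (p + sum_list (replicate n u)) + (p + sum_list (incs f u n p))"
        by (rule piece_map_right) (use pow2s u 3 in \<open>auto simp: sum_list_replicate\<close>)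
      ultimately show ?thesis unfolding sum by simp
    qed
  qed
  then have "f = piece_map p p (replicate n u) (incs f u n p)" by blast
  then show ?thesis using bal p u(1) by blast
qed

section \<open>Perfectness of the compactly supported subgroup\<close>

text \<open>Perfectness is proved in the form that every homomorphism from \<open>Fc\<close> to an
  abelian group is trivial. It is later applied to the quotient of \<open>Fc\<close> by a normal
  subgroup that contains all commutators.\<close>

locale Fc_hom = comm_group Q for Q :: "('q, 'm) monoid_scheme" (structure) +
  fixes \<phi> :: "(real \<Rightarrow> real) \<Rightarrow> 'q"
  assumes phi_closed [simp]: "f \<in> Fc \<Longrightarrow> \<phi> f \<in> carrier Q"
    and phi_mult: "f \<in> Fc \<Longrightarrow> g \<in> Fc \<Longrightarrow> \<phi> (g \<circ> f) = \<phi> g \<otimes> \<phi> f"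
begin

lemma phi_id: "\<phi> id = \<one>"
  using phi_mult[OF id_in_Fc id_in_Fc] phi_closed[OF id_in_Fc] by (metis comp_id l_cancel_one')

lemma phi_conj: assumes "f \<in> Fc" "k \<in> Fc" shows "\<phi> (k \<circ> f \<circ> finv k) = \<phi> f"
proof -
  have ki: "finv k \<in> Fc" using assms by (rule_tac Fc_inv)
  have "\<phi> k \<otimes> \<phi> (finv k) = \<one>"
    using phi_mult[OF ki assms(2)] Fc_bij[OF assms(2)] by (simp add: phi_id)
  moreover have "\<phi> (k \<circ> f \<circ> finv k) = \<phi> k \<otimes> \<phi> f \<otimes> \<phi> (finv k)"
    using assms ki by (simp add: phi_mult Fc_comp)
  moreover have "\<phi> k \<otimes> \<phi> f \<otimes> \<phi> (finv k) = \<phi> f \<otimes> (\<phi> k \<otimes> \<phi> (finv k))"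
    using assms ki by (simp add: m_ac)
  ultimately show ?thesis using assms by simp
qed

definition val :: "real list \<Rightarrow> real list \<Rightarrow> 'q" where
  "val a b = \<phi> (piece_map 0 0 a b)"

lemma val_closed [simp]: "balanced a b \<Longrightarrow> val a b \<in> carrier Q"
  by (simp add: val_def piece_map_Fc)

lemma balanced_refl: "pow2s a \<Longrightarrow> balanced a a"
  by (simp add: balanced_def)

lemma balanced_sym: "balanced a b \<Longrightarrow> balanced b a"
  by (simp add: balanced_def)

lemma val_trans:
  assumes "balanced a b" "balanced b c"
  shows "val a c = val b c \<otimes> val a b"
proof -
  have "piece_map 0 0 a c = piece_map 0 0 b c \<circ> piece_map 0 0 a b"
    using assms by (auto simp: fun_eq_iff balanced_def piece_map_comp)
  then show ?thesis using assms by (simp add: val_def phi_mult piece_map_Fc)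
qed

lemma val_refl: "pow2s a \<Longrightarrow> val a a = \<one>"
proof -
  assume "pow2s a"
  then have "piece_map 0 0 a a = id" by (auto simp: piece_map_refl)
  then show ?thesis by (simp add: val_def phi_id)
qed

text \<open>The map placed at \<open>p\<close> and scaled by \<open>c\<close> is conjugate to the
  one at 0 by an element \<open>k\<close> of \<open>Fc\<close> that equals \<open>c * x + p\<close>
  on the interval carrying the support. Thus \<open>\<phi>\<close> sees neither position nor scale,
  and all computations below live on this.\<close>

lemma val_affine:
  assumes ab: "balanced a b" and p: "p \<in> dyadic" and c: "c \<in> pow2"
  shows "\<phi> (piece_map p p (map ((*) c) a) (map ((*) c) b)) = val a b"
proof -
  define \<Sigma> where "\<Sigma> = sum_list a"
  have pos: "c > 0" "\<Sigma> \<ge> 0" using c ab by (auto simp: \<Sigma>_def pow2_pos balanced_def pow2s_sum_nonneg)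
  have "sum_list a \<in> dyadic" if "pow2s a" for a using that by (induct a) auto
  then have "\<Sigma> \<in> dyadic" using ab by (simp add: \<Sigma>_def balanced_def)
  then obtain k where k: "k \<in> Fc" "\<And>x. 0 \<le> x \<Longrightarrow> x \<le> \<Sigma> \<Longrightarrow> k x = c * x + p"
    using Fc_extension[OF affine_in_P_plus[OF c p], of 0 \<Sigma>] pos by auto
  have kP: "k \<in> P_plus" using k(1) by (rule Fc_P_plus)
  let ?f = "piece_map 0 0 a b" and ?g = "piece_map p p (map ((*) c) a) (map ((*) c) b)"
  have fF: "?f \<in> Fc" using ab by (simp add: piece_map_Fc)
  have smap: "sum_list (map ((*) c) a) = c * \<Sigma>" "sum_list (map ((*) c) b) = c * \<Sigma>"
    using ab by (simp_all add: sum_list_const_mult \<Sigma>_def balanced_def)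
  \<comment> \<open>Inside the interval this is the affine covariance of \<open>piece_map\<close>;
    outside, both maps are the identity and \<open>k\<close> only has to preserve the two
    sides.\<close>
  have eq: "?g (k x) = k (?f x)" for x
  proof -
    consider "x < 0" | "0 \<le> x" "x \<le> \<Sigma>" | "\<Sigma> < x" by linarith
    then show ?thesis
    proof cases
      case 1
      then have "k x < k 0" using kP by (simp add: P_plus_less_iff)
      then have "k x \<le> p" using k(2)[of 0] pos by simp
      then have "?g (k x) = k x" using ab c by (simp add: piece_map_left pow2s_map balanced_def)
      then show ?thesis using 1 ab by (simp add: piece_map_left balanced_def)
    next
      case 2
      have f0: "?f 0 = 0" "?f \<Sigma> = \<Sigma>"
        using ab by (auto simp: piece_map_left piece_map_right balanced_def \<Sigma>_def)
      have "?f 0 \<le> ?f x" "?f x \<le> ?f \<Sigma>"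
        using 2 Fc_P_plus[OF fF] by (simp_all add: P_plus_le_iff)
      then have "k (?f x) = c * ?f x + p" using k(2) f0 by simp
      moreover have "?g (k x) = c * ?f x + p"
        using piece_map_scale[of a b c 0 p 0 p x] 2 k(2)[of x] ab pos by (simp add: balanced_def)
      ultimately show ?thesis by simp
    next
      case 3
      then have "k \<Sigma> < k x" using kP by (simp add: P_plus_less_iff)
      then have "p + c * \<Sigma> \<le> k x" using k(2)[of \<Sigma>] pos by simp
      then have "?g (k x) = k x" using ab c smap
        by (subst piece_map_right) (auto simp: pow2s_map balanced_def)
      moreover have "?f x = x" using 3 ab by (subst piece_map_right) (auto simp: \<Sigma>_def balanced_def)
      ultimately show ?thesis by simp
    qed
  qed
  have "k \<circ> ?f \<circ> finv k = ?g"
  proof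
    fix y
    have "k (finv k y) = y" using Fc_bij[OF k(1)] by (simp add: bij_is_surj surj_f_inv_f)
    then show "(k \<circ> ?f \<circ> finv k) y = ?g y" using eq[of "finv k y"] by simp
  qed
  then show ?thesis using phi_conj[OF fF k(1)] by (simp add: val_def)
qed

lemma val_scale:
  "balanced a b \<Longrightarrow> c \<in> pow2 \<Longrightarrow> val (map ((*) c) a) (map ((*) c) b) = val a b"
  using val_affine[of a b 0 c] by (simp add: val_def)

lemma sum_list_dyadic: "pow2s a \<Longrightarrow> sum_list a \<in> dyadic"
  by (induct a) auto

text \<open>A common prefix shifts the base point, which \<open>val_affine\<close> absorbs, and a
  common suffix leaves the map as it is.\<close>

lemma val_append:
  assumes "balanced a b" "pow2s c" "pow2s d"
  shows "val (c @ a @ d) (c @ b @ d) = val a b"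
proof -
  have "piece_map 0 0 (c @ a @ d) (c @ b @ d) = piece_map (sum_list c) (sum_list c) a b"
    using assms by (auto simp: fun_eq_iff balanced_def piece_map_append_left piece_map_append_right)
  moreover have "\<phi> (piece_map (sum_list c) (sum_list c) a b) = val a b"
    using val_affine[of a b "sum_list c" 1] assms by (simp add: sum_list_dyadic map_idI)
  ultimately show ?thesis by (simp add: val_def)
qed

lemma val_inverse:
  assumes "balanced a b" "val a b = \<one>"
  shows "val b a = \<one>"
  using val_trans[OF assms(1) balanced_sym[OF assms(1)]] assms val_refl[of a]
    val_closed[OF balanced_sym[OF assms(1)]] by (simp add: balanced_def)

text \<open>The values of \<open>\<phi>\<close> on swaps of two adjacent intervals are computed by passing from one list of
  lengths to another in two ways.\<close>

lemma val_swap_double: "val [1, 2] [2, 1] = \<one>"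
proof -
  \<comment> \<open>Two routes lead from \<open>?X\<close> to \<open>?Z\<close>. Through
    \<open>?Y\<close> the exchange \<open>d\<close> acts on the leading entries and a 1 then passes
    two halves, each pass costing \<open>s\<close> by scale invariance. Through \<open>?W\<close>
    the same \<open>d\<close> acts on the trailing entries and a single swap \<open>s\<close>
    remains. Hence \<open>s \<otimes> s \<otimes> d = s \<otimes> d\<close>.\<close>
  let ?X = "[1, 1, 1, 1]" and ?Y = "[2, 1 / 2, 1 / 2, 1]" and ?Y' = "[2, 1 / 2, 1, 1 / 2]"
    and ?Z = "[2, 1, 1 / 2, 1 / 2]" and ?W = "[1, 2, 1 / 2, 1 / 2]"
  define d where "d = val [1, 1, 1] [2, 1 / 2, 1 / 2]"
  define s where "s = val [1, 2] [2, 1]"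
  have bal: "balanced ?X ?Y" "balanced ?Y ?Y'" "balanced ?Y' ?Z" "balanced ?Y ?Z" "balanced ?X ?W"
    "balanced ?W ?Z" "balanced [1, 1, 1] [2, 1 / 2, 1 / 2]" "balanced [1, 2] [2, 1]"
    "balanced [1 / 2, 1] [1, 1 / 2]"
    by (simp_all add: balanced_def)
  have s: "s \<in> carrier Q" and d: "d \<in> carrier Q" using bal by (simp_all add: s_def d_def)
  have half: "val [1 / 2, 1] [1, 1 / 2] = s"
    using val_scale[of "[1, 2]" "[2, 1]" "1 / 2"] bal by (simp add: s_def)
  have 1: "val ?X ?Y = d" using val_append[OF bal(7), of "[]" "[1]"] by (simp add: d_def)
  have 2: "val ?Y ?Y' = s" using val_append[OF bal(9), of "[2, 1 / 2]" "[]"] half by simp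
  have 3: "val ?Y' ?Z = s" using val_append[OF bal(9), of "[2]" "[1 / 2]"] half by simp
  have 4: "val ?X ?W = d" using val_append[OF bal(7), of "[1]" "[]"] by (simp add: d_def)
  have 5: "val ?W ?Z = s" using val_append[OF bal(8), of "[]" "[1 / 2, 1 / 2]"] by (simp add: s_def)
  have "s \<otimes> s \<otimes> d = val ?X ?Z"
    using val_trans[OF bal(1,4)] val_trans[OF bal(2,3)] 1 2 3 by simp
  also have "\<dots> = s \<otimes> d" using val_trans[OF bal(5,6)] 4 5 by simp
  finally have "s \<otimes> s = s" using s d by (simp add: right_cancel)
  then show ?thesis using s by (simp flip: s_def)
qed

text \<open>Induction on \<open>j\<close>, again by two routes between the same lists. Replacing
  \<open>[s, s, t]\<close> by \<open>[2 * s, t / 2, t / 2]\<close> costs \<open>d\<close> wherever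
  it happens. One route also swaps \<open>s\<close> with \<open>t\<close> at cost \<open>c\<close>,
  and all remaining swaps are trivial by induction or by \<open>val_swap_double\<close>; so
  \<open>d = d \<otimes> c\<close>.\<close>

lemma val_swap_aux:
  assumes s: "s \<in> pow2"
  shows "val [s, 2 ^ j * s] [2 ^ j * s, s] = \<one>"
proof (induct j)
  case 0
  then show ?case using s by (simp add: val_refl)
next
  case (Suc j)
  define t where "t = 2 ^ Suc j * s"
  have t: "t \<in> pow2" "2 * s \<in> pow2" using s by (auto simp: t_def simp del: power_Suc)
  then have t2: "t / 2 \<in> pow2" by auto
  let ?X = "[s, s, s, t]" and ?Z = "[2 * s, s, t / 2, t / 2]" and ?W = "[s, 2 * s, t / 2, t / 2]"
    and ?V = "[s, s, t, s]" and ?V' = "[2 * s, t / 2, t / 2, s]" and ?V'' = "[2 * s, t / 2, s, t / 2]"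
  have bal: "balanced ?X ?W" "balanced ?W ?Z" "balanced ?X ?V" "balanced ?V ?V'" "balanced ?V' ?V''"
    "balanced ?V'' ?Z" "balanced [s, s, t] [2 * s, t / 2, t / 2]" "balanced [s, t / 2] [t / 2, s]"
    "balanced [s, t] [t, s]" "balanced [s, 2 * s] [2 * s, s]" "balanced [t / 2, s] [s, t / 2]"
    "balanced ?V ?Z" "balanced ?V' ?Z" "balanced [1, 2] [2, 1]"
    using s t t2 by (simp_all add: balanced_def)
  define d where "d = val [s, s, t] [2 * s, t / 2, t / 2]"
  define c where "c = val [s, t] [t, s]"
  have d: "d \<in> carrier Q" and c: "c \<in> carrier Q" using bal by (simp_all add: d_def c_def)
  have e: "val [t / 2, s] [s, t / 2] = \<one>"
    using val_inverse[OF bal(8)] Suc by (simp add: t_def)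
  have sd: "val [s, 2 * s] [2 * s, s] = \<one>"
    using val_scale[OF bal(14) s] val_swap_double by (simp add: mult.commute)
  have 1: "val ?X ?W = d" using val_append[OF bal(7), of "[s]" "[]"] s by (simp add: d_def)
  have 2: "val ?W ?Z = \<one>" using val_append[OF bal(10), of "[]" "[t / 2, t / 2]"] t2 sd by simp
  have 3: "val ?X ?V = c" using val_append[OF bal(9), of "[s, s]" "[]"] s by (simp add: c_def)
  have 4: "val ?V ?V' = d" using val_append[OF bal(7), of "[]" "[s]"] s by (simp add: d_def)
  have 5: "val ?V' ?V'' = \<one>" using val_append[OF bal(11), of "[2 * s, t / 2]" "[]"] t t2 e by simp
  have 6: "val ?V'' ?Z = \<one>" using val_append[OF bal(11), of "[2 * s]" "[t / 2]"] t t2 e by simp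
  have "d = val ?X ?Z" using val_trans[OF bal(1,2)] 1 2 d by simp
  also have "\<dots> = d \<otimes> c"
    using val_trans[OF bal(3,12)] val_trans[OF bal(4,13)] val_trans[OF bal(5,6)] 3 4 5 6 c d by simp
  finally have "c = \<one>" using c d l_cancel_one'[of d c] by simp
  then show ?case by (simp add: c_def t_def)
qed

lemma val_swap:
  assumes s: "s \<in> pow2" and t: "t \<in> pow2"
  shows "val [s, t] [t, s] = \<one>"
proof (cases "s \<le> t")
  case True
  have "t / s \<in> pow2" "t / s \<ge> 1" using s t True pow2_pos[OF s] by auto
  then obtain j :: nat where "t / s = 2 ^ j" using pow2_ge_1 by blast
  then have "t = 2 ^ j * s" using pow2_pos[OF s] by (simp add: field_simps)
  then show ?thesis using val_swap_aux[OF s] by simp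
next
  case False
  have "s / t \<in> pow2" "s / t \<ge> 1" using s t False pow2_pos[OF t] by auto
  then obtain j :: nat where "s / t = 2 ^ j" using pow2_ge_1 by blast
  then have "s = 2 ^ j * t" using pow2_pos[OF t] by (simp add: field_simps)
  then have "val [t, s] [s, t] = \<one>" using val_swap_aux[OF t] by simp
  moreover have "balanced [t, s] [s, t]" using s t by (simp add: balanced_def)
  ultimately show ?thesis by (rule val_inverse[rotated])
qed

section \<open>Reduction of lists to equal lengths\<close>

definition triv :: "real list \<Rightarrow> real list \<Rightarrow> bool" where
  "triv a b \<longleftrightarrow> balanced a b \<and> val a b = \<one>"

lemma triv_refl: "pow2s a \<Longrightarrow> triv a a"
  by (simp add: triv_def balanced_refl val_refl)

lemma triv_sym: "triv a b \<Longrightarrow> triv b a"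
  by (simp add: triv_def balanced_sym val_inverse)

lemma triv_trans: "triv a b \<Longrightarrow> triv b c \<Longrightarrow> triv a c"
proof -
  assume 1: "triv a b" and 2: "triv b c"
  then have "val a c = val b c \<otimes> val a b" by (intro val_trans) (auto simp: triv_def)
  moreover have "balanced a c" using 1 2 by (auto simp: triv_def balanced_def)
  ultimately show ?thesis using 1 2 by (simp add: triv_def)
qed

lemma triv_append:
  assumes "triv a b" "pow2s c" "pow2s d" shows "triv (c @ a @ d) (c @ b @ d)"
  using assms val_append[of a b c d] by (auto simp: triv_def balanced_def)

lemma triv_swap: "s \<in> pow2 \<Longrightarrow> t \<in> pow2 \<Longrightarrow> triv [s, t] [t, s]"
  by (simp add: triv_def val_swap balanced_def)

text \<open>Halving the first interval of both lists shows that the swap of \<open>2 * s\<close> and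
  \<open>t\<close> is the same map as the one from \<open>[s, s, t]\<close> to
  \<open>[t / 2, t / 2, 2 * s]\<close>. Further swaps bring \<open>2 * s\<close> to the
  front.\<close>

lemma triv_merge:
  assumes s: "s \<in> pow2" and t: "t \<in> pow2"
  shows "triv [s, s, t] [2 * s, t / 2, t / 2]"
proof -
  have s2: "2 * s \<in> pow2" and t2: "t / 2 \<in> pow2" using s t by auto
  let ?A = "[s, s, t]" and ?B = "[2 * s, t / 2, t / 2]" and ?C = "[t / 2, t / 2, 2 * s]"
  have "piece_map 0 0 [2 * s, t] [t, 2 * s] = piece_map 0 0 ?A ?C"
    using piece_map_halve[of "2 * s" 0 0 "[t]" t "[2 * s]"] pow2_pos[OF s] by (simp add: fun_eq_iff del: piece_map.simps)
  then have "val ?A ?C = val [2 * s, t] [t, 2 * s]" by (simp add: val_def del: piece_map.simps)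
  then have 1: "triv ?A ?C" using val_swap[OF s2 t] s s2 t t2 by (simp add: triv_def balanced_def)
  have 2: "triv ?B [t / 2, 2 * s, t / 2]"
    using triv_append[OF triv_swap[OF s2 t2], of "[]" "[t / 2]"] t2 by simp
  have 3: "triv [t / 2, 2 * s, t / 2] ?C"
    using triv_append[OF triv_swap[OF s2 t2], of "[t / 2]" "[]"] t2 by simp
  show ?thesis using triv_trans[OF 1 triv_sym[OF triv_trans[OF 2 3]]] .
qed

lemma triv_move: "pow2s (a @ [x] @ b) \<Longrightarrow> triv (x # a @ b) (a @ [x] @ b)"
proof (induct a)
  case Nil
  then show ?case by (simp add: triv_refl)
next
  case (Cons y a)
  have "triv (x # y # a @ b) (y # x # a @ b)"
    using triv_append[OF triv_swap[of x y], of "[]" "a @ b"] Cons by simp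
  moreover have "triv (y # x # a @ b) (y # a @ [x] @ b)"
    using triv_append[of "x # a @ b" "a @ [x] @ b" "[y]" "[]"] Cons by simp
  ultimately show ?case using triv_trans by simp
qed

lemma triv_mset: "pow2s a \<Longrightarrow> mset a = mset b \<Longrightarrow> triv a b"
proof (induct a arbitrary: b)
  case Nil
  then show ?case by (simp add: triv_refl)
next
  case (Cons x a)
  have "x \<in> set b" using Cons(3) by (metis list.set_intros(1) set_mset_mset)
  then obtain b1 b2 where b: "b = b1 @ [x] @ b2" by (metis append_Cons append_Nil split_list)
  then have m: "mset a = mset (b1 @ b2)" using Cons(3) by simp
  then have "triv a (b1 @ b2)" using Cons by simp
  then have 1: "triv (x # a) (x # b1 @ b2)"
    using triv_append[of a "b1 @ b2" "[x]" "[]"] Cons by simp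
  have "set b = set (x # a)" using Cons(3) by (metis set_mset_mset)
  then have "pow2s b" using Cons(2) by (simp add: pow2s_def)
  then have "triv (x # b1 @ b2) b" using triv_move b by simp
  then show ?case using 1 triv_trans by blast
qed

text \<open>Since \<open>t / 2\<close> is an integral multiple of \<open>s\<close>, the halved
  interval stays on the grid of mesh \<open>1 / 2 ^ M\<close>. The grid is thus never refined, and
  the scaled sum of squares remains a natural number throughout the descent in
  \<open>triv_uniform\<close>.\<close>

lemma pow2_grid_half:
  assumes "s \<in> pow2" "t \<in> pow2" "2 ^ M * s \<in> \<nat>" "4 * s \<le> t"
  shows "2 ^ M * (t / 2) \<in> \<nat>"
proof -
  have s: "s > 0" using assms(1) by (rule pow2_pos)
  have "t / 2 / s \<in> pow2" "t / 2 / s \<ge> 1" using assms s by (auto simp: field_simps)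
  then obtain k :: nat where "t / 2 / s = 2 ^ k" using pow2_ge_1 by blast
  then have "t / 2 = 2 ^ k * s" using s by (simp add: field_simps)
  then have "2 ^ M * (t / 2) = 2 ^ k * (2 ^ M * s)" by simp
  also have "\<dots> \<in> \<nat>" by (rule Nats_mult[OF _ assms(3)]) (use of_nat_in_Nats[of "2 ^ k"] in simp)
  finally show ?thesis .
qed

lemma sum_squares_Nats:
  fixes b :: "real list"
  assumes "\<And>x. x \<in> set b \<Longrightarrow> c * x \<in> \<nat>"
  shows "(\<Sum>x\<leftarrow>b. (c * x)\<^sup>2) \<in> \<nat>"
  using assms
proof (induct b)
  case (Cons x b)
  have x: "c * x \<in> \<nat>" using Cons(2) by simp
  have "(c * x)\<^sup>2 \<in> \<nat>" unfolding power2_eq_square by (rule Nats_mult[OF x x])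
  then show ?case using Cons by (simp del: power_mult_distrib)
qed simp

text \<open>Merging two shortest intervals and halving a longest one decreases the sum of squares.\<close>

lemma triv_uniform:
  fixes a :: "real list" and u :: real
  assumes "pow2s a" "u \<in> pow2" "sum_list a = length a * u" "\<And>x. x \<in> set a \<Longrightarrow> 2 ^ M * x \<in> \<nat>"
    "(\<Sum>x\<leftarrow>a. (2 ^ M * x)\<^sup>2) = real N"
  shows "triv a (replicate (length a) u)"
  using assms
proof (induct N arbitrary: a rule: less_induct)
  case (less N a)
  show ?case
  proof (cases "\<forall>x\<in>set a. x = u")
    case True
    then have "a = replicate (length a) u" by (simp add: replicate_length_same)
    then show ?thesis using triv_refl[OF less(2)] by simp
  next
    case False
    then have ne: "a \<noteq> []" "finite (set a)" "set a \<noteq> {}" by auto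
    have pw: "x \<in> set a \<Longrightarrow> x \<in> pow2" for x using less(2) by (auto simp: pow2s_def)
    \<comment> \<open>The mean length is \<open>u\<close>, so unless all lengths equal
      \<open>u\<close> some are smaller and some are larger.\<close>
    have sum_u: "(\<Sum>x\<leftarrow>a. x - u) = 0"
      using less(4) by (simp add: sum_list_subtractf sum_list_triv)
    have nn: "\<forall>x\<in>set a. x = u" if "\<forall>x\<in>set a. x \<ge> u"
    proof -
      have "(\<Sum>x\<leftarrow>a. x - u) = 0 \<longleftrightarrow> (\<forall>y\<in>set (map (\<lambda>x. x - u) a). y = 0)"
        by (rule sum_list_nonneg_eq_0_iff) (use that in auto)
      then show ?thesis using sum_u by simp
    qed
    have np: "\<forall>x\<in>set a. x = u" if "\<forall>x\<in>set a. x \<le> u"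
    proof -
      have "(\<Sum>x\<leftarrow>a. u - x) = 0" using less(4) by (simp add: sum_list_subtractf sum_list_triv)
      moreover have "(\<Sum>x\<leftarrow>a. u - x) = 0 \<longleftrightarrow> (\<forall>y\<in>set (map (\<lambda>x. u - x) a). y = 0)"
        by (rule sum_list_nonneg_eq_0_iff) (use that in auto)
      ultimately show ?thesis by simp
    qed
    define s where "s = Min (set a)"
    define t where "t = Max (set a)"
    have s: "s \<in> set a" "\<And>x. x \<in> set a \<Longrightarrow> s \<le> x" and t: "t \<in> set a" "\<And>x. x \<in> set a \<Longrightarrow> x \<le> t"
      using ne by (auto simp: s_def t_def)
    have su: "s < u"
    proof (rule ccontr)
      assume "\<not> s < u"
      then have "\<forall>x\<in>set a. x \<ge> u" using s(2) by force
      then show False using nn False by blast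
    qed
    have tu: "u < t"
    proof (rule ccontr)
      assume "\<not> u < t"
      then have "\<forall>x\<in>set a. x \<le> u" using t(2) by force
      then show False using np False by blast
    qed
    have sp: "s \<in> pow2" "s > 0" and tp: "t \<in> pow2" using pw s(1) t(1) by (auto intro: pow2_pos)
    have s2u: "2 * s \<le> u" and u2t: "2 * u \<le> t"
      using pow2_less_imp_double sp tp less(3) su tu by auto
    then have st: "4 * s \<le> t" by linarith
    define r1 where "r1 = remove1 s a"
    have m1: "mset a = add_mset s (mset r1)" using s(1) by (simp add: r1_def)
    have sr1: "set r1 \<subseteq> set a" by (simp add: r1_def set_remove1_subset)
    \<comment> \<open>A unique shortest interval is impossible: all other lengths and the total
      length would be multiples of \<open>2 * s\<close>, making 1/2 an integer.\<close>
    have "s \<in> set r1"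
    proof (rule ccontr)
      assume ns: "s \<notin> set r1"
      have quot: "x / (2 * s) \<in> \<int>" if "x \<in> pow2" "2 * s \<le> x" for x
      proof -
        have "x / (2 * s) \<in> pow2" "x / (2 * s) \<ge> 1" using that sp by auto
        then obtain k :: nat where "x / (2 * s) = 2 ^ k" using pow2_ge_1 by blast
        then show ?thesis by simp
      qed
      have "x / (2 * s) \<in> \<int>" if "x \<in> set r1" for x
      proof (rule quot)
        have "x \<in> set a" "x \<noteq> s" using that sr1 ns by auto
        then show "x \<in> pow2" "2 * s \<le> x"
          using pw pow2_less_imp_double[OF sp(1), of x] s(2)[of x] by auto
      qed
      then have "(\<Sum>x\<leftarrow>r1. x / (2 * s)) \<in> \<int>" by (induct r1) auto
      moreover have "sum_list a = s + sum_list r1"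
        using m1 by (metis sum_mset_sum_list sum_mset.add_mset)
      then have "sum_list r1 = real (length a) * u - s" using less(4) by simp
      moreover have "(\<Sum>x\<leftarrow>r1. x / (2 * s)) = sum_list r1 / (2 * s)"
        by (induct r1) (auto simp: add_divide_distrib)
      ultimately have "(\<Sum>x\<leftarrow>r1. x / (2 * s)) \<in> \<int>"
        and "(\<Sum>x\<leftarrow>r1. x / (2 * s)) = real (length a) * (u / (2 * s)) - 1 / 2"
        using sp(2) by (simp_all add: field_simps)
      moreover have "real (length a) * (u / (2 * s)) \<in> \<int>"
        by (rule Ints_mult[OF _ quot[OF less(3) s2u]]) simp
      ultimately have "real (length a) * (u / (2 * s)) - (real (length a) * (u / (2 * s)) - 1 / 2) \<in> \<int>"
        using Ints_diff by metis
      then have "(1 / 2 :: real) \<in> \<int>" by simp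
      then obtain k where "(1 / 2 :: real) = of_int k" by (auto elim: Ints_cases)
      then have "real_of_int (2 * k) = real_of_int 1" by simp
      then show False by (simp only: of_int_eq_iff) presburger
    qed
    define r2 where "r2 = remove1 s r1"
    have m2: "mset a = add_mset s (add_mset s (mset r2))"
      using m1 \<open>s \<in> set r1\<close> by (simp add: r2_def)
    have "t \<noteq> s" using su tu by auto
    then have "t \<in># mset r2" using t(1) m2 by (metis insert_iff set_mset_add_mset_insert set_mset_mset)
    then have translation: "t \<in> set r2" by simp
    define r where "r = remove1 t r2"
    have m: "mset a = mset ([s, s, t] @ r)" using m2 translation by (simp add: r_def)
    define a' where "a' = [2 * s, t / 2, t / 2] @ r"
    have sa: "set a = set ([s, s, t] @ r)" using m by (metis set_mset_mset)
    then have plr: "pow2s r" using less(2) by (auto simp: pow2s_def)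
    have tr1: "triv a ([s, s, t] @ r)" using triv_mset[OF less(2) m] .
    have tr2: "triv ([s, s, t] @ r) a'"
      using triv_append[OF triv_merge[OF sp(1) tp], of "[]" r] plr by (simp add: a'_def)
    have len: "length a' = length a" using arg_cong[OF m, of size] by (simp add: a'_def)
      have grid: "2 ^ M * x \<in> \<nat>" if "x \<in> set a'" for x
      proof -
        have g: "2 ^ M * s \<in> \<nat>" using less(5) s(1) by blast
        have "2 ^ M * (2 * s) = 2 * (2 ^ M * s)" by simp
        also have "\<dots> \<in> \<nat>" by (rule Nats_mult[OF _ g]) simp
        finally have "2 ^ M * (2 * s) \<in> \<nat>" .
        moreover have "2 ^ M * (t / 2) \<in> \<nat>" using pow2_grid_half[OF sp(1) tp g st] .
        moreover have "2 ^ M * x \<in> \<nat>" if "x \<in> set r"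
          using less(5)[of x] sa that by simp
        moreover have "x = 2 * s \<or> x = t / 2 \<or> x \<in> set r" using that by (simp add: a'_def)
        ultimately show ?thesis by metis
      qed
      have sq: "(\<Sum>x\<leftarrow>b. (2 ^ M * x)\<^sup>2) = (\<Sum>x\<in>#mset b. (2 ^ M * x)\<^sup>2)" for b :: "real list"
        by (simp add: sum_mset_sum_list flip: mset_map)
      have "(\<Sum>x\<leftarrow>a'. (2 ^ M * x)\<^sup>2) \<in> \<nat>" using grid by (rule sum_squares_Nats)
      then obtain N' where N': "(\<Sum>x\<leftarrow>a'. (2 ^ M * x)\<^sup>2) = real N'" by (auto elim: Nats_cases)
    have "triv a' (replicate (length a') u)"
    proof (rule less(1)[of N'])
      show "\<And>x. x \<in> set a' \<Longrightarrow> 2 ^ M * x \<in> \<nat>" by (rule grid)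
      show "(\<Sum>x\<leftarrow>a'. (2 ^ M * x)\<^sup>2) = real N'" by (rule N')
      have "real N = (\<Sum>x\<leftarrow>[s, s, t] @ r. (2 ^ M * x)\<^sup>2)"
        using less(6) sq[of a] sq[of "[s, s, t] @ r"] m by simp
      then have "real N - real N' = (2 ^ M)\<^sup>2 * (t\<^sup>2 / 2 - 2 * s\<^sup>2)"
        unfolding N'[symmetric] by (simp add: a'_def power_mult_distrib power_divide algebra_simps)
      \<comment> \<open>Up to the scaling factor this is the drop in the sum of squares when
        \<open>s, s, t\<close> become \<open>2 * s, t / 2, t / 2\<close>; it is positive because
        \<open>4 * s \<le> t\<close>.\<close>
      moreover have "t\<^sup>2 / 2 - 2 * s\<^sup>2 > 0"
      proof -
        have "(4 * s)\<^sup>2 \<le> t\<^sup>2" using st sp by (intro power_mono) auto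
        moreover have "s\<^sup>2 > 0" using sp by simp
        moreover have "(4 * s)\<^sup>2 = 16 * s\<^sup>2" by (simp add: power_mult_distrib)
        ultimately show ?thesis by linarith
      qed
      ultimately have "real N - real N' > 0" by simp
      then show "N' < N" by simp
      show "pow2s a'" using plr sp tp by (auto simp: a'_def)
      have "sum_list a = sum_list ([s, s, t] @ r)"
        by (metis m sum_mset_sum_list)
      also have "\<dots> = sum_list a'" by (simp add: a'_def)
      finally show "sum_list a' = length a' * u"
        using less(4) len by simp
    qed (rule less(3))
    then show ?thesis using triv_trans[OF tr1 triv_trans[OF tr2]] len by simp
  qed
qed

text \<open>The source list of \<open>f\<close> can be taken uniform. The target list
  \<open>b\<close> has as many entries and the same sum, so \<open>triv_uniform\<close> leads from
  \<open>b\<close> back to the source list.\<close>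

theorem phi_trivial: assumes "f \<in> Fc" shows "\<phi> f = \<one>"
proof -
  obtain p n u b where b: "p \<in> dyadic" "u \<in> pow2" "balanced (replicate n u) b"
    "f = piece_map p p (replicate n u) b"
    using Fc_as_lm[OF assms] by blast
  have plb: "pow2s b" and len: "length b = n" and sum: "sum_list b = length b * u"
    using b(3) by (auto simp: balanced_def sum_list_replicate)
  have "set b \<subseteq> dyadic" using plb by (auto simp: pow2s_def)
  then obtain M :: nat where M: "\<And>x. x \<in> set b \<Longrightarrow> 2 ^ M * x \<in> \<int>"
    using finite_dyadic_common[of "set b"] by auto
  have nat: "2 ^ M * x \<in> \<nat>" if x: "x \<in> set b" for x
  proof -
    have "x > 0" using x plb by (auto simp: pow2s_def intro: pow2_pos)
    then show ?thesis using M[OF x] by (simp add: Nats_altdef2)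
  qed
  have "(\<Sum>x\<leftarrow>b. (2 ^ M * x)\<^sup>2) \<in> \<nat>"
    using nat by (rule sum_squares_Nats)
  then obtain N where "(\<Sum>x\<leftarrow>b. (2 ^ M * x)\<^sup>2) = real N" by (auto elim: Nats_cases)
  then have "triv b (replicate n u)"
    using triv_uniform[OF plb b(2) sum nat] len by simp
  then have "triv (replicate n u) b" by (rule triv_sym)
  then have "val (replicate n u) b = \<one>" by (simp add: triv_def)
  moreover have "\<phi> f = val (replicate n u) b"
    using val_affine[OF b(3,1), of 1] b(4) by (simp add: map_idI)
  ultimately show ?thesis by simp
qed

end

section \<open>Subgroups of finite index\<close>

definition P_subgroup :: "(real \<Rightarrow> real) set \<Rightarrow> bool" where
  "P_subgroup A \<longleftrightarrow> A \<subseteq> P_set \<and> id \<in> A \<and> (\<forall>f\<in>A. \<forall>g\<in>A. f \<circ> g \<in> A) \<and> (\<forall>f\<in>A. finv f \<in> A)"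

text \<open>A finite set of representatives, possibly redundant, replaces the cosets. Together with
  \<open>P_subgroup\<close> this keeps the arguments on the level of sets, while the ambient group
  varies.\<close>

definition finite_index :: "(real \<Rightarrow> real) set \<Rightarrow> (real \<Rightarrow> real) set \<Rightarrow> bool" where
  "finite_index G A \<longleftrightarrow> P_subgroup A \<and> A \<subseteq> G \<and> (\<exists>S. finite S \<and> S \<subseteq> G \<and> (\<forall>g\<in>G. \<exists>s\<in>S. g \<circ> finv s \<in> A))"

lemma P_subgroup_P_set: "P_subgroup A \<Longrightarrow> f \<in> A \<Longrightarrow> f \<in> P_set"
  by (auto simp: P_subgroup_def)

lemma P_subgroup_bij: "P_subgroup A \<Longrightarrow> f \<in> A \<Longrightarrow> bij f"
  by (auto simp: P_subgroup_def P_set_bij)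

lemma P_subgroup_id: "P_subgroup A \<Longrightarrow> id \<in> A"
  by (auto simp: P_subgroup_def)

lemma P_subgroup_comp: "P_subgroup A \<Longrightarrow> f \<in> A \<Longrightarrow> g \<in> A \<Longrightarrow> f \<circ> g \<in> A"
  by (auto simp: P_subgroup_def)

lemma P_subgroup_inv: "P_subgroup A \<Longrightarrow> f \<in> A \<Longrightarrow> finv f \<in> A"
  by (auto simp: P_subgroup_def)

lemma P_subgroup_iff: "P_subgroup A \<longleftrightarrow> subgroup A P_group"
proof
  assume A: "P_subgroup A"
  then show "subgroup A P_group"
    by (intro P.subgroupI) (auto simp: P_subgroup_def P_group_inv subset_iff)
next
  assume A: "subgroup A P_group"
  then show "P_subgroup A"
    using subgroup.subset[OF A] subgroup.one_closed[OF A] subgroup.m_closed[OF A]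
      subgroup.m_inv_closed[OF A]
    by (auto simp: P_subgroup_def subset_iff simp flip: P_group_inv)
qed

lemma P_subgroup_inter: "P_subgroup A \<Longrightarrow> P_subgroup B \<Longrightarrow> P_subgroup (A \<inter> B)"
  by (auto simp: P_subgroup_def)

lemma finv_comp: "bij f \<Longrightarrow> bij g \<Longrightarrow> finv (f \<circ> g) = finv g \<circ> finv f"
  by (simp add: o_inv_distrib)

lemma finv_finv [simp]: "bij f \<Longrightarrow> finv (finv f) = f"
  by (simp add: inv_inv_eq)

lemma finv_left [simp]: "bij f \<Longrightarrow> finv f (f x) = x"
  by (simp add: bij_is_inj)

lemma finv_right [simp]: "bij f \<Longrightarrow> f (finv f x) = x"
  by (simp add: bij_is_surj surj_f_inv_f)

lemma finv_comp_left [simp]: "bij f \<Longrightarrow> finv f \<circ> (f \<circ> g) = g"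
  by (simp add: fun_eq_iff)

lemma finv_comp_right [simp]: "bij f \<Longrightarrow> f \<circ> (finv f \<circ> g) = g"
  by (simp add: fun_eq_iff)

lemma bij_finv [simp]: "bij f \<Longrightarrow> bij (finv f)"
  by (rule bij_imp_bij_inv)

lemma (in group) finite_rcosets_iff:
  assumes A: "subgroup A G"
  shows "finite (rcosets A) \<longleftrightarrow> (\<exists>S. finite S \<and> S \<subseteq> carrier G \<and> (\<forall>g\<in>carrier G. \<exists>s\<in>S. g \<otimes> inv s \<in> A))"
proof
  assume fin: "finite (rcosets A)"
  define r where "r X = (SOME x. x \<in> X)" for X :: "'a set"
  have rX: "r X \<in> X" if "X \<in> rcosets A" for X
    using subgroup.rcosets_non_empty[OF A that] by (auto simp: r_def some_in_eq)
  show "\<exists>S. finite S \<and> S \<subseteq> carrier G \<and> (\<forall>g\<in>carrier G. \<exists>s\<in>S. g \<otimes> inv s \<in> A)"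
  proof (intro exI[of _ "r ` (rcosets A)"] conjI ballI)
    show "finite (r ` (rcosets A))" using fin by simp
    show "r ` (rcosets A) \<subseteq> carrier G"
      using rX subgroup.rcosets_carrier[OF A group_axioms] by auto
    fix g assume g: "g \<in> carrier G"
    let ?X = "A #> g"
    have X: "?X \<in> rcosets A" using g subgroup.subset[OF A] by (intro rcosetsI)
    have rc: "r ?X \<in> carrier G" using rX[OF X] subgroup.rcosets_carrier[OF A group_axioms X] by auto
    have "r ?X \<otimes> inv g \<in> A" using subgroup.rcos_module_imp[OF A group_axioms g rX[OF X]] .
    then have "inv (r ?X \<otimes> inv g) \<in> A" by (rule subgroup.m_inv_closed[OF A])
    then have "g \<otimes> inv (r ?X) \<in> A" using g rc by (simp add: inv_mult_group)
    then show "\<exists>s\<in>r ` (rcosets A). g \<otimes> inv s \<in> A" using X by blast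
  qed
next
  assume "\<exists>S. finite S \<and> S \<subseteq> carrier G \<and> (\<forall>g\<in>carrier G. \<exists>s\<in>S. g \<otimes> inv s \<in> A)"
  then obtain S where S: "finite S" "S \<subseteq> carrier G" "\<And>g. g \<in> carrier G \<Longrightarrow> \<exists>s\<in>S. g \<otimes> inv s \<in> A" by blast
  have "rcosets A \<subseteq> (\<lambda>s. A #> s) ` S"
  proof
    fix X assume "X \<in> rcosets A"
    then obtain g where g: "g \<in> carrier G" "X = A #> g" by (auto simp: RCOSETS_def)
    obtain s where s: "s \<in> S" "g \<otimes> inv s \<in> A" using S(3)[OF g(1)] by blast
    then have "g \<in> A #> s" using subgroup.rcos_module_rev[OF A group_axioms] g S(2) by auto
    then have "A #> s = A #> g" using repr_independence[OF _ _ A] s S(2) by auto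
    then show "X \<in> (\<lambda>s. A #> s) ` S" using g s by auto
  qed
  then show "finite (rcosets A)" using S(1) finite_surj by auto
qed

lemma finite_index_iff:
  assumes G: "P_subgroup G"
  shows "finite_index_subgroup (P_group\<lparr>carrier := G\<rparr>) A \<longleftrightarrow> finite_index G A"
proof -
  have sG: "subgroup G P_group" using G by (simp add: P_subgroup_iff)
  interpret G: group "P_group\<lparr>carrier := G\<rparr>"
    using subgroup.subgroup_is_group[OF sG group_P_group] .
  have sub: "subgroup A (P_group\<lparr>carrier := G\<rparr>) \<longleftrightarrow> P_subgroup A \<and> A \<subseteq> G"
  proof
    assume A: "subgroup A (P_group\<lparr>carrier := G\<rparr>)"
    show "P_subgroup A \<and> A \<subseteq> G"
      using P.incl_subgroup[OF sG A] subgroup.subset[OF A] by (simp add: P_subgroup_iff)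
  next
    assume "P_subgroup A \<and> A \<subseteq> G"
    then show "subgroup A (P_group\<lparr>carrier := G\<rparr>)"
      using P.subgroup_incl[of A G] sG by (simp add: P_subgroup_iff)
  qed
  have inv: "inv\<^bsub>P_group\<lparr>carrier := G\<rparr>\<^esub> s = finv s" if "s \<in> G" for s
    using P.m_inv_consistent[OF sG that] P_group_inv[OF P_subgroup_P_set[OF G that]] by simp
  show ?thesis
  proof (cases "P_subgroup A \<and> A \<subseteq> G")
    case True
    then have "subgroup A (P_group\<lparr>carrier := G\<rparr>)" using sub by simp
    then have "finite (rcosets\<^bsub>P_group\<lparr>carrier := G\<rparr>\<^esub> A) \<longleftrightarrow>
        (\<exists>S. finite S \<and> S \<subseteq> G \<and> (\<forall>g\<in>G. \<exists>s\<in>S. g \<circ> inv\<^bsub>P_group\<lparr>carrier := G\<rparr>\<^esub> s \<in> A))"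
      using G.finite_rcosets_iff by simp
    also have "\<dots> \<longleftrightarrow> (\<exists>S. finite S \<and> S \<subseteq> G \<and> (\<forall>g\<in>G. \<exists>s\<in>S. g \<circ> finv s \<in> A))"
      by (intro ex_cong1 conj_cong ball_cong bex_cong refl) (auto simp: inv)
    finally show ?thesis using True sub by (simp add: finite_index_subgroup_def finite_index_def)
  next
    case False
    then show ?thesis using sub by (auto simp: finite_index_subgroup_def finite_index_def)
  qed
qed

lemma finite_index_psub: "finite_index G A \<Longrightarrow> P_subgroup A"
  by (simp add: finite_index_def)

lemma finite_index_subset: "finite_index G A \<Longrightarrow> A \<subseteq> G"
  by (simp add: finite_index_def)

lemma finite_index_trans:
  assumes G: "P_subgroup G" and A: "finite_index G A" and K: "finite_index A K"
  shows "finite_index G K"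
proof -
  obtain S where S: "finite S" "S \<subseteq> G" "\<And>g. g \<in> G \<Longrightarrow> \<exists>s\<in>S. g \<circ> finv s \<in> A"
    using A by (auto simp: finite_index_def)
  obtain T where T: "finite T" "T \<subseteq> A" "\<And>g. g \<in> A \<Longrightarrow> \<exists>t\<in>T. g \<circ> finv t \<in> K"
    using K by (auto simp: finite_index_def)
  have TG: "T \<subseteq> G" using T(2) finite_index_subset[OF A] by auto
  let ?U = "(\<lambda>(t, s). t \<circ> s) ` (T \<times> S)"
  have "\<exists>u\<in>?U. g \<circ> finv u \<in> K" if g: "g \<in> G" for g
  proof -
    obtain s where s: "s \<in> S" "g \<circ> finv s \<in> A" using S(3)[OF g] by blast
    obtain t where t: "t \<in> T" "g \<circ> finv s \<circ> finv t \<in> K" using T(3)[OF s(2)] by blast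
    have "g \<circ> finv (t \<circ> s) \<in> K"
      using t s S(2) TG P_subgroup_bij[OF G] by (simp add: finv_comp subset_iff comp_assoc)
    then show ?thesis using s t by (intro bexI[of _ "t \<circ> s"]) auto
  qed
  moreover have "?U \<subseteq> G" using S(2) TG P_subgroup_comp[OF G] by auto
  moreover have "finite ?U" using S(1) T(1) by simp
  ultimately show ?thesis using finite_index_psub[OF K] finite_index_subset[OF K] finite_index_subset[OF A]
    unfolding finite_index_def by (intro conjI exI[of _ ?U]) (auto simp only: subset_iff)
qed

lemma finite_index_super:
  assumes K: "finite_index G K" and "K \<subseteq> A" "A \<subseteq> G" "P_subgroup A"
  shows "finite_index G A"
proof -
  obtain S where "finite S" "S \<subseteq> G" "\<And>g. g \<in> G \<Longrightarrow> \<exists>s\<in>S. g \<circ> finv s \<in> K"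
    using K by (auto simp: finite_index_def)
  then show ?thesis unfolding finite_index_def using assms(2-4) by (intro conjI exI[of _ S]) (auto, meson subsetD)
qed

text \<open>Cosets of \<open>K\<close> that are met by the image of \<open>\<alpha>\<close> get a
  representative from \<open>A\<close>, and two elements of \<open>A\<close> landing in the same
  coset differ by an element of the preimage. Intersections, preimages of congruence subgroups and
  domains of composites are all instances.\<close>

lemma finite_index_vimage:
  assumes A: "P_subgroup A" and B: "P_subgroup B" and K: "finite_index B K"
    and hom: "\<And>x. x \<in> A \<Longrightarrow> \<alpha> x \<in> B" "\<And>x y. x \<in> A \<Longrightarrow> y \<in> A \<Longrightarrow> \<alpha> (x \<circ> y) = \<alpha> x \<circ> \<alpha> y"
  shows "finite_index A {x \<in> A. \<alpha> x \<in> K}"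
proof -
  have K': "P_subgroup K" "K \<subseteq> B" using K by (auto simp: finite_index_def)
  have id: "\<alpha> id = id"
  proof -
    have "\<alpha> id \<circ> \<alpha> id = \<alpha> id" using hom(2)[OF P_subgroup_id[OF A] P_subgroup_id[OF A]] by simp
    then have "finv (\<alpha> id) \<circ> (\<alpha> id \<circ> \<alpha> id) = finv (\<alpha> id) \<circ> \<alpha> id" by simp
    then show ?thesis using P_subgroup_bij[OF B hom(1)[OF P_subgroup_id[OF A]]] by simp
  qed
  have inv: "\<alpha> (finv x) = finv (\<alpha> x)" if x: "x \<in> A" for x
  proof -
    have "\<alpha> x \<circ> \<alpha> (finv x) = id"
      using hom(2)[OF x P_subgroup_inv[OF A x]] P_subgroup_bij[OF A x] id by simp
    then have "finv (\<alpha> x) \<circ> (\<alpha> x \<circ> \<alpha> (finv x)) = finv (\<alpha> x)" by simp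
    then show ?thesis using P_subgroup_bij[OF B hom(1)[OF x]] by simp
  qed
  have ps: "P_subgroup {x \<in> A. \<alpha> x \<in> K}"
    unfolding P_subgroup_def using A K'(1) by (auto simp: P_subgroup_def id inv hom(2))
  obtain S where S: "finite S" "S \<subseteq> B" "\<And>g. g \<in> B \<Longrightarrow> \<exists>s\<in>S. g \<circ> finv s \<in> K"
    using K by (auto simp: finite_index_def)
  define r where "r s = (SOME x. x \<in> A \<and> \<alpha> x \<circ> finv s \<in> K)" for s
  define T where "T = {s \<in> S. \<exists>x\<in>A. \<alpha> x \<circ> finv s \<in> K}"
  have r: "r s \<in> A \<and> \<alpha> (r s) \<circ> finv s \<in> K" if "s \<in> T" for s
    unfolding r_def using that someI_ex[of "\<lambda>x. x \<in> A \<and> \<alpha> x \<circ> finv s \<in> K"] by (auto simp: T_def)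
  have "\<exists>t\<in>r ` T. a \<circ> finv t \<in> {x \<in> A. \<alpha> x \<in> K}" if a: "a \<in> A" for a
  proof -
    obtain s where s: "s \<in> S" "\<alpha> a \<circ> finv s \<in> K" using S(3)[OF hom(1)[OF a]] by blast
    then have sT: "s \<in> T" using a by (auto simp: T_def)
    note rs = r[OF sT]
    have bs: "bij s" using s(1) S(2) P_subgroup_bij[OF B] by auto
    have bx: "bij (\<alpha> (r s))" using rs hom(1) P_subgroup_bij[OF B] by auto
    have "\<alpha> a \<circ> finv s \<circ> finv (\<alpha> (r s) \<circ> finv s) \<in> K"
      using s rs K'(1) P_subgroup_comp P_subgroup_inv by blast
    then have "\<alpha> a \<circ> finv (\<alpha> (r s)) \<in> K"
      using bs bx by (simp add: finv_comp comp_assoc)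
    then have "\<alpha> (a \<circ> finv (r s)) \<in> K"
      using hom(2)[OF a P_subgroup_inv[OF A]] rs inv by simp
    then show ?thesis using sT rs a P_subgroup_comp[OF A] P_subgroup_inv[OF A] by auto
  qed
  moreover have "finite (r ` T)" "r ` T \<subseteq> A" using S(1) r by (auto simp: T_def)
  ultimately show ?thesis using ps unfolding finite_index_def by blast
qed

lemma finite_index_inter:
  assumes G: "P_subgroup G" and A: "finite_index G A" and B: "finite_index G B"
  shows "finite_index G (A \<inter> B)"
proof -
  have "finite_index A {x \<in> A. (\<lambda>x. x) x \<in> B}"
    by (rule finite_index_vimage[OF finite_index_psub[OF A] G B]) (use finite_index_subset[OF A] in auto)
  moreover have "{x \<in> A. (\<lambda>x. x) x \<in> B} = A \<inter> B" by auto
  ultimately show ?thesis using finite_index_trans[OF G A] by simp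
qed

section \<open>Thompson's group and its translations\<close>

lemma thompson_F_P_plus: "f \<in> thompson_F \<Longrightarrow> f \<in> P_plus"
  by (simp add: thompson_F_def)

lemma thompson_FI:
  assumes "f \<in> P_plus" "\<And>t. t > M \<Longrightarrow> f t = t + of_int r" "\<And>t. t < - M \<Longrightarrow> f t = t + of_int l"
  shows "f \<in> thompson_F"
proof -
  have "(\<forall>t>max M 1. f t = t + of_int r) \<and> (\<forall>t. t < - max M 1 \<longrightarrow> f t = t + of_int l)"
    using assms(2,3) by simp
  moreover have "max M 1 > 0" by simp
  ultimately show ?thesis unfolding thompson_F_def using assms(1) by blast
qed

lemma thompson_FE:
  assumes "f \<in> thompson_F"
  obtains l r M where "f \<in> P_plus" "M > 0" "\<And>t. t > M \<Longrightarrow> f t = t + of_int r"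
    "\<And>t. t < - M \<Longrightarrow> f t = t + of_int l"
  using assms unfolding thompson_F_def by blast

lemma thompson_F_comp: assumes "f \<in> thompson_F" "g \<in> thompson_F" shows "f \<circ> g \<in> thompson_F"
proof -
  obtain l r M where f: "f \<in> P_plus" "\<And>t. t > M \<Longrightarrow> f t = t + of_int r"
    "\<And>t. t < - M \<Longrightarrow> f t = t + of_int l" using thompson_FE[OF assms(1)] by metis
  obtain l' r' M' where g: "g \<in> P_plus" "\<And>t. t > M' \<Longrightarrow> g t = t + of_int r'"
    "\<And>t. t < - M' \<Longrightarrow> g t = t + of_int l'" using thompson_FE[OF assms(2)] by metis
  show ?thesis
  proof (rule thompson_FI[of _ "\<bar>M\<bar> + \<bar>M'\<bar> + \<bar>of_int r'\<bar> + \<bar>of_int l'\<bar>" "r + r'" "l + l'"])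
    show "f \<circ> g \<in> P_plus" using f(1) g(1) by (simp add: P_plus_comp)
    fix t :: real
    show "(f \<circ> g) t = t + of_int (r + r')" if "t > \<bar>M\<bar> + \<bar>M'\<bar> + \<bar>of_int r'\<bar> + \<bar>of_int l'\<bar>"
    proof -
      have "t > M'" "t + of_int r' > M" using that by linarith+
      then show ?thesis using f(2)[of "t + of_int r'"] g(2)[of t] by simp
    qed
    show "(f \<circ> g) t = t + of_int (l + l')" if "t < - (\<bar>M\<bar> + \<bar>M'\<bar> + \<bar>of_int r'\<bar> + \<bar>of_int l'\<bar>)"
    proof -
      have "t < - M'" "t + of_int l' < - M" using that by linarith+
      then show ?thesis using f(3)[of "t + of_int l'"] g(3)[of t] by simp
    qed
  qed
qed

lemma thompson_F_inv: assumes "f \<in> thompson_F" shows "finv f \<in> thompson_F"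
proof -
  obtain l r M where f: "f \<in> P_plus" "\<And>t. t > M \<Longrightarrow> f t = t + of_int r"
    "\<And>t. t < - M \<Longrightarrow> f t = t + of_int l" using thompson_FE[OF assms(1)] by metis
  have b: "bij f" using f(1) by (simp add: P_plus_P_set P_set_bij)
  show ?thesis
  proof (rule thompson_FI[of _ "\<bar>M\<bar> + \<bar>of_int r\<bar> + \<bar>of_int l\<bar>" "- r" "- l"])
    show "finv f \<in> P_plus" using f(1) by (rule P_plus_inv)
    fix t :: real
    show "finv f t = t + of_int (- r)" if "t > \<bar>M\<bar> + \<bar>of_int r\<bar> + \<bar>of_int l\<bar>"
    proof -
      have "t - of_int r > M" using that by linarith
      then have "f (t - of_int r) = t" using f(2)[of "t - of_int r"] by simp
      then show ?thesis using finv_left[OF b, of "t - of_int r"] by simp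
    qed
    show "finv f t = t + of_int (- l)" if "t < - (\<bar>M\<bar> + \<bar>of_int r\<bar> + \<bar>of_int l\<bar>)"
    proof -
      have "t - of_int l < - M" using that by linarith
      then have "f (t - of_int l) = t" using f(3)[of "t - of_int l"] by simp
      then show ?thesis using finv_left[OF b, of "t - of_int l"] by simp
    qed
  qed
qed

lemma Fc_subset_thompson_F: "Fc \<subseteq> thompson_F"
proof
  fix f assume "f \<in> Fc"
  then obtain M where "f \<in> P_plus" "\<And>t. \<bar>t\<bar> > M \<Longrightarrow> f t = t" by (auto simp: Fc_def)
  then show "f \<in> thompson_F" by (intro thompson_FI[of f "\<bar>M\<bar>" 0 0]) auto
qed

lemma P_subgroup_thompson_F: "P_subgroup thompson_F"
  unfolding P_subgroup_def
proof (intro conjI ballI)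
  show "thompson_F \<subseteq> P_set" using thompson_F_P_plus P_plus_P_set by (meson subsetI)
  show "id \<in> thompson_F" using Fc_subset_thompson_F id_in_Fc by (rule subsetD)
qed (simp_all add: thompson_F_comp thompson_F_inv)

lemma P_subgroup_Fc: "P_subgroup Fc"
  unfolding P_subgroup_def using Fc_comp Fc_inv id_in_Fc Fc_P_set by auto

definition translation :: "int \<Rightarrow> real \<Rightarrow> real" where
  "translation k = (\<lambda>t. t + of_int k)"

lemma translation_in_thompson_F: "translation k \<in> thompson_F"
  using affine_in_P_plus[of 1 "of_int k"] by (intro thompson_FI[of _ 0 k k]) (auto simp: translation_def)

lemma translation_add: "translation j \<circ> translation k = translation (j + k)"
  by (auto simp: translation_def)

lemma translation_bij: "bij (translation k)"
  using P_subgroup_bij[OF P_subgroup_thompson_F translation_in_thompson_F] .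

lemma finv_tr: "finv (translation k) = translation (- k)"
proof -
  have "translation k \<circ> translation (- k) = id" by (auto simp: translation_def)
  then have "finv (translation k) \<circ> (translation k \<circ> translation (- k)) = finv (translation k)" by simp
  then show ?thesis using translation_bij by simp
qed

text \<open>A moved point has a moved image, so where \<open>g\<close> moves \<open>x\<close> the
  map \<open>f\<close> fixes both \<open>x\<close> and \<open>g x\<close>.\<close>

lemma disjoint_support_commute:
  assumes f: "f \<in> Fc" and g: "g \<in> Fc" and "\<And>x. f x = x \<or> g x = x"
  shows "f \<circ> g = g \<circ> f"
proof
  fix x
  have inj: "inj f" "inj g" using Fc_bij f g by (auto simp: bij_is_inj)
  show "(f \<circ> g) x = (g \<circ> f) x"
  proof (cases "g x = x")
    case True
    show ?thesis
    proof (cases "f x = x")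
      case False
      then have "f (f x) \<noteq> f x" using inj(1) by (auto dest: injD)
      then show ?thesis using assms(3)[of "f x"] True by auto
    qed (use True in auto)
  next
    case False
    then have "g (g x) \<noteq> g x" using inj(2) by (auto dest: injD)
    then show ?thesis using assms(3)[of "g x"] assms(3)[of x] False by auto
  qed
qed

text \<open>By the pigeonhole principle on \<open>card S + 1\<close> powers, a conjugated
  translation by some \<open>d \<le> card S\<close> lies in \<open>A\<close>. This \<open>d\<close>
  depends on \<open>x\<close>; the factorial of \<open>card S\<close> is a common multiple of all
  candidates and so serves every conjugate.\<close>

lemma power_translation_in_core:
  assumes A: "finite_index thompson_F A"
  shows "\<exists>m>0. \<forall>j. \<forall>x\<in>thompson_F. x \<circ> translation (int m * j) \<circ> finv x \<in> A"
proof -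
  have pA: "P_subgroup A" using A by (rule finite_index_psub)
  obtain S where S: "finite S" "S \<subseteq> thompson_F" "\<And>g. g \<in> thompson_F \<Longrightarrow> \<exists>s\<in>S. g \<circ> finv s \<in> A"
    using A by (auto simp: finite_index_def)
  have step: "x \<circ> translation (int (fact (card S)) * j) \<circ> finv x \<in> A" if x: "x \<in> thompson_F" for x j
  proof -
    have bx: "bij x" using x P_subgroup_bij[OF P_subgroup_thompson_F] by auto
    have "\<exists>s\<in>S. x \<circ> translation (int i) \<circ> finv s \<in> A" for i
      by (rule S(3)) (intro thompson_F_comp x translation_in_thompson_F)
    then obtain s where s: "\<And>i. s i \<in> S \<and> x \<circ> translation (int i) \<circ> finv (s i) \<in> A" by metis
    have "card (s ` {..card S}) \<le> card S" using s S(1) by (intro card_mono) auto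
    then have "\<not> inj_on s {..card S}" by (auto dest: card_image)
    then obtain i i' where ii: "i \<le> card S" "i' \<le> card S" "i < i'" "s i = s i'"
      unfolding inj_on_def by (metis atMost_iff linorder_neqE_nat)
    define d where "d = i' - i"
    have bs: "bij (s i)" using s S(2) P_subgroup_bij[OF P_subgroup_thompson_F] by blast
    have "(x \<circ> translation (int i') \<circ> finv (s i)) \<circ> finv (x \<circ> translation (int i) \<circ> finv (s i)) \<in> A"
      using s[of i] s[of i'] ii(4) pA P_subgroup_comp P_subgroup_inv by metis
    also have "(x \<circ> translation (int i') \<circ> finv (s i)) \<circ> finv (x \<circ> translation (int i) \<circ> finv (s i)) =
        x \<circ> (translation (int i') \<circ> translation (- int i)) \<circ> finv x"
      using bx bs translation_bij by (simp add: finv_comp bij_comp comp_assoc finv_tr)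
    also have "translation (int i') \<circ> translation (- int i) = translation (int d)" using ii(3) by (simp add: translation_add d_def of_nat_diff)
    finally have d: "x \<circ> translation (int d) \<circ> finv x \<in> A" .
    have nat_mult: "x \<circ> translation (int d * int k) \<circ> finv x \<in> A" for k
    proof (induct k)
      case 0
      have "x \<circ> translation (int d * int 0) \<circ> finv x = id" using bx by (simp add: fun_eq_iff translation_def)
      then show ?case using P_subgroup_id[OF pA] by (simp only:)
    next
      case (Suc k)
      have "(x \<circ> translation (int d) \<circ> finv x) \<circ> (x \<circ> translation (int d * int k) \<circ> finv x) \<in> A"
        by (rule P_subgroup_comp[OF pA d Suc])
      also have "(x \<circ> translation (int d) \<circ> finv x) \<circ> (x \<circ> translation (int d * int k) \<circ> finv x) =
          x \<circ> (translation (int d) \<circ> translation (int d * int k)) \<circ> finv x"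
        using bx by (simp add: comp_assoc)
      finally show ?case by (simp add: translation_add algebra_simps)
    qed
    have int_mult: "x \<circ> translation (int d * k) \<circ> finv x \<in> A" for k :: int
    proof (cases "k \<ge> 0")
      case True
      then show ?thesis using nat_mult[of "nat k"] by simp
    next
      case False
      then have "finv (x \<circ> translation (- (int d * k)) \<circ> finv x) \<in> A"
        using P_subgroup_inv[OF pA nat_mult[of "nat (- k)"]] by simp
      then show ?thesis using bx translation_bij by (simp add: finv_comp bij_comp comp_assoc finv_tr)
    qed
    have "d dvd fact (card S)" using ii by (intro dvd_fact) (auto simp: d_def)
    then obtain c where "fact (card S) = d * c" by (auto simp: dvd_def)
    then have "int (fact (card S)) * j = int d * (int c * j)" by simp
    then show ?thesis using int_mult[of "int c * j"] by (simp only:)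
  qed
  then show ?thesis by (intro exI[of _ "fact (card S)"]) auto
qed

theorem Fc_subset_finite_index:
  assumes A: "finite_index thompson_F A"
  shows "Fc \<subseteq> A"
proof -
  have pA: "P_subgroup A" using A by (rule finite_index_psub)
  obtain m where m: "m > 0" "\<And>j x. x \<in> thompson_F \<Longrightarrow> x \<circ> translation (int m * j) \<circ> finv x \<in> A"
    using power_translation_in_core[OF A] by blast
  \<comment> \<open>\<open>N\<close> is the normal core of \<open>A\<close>; the fact just obtained
    says that it contains a translation.\<close>
  define N where "N = {g \<in> thompson_F. \<forall>x\<in>thompson_F. x \<circ> g \<circ> finv x \<in> A}"
  note tF = P_subgroup_thompson_F
  have pN: "P_subgroup N" unfolding P_subgroup_def
  proof (intro conjI ballI)
    show "N \<subseteq> P_set" using P_subgroup_P_set[OF tF] by (auto simp: N_def)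
    show "id \<in> N" using P_subgroup_id[OF tF] P_subgroup_id[OF pA] P_subgroup_bij[OF tF] by (auto simp: N_def)
    fix f g assume fg: "f \<in> N" "g \<in> N"
    have "x \<circ> (f \<circ> g) \<circ> finv x \<in> A" if x: "x \<in> thompson_F" for x
    proof -
      have "(x \<circ> f \<circ> finv x) \<circ> (x \<circ> g \<circ> finv x) \<in> A" using fg x P_subgroup_comp[OF pA] by (auto simp: N_def)
      then show ?thesis using P_subgroup_bij[OF tF x] by (simp add: comp_assoc)
    qed
    then show "f \<circ> g \<in> N" using fg P_subgroup_comp[OF tF] by (auto simp: N_def)
  next
    fix f assume f: "f \<in> N"
    have bf: "bij f" using f P_subgroup_bij[OF tF] by (auto simp: N_def)
    have "x \<circ> finv f \<circ> finv x \<in> A" if x: "x \<in> thompson_F" for x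
    proof -
      have "finv (x \<circ> f \<circ> finv x) \<in> A" using f x P_subgroup_inv[OF pA] by (auto simp: N_def)
      then show ?thesis using P_subgroup_bij[OF tF x] bf by (simp add: finv_comp bij_comp comp_assoc)
    qed
    then show "finv f \<in> N" using f P_subgroup_inv[OF tF] by (auto simp: N_def)
  qed
  have normal: "y \<circ> g \<circ> finv y \<in> N" if g: "g \<in> N" and y: "y \<in> thompson_F" for y g
  proof -
    have "x \<circ> (y \<circ> g \<circ> finv y) \<circ> finv x \<in> A" if x: "x \<in> thompson_F" for x
    proof -
      have "(x \<circ> y) \<circ> g \<circ> finv (x \<circ> y) \<in> A"
        using g P_subgroup_comp[OF tF x y] by (auto simp: N_def)
      then show ?thesis using P_subgroup_bij[OF tF] x y by (simp add: finv_comp comp_assoc)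
    qed
    then show ?thesis using g y P_subgroup_comp[OF tF] P_subgroup_inv[OF tF] by (auto simp: N_def)
  qed
  have trN: "translation (int m * j) \<in> N" for j using m(2) translation_in_thompson_F by (auto simp: N_def)
  have FcF: "f \<in> thompson_F" if "f \<in> Fc" for f using that Fc_subset_thompson_F by auto
  have comm: "f \<circ> g \<circ> finv f \<circ> finv g \<in> N" if f: "f \<in> Fc" and g: "g \<in> Fc" for f g
  proof -
    have bf: "bij f" and bg: "bij g" using f g by (auto simp: Fc_bij)
    obtain M where M: "\<And>t. \<bar>t\<bar> > M \<Longrightarrow> f t = t" using f by (auto simp: Fc_def)
    obtain M' where M': "\<And>t. \<bar>t\<bar> > M' \<Longrightarrow> g t = t" using g by (auto simp: Fc_def)
    obtain j :: nat where j: "\<bar>M\<bar> + \<bar>M'\<bar> < j" using reals_Archimedean2 by blast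
    define k where "k = int m * int j"
    have "1 * real j \<le> real m * real j" using m(1) by (intro mult_right_mono) auto
    then have "real j \<le> real m * real j" by simp
    then have k: "\<bar>M\<bar> + \<bar>M'\<bar> < of_int k" using j by (simp add: k_def)
    define f' where "f' = translation k \<circ> f \<circ> finv (translation k)"
    have f': "f' \<in> Fc" unfolding f'_def
      using Fc_conj[OF f] P_subgroup_P_set[OF tF translation_in_thompson_F] by blast
    have "f' x = x \<or> g x = x" for x
    proof -
      have "f' x = f (x - of_int k) + of_int k" by (simp add: f'_def finv_tr) (simp add: translation_def)
      moreover have "\<bar>x - of_int k\<bar> > M \<or> \<bar>x\<bar> > M'" using k by linarith
      ultimately show ?thesis using M M' by force
    qed
    then have c: "f' \<circ> g = g \<circ> f'" by (rule disjoint_support_commute[OF f' g])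
    have bf': "bij f'" using f' by (rule Fc_bij)
    \<comment> \<open>\<open>n\<close> is the commutator of \<open>f\<close> with a translation in
      \<open>N\<close>. Modulo \<open>N\<close> the factor \<open>f\<close> may therefore be
      replaced by \<open>f'\<close>, which commutes with \<open>g\<close>.\<close>
    define n where "n = f \<circ> finv f'"
    have "n = (f \<circ> translation k \<circ> finv f) \<circ> finv (translation k)"
      using bf translation_bij by (simp add: n_def f'_def finv_comp bij_comp comp_assoc)
    then have n: "n \<in> N" using normal[OF _ FcF[OF f], of "translation k"] trN[of "int j"] P_subgroup_comp[OF pN] P_subgroup_inv[OF pN]
      by (simp add: k_def)
    have bn: "bij n" using P_subgroup_bij[OF pN n] .
    have fn: "f = n \<circ> f'" using bf' by (simp add: n_def comp_assoc)
    have "f \<circ> g \<circ> finv f \<circ> finv g = n \<circ> (f' \<circ> g) \<circ> finv f' \<circ> finv n \<circ> finv g"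
      using bn bf' by (simp add: fn finv_comp comp_assoc)
    also have "\<dots> = n \<circ> (g \<circ> finv n \<circ> finv g)"
      unfolding c using bf' by (simp add: comp_assoc)
    also have "\<dots> \<in> N" using n normal[OF P_subgroup_inv[OF pN n] FcF[OF g]] P_subgroup_comp[OF pN] by blast
    finally show ?thesis .
  qed
  \<comment> \<open>The quotient of \<open>Fc\<close> by \<open>?H\<close> is abelian, hence trivial
    by perfectness, and so \<open>?H\<close> is all of \<open>Fc\<close>.\<close>
  let ?G = "P_group\<lparr>carrier := Fc\<rparr>"
  let ?H = "N \<inter> Fc"
  have sFc: "subgroup Fc P_group" using P_subgroup_Fc by (simp add: P_subgroup_iff)
  interpret G: group ?G using subgroup.subgroup_is_group[OF sFc group_P_group] .
  have invG: "inv\<^bsub>?G\<^esub> s = finv s" if "s \<in> Fc" for s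
    using P.m_inv_consistent[OF sFc that] P_group_inv[OF Fc_P_set[OF that]] by simp
  have sH: "subgroup ?H ?G"
    using P_subgroup_inter[OF pN P_subgroup_Fc] sFc by (intro P.subgroup_incl) (auto simp: P_subgroup_iff)
  have nH: "?H \<lhd> ?G" unfolding G.normal_inv_iff
    using sH normal FcF P_subgroup_comp[OF P_subgroup_Fc] P_subgroup_inv[OF P_subgroup_Fc] by (auto simp: invG)
  interpret H: normal ?H ?G by (rule nH)
  have Mod: "group (?G Mod ?H)" by (rule H.factorgroup_is_group)
  let ?\<phi> = "\<lambda>f. ?H #>\<^bsub>?G\<^esub> f"
  have sum: "?\<phi> f <#>\<^bsub>?G\<^esub> ?\<phi> g = ?\<phi> (f \<circ> g)" if "f \<in> Fc" "g \<in> Fc" for f g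
    using H.rcos_sum[of f g] that by simp
  have swap: "?\<phi> (f \<circ> g) = ?\<phi> (g \<circ> f)" if f: "f \<in> Fc" and g: "g \<in> Fc" for f g
  proof -
    have "f \<circ> g \<circ> finv f \<circ> finv g \<in> ?H"
      using comm[OF f g] f g P_subgroup_comp[OF P_subgroup_Fc] P_subgroup_inv[OF P_subgroup_Fc] by auto
    moreover have "f \<circ> g \<circ> finv (g \<circ> f) = f \<circ> g \<circ> finv f \<circ> finv g"
      using Fc_bij f g by (simp add: finv_comp comp_assoc)
    ultimately have "f \<circ> g \<in> ?\<phi> (g \<circ> f)"
      using H.rcos_module_rev[OF G.is_group, of "g \<circ> f" "f \<circ> g"] f g by (simp add: Fc_comp invG)
    then show ?thesis using G.repr_independence[OF _ _ sH, of "f \<circ> g" "g \<circ> f"] f g by (simp add: Fc_comp)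
  qed
  have "comm_group (?G Mod ?H)"
  proof (rule group.group_comm_groupI[OF Mod])
    fix X Y assume "X \<in> carrier (?G Mod ?H)" "Y \<in> carrier (?G Mod ?H)"
    then obtain f g where "f \<in> Fc" "g \<in> Fc" "X = ?\<phi> f" "Y = ?\<phi> g"
      by (auto simp: FactGroup_def RCOSETS_def)
    then show "X \<otimes>\<^bsub>?G Mod ?H\<^esub> Y = Y \<otimes>\<^bsub>?G Mod ?H\<^esub> X"
      using sum swap by (simp add: FactGroup_def)
  qed
  then interpret Q: comm_group "?G Mod ?H" .
  interpret \<phi>: Fc_hom "?G Mod ?H" ?\<phi>
    by unfold_locales (use sum in \<open>auto simp: FactGroup_def RCOSETS_def\<close>)
  show ?thesis
  proof
    fix f assume f: "f \<in> Fc"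
    have "?\<phi> f = ?H" using \<phi>.phi_trivial[OF f] by (simp add: FactGroup_def)
    then have "f \<in> ?H" using G.coset_join1[OF _ _ sH] f by simp
    then have "id \<circ> f \<circ> finv id \<in> A" using P_subgroup_id[OF tF] by (auto simp: N_def)
    then show "f \<in> A" by simp
  qed
qed

section \<open>Automorphisms of the compactly supported subgroup\<close>

locale interval_system =
  fixes B :: "'b set" and l r :: "'b \<Rightarrow> real"
  assumes less: "b \<in> B \<Longrightarrow> l b < r b"
    and dense: "u < x \<Longrightarrow> x < v \<Longrightarrow> \<exists>b\<in>B. u < l b \<and> l b < x \<and> x < r b \<and> r b < v"

text \<open>One index set carries two systems of intervals with the same inclusions and the same
  disjoint pairs. In the application the indices are the elements of \<open>basic\<close>, and the
  second system is read through the automorphism.\<close>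

locale interval_iso = S: interval_system B l r + T: interval_system B l' r'
  for B :: "'b set" and l r l' r' +
  assumes incl: "b \<in> B \<Longrightarrow> c \<in> B \<Longrightarrow> (l c \<le> l b \<and> r b \<le> r c) \<longleftrightarrow> (l' c \<le> l' b \<and> r' b \<le> r' c)"
    and disj: "b \<in> B \<Longrightarrow> c \<in> B \<Longrightarrow> (r b \<le> l c \<or> r c \<le> l b) \<longleftrightarrow> (r' b \<le> l' c \<or> r' c \<le> l' b)"
begin

text \<open>Intervals are taken open around \<open>x\<close> but closed around \<open>y\<close>, so
  that a supremum of left ends qualifies as \<open>y\<close>.\<close>

definition fits :: "real \<Rightarrow> real \<Rightarrow> bool" where
  "fits x y \<longleftrightarrow> (\<forall>b\<in>B. l b < x \<and> x < r b \<longrightarrow> l' b \<le> y \<and> y \<le> r' b)"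

lemma small: assumes "c \<in> B" "e > 0" "u < x" "x < v"
  shows "\<exists>b\<in>B. u < l b \<and> l b < x \<and> x < r b \<and> r b < v \<and> r b - l b < e"
proof -
  have "max u (x - e / 2) < x" "x < min v (x + e / 2)" using assms by auto
  then obtain b where "b \<in> B" "max u (x - e / 2) < l b" "l b < x" "x < r b" "r b < min v (x + e / 2)"
    using S.dense by blast
  then show ?thesis by (intro bexI[of _ b]) (auto simp: field_simps)
qed

lemma common:
  assumes "b \<in> B" "c \<in> B" "l b < x" "x < r b" "l c < x" "x < r c"
  shows "l' b \<le> r' c"
proof -
  obtain e where e: "e \<in> B" "max (l b) (l c) < l e" "r e < min (r b) (r c)"
    using S.dense[of "max (l b) (l c)" x "min (r b) (r c)"] assms by auto
  then have "l' b \<le> l' e" "r' e \<le> r' c" using incl[of e b] incl[of e c] assms by auto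
  then show ?thesis using T.less[OF e(1)] by linarith
qed

lemma fits_exists: "\<exists>y. fits x y"
proof -
  let ?A = "{l' b |b. b \<in> B \<and> l b < x \<and> x < r b}"
  obtain b0 where b0: "b0 \<in> B" "l b0 < x" "x < r b0" using S.dense[of "x - 1" x "x + 1"] by auto
  have "l' b \<le> Sup ?A \<and> Sup ?A \<le> r' b" if b: "b \<in> B" "l b < x" "x < r b" for b
  proof
    have "bdd_above ?A" using common[OF _ b0(1)] b0 by (intro bdd_aboveI[of _ "r' b0"]) auto
    then show "l' b \<le> Sup ?A" using b by (intro cSup_upper) auto
    show "Sup ?A \<le> r' b" using b common[OF _ b(1)] by (intro cSup_least) auto
  qed
  then show ?thesis unfolding fits_def by blast
qed

text \<open>An interval \<open>k\<close> whose image lies between \<open>y\<close> and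
  \<open>z\<close> is contained in every interval around \<open>x\<close>, so its length bounds
  theirs from below; but there are arbitrarily short ones.\<close>

lemma fits_less:
  assumes y: "fits x y" and z: "fits x z" and yz: "y < z"
  shows False
proof -
  obtain k where k: "k \<in> B" "y < l' k" "r' k < z" using T.dense[of y "(y + z) / 2" z] yz by auto
  obtain b where b: "b \<in> B" "l b < x" "x < r b" "r b - l b < r k - l k"
    using small[OF k(1), of "r k - l k" "x - 1" x "x + 1"] S.less[OF k(1)] by auto
  have "l' b \<le> y" "z \<le> r' b" using y z b unfolding fits_def by auto
  then have "l b \<le> l k \<and> r k \<le> r b" using incl[OF k(1) b(1)] k by auto
  then show False using b(4) by linarith
qed

lemma fits_unique: "fits x y \<Longrightarrow> fits x z \<Longrightarrow> y = z"
  by (meson fits_less linorder_neqE)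

text \<open>Otherwise some interval around \<open>x\<close> is disjoint from \<open>k\<close>, while
  \<open>y\<close> lies inside the image of \<open>k\<close> and in the closed image of that
  interval.\<close>

lemma fits_swap_closed:
  assumes "fits x y" "k \<in> B" "l' k < y" "y < r' k"
  shows "l k \<le> x \<and> x \<le> r k"
proof (rule ccontr)
  assume "\<not> (l k \<le> x \<and> x \<le> r k)"
  then consider "x < l k" | "r k < x" by linarith
  then obtain b where b: "b \<in> B" "l b < x" "x < r b" "r k \<le> l b \<or> r b \<le> l k"
  proof cases
    case 1 then show ?thesis using S.dense[of "x - 1" x "l k"] that by auto
  next
    case 2 then show ?thesis using S.dense[of "r k" x "x + 1"] that by auto
  qed
  have "r' k \<le> l' b \<or> r' b \<le> l' k" using disj[OF assms(2) b(1)] b(4) by simp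
  moreover have "l' b \<le> y \<and> y \<le> r' b" using assms(1) b unfolding fits_def by auto
  ultimately show False using assms by linarith
qed

text \<open>Suppose \<open>x\<close> is an end of \<open>k\<close>. A short interval
  \<open>b\<close> around \<open>x\<close> contains some \<open>c\<close> outside \<open>k\<close>,
  so the image of \<open>b\<close> reaches from \<open>y\<close> out of the image of
  \<open>k\<close> and covers the image of \<open>k1\<close> or of \<open>k2\<close>. Then
  \<open>b\<close> is at least as long as one of these, against its choice.\<close>

lemma fits_swap_open:
  assumes f: "fits x y" and k: "k \<in> B" "l' k < y" "y < r' k"
  shows "l k < x \<and> x < r k"
proof (rule ccontr)
  assume "\<not> (l k < x \<and> x < r k)"
  then have x: "x = l k \<or> x = r k" using fits_swap_closed[OF assms] by linarith
  obtain k1 where k1: "k1 \<in> B" "l' k < l' k1" "r' k1 < y"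
    using T.dense[of "l' k" "(l' k + y) / 2" y] k by auto
  obtain k2 where k2: "k2 \<in> B" "y < l' k2" "r' k2 < r' k"
    using T.dense[of y "(r' k + y) / 2" "r' k"] k by auto
  have "min (r k1 - l k1) (r k2 - l k2) > 0" using S.less k1(1) k2(1) by simp
  then obtain b where b: "b \<in> B" "l b < x" "x < r b" "r b - l b < min (r k1 - l k1) (r k2 - l k2)"
    using small[OF k(1), of "min (r k1 - l k1) (r k2 - l k2)" "x - 1" x "x + 1"] by (auto simp del: min_less_iff_conj)
  obtain c where c: "c \<in> B" "l b < l c" "r c < r b" "r k \<le> l c \<or> r c \<le> l k"
    using x
  proof
    assume "x = l k"
    then show ?thesis using S.dense[of "l b" "(l b + x) / 2" x] b that by auto
  next
    assume "x = r k"
    then show ?thesis using S.dense[of x "(r b + x) / 2" "r b"] b that by auto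
  qed
  have "r' k \<le> l' c \<or> r' c \<le> l' k" using disj[OF k(1) c(1)] c(4) by auto
  moreover have "l' b \<le> l' c" "r' c \<le> r' b" using incl[OF c(1) b(1)] c by auto
  moreover have "l' b \<le> y" "y \<le> r' b" using f b unfolding fits_def by auto
  ultimately have "l' b \<le> l' k1 \<and> r' k1 \<le> r' b \<or> l' b \<le> l' k2 \<and> r' k2 \<le> r' b"
    using k1 k2 T.less[OF c(1)] by linarith
  then have "r k1 - l k1 \<le> r b - l b \<or> r k2 - l k2 \<le> r b - l b"
    using incl[OF k1(1) b(1)] incl[OF k2(1) b(1)] by linarith
  then show False using b(4) by linarith
qed

definition fitted_point :: "real \<Rightarrow> real" where
  "fitted_point x = (SOME y. fits x y)"

lemma fits_pt: "fits x (fitted_point x)"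
  unfolding fitted_point_def using fits_exists by (rule someI_ex)

lemma fitted_point_eq: "fits x y \<Longrightarrow> fitted_point x = y"
  using fits_unique fits_pt by blast

lemma fitted_point_continuous: "continuous_on UNIV fitted_point"
proof -
  have "isCont fitted_point x" for x
    unfolding continuous_at_eps_delta
  proof (intro allI impI)
    fix e :: real assume "e > 0"
    then obtain k where k: "k \<in> B" "fitted_point x - e / 2 < l' k" "l' k < fitted_point x" "fitted_point x < r' k" "r' k < fitted_point x + e / 2"
      using T.dense[of "fitted_point x - e / 2" "fitted_point x" "fitted_point x + e / 2"] by auto
    note x = fits_swap_open[OF fits_pt k(1,3,4)]
    show "\<exists>d>0. \<forall>x'. dist x' x < d \<longrightarrow> dist (fitted_point x') (fitted_point x) < e"
    proof (intro exI[of _ "min (x - l k) (r k - x)"] conjI allI impI)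
      fix x' assume "dist x' x < min (x - l k) (r k - x)"
      then have "l k < x'" "x' < r k" by (auto simp: dist_real_def)
      then have "l' k \<le> fitted_point x'" "fitted_point x' \<le> r' k" using fits_pt[of x'] k(1) by (auto simp: fits_def)
      then show "dist (fitted_point x') (fitted_point x) < e" using k \<open>e > 0\<close> by (auto simp: dist_real_def)
    qed (use x in auto)
  qed
  then show ?thesis by (simp add: continuous_at_imp_continuous_on)
qed

end

lemma (in interval_iso) swap: "interval_iso B l' r' l r"
  using S.interval_system_axioms T.interval_system_axioms
  by (simp add: interval_iso_def interval_iso_axioms_def incl disj)

text \<open>The same construction with the two systems exchanged is the inverse.\<close>

lemma (in interval_iso) fitted_point_bij: "bij fitted_point"
proof -
  interpret W: interval_iso B l' r' l r by (rule swap)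
  have "W.fits (fitted_point x) x" for x
    unfolding W.fits_def using fits_swap_closed[OF fits_pt] by blast
  then have "W.fitted_point (fitted_point x) = x" for x by (rule W.fitted_point_eq)
  moreover have "fits (W.fitted_point x) x" for x
    unfolding fits_def using W.fits_swap_closed[OF W.fits_pt] by blast
  then have "fitted_point (W.fitted_point x) = x" for x by (rule fitted_point_eq)
  ultimately show ?thesis by (intro o_bij[of W.fitted_point]) (auto simp: fun_eq_iff)
qed

section \<open>Fixed points and hulls of supports\<close>

lemma right_germ:
  assumes f: "f \<in> Fc" and q: "f q = q"
  shows "\<exists>e>0. (\<forall>x. q \<le> x \<and> x < q + e \<longrightarrow> f x = x) \<or> (\<forall>x. q < x \<and> x < q + e \<longrightarrow> f x \<noteq> x)"
proof -
  obtain a b where ab: "has_slopes f q a b" using P_plusE[OF Fc_P_plus[OF f], of q] .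
  obtain e where e: "e > 0" "\<And>u. 0 \<le> u \<Longrightarrow> u < e \<Longrightarrow> f (q + u) = q + a * u"
    using has_slopesE[OF ab] q by metis
  show ?thesis
  proof (intro exI[of _ e] conjI e(1))
    show "(\<forall>x. q \<le> x \<and> x < q + e \<longrightarrow> f x = x) \<or> (\<forall>x. q < x \<and> x < q + e \<longrightarrow> f x \<noteq> x)"
    proof (cases "a = 1")
      case True
      have "f x = x" if "q \<le> x" "x < q + e" for x using e(2)[of "x - q"] that True by simp
      then show ?thesis by blast
    next
      case False
      have "f x \<noteq> x" if x: "q < x" "x < q + e" for x
      proof
        assume "f x = x"
        then have "(a - 1) * (x - q) = 0" using e(2)[of "x - q"] x by (simp add: algebra_simps)
        then show False using False x by simp
      qed
      then show ?thesis by blast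
    qed
  qed
qed

text \<open>Away from the dyadic numbers the two slopes agree, so the alternative between an
  identity germ and an isolated fixed point holds on both sides at once.\<close>

lemma nondyadic_germ:
  assumes f: "f \<in> Fc" and q: "f q = q" and nd: "q \<notin> dyadic"
  shows "\<exists>e>0. (\<forall>x. \<bar>x - q\<bar> < e \<longrightarrow> f x = x) \<or> (\<forall>x. \<bar>x - q\<bar> < e \<and> x \<noteq> q \<longrightarrow> f x \<noteq> x)"
proof -
  obtain a where "has_slopes f q a a" using P_plusE[OF Fc_P_plus[OF f], of q] nd by metis
  then obtain e where e: "e > 0" "\<And>x. \<bar>x - q\<bar> < e \<Longrightarrow> f x = q + a * (x - q)"
    using has_slopes_eq_interval[of f q a] q by metis
  show ?thesis
  proof (intro exI[of _ e] conjI e(1))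
    show "(\<forall>x. \<bar>x - q\<bar> < e \<longrightarrow> f x = x) \<or> (\<forall>x. \<bar>x - q\<bar> < e \<and> x \<noteq> q \<longrightarrow> f x \<noteq> x)"
    proof (cases "a = 1")
      case True
      have "f x = x" if "\<bar>x - q\<bar> < e" for x using e(2)[OF that] True by simp
      then show ?thesis by blast
    next
      case False
      have "f x \<noteq> x" if x: "\<bar>x - q\<bar> < e" "x \<noteq> q" for x
      proof
        assume "f x = x"
        then have "(a - 1) * (x - q) = 0" using e(2)[OF x(1)] by (simp add: algebra_simps)
        then show False using False x by simp
      qed
      then show ?thesis by blast
    qed
  qed
qed

lemma Fc_isCont: "f \<in> Fc \<Longrightarrow> isCont f x"
  using locally_PL_dyadic_continuous[of f UNIV] Fc_P_set[of f] by (simp add: P_set_iff continuous_on_eq_continuous_at)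

lemma Fc_less_iff: "f \<in> Fc \<Longrightarrow> f x < f y \<longleftrightarrow> x < y"
  using P_plus_less_iff Fc_P_plus by blast

lemma Fc_le_iff: "f \<in> Fc \<Longrightarrow> f x \<le> f y \<longleftrightarrow> x \<le> y"
  using P_plus_le_iff Fc_P_plus by blast

lemma Fc_eq_iff: "f \<in> Fc \<Longrightarrow> f x = f y \<longleftrightarrow> x = y"
  using Fc_le_iff[of f x y] Fc_le_iff[of f y x] by auto

lemma Fc_dyadic_iff: "f \<in> Fc \<Longrightarrow> f x \<in> dyadic \<longleftrightarrow> x \<in> dyadic"
  using P_set_dyadic_iff Fc_P_set by blast

lemma isCont_fixed_limit:
  fixes f :: "real \<Rightarrow> real"
  assumes f: "isCont f p" and "\<And>e. e > 0 \<Longrightarrow> \<exists>x. \<bar>x - p\<bar> < e \<and> f x = x"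
  shows "f p = p"
proof (rule ccontr)
  assume "f p \<noteq> p"
  then have "((\<lambda>x. f x - x) \<longlongrightarrow> f p - p) (at p)" "f p - p \<noteq> 0"
    using f by (auto simp: isCont_def intro!: tendsto_intros)
  then have "\<forall>\<^sub>F x in at p. f x - x \<noteq> 0" by (rule tendsto_imp_eventually_ne)
  then obtain d where d: "d > 0" "\<And>x. x \<noteq> p \<Longrightarrow> dist x p < d \<Longrightarrow> f x - x \<noteq> 0"
    by (auto simp: eventually_at)
  obtain x where "\<bar>x - p\<bar> < d" "f x = x" using assms(2) d(1) by blast
  then show False using d(2)[of x] \<open>f p \<noteq> p\<close> by (auto simp: dist_real_def)
qed

definition lo :: "(real \<Rightarrow> real) \<Rightarrow> real" where
  "lo f = Inf {x. f x \<noteq> x}"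

text \<open>Conjugation by \<open>uminus\<close>. It turns facts about the lower end of a support
  into facts about the upper end, and is used again for the left germs of a normalizing
  \<open>h\<close>.\<close>

definition reflect :: "(real \<Rightarrow> real) \<Rightarrow> real \<Rightarrow> real" where
  "reflect f x = - f (- x)"

definition hi :: "(real \<Rightarrow> real) \<Rightarrow> real" where
  "hi f = - lo (reflect f)"

lemma finv_uminus: "finv uminus = uminus"
  by (intro inv_equality) auto

lemma reflect_Fc: assumes "f \<in> Fc" shows "reflect f \<in> Fc"
proof -
  have "uminus \<circ> f \<circ> finv uminus \<in> Fc" using Fc_conj[OF assms uminus_in_P_set] .
  also have "uminus \<circ> f \<circ> finv uminus = reflect f" by (auto simp: finv_uminus reflect_def)
  finally show ?thesis .
qed

lemma reflect_mir [simp]: "reflect (reflect f) = f"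
  by (auto simp: reflect_def)

lemma reflect_eq_iff: "reflect f x = x \<longleftrightarrow> f (- x) = - x"
  by (auto simp: reflect_def)

lemma reflect_comp: "reflect (f \<circ> g) = reflect f \<circ> reflect g"
  by (auto simp: reflect_def)

lemma reflect_id [simp]: "reflect id = id"
  by (auto simp: reflect_def)

lemma reflect_eq_id_iff [simp]: "reflect f = id \<longleftrightarrow> f = id"
  by (metis reflect_mir reflect_id)

lemma dyadic_minus_iff [simp]: "- x \<in> dyadic \<longleftrightarrow> x \<in> dyadic"
  using dyadic_uminus[of x] dyadic_uminus[of "- x"] by auto

lemma lo_unique:
  assumes "\<And>x. x \<le> a \<Longrightarrow> f x = x" "a < b" "\<And>x. a < x \<Longrightarrow> x < b \<Longrightarrow> f x \<noteq> x"
  shows "lo f = a"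
  unfolding lo_def
proof (rule cInf_eq_non_empty)
  show "{x. f x \<noteq> x} \<noteq> {}" using assms(3)[of "(a + b) / 2"] assms(2) by force
  show "a \<le> x" if "x \<in> {x. f x \<noteq> x}" for x using assms(1)[of x] that by force
  show "z \<le> a" if z: "\<And>x. x \<in> {x. f x \<noteq> x} \<Longrightarrow> z \<le> x" for z
  proof (rule ccontr)
    assume "\<not> z \<le> a"
    then show False using z[of "(a + min z b) / 2"] assms(3)[of "(a + min z b) / 2"] assms(2)
      by (auto simp: min_def split: if_splits)
  qed
qed

lemma hi_unique:
  assumes "\<And>x. a \<le> x \<Longrightarrow> f x = x" "b < a" "\<And>x. b < x \<Longrightarrow> x < a \<Longrightarrow> f x \<noteq> x"
  shows "hi f = a"
proof -
  have "lo (reflect f) = - a"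
    by (rule lo_unique[of _ _ "- b"]) (use assms in \<open>auto simp: reflect_eq_iff\<close>)
  then show ?thesis by (simp add: hi_def)
qed

text \<open>At the lower end of the support the left germ is the identity and the right germ is not,
  so the point is a break and therefore dyadic. The right slope differs from 1, which leaves no
  fixed points just above.\<close>

lemma lo_facts:
  assumes f: "f \<in> Fc" and nid: "f \<noteq> id"
  shows "lo f \<in> dyadic" "\<And>x. x \<le> lo f \<Longrightarrow> f x = x"
    "\<exists>b>lo f. \<forall>x. lo f < x \<and> x < b \<longrightarrow> f x \<noteq> x"
proof -
  let ?M = "{x. f x \<noteq> x}"
  obtain M where M: "\<And>t. \<bar>t\<bar> > M \<Longrightarrow> f t = t" using f by (auto simp: Fc_def)
  have bdd: "bdd_below ?M"
  proof (rule bdd_belowI[of _ "- M"])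
    fix x assume "x \<in> ?M"
    then have "\<not> \<bar>x\<bar> > M" using M by blast
    then show "- M \<le> x" by linarith
  qed
  have ne: "?M \<noteq> {}" using nid by (auto simp: fun_eq_iff)
  have left: "f x = x" if "x < lo f" for x
    using cInf_lower[OF _ bdd, of x] that by (force simp: lo_def)
  have "\<exists>x. \<bar>x - lo f\<bar> < e \<and> f x = x" if "e > 0" for e
    using left[of "lo f - e / 2"] that by (intro exI[of _ "lo f - e / 2"]) auto
  then have fl: "f (lo f) = lo f" by (rule isCont_fixed_limit[OF Fc_isCont[OF f]])
  show le: "f x = x" if "x \<le> lo f" for x using left fl that by (cases "x = lo f") auto
  have near: "\<exists>x. lo f < x \<and> x < lo f + e \<and> f x \<noteq> x" if "e > 0" for e
  proof -
    obtain x where x: "x \<in> ?M" "x < lo f + e" using cInf_lessD[OF ne, of "lo f + e"] \<open>e > 0\<close> by (auto simp: lo_def)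
    moreover have "lo f < x" using le[of x] x by force
    ultimately show ?thesis by auto
  qed
  obtain e where e: "e > 0" "(\<forall>x. lo f \<le> x \<and> x < lo f + e \<longrightarrow> f x = x) \<or> (\<forall>x. lo f < x \<and> x < lo f + e \<longrightarrow> f x \<noteq> x)"
    using right_germ[OF f fl] by blast
  then have "\<forall>x. lo f < x \<and> x < lo f + e \<longrightarrow> f x \<noteq> x" using near[OF e(1)] by auto
  then show "\<exists>b>lo f. \<forall>x. lo f < x \<and> x < b \<longrightarrow> f x \<noteq> x" using e(1) by (intro exI[of _ "lo f + e"]) auto
  show "lo f \<in> dyadic"
  proof (rule ccontr)
    assume "lo f \<notin> dyadic"
    then obtain e where e: "e > 0" "(\<forall>x. \<bar>x - lo f\<bar> < e \<longrightarrow> f x = x) \<or> (\<forall>x. \<bar>x - lo f\<bar> < e \<and> x \<noteq> lo f \<longrightarrow> f x \<noteq> x)"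
      using nondyadic_germ[OF f fl] by blast
    obtain x where "lo f < x" "x < lo f + e" "f x \<noteq> x" using near[OF e(1)] by blast
    then have "f x \<noteq> x" "\<bar>x - lo f\<bar> < e" by auto
    moreover have "f (lo f - e / 2) = lo f - e / 2" "\<bar>(lo f - e / 2) - lo f\<bar> < e" "lo f - e / 2 \<noteq> lo f"
      using left e(1) by auto
    ultimately show False using e(2) by blast
  qed
qed

lemma hi_facts:
  assumes f: "f \<in> Fc" and nid: "f \<noteq> id"
  shows "hi f \<in> dyadic" "\<And>x. hi f \<le> x \<Longrightarrow> f x = x"
    "\<exists>b<hi f. \<forall>x. b < x \<and> x < hi f \<longrightarrow> f x \<noteq> x"
proof -
  have m: "reflect f \<in> Fc" "reflect f \<noteq> id" using reflect_Fc f nid by auto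
  note l = lo_facts[OF m]
  show "hi f \<in> dyadic" using l(1) by (simp add: hi_def)
  show "f x = x" if "hi f \<le> x" for x using l(2)[of "- x"] that by (auto simp: hi_def reflect_eq_iff)
  obtain b where b: "b > lo (reflect f)" "\<And>x. lo (reflect f) < x \<Longrightarrow> x < b \<Longrightarrow> reflect f x \<noteq> x" using l(3) by blast
  have "f x \<noteq> x" if "- b < x" "x < hi f" for x
    using b(2)[of "- x"] that by (auto simp: hi_def reflect_eq_iff)
  then show "\<exists>b<hi f. \<forall>x. b < x \<and> x < hi f \<longrightarrow> f x \<noteq> x"
    using b(1) by (intro exI[of _ "- b"]) (auto simp: hi_def)
qed

lemma moved_in_hull:
  assumes "f \<in> Fc" "f x \<noteq> x" shows "lo f < x" "x < hi f"
proof -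
  have nid: "f \<noteq> id" using assms by auto
  show "lo f < x" using lo_facts(2)[OF assms(1) nid, of x] assms(2) by force
  show "x < hi f" using hi_facts(2)[OF assms(1) nid, of x] assms(2) by force
qed

lemma lo_less_hi: assumes "f \<in> Fc" "f \<noteq> id" shows "lo f < hi f"
proof -
  obtain x where "f x \<noteq> x" using assms(2) by (auto simp: fun_eq_iff)
  then show ?thesis using moved_in_hull[OF assms(1), of x] by linarith
qed

lemma conj_fixed_iff:
  assumes k: "bij k" shows "(k \<circ> f \<circ> finv k) x = x \<longleftrightarrow> f (finv k x) = finv k x"
  using k by (metis comp_apply finv_left finv_right)

lemma lo_conj:
  assumes f: "f \<in> Fc" "f \<noteq> id" and k: "k \<in> Fc"
  shows "lo (k \<circ> f \<circ> finv k) = k (lo f)"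
proof -
  have bk: "bij k" using k by (rule Fc_bij)
  have less: "finv k x < y \<longleftrightarrow> x < k y" "y < finv k x \<longleftrightarrow> k y < x" for x y
    using Fc_less_iff[OF k, of "finv k x" y] Fc_less_iff[OF k, of y "finv k x"] bk by auto
  obtain b where b: "b > lo f" "\<And>x. lo f < x \<Longrightarrow> x < b \<Longrightarrow> f x \<noteq> x" using lo_facts(3)[OF f] by blast
  show ?thesis
  proof (rule lo_unique[of _ _ "k b"])
    fix x assume "x \<le> k (lo f)"
    then have "finv k x \<le> lo f" using less(2)[of "lo f" x] by linarith
    then show "(k \<circ> f \<circ> finv k) x = x" using lo_facts(2)[OF f] by (simp only: conj_fixed_iff[OF bk])
  next
    show "k (lo f) < k b" using b by (simp add: Fc_less_iff[OF k])
    fix x assume "k (lo f) < x" "x < k b"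
    then show "(k \<circ> f \<circ> finv k) x \<noteq> x" using b(2)[of "finv k x"] less by (simp only: conj_fixed_iff[OF bk]) auto
  qed
qed

lemma reflect_finv: assumes "f \<in> Fc" shows "reflect (finv f) = finv (reflect f)"
proof -
  have "finv (reflect f) = reflect (finv f)"
    by (rule inv_equality) (use Fc_bij[OF assms] in \<open>auto simp: reflect_def\<close>)
  then show ?thesis ..
qed

lemma hi_conj:
  assumes f: "f \<in> Fc" "f \<noteq> id" and k: "k \<in> Fc"
  shows "hi (k \<circ> f \<circ> finv k) = k (hi f)"
  using lo_conj[of "reflect f" "reflect k"] f k reflect_Fc
  by (simp add: hi_def reflect_comp reflect_finv) (simp add: reflect_def)

text \<open>The interval around \<open>x\<close> is shrunk so as to exclude \<open>f x\<close>. A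
  bump \<open>k\<close> there moves \<open>x\<close> but fixes \<open>f x\<close>, and hence cannot
  commute with \<open>f\<close>.\<close>

lemma bump_between:
  assumes f: "f \<in> Fc" and x: "f x \<noteq> x" "a < x" "x < d"
  shows "\<exists>k\<in>Fc. (\<forall>t. t \<le> a \<or> d \<le> t \<longrightarrow> k t = t) \<and> k \<circ> f \<noteq> f \<circ> k"
proof -
  define a' where "a' = (if f x < x then max a (f x) else a)"
  define d' where "d' = (if f x < x then d else min d (f x))"
  have "a' < x" "x < d'" using x by (auto simp: a'_def d'_def)
  then obtain u v where u: "u \<in> dyadic" "a' < u" "u < x" and v: "v \<in> dyadic" "x < v" "v < d'"
    using dyadic_dense[of a' x] dyadic_dense[of x d'] by auto
  obtain k where k: "k \<in> Fc" "\<And>x. u < x \<Longrightarrow> x < v \<Longrightarrow> x < k x" "\<And>x. x \<le> u \<or> v \<le> x \<Longrightarrow> k x = x"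
    using bump_exists[OF u(1) v(1)] u v by auto
  have "k t = t" if "t \<le> a \<or> d \<le> t" for t
    using k(3)[of t] that u v x by (auto simp: a'_def d'_def split: if_splits)
  moreover have "k (f x) = f x"
    using k(3)[of "f x"] u v x by (auto simp: a'_def d'_def split: if_splits)
  moreover have "k x > x" using k(2) u v by auto
  ultimately have "k (f x) \<noteq> f (k x)" using Fc_eq_iff[OF f, of x "k x"] by auto
  then have "k \<circ> f \<noteq> f \<circ> k" by (metis comp_apply)
  then show ?thesis using k(1) \<open>\<And>t. t \<le> a \<or> d \<le> t \<Longrightarrow> k t = t\<close> by blast
qed

section \<open>Centralizers in \<open>Fc\<close>\<close>

definition centralizer :: "(real \<Rightarrow> real) \<Rightarrow> (real \<Rightarrow> real) set" where
  "centralizer f = {k \<in> Fc. k \<circ> f = f \<circ> k}"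

lemma comm_apply: "k \<circ> f = f \<circ> k \<Longrightarrow> k (f x) = f (k x)"
  by (metis comp_apply)

lemma comm_finv: assumes "k \<in> Fc" "f \<in> Fc" "k \<circ> f = f \<circ> k" shows "k \<circ> finv f = finv f \<circ> k"
proof
  fix x
  have b: "bij f" using assms(2) by (rule Fc_bij)
  have "f (k (finv f x)) = k x" using comm_apply[OF assms(3), of "finv f x"] b by simp
  then have "finv f (f (k (finv f x))) = finv f (k x)" by simp
  then show "(k \<circ> finv f) x = (finv f \<circ> k) x" using b by simp
qed

lemma comm_moved: assumes "k \<in> Fc" "k \<circ> f = f \<circ> k" shows "f (k x) = k x \<longleftrightarrow> f x = x"
  using comm_apply[OF assms(2), of x] Fc_eq_iff[OF assms(1)] by metis

lemma comm_conj: assumes "k \<in> Fc" "k \<circ> f = f \<circ> k" shows "k \<circ> f \<circ> finv k = f"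
  using assms Fc_bij[OF assms(1)] by (simp add: comp_assoc)

lemma comm_lo_hi:
  assumes "k \<in> Fc" "f \<in> Fc" "f \<noteq> id" "k \<circ> f = f \<circ> k"
  shows "k (lo f) = lo f" "k (hi f) = hi f"
  using lo_conj[OF assms(2,3,1)] hi_conj[OF assms(2,3,1)] comm_conj[OF assms(1,4)] by simp_all

text \<open>The point where the identity germ of \<open>r\<close> stops spreading to the right is fixed by \<open>f\<close>, hence
  not dyadic, hence not a breakpoint of \<open>r\<close>.\<close>

lemma identity_spreads_right:
  assumes f: "f \<in> Fc" and r: "r \<in> Fc" and comm: "r \<circ> f = f \<circ> r"
    and fq: "f q = q" and nf: "\<And>x. x \<in> dyadic \<Longrightarrow> q < x \<Longrightarrow> x < d \<Longrightarrow> f x \<noteq> x"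
    and e: "e > 0" "\<And>x. q \<le> x \<Longrightarrow> x < q + e \<Longrightarrow> r x = x" and x: "q \<le> x" "x \<le> d"
  shows "r x = x"
proof (rule ccontr)
  assume rx: "r x \<noteq> x"
  define S where "S = {y. q \<le> y \<and> r y \<noteq> y}"
  define s where "s = Inf S"
  have xS: "x \<in> S" using rx x by (simp add: S_def)
  have bdd: "bdd_below S" by (intro bdd_belowI[of _ q]) (auto simp: S_def)
  have "q + e \<le> y" if "y \<in> S" for y
    using that e(2)[of y] by (force simp: S_def)
  then have qs: "q + e \<le> s" using xS by (auto simp: s_def intro!: cInf_greatest)
  have left: "r y = y" if "q \<le> y" "y < s" for y
    using cInf_lower[OF _ bdd, of y] that by (force simp: s_def S_def)
  have "\<exists>y. \<bar>y - s\<bar> < e' \<and> r y = y" if "e' > 0" for e'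
  proof -
    have "r (max q (s - e' / 2)) = max q (s - e' / 2)"
      by (rule left) (use that qs e(1) in auto)
    then show ?thesis using that qs e(1) by (intro exI[of _ "max q (s - e' / 2)"]) auto
  qed
  then have rs: "r s = s" by (rule isCont_fixed_limit[OF Fc_isCont[OF r]])
  have sx: "s \<le> x" using cInf_lower[OF xS bdd] by (simp add: s_def)
  then have sd: "s < d" using rs rx x by (cases "s = x") auto
  have near: "\<exists>y. s < y \<and> y < s + e' \<and> r y \<noteq> y" if "e' > 0" for e'
  proof -
    obtain y where y: "y \<in> S" "y < s + e'" using cInf_lessD[of S "s + e'"] xS \<open>e' > 0\<close> by (auto simp: s_def)
    moreover have "s \<noteq> y" using y rs by (auto simp: S_def)
    moreover have "s \<le> y" using cInf_lower[OF y(1) bdd] by (simp add: s_def)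
    ultimately have "s < y" "y < s + e'" "r y \<noteq> y" by (auto simp: S_def)
    then show ?thesis by blast
  qed
  \<comment> \<open>A map commuting with \<open>r\<close> carries fixed points of \<open>r\<close>
    to fixed points of \<open>r\<close>, so it cannot move \<open>s\<close> up: that would extend
    the identity interval of \<open>r\<close> beyond \<open>s\<close>. Applied to \<open>f\<close>
    and to its inverse this gives \<open>f s = s\<close>.\<close>
  have inv: "g s \<le> s" if g: "g \<in> Fc" "r \<circ> g = g \<circ> r" "g q = q" for g
  proof (rule ccontr)
    assume "\<not> g s \<le> s"
    then obtain y where y: "s < y" "y < g s" "r y \<noteq> y" using near[of "g s - s"] by auto
    define z where "z = finv g y"
    have gz: "g z = y" using Fc_bij[OF g(1)] by (simp add: z_def)
    have "q < y" using y(1) qs e(1) by linarith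
    then have "q < z" "z < s" using Fc_less_iff[OF g(1), of q z] Fc_less_iff[OF g(1), of z s] gz g(3) y by auto
    then have "r z = z" using left by auto
    then have "r y = y" using comm_apply[OF g(2), of z] gz by simp
    then show False using y by simp
  qed
  have bf: "bij f" using f by (rule Fc_bij)
  have "finv f q = q" using finv_left[OF bf, of q] fq by simp
  then have "finv f s \<le> s" using inv[OF Fc_inv[OF f] comm_finv[OF r f comm]] by simp
  then have "f (finv f s) \<le> f s" by (simp add: Fc_le_iff[OF f])
  then have "f s = s" using inv[OF f comm fq] bf by simp
  then have "s \<notin> dyadic" using nf[of s] sd qs e(1) by auto
  then obtain e' where e': "e' > 0" "(\<forall>x. \<bar>x - s\<bar> < e' \<longrightarrow> r x = x) \<or> (\<forall>x. \<bar>x - s\<bar> < e' \<and> x \<noteq> s \<longrightarrow> r x \<noteq> x)"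
    using nondyadic_germ[OF r rs] by blast
  let ?y = "max q (s - e' / 2)"
  have "r ?y = ?y" by (rule left) (use e' qs e(1) in auto)
  moreover have "\<bar>?y - s\<bar> < e'" "?y \<noteq> s" using e' qs e(1) by auto
  ultimately have "\<forall>x. \<bar>x - s\<bar> < e' \<longrightarrow> r x = x" using e'(2) by blast
  moreover obtain y where "s < y" "y < s + e'" "r y \<noteq> y" using near[OF e'(1)] by blast
  ultimately show False by (auto dest: spec[of _ y])
qed

text \<open>At its lowest interior dyadic fixed point an element can be cut off, and what is left
  has a larger centralizer. The definition excludes such points; \<open>basic_iff\<close> recovers
  it from centralizers alone.\<close>

definition basic :: "(real \<Rightarrow> real) set" where
  "basic = {f \<in> Fc. f \<noteq> id \<and> (\<forall>x\<in>dyadic. lo f < x \<and> x < hi f \<longrightarrow> f x \<noteq> x)}"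

text \<open>The commutator \<open>r\<close> of \<open>k\<close> and \<open>f\<close> commutes with
  \<open>g\<close>. All maps involved fix \<open>lo g\<close>, where slopes multiply, so
  \<open>r\<close> has slope 1 there; its identity germ spreads over the hull of \<open>g\<close>,
  which contains no dyadic fixed point of \<open>g\<close> in its interior.\<close>

lemma centralizer_subset_same_hull:
  assumes f: "f \<in> Fc" and g: "g \<in> basic" and comm: "f \<circ> g = g \<circ> f"
    and hull: "\<And>x. x \<le> lo g \<or> hi g \<le> x \<Longrightarrow> f x = x"
  shows "centralizer g \<subseteq> centralizer f"
proof
  fix k assume "k \<in> centralizer g"
  then have k: "k \<in> Fc" "k \<circ> g = g \<circ> k" by (auto simp: centralizer_def)
  have gF: "g \<in> Fc" "g \<noteq> id" using g by (auto simp: basic_def)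
  have bk: "bij k" and bf: "bij f" using k f by (auto simp: Fc_bij)
  note kl = comm_lo_hi[OF k(1) gF k(2)]
  define r where "r = k \<circ> f \<circ> finv k \<circ> finv f"
  have kd: "k \<circ> f \<circ> finv k \<in> Fc" using Fc_conj[OF f Fc_P_set[OF k(1)]] .
  have r: "r \<in> Fc" unfolding r_def using Fc_comp[OF Fc_inv[OF f] kd] by (simp add: comp_assoc)
  have "r \<circ> g = k \<circ> f \<circ> finv k \<circ> (finv f \<circ> g)" by (simp add: r_def comp_assoc)
  also have "finv f \<circ> g = g \<circ> finv f" using comm_finv[OF gF(1) f] comm by simp
  also have "k \<circ> f \<circ> finv k \<circ> (g \<circ> finv f) = k \<circ> f \<circ> (finv k \<circ> g) \<circ> finv f" by (simp add: comp_assoc)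
  also have "finv k \<circ> g = g \<circ> finv k" using comm_finv[OF gF(1) k(1)] k(2) by simp
  also have "k \<circ> f \<circ> (g \<circ> finv k) \<circ> finv f = k \<circ> (f \<circ> g) \<circ> finv k \<circ> finv f" by (simp add: comp_assoc)
  also have "\<dots> = (k \<circ> g) \<circ> f \<circ> finv k \<circ> finv f" unfolding comm by (simp add: comp_assoc)
  also have "\<dots> = g \<circ> r" unfolding k(2) r_def by (simp add: comp_assoc)
  finally have rg: "r \<circ> g = g \<circ> r" .
  let ?a = "lo g"
  have fa: "f ?a = ?a" using hull by simp
  obtain a b where ab: "has_slopes f ?a a b" "a \<in> pow2" "b \<in> pow2"
    using P_plusE[OF Fc_P_plus[OF f], of ?a] by metis
  obtain c d where cd: "has_slopes k ?a c d" "c \<in> pow2" "d \<in> pow2"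
    using P_plusE[OF Fc_P_plus[OF k(1)], of ?a] by metis
  note pos = pow2_pos[OF ab(2)] pow2_pos[OF ab(3)] pow2_pos[OF cd(2)] pow2_pos[OF cd(3)]
  have f1: "has_slopes (finv f) ?a (1 / a) (1 / b)" using has_slopes_inv_pos[OF bf ab(1)] pos fa by simp
  have fi: "finv f ?a = ?a" using finv_left[OF bf, of ?a] fa by simp
  have k1: "has_slopes (finv k) ?a (1 / c) (1 / d)" using has_slopes_inv_pos[OF bk cd(1)] pos kl by simp
  have ka: "finv k ?a = ?a" using finv_left[OF bk, of ?a] kl by simp
  have s1: "has_slopes (finv k \<circ> finv f) ?a (1 / c * (1 / a)) (1 / d * (1 / b))"
    by (rule has_slopes_comp_pos[OF f1]) (use k1 fi pos in auto)
  have kfa: "(finv k \<circ> finv f) ?a = ?a" using ka fi by simp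
  have s2: "has_slopes (f \<circ> (finv k \<circ> finv f)) ?a (a * (1 / c * (1 / a))) (b * (1 / d * (1 / b)))"
    by (rule has_slopes_comp_pos[OF s1]) (use pos ab(1) in \<open>auto simp: kfa simp del: comp_apply\<close>)
  have ffa: "(f \<circ> (finv k \<circ> finv f)) ?a = ?a" using kfa fa by simp
  have "has_slopes (k \<circ> (f \<circ> (finv k \<circ> finv f))) ?a (c * (a * (1 / c * (1 / a)))) (d * (b * (1 / d * (1 / b))))"
    by (rule has_slopes_comp_pos[OF s2]) (use pos cd(1) in \<open>auto simp: ffa simp del: comp_apply\<close>)
  then have "has_slopes r ?a 1 1" using pos by (simp add: r_def comp_assoc)
  then obtain e where e: "e > 0" "\<And>u. 0 \<le> u \<Longrightarrow> u < e \<Longrightarrow> r (?a + u) = r ?a + u"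
    by (auto elim!: has_slopesE)
  have ra: "r ?a = ?a" using kfa fa kl by (simp add: r_def)
  have "r x = x" for x
  proof (cases "?a \<le> x \<and> x \<le> hi g")
    case True
    show ?thesis
    proof (rule identity_spreads_right[OF gF(1) r rg _ _ e(1), of ?a "hi g"])
      show "g ?a = ?a" using lo_facts(2)[OF gF] by simp
      show "g y \<noteq> y" if "y \<in> dyadic" "?a < y" "y < hi g" for y using that g by (auto simp: basic_def)
      show "r y = y" if "?a \<le> y" "y < ?a + e" for y using e(2)[of "y - ?a"] that ra by simp
    qed (use True in auto)
  next
    case False
    have kf: "k (finv k x) = x" using bk by simp
    have "f x = x" using hull[of x] False by linarith
    then have "finv f x = x" using finv_left[OF bf, of x] by simp
    moreover have "finv k x \<le> ?a \<or> hi g \<le> finv k x"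
      using Fc_le_iff[OF k(1), of "finv k x" ?a] Fc_le_iff[OF k(1), of "hi g" "finv k x"] False kf kl by auto
    then have "f (finv k x) = finv k x" by (rule hull)
    ultimately show ?thesis using kf by (simp add: r_def)
  qed
  then have "r = id" by auto
  then have "r \<circ> f \<circ> k = f \<circ> k" by simp
  moreover have "r \<circ> f \<circ> k = k \<circ> f" using bk bf by (simp add: r_def comp_assoc)
  ultimately show "k \<in> centralizer f" using k(1) by (simp add: centralizer_def)
qed

lemma mono_iterates_tendsto:
  fixes f :: "real \<Rightarrow> real"
  assumes mono: "strict_mono f" and cont: "\<And>x. isCont f x" and a: "f a = a" "a \<le> p" and fp: "f p < p"
  obtains q where "a \<le> q" "q < p" "f q = q" "(\<lambda>n. (f ^^ n) p) \<longlonglongrightarrow> q" "\<And>n. q < (f ^^ n) p"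
proof -
  define s where "s n = (f ^^ n) p" for n
  have dec: "s (Suc n) < s n" for n
    by (induct n) (use fp mono in \<open>auto simp: s_def strict_mono_less\<close>)
  then have sd: "decseq s" by (simp add: decseq_Suc_iff less_imp_le)
  have lower: "a \<le> s n" for n
  proof (induct n)
    case (Suc n)
    then have "f a \<le> f (s n)" using mono by (simp add: strict_mono_less_eq)
    then show ?case using a by (simp add: s_def)
  qed (use a in \<open>simp add: s_def\<close>)
  obtain q where q: "s \<longlonglongrightarrow> q" "\<And>n. q \<le> s n" using decseq_convergent[OF sd, of a] lower by blast
  have "(\<lambda>n. f (s n)) \<longlonglongrightarrow> f q" using isCont_tendsto_compose[OF cont q(1)] .
  moreover have "(\<lambda>n. f (s n)) \<longlonglongrightarrow> q" using LIMSEQ_Suc[OF q(1)] by (simp add: s_def)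
  ultimately have "f q = q" by (rule LIMSEQ_unique)
  moreover have "a \<le> q" by (rule LIMSEQ_le_const[OF q(1)]) (use lower in auto)
  moreover have qs: "q < s n" for n using q(2)[of "Suc n"] dec[of n] by linarith
  moreover have "q < p" using qs[of 0] by (simp add: s_def)
  ultimately show thesis using that q(1) unfolding s_def by blast
qed

text \<open>A point moved by \<open>g\<close> outside the hull of \<open>f\<close> would allow a
  bump commuting with \<open>f\<close> but not with \<open>g\<close>. The hull ends of
  \<open>g\<close> are dyadic and fixed by \<open>f\<close>, so they are the hull ends of
  \<open>f\<close>. A dyadic fixed point \<open>p\<close> of \<open>g\<close> inside is excluded by
  iteration: the orbit of \<open>p\<close> under \<open>f\<close> or its inverse consists of fixed
  points of \<open>g\<close>, accumulates at some \<open>q\<close>, and forces \<open>g\<close> to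
  be the identity from \<open>q\<close> to \<open>hi f\<close>.\<close>

lemma basic_cent_maximal:
  assumes f: "f \<in> basic" and g: "g \<in> Fc" "g \<noteq> id" and sub: "centralizer f \<subseteq> centralizer g"
  shows "g \<in> basic" "lo g = lo f" "hi g = hi f"
proof -
  have fF: "f \<in> Fc" "f \<noteq> id" and nf: "\<And>x. x \<in> dyadic \<Longrightarrow> lo f < x \<Longrightarrow> x < hi f \<Longrightarrow> f x \<noteq> x"
    using f by (auto simp: basic_def)
  note lf = lo_facts[OF fF] and hf = hi_facts[OF fF] and lg = lo_facts[OF g] and hg = hi_facts[OF g]
  have "f \<in> centralizer f" using fF by (simp add: centralizer_def)
  then have comm: "f \<circ> g = g \<circ> f" using sub by (auto simp: centralizer_def)
  have off: "g x = x" if x: "x < lo f \<or> hi f < x" for x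
  proof (rule ccontr)
    assume gx: "g x \<noteq> x"
    obtain u v where uv: "u < x" "x < v" "v \<le> lo f \<or> hi f \<le> u"
      using x by (metis lt_ex gt_ex order_refl)
    obtain k where k: "k \<in> Fc" "\<And>t. t \<le> u \<or> v \<le> t \<Longrightarrow> k t = t" "k \<circ> g \<noteq> g \<circ> k"
      using bump_between[OF g(1) gx uv(1,2)] by blast
    have "k t = t \<or> f t = t" for t
    proof -
      have "t \<le> u \<or> v \<le> t \<or> t \<le> lo f \<or> hi f \<le> t" using uv(3) by linarith
      then show ?thesis using k(2) lf(2) hf(2) by metis
    qed
    then have "k \<circ> f = f \<circ> k" by (rule disjoint_support_commute[OF k(1) fF(1)])
    then show False using k sub by (auto simp: centralizer_def)
  qed
  have ends: "f (lo g) = lo g" "f (hi g) = hi g" using comm_lo_hi[OF fF(1) g comm] by auto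
  obtain x where x: "g x \<noteq> x" using g(2) by (auto simp: fun_eq_iff)
  have "\<not> lo g < lo f"
  proof
    assume l: "lo g < lo f"
    obtain b where b: "lo g < b" "\<forall>x. lo g < x \<and> x < b \<longrightarrow> g x \<noteq> x" using lg(3) by blast
    let ?y = "(lo g + min b (lo f)) / 2"
    have "lo g < ?y" "?y < b" "?y < lo f" using l b(1) by (auto simp: min_def)
    then show False using b(2) off[of ?y] by blast
  qed
  moreover have "\<not> hi f < hi g"
  proof
    assume l: "hi f < hi g"
    obtain b where b: "b < hi g" "\<forall>x. b < x \<and> x < hi g \<longrightarrow> g x \<noteq> x" using hg(3) by blast
    let ?y = "(hi g + max b (hi f)) / 2"
    have "b < ?y" "?y < hi g" "hi f < ?y" using l b(1) by (auto simp: max_def)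
    then show False using b(2) off[of ?y] by blast
  qed
  moreover have "lo g < hi g" by (rule lo_less_hi[OF g])
  ultimately show l: "lo g = lo f" and h: "hi g = hi f"
    using nf[OF lg(1)] nf[OF hg(1)] ends by linarith+
  have fl: "f (lo f) = lo f" "f (hi f) = hi f" using lf(2) hf(2) by auto
  \<comment> \<open>\<open>\<phi>\<close> will be \<open>f\<close> or its inverse, whichever moves
    \<open>p\<close> to the left.\<close>
  have no: False if p: "p \<in> dyadic" "lo f < p" "p < hi f" "g p = p" "\<phi> p < p"
    and \<phi>: "\<phi> \<in> Fc" "\<phi> \<circ> g = g \<circ> \<phi>" "\<phi> (lo f) = lo f"
      "\<And>x. x \<in> dyadic \<Longrightarrow> lo f < x \<Longrightarrow> x < hi f \<Longrightarrow> \<phi> x \<noteq> x" for p \<phi>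
  proof -
    obtain q where q: "lo f \<le> q" "q < p" "\<phi> q = q" "(\<lambda>n. (\<phi> ^^ n) p) \<longlonglongrightarrow> q" "\<And>n. q < (\<phi> ^^ n) p"
      using mono_iterates_tendsto[of \<phi> "lo f" p] P_plus_strict_mono[OF Fc_P_plus[OF \<phi>(1)]] Fc_isCont[OF \<phi>(1)] \<phi>(3) p
      by (metis less_imp_le)
    have gs: "g ((\<phi> ^^ n) p) = (\<phi> ^^ n) p" for n
      by (induct n) (use p(4) comm_moved[OF \<phi>(1,2)] in auto)
    have near: "\<exists>y. q < y \<and> y < q + e \<and> g y = y" if e: "e > 0" for e
    proof -
      have "\<forall>\<^sub>F n in sequentially. (\<phi> ^^ n) p < q + e"
        using order_tendstoD(2)[OF q(4), of "q + e"] e by simp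
      then obtain n where "(\<phi> ^^ n) p < q + e" by (auto simp: eventually_sequentially)
      then show ?thesis using q(5) gs by blast
    qed
    have "\<exists>y. \<bar>y - q\<bar> < e \<and> g y = y" if "e > 0" for e
    proof -
      obtain y where "q < y" "y < q + e" "g y = y" using near[OF \<open>e > 0\<close>] by blast
      then show ?thesis by (intro exI[of _ y]) auto
    qed
    then have "g q = q" by (rule isCont_fixed_limit[OF Fc_isCont[OF g(1)]])
    then obtain e where e: "e > 0" "(\<forall>x. q \<le> x \<and> x < q + e \<longrightarrow> g x = x) \<or> (\<forall>x. q < x \<and> x < q + e \<longrightarrow> g x \<noteq> x)"
      using right_germ[OF g(1)] by blast
    then have id: "g x = x" if "q \<le> x" "x < q + e" for x using near[OF e(1)] that by blast
    have gid: "g x = x" if "q \<le> x" "x \<le> hi f" for x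
      using identity_spreads_right[OF \<phi>(1) g(1) \<phi>(2)[symmetric] q(3) _ e(1) id that] \<phi>(4) q(1)
      by (meson order_le_less_trans)
    obtain b where b: "b < hi g" "\<forall>x. b < x \<and> x < hi g \<longrightarrow> g x \<noteq> x" using hg(3) by blast
    let ?y = "(hi g + max b q) / 2"
    have "b < ?y" "?y < hi g" "q < ?y" using q p h b(1) by (auto simp: max_def)
    then show False using b(2) gid[of ?y] h by (metis less_imp_le)
  qed
  have "g x \<noteq> x" if x: "x \<in> dyadic" "lo f < x" "x < hi f" for x
  proof
    assume gx: "g x = x"
    have b: "bij f" using fF by (simp add: Fc_bij)
    consider "f x < x" | "x < f x" using nf[OF x] by linarith
    then show False
    proof cases
      case 1
      then show False using no[OF x gx _ fF(1) comm fl(1) nf] by blast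
    next
      case 2
      then have "finv f x < x" using Fc_less_iff[OF fF(1), of "finv f x" x] b by simp
      moreover have "finv f (lo f) = lo f" using finv_left[OF b, of "lo f"] fl(1) by simp
      moreover have "finv f y \<noteq> y" if "y \<in> dyadic" "lo f < y" "y < hi f" for y
        using nf[OF that] finv_right[OF b, of y] by metis
      ultimately show False
        using no[OF x gx _ Fc_inv[OF fF(1)] comm_finv[OF g(1) fF(1) comm[symmetric], symmetric]] by blast
    qed
  qed
  then show "g \<in> basic" using g l h by (auto simp: basic_def)
qed

text \<open>Cut \<open>f\<close> at its lowest interior dyadic fixed point \<open>p\<close> and keep
  the part to the left. Elements commuting with \<open>f\<close> permute the interior dyadic fixed
  points, so they fix \<open>p\<close> and commute with the cut map. A bump to the right of
  \<open>p\<close> shows that the inclusion of centralizers is strict.\<close>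

lemma not_basic_cent:
  assumes f: "f \<in> Fc" "f \<noteq> id" and nb: "f \<notin> basic"
  shows "\<exists>g\<in>Fc. g \<noteq> id \<and> centralizer f \<subseteq> centralizer g \<and> \<not> centralizer g \<subseteq> centralizer f"
proof -
  note lf = lo_facts[OF f] and hf = hi_facts[OF f]
  define S where "S = {x \<in> dyadic. lo f < x \<and> x < hi f \<and> f x = x}"
  define p where "p = Inf S"
  obtain x0 where x0: "x0 \<in> S" using f nb by (auto simp: basic_def S_def)
  have bdd: "bdd_below S" by (intro bdd_belowI[of _ "lo f"]) (auto simp: S_def)
  obtain b where b: "lo f < b" "\<forall>x. lo f < x \<and> x < b \<longrightarrow> f x \<noteq> x" using lf(3) by blast
  have "b \<le> y" if "y \<in> S" for y using that b(2) by (force simp: S_def)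
  then have bp: "b \<le> p" using x0 by (auto simp: p_def intro!: cInf_greatest)
  have px: "p \<le> x" if "x \<in> S" for x using cInf_lower[OF that bdd] by (simp add: p_def)
  have near: "\<exists>y\<in>S. p \<le> y \<and> y < p + e" if "e > 0" for e
    using cInf_lessD[of S "p + e"] x0 px that by (auto simp: p_def)
  have "\<exists>y. \<bar>y - p\<bar> < e \<and> f y = y" if "e > 0" for e
  proof -
    obtain y where "y \<in> S" "p \<le> y" "y < p + e" using near[OF \<open>e > 0\<close>] by blast
    then show ?thesis by (intro exI[of _ y]) (auto simp: S_def)
  qed
  then have fp: "f p = p" by (rule isCont_fixed_limit[OF Fc_isCont[OF f(1)]])
  have pd: "p < hi f" using px[OF x0] x0 by (auto simp: S_def)
  \<comment> \<open>At a non-dyadic infimum \<open>f\<close> would be the identity nearby, which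
    produces smaller dyadic fixed points.\<close>
  have pdy: "p \<in> dyadic"
  proof (rule ccontr)
    assume nd: "p \<notin> dyadic"
    then obtain e where e: "e > 0" "(\<forall>x. \<bar>x - p\<bar> < e \<longrightarrow> f x = x) \<or> (\<forall>x. \<bar>x - p\<bar> < e \<and> x \<noteq> p \<longrightarrow> f x \<noteq> x)"
      using nondyadic_germ[OF f(1) fp] by blast
    obtain y where y: "y \<in> S" "p \<le> y" "y < p + e" using near[OF e(1)] by blast
    moreover have "y \<noteq> p" using y(1) nd by (auto simp: S_def)
    ultimately have id: "\<forall>x. \<bar>x - p\<bar> < e \<longrightarrow> f x = x" using e(2) by (auto simp: S_def)
    obtain z where z: "z \<in> dyadic" "max (lo f) (p - e) < z" "z < p"
      using dyadic_dense[of "max (lo f) (p - e)" p] b(1) bp e(1) by auto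
    then have "f z = z" using id by auto
    then have "z \<in> S" using z pd by (auto simp: S_def)
    then show False using px z(3) by fastforce
  qed
  define g where "g = glue p f id"
  have gP: "g \<in> P_plus" unfolding g_def
    using Fc_P_plus[OF f(1)] id_in_P_plus pdy by (rule glue_in_P_plus) (simp add: fp)
  obtain M where M: "\<And>t. \<bar>t\<bar> > M \<Longrightarrow> f t = t" using f by (auto simp: Fc_def)
  have gF: "g \<in> Fc" by (rule FcI[OF gP, of M]) (use M in \<open>auto simp: g_def glue_def\<close>)
  define m where "m = (lo f + b) / 2"
  have "lo f < m" "m < b" using b(1) by (auto simp: m_def)
  then have "g m \<noteq> m" using b(2) bp by (simp add: g_def glue_def)
  then have "g \<noteq> id" by auto
  moreover have "centralizer f \<subseteq> centralizer g"
  proof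
    fix k assume "k \<in> centralizer f"
    then have k: "k \<in> Fc" "k \<circ> f = f \<circ> k" by (auto simp: centralizer_def)
    have inv: "m x \<in> S" if "m \<in> Fc" "m \<circ> f = f \<circ> m" "x \<in> S" for m x
      using that comm_lo_hi[OF that(1) f that(2)] comm_moved[OF that(1,2), of x]
        Fc_less_iff[OF that(1), of "lo f" x] Fc_less_iff[OF that(1), of x "hi f"] Fc_dyadic_iff[OF that(1), of x]
      by (auto simp: S_def)
    have low: "p \<le> m p" if m: "m \<in> Fc" "m \<circ> f = f \<circ> m" for m
    proof (rule ccontr)
      assume "\<not> p \<le> m p"
      have bm: "bij m" using m by (simp add: Fc_bij)
      from \<open>\<not> p \<le> m p\<close> have "p < finv m p" using Fc_less_iff[OF m(1), of p "finv m p"] bm by simp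
      then obtain y where y: "y \<in> S" "y < finv m p" using near[of "finv m p - p"] by auto
      then have "m y < p" using Fc_less_iff[OF m(1), of y "finv m p"] bm by simp
      then show False using px[OF inv[OF m y(1)]] by linarith
    qed
    have "p \<le> finv k p" using low[OF Fc_inv[OF k(1)]] comm_finv[OF f(1) k(1) k(2)[symmetric]] by simp
    then have "k p \<le> p" using Fc_le_iff[OF k(1), of p "finv k p"] Fc_bij[OF k(1)] by simp
    then have kp: "k p = p" using low[OF k] by simp
    have "k (g x) = g (k x)" for x
    proof (cases "x < p")
      case True
      then have "k x < p" using Fc_less_iff[OF k(1), of x p] kp by simp
      then show ?thesis using True comm_apply[OF k(2)] by (simp add: g_def glue_def)
    next
      case False
      then have "\<not> k x < p" using Fc_less_iff[OF k(1), of x p] kp by simp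
      then show ?thesis using False by (simp add: g_def glue_def)
    qed
    then show "k \<in> centralizer g" using k(1) by (auto simp: centralizer_def)
  qed
  moreover have "\<not> centralizer g \<subseteq> centralizer f"
  proof -
    obtain c where c: "c < hi f" "\<forall>x. c < x \<and> x < hi f \<longrightarrow> f x \<noteq> x" using hf(3) by blast
    let ?y = "(hi f + max c p) / 2"
    have "c < ?y" "?y < hi f" "p < ?y" using pd c(1) by (auto simp: max_def)
    then obtain k where k: "k \<in> Fc" "\<And>t. t \<le> p \<or> hi f \<le> t \<Longrightarrow> k t = t" "k \<circ> f \<noteq> f \<circ> k"
      using bump_between[OF f(1), of ?y p "hi f"] c(2) by blast
    have "k \<circ> g = g \<circ> k"
      by (rule disjoint_support_commute[OF k(1) gF]) (use k(2) in \<open>auto simp: g_def glue_def\<close>)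
    then show ?thesis using k by (auto simp: centralizer_def)
  qed
  ultimately show ?thesis using gF by blast
qed

text \<open>The right-hand side speaks of the abstract group only, so automorphisms of
  \<open>Fc\<close> preserve \<open>basic\<close>.\<close>

lemma basic_iff:
  "f \<in> basic \<longleftrightarrow> f \<in> Fc \<and> f \<noteq> id \<and> (\<forall>g\<in>Fc. g \<noteq> id \<and> centralizer f \<subseteq> centralizer g \<longrightarrow> centralizer g \<subseteq> centralizer f)"
proof
  assume f: "f \<in> basic"
  then have fF: "f \<in> Fc" "f \<noteq> id" by (auto simp: basic_def)
  have "centralizer g \<subseteq> centralizer f" if g: "g \<in> Fc" "g \<noteq> id" "centralizer f \<subseteq> centralizer g" for g
  proof (rule centralizer_subset_same_hull[OF fF(1)])
    note m = basic_cent_maximal[OF f g]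
    show "g \<in> basic" by (rule m)
    have "f \<in> centralizer g" using g(3) fF by (auto simp: centralizer_def)
    then show "f \<circ> g = g \<circ> f" by (simp add: centralizer_def)
    show "f x = x" if "x \<le> lo g \<or> hi g \<le> x" for x
      using that lo_facts(2)[OF fF] hi_facts(2)[OF fF] by (auto simp: m)
  qed
  then show "f \<in> Fc \<and> f \<noteq> id \<and> (\<forall>g\<in>Fc. g \<noteq> id \<and> centralizer f \<subseteq> centralizer g \<longrightarrow> centralizer g \<subseteq> centralizer f)"
    using fF by blast
next
  assume "f \<in> Fc \<and> f \<noteq> id \<and> (\<forall>g\<in>Fc. g \<noteq> id \<and> centralizer f \<subseteq> centralizer g \<longrightarrow> centralizer g \<subseteq> centralizer f)"
  then show "f \<in> basic" using not_basic_cent by blast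
qed

text \<open>If \<open>f\<close> and \<open>g\<close> commute, the hull ends of each are dyadic
  points fixed by the other and hence not interior to the other hull: the hulls are disjoint or
  equal. Equal hulls give equal centralizers by \<open>centralizer_subset_same_hull\<close>.\<close>

lemma basic_disjoint_iff:
  assumes f: "f \<in> basic" and g: "g \<in> basic"
  shows "(hi f \<le> lo g \<or> hi g \<le> lo f) \<longleftrightarrow> f \<circ> g = g \<circ> f \<and> centralizer f \<noteq> centralizer g"
proof -
  have fF: "f \<in> Fc" "f \<noteq> id" and gF: "g \<in> Fc" "g \<noteq> id" using f g by (auto simp: basic_def)
  note lf = lo_facts[OF fF] and hf = hi_facts[OF fF] and lg = lo_facts[OF gF] and hg = hi_facts[OF gF]
  show ?thesis
  proof
    assume d: "hi f \<le> lo g \<or> hi g \<le> lo f"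
    have "f x = x \<or> g x = x" for x
      using d lf(2)[of x] hf(2)[of x] lg(2)[of x] hg(2)[of x] by linarith
    then have "f \<circ> g = g \<circ> f" by (rule disjoint_support_commute[OF fF(1) gF(1)])
    moreover obtain x where x: "f x \<noteq> x" using fF by (auto simp: fun_eq_iff)
    then obtain k where k: "k \<in> Fc" "\<And>t. t \<le> lo f \<or> hi f \<le> t \<Longrightarrow> k t = t" "k \<circ> f \<noteq> f \<circ> k"
      using bump_between[OF fF(1) x] moved_in_hull[OF fF(1) x] by blast
    have "k t = t \<or> g t = t" for t
      using d k(2)[of t] lg(2)[of t] hg(2)[of t] by linarith
    then have "k \<circ> g = g \<circ> k" by (rule disjoint_support_commute[OF k(1) gF(1)])
    then have "k \<in> centralizer g" "k \<notin> centralizer f" using k by (auto simp: centralizer_def)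
    ultimately show "f \<circ> g = g \<circ> f \<and> centralizer f \<noteq> centralizer g" by blast
  next
    assume c: "f \<circ> g = g \<circ> f \<and> centralizer f \<noteq> centralizer g"
    then have comm: "f \<circ> g = g \<circ> f" by simp
    show "hi f \<le> lo g \<or> hi g \<le> lo f"
    proof (rule ccontr)
      assume nd: "\<not> (hi f \<le> lo g \<or> hi g \<le> lo f)"
      have "\<not> (lo f < lo g \<and> lo g < hi f)" "\<not> (lo f < hi g \<and> hi g < hi f)"
        using f comm_lo_hi[OF fF(1) gF comm] lg(1) hg(1) by (auto simp: basic_def)
      moreover have "\<not> (lo g < lo f \<and> lo f < hi g)" "\<not> (lo g < hi f \<and> hi f < hi g)"
        using g comm_lo_hi[OF gF(1) fF comm[symmetric]] lf(1) hf(1) by (auto simp: basic_def)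
      ultimately have eq: "lo f = lo g" "hi f = hi g" using nd by linarith+
      have "centralizer g \<subseteq> centralizer f"
        by (rule centralizer_subset_same_hull[OF fF(1) g comm]) (use lf(2) hf(2) eq in auto)
      moreover have "centralizer f \<subseteq> centralizer g"
        by (rule centralizer_subset_same_hull[OF gF(1) f comm[symmetric]]) (use lg(2) hg(2) eq in auto)
      ultimately show False using c by blast
    qed
  qed
qed

lemma basic_hull_exists:
  assumes "a \<in> dyadic" "d \<in> dyadic" "a < d"
  shows "\<exists>f\<in>basic. lo f = a \<and> hi f = d"
proof -
  obtain f where f: "f \<in> Fc" "\<And>x. a < x \<Longrightarrow> x < d \<Longrightarrow> x < f x" "\<And>x. x \<le> a \<or> d \<le> x \<Longrightarrow> f x = x"
    using bump_exists[OF assms] by blast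
  have ne: "f x \<noteq> x" if "a < x" "x < d" for x using f(2)[OF that] by simp
  have "lo f = a" by (rule lo_unique[of _ _ d]) (use f(3) ne assms in auto)
  moreover have "hi f = d" by (rule hi_unique[of _ _ a]) (use f(3) ne assms in auto)
  moreover have "f \<noteq> id" using ne[of "(a + d) / 2"] assms(3) by auto
  ultimately show ?thesis using f(1) ne by (intro bexI[of _ f]) (auto simp: basic_def)
qed

text \<open>If the hull of \<open>f\<close> sticks out of that of \<open>g\<close>, a bump in the
  part that sticks out is disjoint from \<open>g\<close> but not from \<open>f\<close>.\<close>

lemma basic_incl_iff:
  assumes f: "f \<in> basic" and g: "g \<in> basic"
  shows "(lo g \<le> lo f \<and> hi f \<le> hi g) \<longleftrightarrow>
    (\<forall>k\<in>basic. (hi k \<le> lo g \<or> hi g \<le> lo k) \<longrightarrow> (hi k \<le> lo f \<or> hi f \<le> lo k))"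
proof
  assume a: "lo g \<le> lo f \<and> hi f \<le> hi g"
  show "\<forall>k\<in>basic. (hi k \<le> lo g \<or> hi g \<le> lo k) \<longrightarrow> (hi k \<le> lo f \<or> hi f \<le> lo k)"
    using a by (meson order_trans)
next
  assume a: "\<forall>k\<in>basic. (hi k \<le> lo g \<or> hi g \<le> lo k) \<longrightarrow> (hi k \<le> lo f \<or> hi f \<le> lo k)"
  have fF: "f \<in> Fc" "f \<noteq> id" and gF: "g \<in> Fc" "g \<noteq> id" using f g by (auto simp: basic_def)
  have dy: "lo f \<in> dyadic" "hi f \<in> dyadic" "lo g \<in> dyadic" "hi g \<in> dyadic"
    using lo_facts(1) hi_facts(1) fF gF by auto
  have l: "lo f < hi f" using lo_less_hi[OF fF] .
  show "lo g \<le> lo f \<and> hi f \<le> hi g"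
  proof (intro conjI; rule ccontr)
    assume n: "\<not> lo g \<le> lo f"
    have "min (lo g) (hi f) \<in> dyadic" "lo f < min (lo g) (hi f)" using dy l n by (auto simp: min_def)
    then obtain k where "k \<in> basic" "lo k = lo f" "hi k = min (lo g) (hi f)"
      using basic_hull_exists[OF dy(1)] by blast
    then show False using a l n by (auto simp: min_def split: if_splits)
  next
    assume n: "\<not> hi f \<le> hi g"
    have "max (hi g) (lo f) \<in> dyadic" "max (hi g) (lo f) < hi f" using dy l n by (auto simp: max_def)
    then obtain k where "k \<in> basic" "hi k = hi f" "lo k = max (hi g) (lo f)"
      using basic_hull_exists[OF _ dy(2)] by blast
    then show False using a l n by (auto simp: max_def split: if_splits)
  qed
qed

text \<open>Commutation alone determines which elements of \<open>Fc\<close> are basic and how their hulls are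
  nested, so an automorphism of \<open>Fc\<close> acts on the intervals with dyadic endpoints.\<close>

theorem automorphism_is_conjugation:
  assumes bij: "bij_betw \<alpha> Fc Fc" and hom: "\<And>f g. f \<in> Fc \<Longrightarrow> g \<in> Fc \<Longrightarrow> \<alpha> (f \<circ> g) = \<alpha> f \<circ> \<alpha> g"
  shows "\<exists>h. bij h \<and> continuous_on UNIV h \<and> (\<forall>f\<in>Fc. \<alpha> f = h \<circ> f \<circ> finv h)"
proof -
  have \<alpha>F: "\<alpha> f \<in> Fc" if "f \<in> Fc" for f using bij that by (auto simp: bij_betw_def)
  have \<alpha>inj: "\<alpha> f = \<alpha> g \<longleftrightarrow> f = g" if "f \<in> Fc" "g \<in> Fc" for f g
    using bij that by (auto simp: bij_betw_def inj_on_def)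
  have \<alpha>surj: "\<exists>f\<in>Fc. \<alpha> f = g" if "g \<in> Fc" for g using bij_betw_imp_surj_on[OF bij] that by (metis imageE)
  have \<alpha>id: "\<alpha> id = id"
  proof -
    have "\<alpha> id \<circ> \<alpha> id = \<alpha> id" using hom[OF id_in_Fc id_in_Fc] by simp
    then have "finv (\<alpha> id) \<circ> (\<alpha> id \<circ> \<alpha> id) = finv (\<alpha> id) \<circ> \<alpha> id" by simp
    then show ?thesis using Fc_bij[OF \<alpha>F[OF id_in_Fc]] by simp
  qed
  have \<alpha>ne: "\<alpha> f = id \<longleftrightarrow> f = id" if "f \<in> Fc" for f using \<alpha>inj[OF that id_in_Fc] \<alpha>id by simp
  have \<alpha>inv: "\<alpha> (finv f) = finv (\<alpha> f)" if f: "f \<in> Fc" for f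
  proof -
    have "\<alpha> f \<circ> \<alpha> (finv f) = id"
      using hom[OF f Fc_inv[OF f]] Fc_bij[OF f] \<alpha>id by simp
    then have "finv (\<alpha> f) \<circ> (\<alpha> f \<circ> \<alpha> (finv f)) = finv (\<alpha> f)" by simp
    then show ?thesis using Fc_bij[OF \<alpha>F[OF f]] by simp
  qed
  have \<alpha>comm: "\<alpha> f \<circ> \<alpha> g = \<alpha> g \<circ> \<alpha> f \<longleftrightarrow> f \<circ> g = g \<circ> f" if "f \<in> Fc" "g \<in> Fc" for f g
    using hom[OF that] hom[OF that(2,1)] \<alpha>inj[OF Fc_comp[OF that(2,1)] Fc_comp[OF that]] by simp
  have \<alpha>centralizer: "centralizer (\<alpha> f) = \<alpha> ` centralizer f" if f: "f \<in> Fc" for f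
  proof (rule Set.set_eqI)
    fix k
    show "k \<in> centralizer (\<alpha> f) \<longleftrightarrow> k \<in> \<alpha> ` centralizer f"
    proof
      assume k: "k \<in> centralizer (\<alpha> f)"
      then obtain m where "m \<in> Fc" "\<alpha> m = k" using \<alpha>surj by (auto simp: centralizer_def)
      then show "k \<in> \<alpha> ` centralizer f" using k \<alpha>comm[OF _ f] by (auto simp: centralizer_def)
    qed (use \<alpha>F \<alpha>comm[OF _ f] in \<open>auto simp: centralizer_def\<close>)
  qed
  have centralizer_Fc: "centralizer f \<subseteq> Fc" for f by (auto simp: centralizer_def)
  have \<alpha>sub: "centralizer (\<alpha> f) \<subseteq> centralizer (\<alpha> g) \<longleftrightarrow> centralizer f \<subseteq> centralizer g" if "f \<in> Fc" "g \<in> Fc" for f g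
    using inj_on_image_subset_iff[OF bij_betw_imp_inj_on[OF bij] centralizer_Fc[of f] centralizer_Fc[of g]] that
    by (simp add: \<alpha>centralizer)
  have \<alpha>basic: "\<alpha> f \<in> basic \<longleftrightarrow> f \<in> basic" if f: "f \<in> Fc" for f
  proof -
    have "(\<forall>g\<in>Fc. g \<noteq> id \<and> centralizer (\<alpha> f) \<subseteq> centralizer g \<longrightarrow> centralizer g \<subseteq> centralizer (\<alpha> f)) \<longleftrightarrow>
        (\<forall>g\<in>Fc. \<alpha> g \<noteq> id \<and> centralizer (\<alpha> f) \<subseteq> centralizer (\<alpha> g) \<longrightarrow> centralizer (\<alpha> g) \<subseteq> centralizer (\<alpha> f))"
      using \<alpha>surj \<alpha>F by metis
    also have "\<dots> \<longleftrightarrow> (\<forall>g\<in>Fc. g \<noteq> id \<and> centralizer f \<subseteq> centralizer g \<longrightarrow> centralizer g \<subseteq> centralizer f)"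
      by (intro ball_cong refl) (simp add: \<alpha>sub \<alpha>ne f)
    finally show ?thesis unfolding basic_iff using f \<alpha>F \<alpha>ne by simp
  qed
  have bF: "f \<in> Fc" "f \<noteq> id" if "f \<in> basic" for f using that by (auto simp: basic_def)
  have \<alpha>b: "\<alpha> f \<in> basic" if "f \<in> basic" for f using \<alpha>basic[of f] bF that by blast
  have \<alpha>bsurj: "\<exists>f\<in>basic. \<alpha> f = g" if "g \<in> basic" for g using \<alpha>surj[of g] \<alpha>basic bF that by blast
  have disj: "(hi f \<le> lo g \<or> hi g \<le> lo f) \<longleftrightarrow> (hi (\<alpha> f) \<le> lo (\<alpha> g) \<or> hi (\<alpha> g) \<le> lo (\<alpha> f))"
    if "f \<in> basic" "g \<in> basic" for f g
    using basic_disjoint_iff[OF that] basic_disjoint_iff[OF \<alpha>b[OF that(1)] \<alpha>b[OF that(2)]]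
      \<alpha>comm[of f g] \<alpha>sub[of f g] \<alpha>sub[of g f] bF that by blast
  have incl: "(lo g \<le> lo f \<and> hi f \<le> hi g) \<longleftrightarrow> (lo (\<alpha> g) \<le> lo (\<alpha> f) \<and> hi (\<alpha> f) \<le> hi (\<alpha> g))"
    if fg: "f \<in> basic" "g \<in> basic" for f g
  proof -
    have "(\<forall>k\<in>basic. (hi k \<le> lo (\<alpha> g) \<or> hi (\<alpha> g) \<le> lo k) \<longrightarrow> (hi k \<le> lo (\<alpha> f) \<or> hi (\<alpha> f) \<le> lo k)) \<longleftrightarrow>
       (\<forall>k\<in>basic. (hi (\<alpha> k) \<le> lo (\<alpha> g) \<or> hi (\<alpha> g) \<le> lo (\<alpha> k)) \<longrightarrow> (hi (\<alpha> k) \<le> lo (\<alpha> f) \<or> hi (\<alpha> f) \<le> lo (\<alpha> k)))"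
      using \<alpha>bsurj \<alpha>b by metis
    also have "\<dots> \<longleftrightarrow> (\<forall>k\<in>basic. (hi k \<le> lo g \<or> hi g \<le> lo k) \<longrightarrow> (hi k \<le> lo f \<or> hi f \<le> lo k))"
      by (intro ball_cong refl) (use disj fg in simp)
    finally show ?thesis using basic_incl_iff[OF fg] basic_incl_iff[OF \<alpha>b[OF fg(1)] \<alpha>b[OF fg(2)]] by simp
  qed
  have dense: "\<exists>b\<in>basic. u < lo b \<and> lo b < x \<and> x < hi b \<and> hi b < v" if x: "u < x" "x < v" for u x v
  proof -
    obtain a d where "a \<in> dyadic" "u < a" "a < x" "d \<in> dyadic" "x < d" "d < v"
      using dyadic_dense[OF x(1)] dyadic_dense[OF x(2)] by blast
    then show ?thesis using basic_hull_exists[of a d] by force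
  qed
  interpret I: interval_iso basic lo hi "lo \<circ> \<alpha>" "hi \<circ> \<alpha>"
  proof unfold_locales
    show "lo b < hi b" if "b \<in> basic" for b using lo_less_hi bF[OF that] .
    show "(lo \<circ> \<alpha>) b < (hi \<circ> \<alpha>) b" if "b \<in> basic" for b using lo_less_hi bF[OF \<alpha>b[OF that]] by simp
    show "\<exists>b\<in>basic. u < lo b \<and> lo b < x \<and> x < hi b \<and> hi b < v" if "u < x" "x < v" for u x v
      using dense[OF that] .
    show "\<exists>b\<in>basic. u < (lo \<circ> \<alpha>) b \<and> (lo \<circ> \<alpha>) b < x \<and> x < (hi \<circ> \<alpha>) b \<and> (hi \<circ> \<alpha>) b < v"
      if "u < x" "x < v" for u x v
      using dense[OF that] \<alpha>bsurj by fastforce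
  qed (use incl disj in auto)
  have equiv: "I.fitted_point (f x) = \<alpha> f (I.fitted_point x)" if f: "f \<in> Fc" for f x
  proof (rule I.fitted_point_eq)
    show "I.fits (f x) (\<alpha> f (I.fitted_point x))" unfolding I.fits_def
    proof (intro ballI impI)
      fix b assume b: "b \<in> basic" and x: "lo b < f x \<and> f x < hi b"
      define f' where "f' = finv f"
      have f': "f' \<in> Fc" and bf: "bij f" using f Fc_inv Fc_bij by (auto simp: f'_def)
      have ff: "f' (f y) = y" "f (f' y) = y" for y using bf by (auto simp: f'_def)
      have fif: "finv f' = f" using bf by (simp add: f'_def)
      \<comment> \<open>The conjugate of \<open>b\<close> by the inverse of \<open>f\<close> is
        basic and its hull is the preimage under \<open>f\<close> of that of \<open>b\<close>, so it
        tests \<open>x\<close> exactly as \<open>b\<close> tests \<open>f x\<close>.\<close>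
      define c where "c = f' \<circ> b \<circ> finv f'"
      note bb = bF[OF b]
      have hull: "lo c = f' (lo b)" "hi c = f' (hi b)"
        using lo_conj[OF bb f'] hi_conj[OF bb f'] by (auto simp: c_def)
      have c: "c \<in> Fc" unfolding c_def using Fc_conj[OF bb(1) Fc_P_set[OF f']] .
      have cx: "c y = f' (b (f y))" for y by (simp add: c_def fif)
      have "c \<noteq> id"
      proof
        assume "c = id"
        then have "f' (b (f (f' y))) = f' y" for y using cx[of "f' y"] by simp
        then have "b y = y" for y using Fc_eq_iff[OF f'] ff by simp
        then show False using bb by auto
      qed
      moreover have "c y \<noteq> y" if y: "y \<in> dyadic" "lo c < y" "y < hi c" for y
      proof
        assume "c y = y"
        then have "f (c y) = f y" by simp
        then have "b (f y) = f y" by (simp add: cx ff)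
        moreover have "lo b < f y" "f y < hi b"
          using Fc_less_iff[OF f', of "lo b" "f y"] Fc_less_iff[OF f', of "f y" "hi b"] y hull ff by auto
        moreover have "f y \<in> dyadic" using Fc_dyadic_iff[OF f] y by simp
        ultimately show False using b by (auto simp: basic_def)
      qed
      ultimately have cb: "c \<in> basic" using c by (auto simp: basic_def)
      have "lo c < x" "x < hi c" using x hull ff
          Fc_less_iff[OF f', of "lo b" "f x"] Fc_less_iff[OF f', of "f x" "hi b"] by auto
      then have p: "lo (\<alpha> c) \<le> I.fitted_point x" "I.fitted_point x \<le> hi (\<alpha> c)"
        using I.fits_pt[of x] cb unfolding I.fits_def by auto
      have "\<alpha> c = \<alpha> f' \<circ> \<alpha> b \<circ> finv (\<alpha> f')"
        using hom[OF Fc_comp[OF bb(1) f'] Fc_inv[OF f']] hom[OF f' bb(1)] \<alpha>inv[OF f'] by (simp add: c_def)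
      moreover have "\<alpha> b \<noteq> id" using \<alpha>ne bb by auto
      ultimately have "lo (\<alpha> c) = \<alpha> f' (lo (\<alpha> b))" "hi (\<alpha> c) = \<alpha> f' (hi (\<alpha> b))"
        using lo_conj[of "\<alpha> b" "\<alpha> f'"] hi_conj[of "\<alpha> b" "\<alpha> f'"] \<alpha>F bb f' by auto
      moreover have "\<alpha> f' = finv (\<alpha> f)" using \<alpha>inv[OF f] by (simp add: f'_def)
      ultimately have "\<alpha> f (lo (\<alpha> c)) = lo (\<alpha> b)" "\<alpha> f (hi (\<alpha> c)) = hi (\<alpha> b)"
        using Fc_bij[OF \<alpha>F[OF f]] by auto
      then show "(lo \<circ> \<alpha>) b \<le> \<alpha> f (I.fitted_point x) \<and> \<alpha> f (I.fitted_point x) \<le> (hi \<circ> \<alpha>) b"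
        using p Fc_le_iff[OF \<alpha>F[OF f], of "lo (\<alpha> c)" "I.fitted_point x"] Fc_le_iff[OF \<alpha>F[OF f], of "I.fitted_point x" "hi (\<alpha> c)"] by simp
    qed
  qed
  have "\<alpha> f = I.fitted_point \<circ> f \<circ> finv I.fitted_point" if f: "f \<in> Fc" for f
  proof
    fix y
    show "\<alpha> f y = (I.fitted_point \<circ> f \<circ> finv I.fitted_point) y" using equiv[OF f, of "finv I.fitted_point y"] I.fitted_point_bij by simp
  qed
  then show ?thesis using I.fitted_point_bij I.fitted_point_continuous by blast
qed

section \<open>Homeomorphisms normalizing the compactly supported subgroup\<close>

text \<open>Confined to increasing maps; decreasing ones are reduced to these through
  \<open>uminus\<close> in \<open>normalizer_in_P_set\<close>.\<close>

definition normalizes :: "(real \<Rightarrow> real) \<Rightarrow> bool" where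
  "normalizes h \<longleftrightarrow> strict_mono h \<and> bij h \<and> (\<forall>f\<in>Fc. h \<circ> f \<circ> finv h \<in> Fc) \<and> (\<forall>f\<in>Fc. finv h \<circ> f \<circ> h \<in> Fc)"

lemma normalizes_bij: "normalizes h \<Longrightarrow> bij h"
  by (simp add: normalizes_def)

lemma normalizes_mono: "normalizes h \<Longrightarrow> strict_mono h"
  by (simp add: normalizes_def)

lemma normalizes_conj: "normalizes h \<Longrightarrow> f \<in> Fc \<Longrightarrow> h \<circ> f \<circ> finv h \<in> Fc"
  by (simp add: normalizes_def)

lemma normalizes_less_iff: "normalizes h \<Longrightarrow> h x < h y \<longleftrightarrow> x < y"
  by (simp add: normalizes_def strict_mono_less)

lemma normalizes_le_iff: "normalizes h \<Longrightarrow> h x \<le> h y \<longleftrightarrow> x \<le> y"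
  by (simp add: normalizes_def strict_mono_less_eq)

lemma normalizes_inv: "normalizes h \<Longrightarrow> normalizes (finv h)"
  by (simp add: normalizes_def strict_mono_inv)

lemma normalizes_comp: assumes "normalizes h" "normalizes k" shows "normalizes (h \<circ> k)"
  unfolding normalizes_def
proof (intro conjI ballI)
  have b: "bij h" "bij k" using assms by (auto simp: normalizes_bij)
  show "strict_mono (h \<circ> k)" using assms by (simp add: normalizes_def strict_mono_def)
  show "bij (h \<circ> k)" using b by (simp add: bij_comp)
  fix f assume f: "f \<in> Fc"
  have "h \<circ> (k \<circ> f \<circ> finv k) \<circ> finv h \<in> Fc" using assms f by (intro normalizes_conj)
  then show "h \<circ> k \<circ> f \<circ> finv (h \<circ> k) \<in> Fc" using b by (simp add: finv_comp comp_assoc)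
  have "finv k \<circ> (finv h \<circ> f \<circ> h) \<circ> k \<in> Fc" using assms f by (auto simp: normalizes_def)
  then show "finv (h \<circ> k) \<circ> f \<circ> (h \<circ> k) \<in> Fc" using b by (simp add: finv_comp comp_assoc)
qed

lemma P_plus_nrm: assumes "p \<in> P_plus" shows "normalizes p"
proof -
  have p: "p \<in> P_set" "strict_mono p" using assms by (auto simp: P_plus_def)
  have "finv p \<circ> f \<circ> p \<in> Fc" if "f \<in> Fc" for f
    using Fc_conj[OF that P_set_inv[OF p(1)]] P_set_bij[OF p(1)] by simp
  then show ?thesis using p Fc_conj P_set_bij by (auto simp: normalizes_def)
qed

lemma strict_mono_bij_isCont:
  fixes h :: "real \<Rightarrow> real"
  assumes "strict_mono h" "bij h" shows "isCont h x"
proof -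
  have "continuous_on UNIV h"
    by (rule continuous_onI_mono) (use assms in \<open>auto simp: bij_is_surj strict_mono_less_eq\<close>)
  then show ?thesis by (simp add: continuous_on_eq_continuous_at)
qed

lemma normalizes_isCont: "normalizes h \<Longrightarrow> isCont h x"
  by (simp add: normalizes_def strict_mono_bij_isCont)

lemma normalizes_near:
  assumes "normalizes h" "e > 0"
  shows "\<exists>d>0. \<forall>u. \<bar>u\<bar> < d \<longrightarrow> \<bar>h (x + u) - h x\<bar> < e"
proof -
  obtain d where d: "d > 0" "\<And>x'. dist x' x < d \<Longrightarrow> dist (h x') (h x) < e"
    using normalizes_isCont[OF assms(1), of x] assms(2) unfolding continuous_at_eps_delta by blast
  have "\<bar>h (x + u) - h x\<bar> < e" if "\<bar>u\<bar> < d" for u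
    using d(2)[of "x + u"] that by (simp add: dist_real_def)
  then show ?thesis using d(1) by blast
qed

text \<open>Every dyadic number is the lower hull end of some element of \<open>Fc\<close>, such
  ends are always dyadic, and conjugation by \<open>h\<close> moves them by
  \<open>h\<close>.\<close>

lemma normalizes_dyadic: assumes h: "normalizes h" and x: "x \<in> dyadic" shows "h x \<in> dyadic"
proof -
  have bh: "bij h" using h by (rule normalizes_bij)
  obtain f where f: "f \<in> basic" "lo f = x" using basic_hull_exists[OF x, of "x + 1"] x by auto
  have fF: "f \<in> Fc" "f \<noteq> id" using f by (auto simp: basic_def)
  let ?g = "h \<circ> f \<circ> finv h"
  have less: "finv h t < y \<longleftrightarrow> t < h y" "y < finv h t \<longleftrightarrow> h y < t" for t y
    using normalizes_less_iff[OF h, of "finv h t" y] normalizes_less_iff[OF h, of y "finv h t"] bh by auto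
  obtain b where b: "b > x" "\<And>t. x < t \<Longrightarrow> t < b \<Longrightarrow> f t \<noteq> t" using lo_facts(3)[OF fF] f(2) by blast
  have "lo ?g = h x"
  proof (rule lo_unique[of _ _ "h b"])
    show "?g t = t" if "t \<le> h x" for t
    proof -
      have "finv h t \<le> x" using less(2)[of x t] that by linarith
      then show ?thesis using lo_facts(2)[OF fF] f(2) by (simp only: conj_fixed_iff[OF bh])
    qed
    show "h x < h b" using b(1) by (simp add: normalizes_less_iff[OF h])
    show "?g t \<noteq> t" if "h x < t" "t < h b" for t
      using b(2)[of "finv h t"] less that by (simp only: conj_fixed_iff[OF bh]) auto
  qed
  moreover have "?g \<noteq> id"
  proof
    assume "?g = id"
    then have "?g (h t) = h t" for t by simp
    then have "f t = t" for t using conj_fixed_iff[OF bh, of f "h t"] bh by simp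
    then show False using fF by auto
  qed
  ultimately show ?thesis using lo_facts(1)[OF normalizes_conj[OF h fF(1)]] by simp
qed

lemma normalizes_dyadic_iff: assumes h: "normalizes h" shows "h x \<in> dyadic \<longleftrightarrow> x \<in> dyadic"
  using normalizes_dyadic[OF h, of x] normalizes_dyadic[OF normalizes_inv[OF h], of "h x"] normalizes_bij[OF h] by auto

lemma has_slopes_cong:
  assumes hs: "has_slopes g z a b" and e: "e > 0" "\<And>x. \<bar>x - z\<bar> < e \<Longrightarrow> f x = g x"
  shows "has_slopes f z a b"
proof -
  obtain d where d: "d > 0" "\<And>u. 0 \<le> u \<Longrightarrow> u < d \<Longrightarrow> g (z + u) = g z + a * u"
    "\<And>u. 0 \<le> u \<Longrightarrow> u < d \<Longrightarrow> g (z - u) = g z - b * u"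
    using has_slopesE[OF hs] by blast
  show ?thesis unfolding has_slopes_def
    by (rule exI[of _ "min d e"]) (use d e in auto)
qed

text \<open>On bounded intervals elements of \<open>P_plus\<close> agree with elements of
  \<open>Fc\<close>, and slopes are a matter of germs. The result is applied to the translation by
  1, which is outside \<open>Fc\<close>.\<close>

lemma normalizes_conj_P_plus:
  assumes h: "normalizes h" and p: "p \<in> P_plus"
  shows "h \<circ> p \<circ> finv h \<in> P_plus"
proof -
  have bh: "bij h" using h by (rule normalizes_bij)
  have sl: "\<exists>a b. has_slopes (h \<circ> p \<circ> finv h) z a b \<and> \<bar>a\<bar> \<in> pow2 \<and> \<bar>b\<bar> \<in> pow2 \<and> (z \<notin> dyadic \<longrightarrow> a = b)" for z
  proof -
    let ?x = "finv h z"
    obtain a d where ad: "a \<in> dyadic" "a < ?x" "d \<in> dyadic" "?x < d"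
      using dyadic_dense[of "?x - 1" ?x] dyadic_dense[of ?x "?x + 1"] by auto
    then obtain g where g: "g \<in> Fc" "\<And>t. a \<le> t \<Longrightarrow> t \<le> d \<Longrightarrow> g t = p t"
      using Fc_extension[OF p ad(1,3)] by force
    obtain s t where st: "has_slopes (h \<circ> g \<circ> finv h) z s t" "s \<in> pow2" "t \<in> pow2" "z \<notin> dyadic \<longrightarrow> s = t"
      using P_plusE[OF Fc_P_plus[OF normalizes_conj[OF h g(1)]], of z] .
    obtain e where e: "e > 0" "\<And>u. \<bar>u\<bar> < e \<Longrightarrow> \<bar>finv h (z + u) - ?x\<bar> < min (?x - a) (d - ?x)"
      using normalizes_near[OF normalizes_inv[OF h], of "min (?x - a) (d - ?x)" z] ad by auto
    have "has_slopes (h \<circ> p \<circ> finv h) z s t"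
    proof (rule has_slopes_cong[OF st(1) e(1)])
      fix t assume "\<bar>t - z\<bar> < e"
      then show "(h \<circ> p \<circ> finv h) t = (h \<circ> g \<circ> finv h) t"
        using e(2)[of "t - z"] g(2)[of "finv h t"] by auto
    qed
    then show ?thesis using st(2-4) pow2_pos[OF st(2)] pow2_pos[OF st(3)]
      by (intro exI[of _ s] exI[of _ t]) simp
  qed
  have "strict_mono (h \<circ> p \<circ> finv h)"
    using normalizes_mono[OF h] normalizes_mono[OF normalizes_inv[OF h]] P_plus_strict_mono[OF p] by (simp add: strict_mono_def)
  moreover have "bij (h \<circ> p \<circ> finv h)"
    using bh P_set_bij[OF P_plus_P_set[OF p]] by (simp add: bij_comp)
  moreover have "(h \<circ> p \<circ> finv h) ` dyadic \<subseteq> dyadic"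
    using normalizes_dyadic[OF h] normalizes_dyadic[OF normalizes_inv[OF h]] P_set_dyadic[OF P_plus_P_set[OF p]] by auto
  moreover have "locally_PL_dyadic (h \<circ> p \<circ> finv h)" using sl by (auto simp: locally_PL_dyadic_def)
  ultimately show ?thesis by (simp add: P_plus_def P_setI)
qed

section \<open>Doubling germs and blow-ups\<close>

lemma local_affine_in_Fc:
  assumes c: "c \<in> pow2" and x: "x \<in> dyadic" and y: "y \<in> dyadic"
  shows "\<exists>f\<in>Fc. \<forall>u. \<bar>u\<bar> < 1 \<longrightarrow> f (x + u) = y + c * u"
proof -
  have "(\<lambda>t. y + c * (t - x)) \<in> P_plus" using assms by (intro affine_in_P_plus')
  then obtain g where g: "g \<in> Fc" "\<And>t. x - 1 \<le> t \<Longrightarrow> t \<le> x + 1 \<Longrightarrow> g t = y + c * (t - x)"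
    using Fc_extension[of _ "x - 1" "x + 1"] x by force
  have "g (x + u) = y + c * u" if "\<bar>u\<bar> < 1" for u
    using g(2)[of "x + u"] that by (simp add: abs_less_iff)
  then show ?thesis using g(1) by blast
qed

lemma pow2_between_1_4: assumes "c \<in> pow2" "1 < c" "c < 4" shows "c = 2"
proof (rule ccontr)
  assume "c \<noteq> 2"
  have "4 \<in> pow2" using pow2_power[of 2] by simp
  then show False using \<open>c \<noteq> 2\<close> pow2_less_imp_double[of 1 c] pow2_less_imp_double[of 2 c] pow2_less_imp_double[of c 2] assms
    by (cases "c < 2") auto
qed

text \<open>The conjugate by \<open>h\<close> of a map in \<open>Fc\<close> that doubles near
  \<open>x\<close> is affine on both sides of \<open>h x\<close>. Its slopes \<open>c\<close> and
  \<open>d\<close> exceed 1 because doubling is expanding.\<close>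

lemma normalizes_scaling:
  assumes h: "normalizes h" and x: "x \<in> dyadic"
  obtains c d e where "c \<in> pow2" "c > 1" "d \<in> pow2" "d > 1" "e > 0"
    "\<And>u. 0 \<le> u \<Longrightarrow> u < e \<Longrightarrow> h (x + 2 * u) - h x = c * (h (x + u) - h x)"
    "\<And>u. 0 \<le> u \<Longrightarrow> u < e \<Longrightarrow> h x - h (x - 2 * u) = d * (h x - h (x - u))"
proof -
  have bh: "bij h" using h by (rule normalizes_bij)
  obtain f where f: "f \<in> Fc" "\<And>u. \<bar>u\<bar> < 1 \<Longrightarrow> f (x + u) = x + 2 * u"
    using local_affine_in_Fc[of 2 x x] x by auto
  let ?g = "h \<circ> f \<circ> finv h"
  have g: "?g (h t) = h (f t)" for t using bh by simp
  have gy: "?g (h x) = h x" unfolding g using f(2)[of 0] by simp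
  obtain c d where cd: "has_slopes ?g (h x) c d" "c \<in> pow2" "d \<in> pow2"
    using P_plusE[OF Fc_P_plus[OF normalizes_conj[OF h f(1)]], of "h x"] by metis
  obtain e' where e': "e' > 0" "\<And>u. 0 \<le> u \<Longrightarrow> u < e' \<Longrightarrow> ?g (h x + u) = h x + c * u"
    "\<And>u. 0 \<le> u \<Longrightarrow> u < e' \<Longrightarrow> ?g (h x - u) = h x - d * u"
    using has_slopesE[OF cd(1)] gy by metis
  obtain e'' where e'': "e'' > 0" "\<And>u. \<bar>u\<bar> < e'' \<Longrightarrow> \<bar>h (x + u) - h x\<bar> < e'"
    using normalizes_near[OF h e'(1)] by blast
  define e where "e = min 1 e''"
  have R: "h (x + 2 * u) - h x = c * (h (x + u) - h x)" if u: "0 \<le> u" "u < e" for u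
  proof -
    have "h (x + 2 * u) = ?g (h (x + u))" unfolding g using f(2)[of u] u by (simp add: e_def)
    also have "\<dots> = ?g (h x + (h (x + u) - h x))" by simp
    also have "\<dots> = h x + c * (h (x + u) - h x)"
      by (rule e'(2)) (use e''(2)[of u] u normalizes_le_iff[OF h, of x "x + u"] in \<open>auto simp: e_def\<close>)
    finally show ?thesis by simp
  qed
  have L: "h x - h (x - 2 * u) = d * (h x - h (x - u))" if u: "0 \<le> u" "u < e" for u
  proof -
    have "h (x - 2 * u) = ?g (h (x - u))" unfolding g using f(2)[of "- u"] u by (simp add: e_def)
    also have "\<dots> = ?g (h x - (h x - h (x - u)))" by simp
    also have "\<dots> = h x - d * (h x - h (x - u))"
      by (rule e'(3)) (use e''(2)[of "- u"] u normalizes_le_iff[OF h, of "x - u" x] in \<open>auto simp: e_def\<close>)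
    finally show ?thesis by simp
  qed
  have e: "e > 0" using e'' by (simp add: e_def)
  have pos: "h (x + e / 2) - h x > 0" "h x - h (x - e / 2) > 0" using e by (auto simp: normalizes_less_iff[OF h])
  have "c * (h (x + e / 2) - h x) > 1 * (h (x + e / 2) - h x)"
    using R[of "e / 2"] e normalizes_less_iff[OF h, of "x + e / 2" "x + 2 * (e / 2)"] by simp
  then have "c > 1" using pos(1) by (simp only: mult_less_cancel_right_pos)
  moreover have "d * (h x - h (x - e / 2)) > 1 * (h x - h (x - e / 2))"
    using L[of "e / 2"] e normalizes_less_iff[OF h, of "x - 2 * (e / 2)" "x - e / 2"] by simp
  then have "d > 1" using pos(2) by (simp only: mult_less_cancel_right_pos)
  ultimately show thesis using that cd(2,3) e R L by blast
qed

text \<open>The conjugate of the germ \<open>u \<mapsto> 2 * u\<close> is the germ \<open>v \<mapsto> c * v\<close>, and conjugating back the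
  germ \<open>v \<mapsto> 2 * v\<close> gives some \<open>u \<mapsto> c' * u\<close>; as \<open>c' \<ge> 2\<close>, \<open>c \<ge> 4\<close> is impossible.\<close>

lemma normalizes_doubling:
  assumes h: "normalizes h" and x: "x \<in> dyadic"
  shows "\<exists>e>0. \<forall>u. \<bar>u\<bar> < e \<longrightarrow> h (x + 2 * u) - h x = 2 * (h (x + u) - h x)"
proof -
  have bh: "bij h" using h by (rule normalizes_bij)
  let ?k = "finv h" and ?y = "h x"
  note k = normalizes_inv[OF h]
  have k_less: "?k s \<le> ?k t \<longleftrightarrow> s \<le> t" for s t using normalizes_le_iff[OF k] .
  obtain c d e where e: "c \<in> pow2" "c > 1" "d \<in> pow2" "d > 1" "e > 0"
    and R: "\<And>u. 0 \<le> u \<Longrightarrow> u < e \<Longrightarrow> h (x + 2 * u) - h x = c * (h (x + u) - h x)"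
    and L: "\<And>u. 0 \<le> u \<Longrightarrow> u < e \<Longrightarrow> h x - h (x - 2 * u) = d * (h x - h (x - u))"
    using normalizes_scaling[OF h x] by blast
  obtain c' d' e' where e': "c' \<in> pow2" "c' > 1" "d' \<in> pow2" "d' > 1" "e' > 0"
    and R': "\<And>u. 0 \<le> u \<Longrightarrow> u < e' \<Longrightarrow> ?k (?y + 2 * u) - ?k ?y = c' * (?k (?y + u) - ?k ?y)"
    and L': "\<And>u. 0 \<le> u \<Longrightarrow> u < e' \<Longrightarrow> ?k ?y - ?k (?y - 2 * u) = d' * (?k ?y - ?k (?y - u))"
    using normalizes_scaling[OF k normalizes_dyadic[OF h x]] by blast
  have ky: "?k ?y = x" using bh by simp
  have c2: "c' \<ge> 2" "d' \<ge> 2" using pow2_less_imp_double[of 1 c'] pow2_less_imp_double[of 1 d'] e' by auto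
  obtain \<delta> where \<delta>: "\<delta> > 0" "\<And>u. \<bar>u\<bar> < \<delta> \<Longrightarrow> \<bar>h (x + u) - h x\<bar> < e' / 2"
    using normalizes_near[OF h, of "e' / 2" x] e'(5) by auto
  define u where "u = min (e / 2) (\<delta> / 2)"
  have u: "u > 0" "u < e" "u < \<delta>" using e(5) \<delta>(1) by (auto simp: u_def)
  have "c < 4"
  proof (rule ccontr)
    assume "\<not> c < 4"
    define v where "v = h (x + u) - h x"
    have v: "v > 0" "v < e' / 2" using normalizes_less_iff[OF h, of x "x + u"] u \<delta>(2)[of u] by (auto simp: v_def)
    have kv: "?k (?y + v) = x + u" using bh by (simp add: v_def)
    have "?y + c * v = h (x + 2 * u)" using R[of u] u by (simp add: v_def)
    then have "?k (?y + c * v) = x + 2 * u" using bh by simp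
    moreover have "?k (?y + 2 * (2 * v)) - x = c' * (c' * u)"
      using R'[of "2 * v"] R'[of v] v e'(5) ky kv by simp
    moreover have "2 * (2 * v) \<le> c * v" using \<open>\<not> c < 4\<close> v by simp
    then have "?k (?y + 2 * (2 * v)) \<le> ?k (?y + c * v)" by (simp add: k_less)
    \<comment> \<open>If \<open>c \<ge> 4\<close>, then \<open>4 * u \<le> c' * (c' * u) = ?k (?y +
      4 * v) - x \<le> ?k (?y + c * v) - x = 2 * u\<close>.\<close>
    moreover have "c' * (c' * u) \<ge> 2 * (2 * u)"
      using c2 u by (intro mult_mono) auto
    ultimately show False using u by linarith
  qed
  moreover have "d < 4"
  proof (rule ccontr)
    assume "\<not> d < 4"
    define v where "v = h x - h (x - u)"
    have v: "v > 0" "v < e' / 2" using normalizes_less_iff[OF h, of "x - u" x] u \<delta>(2)[of "- u"] by (auto simp: v_def)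
    have kv: "?k (?y - v) = x - u" using bh by (simp add: v_def)
    have "?y - d * v = h (x - 2 * u)" using L[of u] u by (simp add: v_def)
    then have "?k (?y - d * v) = x - 2 * u" using bh by simp
    moreover have "x - ?k (?y - 2 * (2 * v)) = d' * (d' * u)"
      using L'[of "2 * v"] L'[of v] v e'(5) ky kv by simp
    moreover have "2 * (2 * v) \<le> d * v" using \<open>\<not> d < 4\<close> v by simp
    then have "?k (?y - d * v) \<le> ?k (?y - 2 * (2 * v))" by (simp add: k_less)
    moreover have "d' * (d' * u) \<ge> 2 * (2 * u)"
      using c2 u by (intro mult_mono) auto
    ultimately show False using u by linarith
  qed
  ultimately have cd: "c = 2" "d = 2" using pow2_between_1_4 e by blast+
  have "h (x + 2 * u) - h x = 2 * (h (x + u) - h x)" if "\<bar>u\<bar> < e" for u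
    using R[of u] L[of "- u"] cd that by (cases "u \<ge> 0") auto
  then show ?thesis using e(5) by blast
qed

text \<open>The blow-up of \<open>h\<close> at 0. For an \<open>h\<close> commuting with doubling
  near 0 the limit of the rescaled maps is attained at a finite stage on each bounded set, and this
  is what the definition records.\<close>

definition blowup_of :: "(real \<Rightarrow> real) \<Rightarrow> (real \<Rightarrow> real) \<Rightarrow> bool" where
  "blowup_of h \<phi> \<longleftrightarrow> (\<forall>R. \<exists>n::nat. \<forall>x. \<bar>x\<bar> \<le> R \<longrightarrow> \<phi> x = 2 ^ n * h (x / 2 ^ n))"

text \<open>On the support of \<open>f\<close> the blow-up is \<open>h\<close> conjugated by a
  scaling \<open>s\<close>, and scalings by powers of two lie in \<open>P_set\<close>. At the
  remaining points both conjugates are the identity.\<close>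

lemma blowup_conj_Fc:
  assumes b: "bij h" "bij \<phi>" and E: "blowup_of h \<phi>" and h: "\<And>f. f \<in> Fc \<Longrightarrow> h \<circ> f \<circ> finv h \<in> Fc"
    and f: "f \<in> Fc"
  shows "\<phi> \<circ> f \<circ> finv \<phi> \<in> Fc"
proof -
  obtain M where M: "\<And>t. \<bar>t\<bar> > M \<Longrightarrow> f t = t" using f by (auto simp: Fc_def)
  obtain n where n: "\<And>x. \<bar>x\<bar> \<le> M \<Longrightarrow> \<phi> x = 2 ^ n * h (x / 2 ^ n)"
    using E unfolding blowup_of_def by blast
  define s :: "real \<Rightarrow> real" where "s = (\<lambda>x. 2 ^ n * x)"
  define s' :: "real \<Rightarrow> real" where "s' = (\<lambda>x. x / 2 ^ n)"
  have ss: "s (s' x) = x" "s' (s x) = x" for x by (auto simp: s_def s'_def)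
  have bs: "bij s" "bij s'" using ss by (auto intro!: o_bij[of s' s] o_bij[of s s'])
  have fs: "finv s = s'" "finv s' = s" using ss by (auto intro!: inv_equality)
  have sP: "s \<in> P_set" using affine_in_P_plus[of "2 ^ n" 0] by (simp add: s_def P_plus_P_set)
  then have s'P: "s' \<in> P_set" using P_set_inv fs by metis
  have "s' \<circ> f \<circ> s \<in> Fc" using Fc_conj[OF f s'P] fs by simp
  then have "s \<circ> (h \<circ> (s' \<circ> f \<circ> s) \<circ> finv h) \<circ> finv s \<in> Fc" using Fc_conj[OF h sP] by blast
  moreover have "s \<circ> (h \<circ> (s' \<circ> f \<circ> s) \<circ> finv h) \<circ> finv s = \<phi> \<circ> f \<circ> finv \<phi>"
  proof
    fix y
    define x where "x = finv \<phi> y"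
    have y: "y = \<phi> x" using b by (simp add: x_def)
    have bnd: "\<bar>f t\<bar> \<le> M" if "\<bar>t\<bar> \<le> M" for t
    proof (rule ccontr)
      assume "\<not> \<bar>f t\<bar> \<le> M"
      then have "f (f t) = f t" using M by simp
      then have "f t = t" using Fc_eq_iff[OF f] by simp
      then show False using that \<open>\<not> \<bar>f t\<bar> \<le> M\<close> by simp
    qed
    have n': "\<phi> t = s (h (s' t))" if "\<bar>t\<bar> \<le> M" for t using n[OF that] by (simp add: s_def s'_def)
    define w where "w = finv h (s' y)"
    have hw: "h w = s' y" using b by (simp add: w_def)
    have "s (h (s' (f (s w)))) = \<phi> (f x)"
    proof (cases "\<bar>s w\<bar> \<le> M")
      case True
      have "\<phi> (s w) = s (h (s' (s w)))" using n'[OF True] .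
      also have "\<dots> = \<phi> x" by (simp add: ss hw y)
      finally have "s w = x" using b(2) by (metis finv_left)
      then show ?thesis using n'[OF bnd[OF True]] by simp
    next
      case False
      have "\<not> \<bar>x\<bar> \<le> M"
      proof
        assume x: "\<bar>x\<bar> \<le> M"
        then have "y = s (h (s' x))" using n' y by simp
        then have "h w = h (s' x)" using hw by (simp add: ss)
        then have "w = s' x" using b(1) by (metis finv_left)
        then show False using False x by (simp add: ss)
      qed
      then have "f x = x" "f (s w) = s w" using M False by auto
      then show ?thesis by (simp add: ss hw y)
    qed
    then show "(s \<circ> (h \<circ> (s' \<circ> f \<circ> s) \<circ> finv h) \<circ> finv s) y = (\<phi> \<circ> f \<circ> finv \<phi>) y"
      by (simp add: fs w_def x_def)
  qed
  ultimately show ?thesis by simp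
qed

lemma blowup_inv:
  assumes b: "bij h" "bij \<phi>" and mono: "strict_mono \<phi>" and E: "blowup_of h \<phi>"
  shows "blowup_of (finv h) (finv \<phi>)"
  unfolding blowup_of_def
proof
  fix R
  obtain n where n: "\<And>x. \<bar>x\<bar> \<le> \<bar>finv \<phi> R\<bar> + \<bar>finv \<phi> (- R)\<bar> \<Longrightarrow> \<phi> x = 2 ^ n * h (x / 2 ^ n)"
    using E unfolding blowup_of_def by blast
  have "finv \<phi> y = 2 ^ n * finv h (y / 2 ^ n)" if y: "\<bar>y\<bar> \<le> R" for y
  proof -
    have "- R \<le> y" "y \<le> R" using y by auto
    then have "finv \<phi> (- R) \<le> finv \<phi> y" "finv \<phi> y \<le> finv \<phi> R"
      using strict_mono_inv[OF mono b(2)] by (simp_all add: strict_mono_less_eq)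
    then have "y = 2 ^ n * h (finv \<phi> y / 2 ^ n)" using n[of "finv \<phi> y"] b by simp
    then have "y / 2 ^ n = h (finv \<phi> y / 2 ^ n)" by (simp add: field_simps)
    then show ?thesis using b by simp
  qed
  then show "\<exists>n. \<forall>x. \<bar>x\<bar> \<le> R \<longrightarrow> finv \<phi> x = 2 ^ n * finv h (x / 2 ^ n)" by blast
qed

lemma blowup_exists:
  assumes h: "normalizes h" and h0: "h 0 = 0"
  obtains \<phi> where "normalizes \<phi>" "\<And>x. \<phi> (2 * x) = 2 * \<phi> x" "blowup_of h \<phi>"
proof -
  have bh: "bij h" using h by (rule normalizes_bij)
  obtain e where e: "e > 0" "\<And>u. \<bar>u\<bar> < e \<Longrightarrow> h (2 * u) = 2 * h u"
    using normalizes_doubling[OF h dyadic_0] h0 by auto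
  \<comment> \<open>Once \<open>x\<close> is below \<open>e * 2 ^ n\<close> in absolute value,
    increasing \<open>n\<close> no longer changes the rescaled value; the choice of \<open>n\<close>
    in the definition of \<open>\<phi>\<close> is therefore harmless.\<close>
  have step: "2 ^ (m + n) * h (x / 2 ^ (m + n)) = 2 ^ n * h (x / 2 ^ n)" if x: "\<bar>x\<bar> < e * 2 ^ n" for x m n
  proof (induct m)
    case (Suc m)
    have "\<bar>x\<bar> < e * 2 ^ (Suc m + n)"
    proof -
      have "e * 2 ^ n \<le> e * 2 ^ (Suc m + n)" using e(1) by (intro mult_left_mono power_increasing) auto
      then show ?thesis using x by linarith
    qed
    then have "\<bar>x / 2 ^ (Suc m + n)\<bar> < e" by (simp add: field_simps)
    then have "h (2 * (x / 2 ^ (Suc m + n))) = 2 * h (x / 2 ^ (Suc m + n))" by (rule e(2))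
    then show ?case using Suc by simp
  qed simp
  define \<phi> where "\<phi> x = (let n = (SOME n. \<bar>x\<bar> < e * 2 ^ n) in 2 ^ n * h (x / 2 ^ n))" for x
  have ex: "\<exists>n::nat. \<bar>x\<bar> < e * 2 ^ n" for x
  proof -
    obtain n :: nat where "\<bar>x\<bar> / e < 2 ^ n" using real_arch_pow[of 2 "\<bar>x\<bar> / e"] by auto
    then show ?thesis using e(1) by (auto simp: field_simps)
  qed
  have \<phi>: "\<phi> x = 2 ^ n * h (x / 2 ^ n)" if x: "\<bar>x\<bar> < e * 2 ^ n" for x n
  proof -
    define m where "m = (SOME n. \<bar>x\<bar> < e * 2 ^ n)"
    have m: "\<bar>x\<bar> < e * 2 ^ m" unfolding m_def using ex by (rule someI_ex)
    have "2 ^ (m + n) * h (x / 2 ^ (m + n)) = 2 ^ (n + m) * h (x / 2 ^ (n + m))" by (simp add: add.commute)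
    then have "2 ^ n * h (x / 2 ^ n) = 2 ^ m * h (x / 2 ^ m)" using step[OF x, of m] step[OF m, of n] by simp
    then show ?thesis by (simp add: \<phi>_def m_def Let_def)
  qed
  have E: "blowup_of h \<phi>" unfolding blowup_of_def
  proof
    fix R
    obtain n where n: "\<bar>R\<bar> < e * 2 ^ n" using ex by blast
    then show "\<exists>n. \<forall>x. \<bar>x\<bar> \<le> R \<longrightarrow> \<phi> x = 2 ^ n * h (x / 2 ^ n)"
      by (intro exI[of _ n] allI impI \<phi>) linarith
  qed
  have mono: "strict_mono \<phi>"
  proof (rule strict_monoI)
    fix x y :: real assume xy: "x < y"
    obtain n where n: "\<And>t. \<bar>t\<bar> \<le> \<bar>x\<bar> + \<bar>y\<bar> \<Longrightarrow> \<phi> t = 2 ^ n * h (t / 2 ^ n)"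
      using E unfolding blowup_of_def by blast
    show "\<phi> x < \<phi> y" using xy by (simp add: n normalizes_less_iff[OF h] divide_strict_right_mono)
  qed
  have "\<exists>x. \<phi> x = y" for y
  proof -
    have k0: "finv h 0 = 0" using finv_left[OF bh, of 0] h0 by simp
    obtain d where d: "d > 0" "\<And>u. \<bar>u\<bar> < d \<Longrightarrow> \<bar>finv h u\<bar> < e"
      using normalizes_near[OF normalizes_inv[OF h] e(1), of 0] k0 by auto
    obtain n :: nat where "\<bar>y\<bar> / d < 2 ^ n" using real_arch_pow[of 2 "\<bar>y\<bar> / d"] by auto
    then have "\<bar>y / 2 ^ n\<bar> < d" using d(1) by (simp add: field_simps)
    then have "\<bar>2 ^ n * finv h (y / 2 ^ n)\<bar> < e * 2 ^ n" using d(2) by (simp add: abs_mult)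
    then have "\<phi> (2 ^ n * finv h (y / 2 ^ n)) = y" using \<phi> bh by simp
    then show ?thesis ..
  qed
  then have "surj \<phi>" by (metis surj_def)
  then have bij: "bij \<phi>" using mono by (simp add: bij_def strict_mono_imp_inj_on)
  have dbl: "\<phi> (2 * x) = 2 * \<phi> x" for x
  proof -
    obtain n where n: "\<bar>x\<bar> < e * 2 ^ n" using ex by blast
    have "\<phi> (2 * x) = 2 ^ Suc n * h (2 * x / 2 ^ Suc n)" using n by (intro \<phi>) auto
    then show ?thesis using \<phi>[OF n] by simp
  qed
  have "normalizes \<phi>" unfolding normalizes_def
  proof (intro conjI ballI mono bij)
    fix f assume f: "f \<in> Fc"
    show "\<phi> \<circ> f \<circ> finv \<phi> \<in> Fc" using blowup_conj_Fc[OF bh bij E normalizes_conj[OF h] f] .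
    have "finv \<phi> \<circ> f \<circ> finv (finv \<phi>) \<in> Fc"
      using blowup_conj_Fc[OF _ _ blowup_inv[OF bh bij mono E] normalizes_conj[OF normalizes_inv[OF h]] f] bh bij by simp
    then show "finv \<phi> \<circ> f \<circ> \<phi> \<in> Fc" using bij by simp
  qed
  then show thesis using that dbl E by blast
qed

section \<open>Dyadic grids and 2-adic levels\<close>

abbreviation tp :: "int \<Rightarrow> real" where
  "tp n \<equiv> 2 powi n"

lemma tp_pos [simp]: "tp n > 0" by simp

lemma tp_add: "tp (m + n) = tp m * tp n"
  by (simp add: power_int_add)

lemma tp_minus: "tp (- n) = 1 / tp n"
  by (simp add: power_int_minus_divide)

lemma tp_minus_cancel [simp]: "tp (- n) * (tp n * x) = x" "tp n * (tp (- n) * x) = x"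
  by (simp_all add: tp_minus)

text \<open>The integral multiples of \<open>tp (- n)\<close>, for \<open>n\<close> of either sign;
  \<open>grid (- 1)\<close> consists of the even integers.\<close>

definition grid :: "int \<Rightarrow> real set" where
  "grid n = {x. tp n * x \<in> \<int>}"

lemma grid_zero: "x \<in> grid 0 \<longleftrightarrow> x \<in> \<int>"
  by (simp add: grid_def)

lemma zero_in_grid [simp]: "0 \<in> grid n"
  by (simp add: grid_def)

lemma grid_add: "x \<in> grid n \<Longrightarrow> y \<in> grid n \<Longrightarrow> x + y \<in> grid n"
  by (simp add: grid_def distrib_left)

lemma grid_diff: "x \<in> grid n \<Longrightarrow> y \<in> grid n \<Longrightarrow> x - y \<in> grid n"
  by (simp add: grid_def right_diff_distrib)

lemma grid_add_iff: "y \<in> grid n \<Longrightarrow> x + y \<in> grid n \<longleftrightarrow> x \<in> grid n"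
  using grid_add[of x n y] grid_diff[of "x + y" n y] by auto

lemma grid_scale: "tp k * x \<in> grid n \<longleftrightarrow> x \<in> grid (n + k)"
  by (simp add: grid_def tp_add mult.assoc)

lemma grid_mono: assumes "m \<le> n" "x \<in> grid m" shows "x \<in> grid n"
proof -
  have "tp n = tp (n - m) * tp m" using tp_add[of "n - m" m] by simp
  also have "tp (n - m) = of_int (2 ^ nat (n - m))" using assms(1) by (simp add: power_int_def)
  finally have "tp n * x = of_int (2 ^ nat (n - m)) * (tp m * x)" by simp
  also have "\<dots> \<in> \<int>" by (rule Ints_mult[OF Ints_of_int]) (use assms(2) in \<open>simp add: grid_def\<close>)
  finally show ?thesis by (simp add: grid_def)
qed

lemma grid_pred: assumes "tp n * x = of_int i" shows "x \<in> grid (n - 1) \<longleftrightarrow> even i"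
proof -
  have "tp (n - 1) * x = of_int i / 2"
    using assms tp_add[of "n - 1" 1] by (simp add: field_simps)
  moreover have "of_int i / 2 \<in> (\<int> :: real set) \<longleftrightarrow> even i"
  proof
    assume "of_int i / 2 \<in> (\<int> :: real set)"
    then obtain j where "of_int i / 2 = (of_int j :: real)" by (auto elim: Ints_cases)
    then have "(of_int i :: real) = of_int (2 * j)" by simp
    then have "i = 2 * j" by (simp only: of_int_eq_iff)
    then show "even i" by simp
  qed auto
  ultimately show ?thesis unfolding grid_def by (simp only: mem_Collect_eq)
qed

lemma grid_odd:
  assumes "x \<in> grid n" "x \<notin> grid (n - 1)" "y \<in> grid n" "y \<notin> grid (n - 1)"
  shows "x + y \<in> grid (n - 1)" "x - y \<in> grid (n - 1)"
proof -
  obtain i j where ij: "tp n * x = of_int i" "tp n * y = of_int j"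
    using assms(1,3) by (auto simp: grid_def elim!: Ints_cases)
  have "odd i" "odd j" using grid_pred[OF ij(1)] grid_pred[OF ij(2)] assms by auto
  moreover have "tp n * (x + y) = of_int (i + j)" "tp n * (x - y) = of_int (i - j)"
    using ij by (simp_all add: algebra_simps)
  ultimately show "x + y \<in> grid (n - 1)" "x - y \<in> grid (n - 1)"
    using grid_pred[of n "x + y" "i + j"] grid_pred[of n "x - y" "i - j"] by simp_all
qed

lemma grid_gap: assumes "x \<in> grid n" "x \<noteq> 0" shows "tp (- n) \<le> \<bar>x\<bar>"
proof -
  obtain i where i: "tp n * x = of_int i" using assms(1) by (auto simp: grid_def elim: Ints_cases)
  have "i \<noteq> 0" using i assms(2) by auto
  then have "1 \<le> \<bar>tp n * x\<bar>" unfolding i by simp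
  then show ?thesis by (simp add: abs_mult tp_minus field_simps)
qed

lemma dyadic_grid: "x \<in> dyadic \<longleftrightarrow> (\<exists>n. x \<in> grid n)"
proof
  assume "x \<in> dyadic"
  then obtain n :: nat where "2 ^ n * x \<in> \<int>" by (auto simp: dyadic_iff)
  then have "x \<in> grid (int n)" by (simp add: grid_def)
  then show "\<exists>n. x \<in> grid n" ..
next
  assume "\<exists>n. x \<in> grid n"
  then obtain n where "x \<in> grid n" ..
  then have "x \<in> grid (int (nat n))" by (rule grid_mono[rotated]) simp
  then have "2 ^ nat n * x \<in> \<int>" unfolding grid_def by (simp only: mem_Collect_eq power_int_of_nat)
  then show "x \<in> dyadic" unfolding dyadic_iff by blast
qed

text \<open>Minus the 2-adic valuation, so the exponent of the denominator; meaningful for non-zero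
  dyadic arguments only.\<close>

definition level :: "real \<Rightarrow> int" where
  "level x = (THE n. x \<in> grid n \<and> x \<notin> grid (n - 1))"

lemma levelI: assumes "x \<in> grid n" "x \<notin> grid (n - 1)" shows "level x = n"
  unfolding level_def
proof (rule the_equality)
  show "x \<in> grid n \<and> x \<notin> grid (n - 1)" using assms by simp
  fix m assume m: "x \<in> grid m \<and> x \<notin> grid (m - 1)"
  show "m = n"
    using grid_mono[of m "n - 1" x] grid_mono[of n "m - 1" x] assms m by (cases m n rule: linorder_cases) auto
qed

text \<open>Some grid contains \<open>x\<close>, and sufficiently coarse ones do not, since their
  non-zero elements exceed \<open>x\<close> in absolute value. The level is the index at which
  membership starts.\<close>

lemma level: assumes "x \<in> dyadic" "x \<noteq> 0" shows "x \<in> grid (level x)" "x \<notin> grid (level x - 1)"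
proof -
  obtain n where n: "x \<in> grid n" using assms by (auto simp: dyadic_grid)
  obtain m :: nat where m: "1 / 2 ^ m < 1 / \<bar>x\<bar>" using pow2_small[of "1 / \<bar>x\<bar>"] assms(2) by auto
  have low: "x \<notin> grid (- int m)"
  proof
    assume "x \<in> grid (- int m)"
    then have "2 ^ m \<le> \<bar>x\<bar>" using grid_gap[of x "- int m"] assms(2) by simp
    then show False using m assms(2) by (simp add: field_simps)
  qed
  have "\<exists>k. x \<in> grid k \<and> x \<notin> grid (k - 1)"
  proof (rule ccontr)
    assume no: "\<not> ?thesis"
    have "x \<in> grid (n - int j)" for j
      by (induct j) (use n no in \<open>auto simp: algebra_simps\<close>)
    then have "x \<in> grid (n - int (m + nat n))" .
    then show False using low grid_mono[of "n - int (m + nat n)" "- int m" x] by auto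
  qed
  then obtain k where "x \<in> grid k" "x \<notin> grid (k - 1)" by blast
  moreover from this have "level x = k" by (rule levelI)
  ultimately show "x \<in> grid (level x)" "x \<notin> grid (level x - 1)" by auto
qed

lemma grid_iff_level: assumes "x \<in> dyadic" "x \<noteq> 0" shows "x \<in> grid n \<longleftrightarrow> level x \<le> n"
  using level[OF assms] grid_mono[of "level x" n x] grid_mono[of n "level x - 1" x] by (cases "level x \<le> n") auto

lemma level_scale: assumes "x \<in> dyadic" "x \<noteq> 0" shows "level (tp k * x) = level x - k"
  by (rule levelI) (use level[OF assms] in \<open>auto simp: grid_scale\<close>)

text \<open>The ultrametric principle: the summand with the strictly larger denominator
  decides.\<close>

lemma level_add: assumes "x \<in> dyadic" "x \<noteq> 0" "y \<in> grid (level x - 1)" shows "level (x + y) = level x"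
  using level[OF assms(1,2)] assms(3) grid_mono[of "level x - 1" "level x" y]
  by (intro levelI) (auto simp: grid_add_iff)

text \<open>Germs of \<open>\<phi>\<close> compared up to rescaling of source and target by powers
  of two. For maps commuting with doubling this identifies the germs at \<open>x\<close> and
  \<open>2 * x\<close>, so that scalings and integer shifts can be combined.\<close>

definition germ_rel :: "(real \<Rightarrow> real) \<Rightarrow> real \<Rightarrow> real \<Rightarrow> bool" where
  "germ_rel \<phi> x x' \<longleftrightarrow> (\<exists>c\<in>pow2. \<exists>d\<in>pow2. \<exists>e>0. \<forall>u. \<bar>u\<bar> < e \<longrightarrow>
     \<phi> (x' + c * u) - \<phi> x' = d * (\<phi> (x + u) - \<phi> x))"

lemma germ_relI:
  assumes "c \<in> pow2" "d \<in> pow2" "e > 0" "\<And>u. \<bar>u\<bar> < e \<Longrightarrow> \<phi> (x' + c * u) - \<phi> x' = d * (\<phi> (x + u) - \<phi> x)"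
  shows "germ_rel \<phi> x x'"
  using assms unfolding germ_rel_def by blast

lemma germ_relE:
  assumes "germ_rel \<phi> x x'"
  obtains c d e where "c \<in> pow2" "d \<in> pow2" "e > 0"
    "\<And>u. \<bar>u\<bar> < e \<Longrightarrow> \<phi> (x' + c * u) - \<phi> x' = d * (\<phi> (x + u) - \<phi> x)"
  using assms unfolding germ_rel_def by blast

lemma germ_rel_refl: "germ_rel \<phi> x x"
  by (rule germ_relI[of 1 1 1]) auto

lemma germ_rel_sym: assumes "germ_rel \<phi> x x'" shows "germ_rel \<phi> x' x"
proof -
  obtain c d e where e: "c \<in> pow2" "d \<in> pow2" "e > 0"
    "\<And>u. \<bar>u\<bar> < e \<Longrightarrow> \<phi> (x' + c * u) - \<phi> x' = d * (\<phi> (x + u) - \<phi> x)"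
    using germ_relE[OF assms] by blast
  note pos = pow2_pos[OF e(1)] pow2_pos[OF e(2)]
  show ?thesis
  proof (rule germ_relI[of "1 / c" "1 / d" "c * e"])
    fix u assume "\<bar>u\<bar> < c * e"
    then have "\<bar>u / c\<bar> < e" using pos by (simp add: field_simps)
    then have "\<phi> (x' + c * (u / c)) - \<phi> x' = d * (\<phi> (x + u / c) - \<phi> x)" by (rule e(4))
    then show "\<phi> (x + 1 / c * u) - \<phi> x = 1 / d * (\<phi> (x' + u) - \<phi> x')" using pos by simp
  qed (use e pos in auto)
qed

lemma germ_rel_trans: assumes "germ_rel \<phi> x y" "germ_rel \<phi> y z" shows "germ_rel \<phi> x z"
proof -
  obtain c d e where e: "c \<in> pow2" "d \<in> pow2" "e > 0"
    "\<And>u. \<bar>u\<bar> < e \<Longrightarrow> \<phi> (y + c * u) - \<phi> y = d * (\<phi> (x + u) - \<phi> x)"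
    using germ_relE[OF assms(1)] by blast
  obtain c' d' e' where e': "c' \<in> pow2" "d' \<in> pow2" "e' > 0"
    "\<And>u. \<bar>u\<bar> < e' \<Longrightarrow> \<phi> (z + c' * u) - \<phi> z = d' * (\<phi> (y + u) - \<phi> y)"
    using germ_relE[OF assms(2)] by blast
  note pos = pow2_pos[OF e(1)]
  show ?thesis
  proof (rule germ_relI[of "c' * c" "d' * d" "min e (e' / c)"])
    fix u assume u: "\<bar>u\<bar> < min e (e' / c)"
    then have "\<bar>c * u\<bar> < e'" using pos by (simp add: field_simps abs_mult)
    then show "\<phi> (z + c' * c * u) - \<phi> z = d' * d * (\<phi> (x + u) - \<phi> x)"
      using e'(4)[of "c * u"] e(4)[of u] u by (simp add: mult.assoc)
  qed (use e e' pos in auto)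
qed

section \<open>Normalizing maps that commute with doubling\<close>

locale dilation =
  fixes \<phi> :: "real \<Rightarrow> real"
  assumes normalizes: "normalizes \<phi>" and dbl: "\<phi> (2 * x) = 2 * \<phi> x"
begin

abbreviation \<psi> :: "real \<Rightarrow> real" where "\<psi> \<equiv> finv \<phi>"

lemma bij: "bij \<phi>"
  using normalizes by (rule normalizes_bij)

lemma zero [simp]: "\<phi> 0 = 0"
  using dbl[of 0] by simp

lemma scale: assumes "c \<in> pow2" shows "\<phi> (c * x) = c * \<phi> x"
proof -
  have n: "\<phi> (2 ^ n * x) = 2 ^ n * \<phi> x" for n :: nat and x
    by (induct n) (use dbl in \<open>auto simp: mult.assoc\<close>)
  obtain k where c: "c = tp k" using assms by (auto simp: pow2_def)
  show ?thesis
  proof (cases "k \<ge> 0")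
    case True
    then show ?thesis using n[of "nat k" x] by (simp add: c power_int_def)
  next
    case False
    then show ?thesis using n[of "nat (- k)" "c * x"] by (simp add: c power_int_def field_simps)
  qed
qed

lemma inverse_dilation: "dilation \<psi>"
proof
  show "normalizes \<psi>" using normalizes by (rule normalizes_inv)
  fix x
  have "\<phi> (2 * \<psi> x) = 2 * x" using dbl[of "\<psi> x"] bij by simp
  then have "\<psi> (\<phi> (2 * \<psi> x)) = \<psi> (2 * x)" by simp
  then show "\<psi> (2 * x) = 2 * \<psi> x" using bij by simp
qed

lemma pos_iff: "\<phi> x > 0 \<longleftrightarrow> x > 0"
  using normalizes_less_iff[OF normalizes, of 0 x] by simp

lemma germ_rel_scale: assumes "c \<in> pow2" shows "germ_rel \<phi> x (c * x)"
  by (rule germ_relI[of c c 1]) (use assms in \<open>auto simp: scale distrib_left[symmetric] right_diff_distrib[symmetric]\<close>)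

lemma germ_rel_scale_iff: assumes "c \<in> pow2" shows "germ_rel \<phi> (c * x) (c * y) \<longleftrightarrow> germ_rel \<phi> x y"
  using germ_rel_scale[OF assms] germ_rel_sym germ_rel_trans by metis

lemma germ_law: assumes "c \<in> pow2" and x: "x \<in> dyadic"
  shows "\<exists>e>0. \<forall>u. \<bar>u\<bar> < e \<longrightarrow> \<phi> (x + c * u) - \<phi> x = c * (\<phi> (x + u) - \<phi> x)"
proof -
  obtain e where e: "e > 0" "\<And>u. \<bar>u\<bar> < e \<Longrightarrow> \<phi> (x + 2 * u) - \<phi> x = 2 * (\<phi> (x + u) - \<phi> x)"
    using normalizes_doubling[OF normalizes x] by blast
  have n: "\<exists>e>0. \<forall>u. \<bar>u\<bar> < e \<longrightarrow> \<phi> (x + 2 ^ n * u) - \<phi> x = 2 ^ n * (\<phi> (x + u) - \<phi> x)" for n :: nat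
  proof (induct n)
    case 0
    then show ?case by (intro exI[of _ 1]) auto
  next
    case (Suc n)
    then obtain e' where e': "e' > 0" "\<And>u. \<bar>u\<bar> < e' \<Longrightarrow> \<phi> (x + 2 ^ n * u) - \<phi> x = 2 ^ n * (\<phi> (x + u) - \<phi> x)"
      by blast
    show ?case
    proof (intro exI[of _ "min e' (e / 2 ^ n)"] conjI allI impI)
      fix u assume u: "\<bar>u\<bar> < min e' (e / 2 ^ n)"
      then have "\<bar>2 ^ n * u\<bar> < e" by (simp add: field_simps abs_mult)
      then show "\<phi> (x + 2 ^ Suc n * u) - \<phi> x = 2 ^ Suc n * (\<phi> (x + u) - \<phi> x)"
        using e(2)[of "2 ^ n * u"] e'(2)[of u] u by (simp add: mult.assoc)
    qed (use e e' in auto)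
  qed
  obtain k where c: "c = tp k" using assms by (auto simp: pow2_def)
  show ?thesis
  proof (cases "k \<ge> 0")
    case True
    then show ?thesis using n[of "nat k"] by (simp add: c power_int_def)
  next
    case False
    define a :: real where "a = 2 ^ nat (- k)"
    have a: "a > 0" "c = 1 / a" using False by (auto simp: a_def c power_int_def field_simps)
    obtain e where e: "e > 0" "\<And>u. \<bar>u\<bar> < e \<Longrightarrow> \<phi> (x + a * u) - \<phi> x = a * (\<phi> (x + u) - \<phi> x)"
      using n[of "nat (- k)"] by (auto simp: a_def)
    show ?thesis
    proof (intro exI[of _ "a * e"] conjI allI impI)
      fix u assume "\<bar>u\<bar> < a * e"
      then have "\<bar>u / a\<bar> < e" using a by (simp add: field_simps)
      then show "\<phi> (x + c * u) - \<phi> x = c * (\<phi> (x + u) - \<phi> x)" using e(2)[of "u / a"] a by simp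
    qed (use e a in auto)
  qed
qed

definition A :: "real \<Rightarrow> real" where
  "A = \<phi> \<circ> translation 1 \<circ> \<psi>"

lemma A_P_plus: "A \<in> P_plus"
  unfolding A_def using normalizes translation_in_thompson_F[of 1] by (intro normalizes_conj_P_plus) (auto simp: thompson_F_P_plus)

lemma A_eq: "A (\<phi> x) = \<phi> (x + 1)"
  using bij by (simp add: A_def translation_def)

text \<open>\<open>A\<close> takes \<open>\<phi> (x + u)\<close> to
  \<open>\<phi> (x + u + 1)\<close>, so an affine germ of \<open>A\<close> at
  \<open>\<phi> x\<close> compares the germs of \<open>\<phi>\<close> at \<open>x\<close> and
  \<open>x + 1\<close>.\<close>

lemma unbroken_rel:
  assumes "has_slopes A (\<phi> x) a a" "a \<in> pow2" shows "germ_rel \<phi> x (x + 1)"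
proof -
  obtain e where e: "e > 0" "\<And>y. \<bar>y - \<phi> x\<bar> < e \<Longrightarrow> A y = A (\<phi> x) + a * (y - \<phi> x)"
    using has_slopes_eq_interval[OF assms(1)] by blast
  obtain d where d: "d > 0" "\<And>u. \<bar>u\<bar> < d \<Longrightarrow> \<bar>\<phi> (x + u) - \<phi> x\<bar> < e"
    using normalizes_near[OF normalizes e(1)] by blast
  show ?thesis
  proof (rule germ_relI[OF pow2_1 assms(2) d(1)])
    fix u assume "\<bar>u\<bar> < d"
    then have "A (\<phi> (x + u)) = A (\<phi> x) + a * (\<phi> (x + u) - \<phi> x)" using d(2) e(2) by blast
    then show "\<phi> (x + 1 + 1 * u) - \<phi> (x + 1) = a * (\<phi> (x + u) - \<phi> x)"
      by (simp add: A_eq algebra_simps)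
  qed
qed

text \<open>The same germ of \<open>A\<close>, read through
  \<open>\<psi> (A z) = \<psi> z + 1\<close>. Division of \<open>A y\<close> by the slope gives the
  second point the form \<open>y\<close> plus a shift that is constant along an affine piece of
  \<open>A\<close>.\<close>

lemma unbroken_inverse_rel:
  assumes "has_slopes A y a a" "a \<in> pow2" shows "germ_rel \<psi> y (A y / a)"
proof -
  interpret inv: dilation \<psi> by (rule inverse_dilation)
  obtain e where e: "e > 0" "\<And>z. \<bar>z - y\<bar> < e \<Longrightarrow> A z = A y + a * (z - y)"
    using has_slopes_eq_interval[OF assms(1)] by blast
  have \<psi>A: "\<psi> (A z) = \<psi> z + 1" for z using A_eq[of "\<psi> z"] bij by simp
  have "germ_rel \<psi> y (A y)"
  proof (rule germ_relI[OF assms(2) pow2_1 e(1)])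
    fix v assume "\<bar>v\<bar> < e"
    then have "A (y + v) = A y + a * v" using e(2)[of "y + v"] by simp
    then show "\<psi> (A y + a * v) - \<psi> (A y) = 1 * (\<psi> (y + v) - \<psi> y)"
      using \<psi>A[of "y + v"] \<psi>A[of y] by simp
  qed
  moreover have "germ_rel \<psi> (A y) (1 / a * A y)" using inv.germ_rel_scale[of "1 / a" "A y"] assms(2) by auto
  ultimately show ?thesis using germ_rel_trans by simp
qed

text \<open>\<open>germ_law\<close> at \<open>x + 1\<close> moves the rescaling \<open>c\<close>
  from the source to the target, and \<open>A\<close> becomes affine with slope \<open>d / c\<close>
  at \<open>\<phi> x\<close>.\<close>

lemma germ_rel_unbroken:
  assumes x: "x \<in> dyadic" and r: "germ_rel \<phi> x (x + 1)" shows "\<phi> x \<notin> breakpoints A"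
proof -
  obtain c d e where e: "c \<in> pow2" "d \<in> pow2" "e > 0"
    "\<And>u. \<bar>u\<bar> < e \<Longrightarrow> \<phi> (x + 1 + c * u) - \<phi> (x + 1) = d * (\<phi> (x + u) - \<phi> x)"
    using germ_relE[OF r] by blast
  obtain e' where e': "e' > 0" "\<And>u. \<bar>u\<bar> < e' \<Longrightarrow> \<phi> (x + 1 + c * u) - \<phi> (x + 1) = c * (\<phi> (x + 1 + u) - \<phi> (x + 1))"
    using germ_law[OF e(1), of "x + 1"] x by auto
  obtain \<delta> where \<delta>: "\<delta> > 0" "\<And>v. \<bar>v\<bar> < \<delta> \<Longrightarrow> \<bar>\<psi> (\<phi> x + v) - \<psi> (\<phi> x)\<bar> < min e e'"
    using normalizes_near[OF normalizes_inv[OF normalizes], of "min e e'" "\<phi> x"] e(3) e'(1) by auto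
  have A: "A (\<phi> x + v) = A (\<phi> x) + d / c * v" if "\<bar>v\<bar> < \<delta>" for v
  proof -
    define u where "u = \<psi> (\<phi> x + v) - x"
    have u: "\<bar>u\<bar> < e" "\<bar>u\<bar> < e'" using \<delta>(2)[OF that] bij by (auto simp: u_def)
    have \<phi>u: "\<phi> (x + u) = \<phi> x + v" using bij by (simp add: u_def)
    have "A (\<phi> x + v) = \<phi> (x + 1 + u)" using A_eq[of "x + u"] \<phi>u by (simp add: algebra_simps)
    moreover have "c * (\<phi> (x + 1 + u) - \<phi> (x + 1)) = d * v" using e(4)[OF u(1)] e'(2)[OF u(2)] \<phi>u by simp
    ultimately show ?thesis using pow2_pos[OF e(1)] by (simp add: A_eq field_simps)
  qed
  have "has_slopes A (\<phi> x) (d / c) (d / c)" unfolding has_slopes_def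
    by (intro exI[of _ \<delta>] conjI allI impI \<delta>(1)) (use A[of "- _"] A in auto)
  then show ?thesis by (rule locally_PL_dyadic_not_breakpoint)
qed

lemma broken_dyadic: assumes "y \<in> breakpoints A" shows "y \<in> dyadic"
  using assms P_plus_P_set[OF A_P_plus] by (auto simp: P_set_def)

text \<open>Outside the grid of index \<open>m\<close>, the class of the germ at a positive dyadic
  point depends only on the point modulo 1. The least such \<open>m\<close> measures how far
  \<open>\<phi>\<close> is from linear.\<close>

definition uniform_from :: "nat \<Rightarrow> bool" where
  "uniform_from m \<longleftrightarrow> (\<forall>r\<in>dyadic. \<forall>r'\<in>dyadic. 0 < r \<and> 0 < r' \<and> r \<notin> grid (int m) \<and> r' - r \<in> \<int> \<longrightarrow> germ_rel \<phi> r r')"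

lemma nonbreak_rel: assumes "\<phi> x \<notin> breakpoints A" shows "germ_rel \<phi> x (x + 1)"
proof -
  obtain a b where ab: "has_slopes A (\<phi> x) a b" "a \<in> pow2" using P_plusE[OF A_P_plus, of "\<phi> x"] by metis
  then have "a = b" using locally_PL_dyadic_breakpoint_iff assms by blast
  then show ?thesis using unbroken_rel ab by blast
qed

lemma finite_breaks: "finite (breakpoints A \<inter> {a..b})"
  using P_plus_P_set[OF A_P_plus] by (simp add: P_set_def piecewise_linear_def)

text \<open>Choose \<open>m\<close> so that the finitely many breaks of \<open>A\<close> between
  \<open>\<phi> 0\<close> and \<open>\<phi> 1\<close> come from the grid of index \<open>m\<close>.
  Outside it, shifting a point of the unit interval by 1 preserves the class; after scaling by
  \<open>2 ^ j\<close> this removes the leading binary digit of the integer part of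
  \<open>r\<close>, until only the fractional part remains.\<close>

lemma uniform_exists: "\<exists>m. uniform_from m"
proof -
  define X where "X = \<psi> ` (breakpoints A \<inter> {\<phi> 0..\<phi> 1})"
  have "finite X" "X \<subseteq> dyadic"
    using finite_breaks broken_dyadic normalizes_dyadic[OF normalizes_inv[OF normalizes]] by (auto simp: X_def)
  then obtain m :: nat where m: "\<And>x. x \<in> X \<Longrightarrow> 2 ^ m * x \<in> \<int>"
    using finite_dyadic_common[of X] by auto
  have base: "germ_rel \<phi> x (x + 1)" if x: "0 < x" "x \<le> 1" "x \<notin> grid (int m)" for x
  proof (rule nonbreak_rel)
    show "\<phi> x \<notin> breakpoints A"
    proof
      assume b: "\<phi> x \<in> breakpoints A"
      have "\<phi> 0 \<le> \<phi> x" "\<phi> x \<le> \<phi> 1" using x normalizes_le_iff[OF normalizes, of 0 x] normalizes_le_iff[OF normalizes, of x 1] by simp_all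
      then have "\<psi> (\<phi> x) \<in> X" using b by (auto simp: X_def simp del: zero)
      then have "2 ^ m * x \<in> \<int>" using m bij by simp
      then show False using x(3) by (simp add: grid_def)
    qed
  qed
  have frac: "germ_rel \<phi> r (frac r)" if "0 < r" "r \<notin> grid (int m)" for r
    using that
  proof (induct "nat \<lfloor>r\<rfloor>" arbitrary: r rule: less_induct)
    case less
    have nint: "r \<notin> \<int>" using less(3) grid_mono[of 0 "int m" r] by (auto simp: grid_zero)
    show ?case
    proof (cases "r < 1")
      case True
      then have "frac r = r" using less(2) by (simp add: frac_eq)
      then show ?thesis by (simp add: germ_rel_refl)
    next
      case False
      define k where "k = \<lfloor>log 2 r\<rfloor>"
      have k0: "k \<ge> 0" using False by (simp add: k_def)
      then obtain j where j: "k = int j" using nonneg_int_cases by blast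
      have lo: "2 ^ j \<le> r" and up: "r < 2 ^ Suc j"
        using floor_log_eq_powr_iff[of r 2 k] less(2) k_def by (auto simp: j powr_add powr_realpow)
      have ne: "r \<noteq> 2 ^ j" using nint by (auto simp: Ints_power)
      define x where "x = r / 2 ^ j - 1"
      have x: "0 < x" "x \<le> 1" using lo up ne by (auto simp: x_def field_simps)
      have xr: "r = 2 ^ j * (x + 1)" "r - 2 ^ j = 2 ^ j * x" by (auto simp: x_def field_simps)
      have "x \<notin> grid (int m)"
      proof
        assume "x \<in> grid (int m)"
        then have "x + 1 \<in> grid (int m)" using grid_mono[of 0 "int m" 1] by (intro grid_add) (auto simp: grid_zero)
        then have "x + 1 \<in> grid (int m - int j + int j)" by simp
        then have "tp (int j) * (x + 1) \<in> grid (int m - int j)" by (simp only: grid_scale)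
        then have "r \<in> grid (int m - int j)" by (simp add: xr)
        then show False using grid_mono[of "int m - int j" "int m" r] less(3) by simp
      qed
      then have "germ_rel \<phi> x (x + 1)" by (rule base[OF x])
      then have "germ_rel \<phi> (2 ^ j * x) (2 ^ j * (x + 1))" by (simp only: germ_rel_scale_iff[OF pow2_power])
      then have r1: "germ_rel \<phi> r (r - 2 ^ j)" unfolding xr(2) unfolding xr(1)[symmetric] by (rule germ_rel_sym)
      have i: "2 ^ j = real_of_int (2 ^ j)" by simp
      have fl: "\<lfloor>r - 2 ^ j\<rfloor> = \<lfloor>r\<rfloor> - 2 ^ j" unfolding i by (rule floor_diff_of_int)
      have fr: "frac (r - 2 ^ j) = frac r" unfolding frac_def fl by simp
      have pos: "0 < r - 2 ^ j" using lo ne by simp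
      have "1 \<le> \<lfloor>r\<rfloor>" using False by simp
      then have "nat \<lfloor>r - 2 ^ j\<rfloor> < nat \<lfloor>r\<rfloor>" unfolding fl by simp
      moreover have "r - 2 ^ j \<notin> grid (int m)"
      proof
        assume "r - 2 ^ j \<in> grid (int m)"
        moreover have "2 ^ j \<in> grid (int m)" using grid_mono[of 0 "int m" "2 ^ j"] by (auto simp: grid_zero)
        ultimately have "r - 2 ^ j + 2 ^ j \<in> grid (int m)" by (rule grid_add)
        then show False using less(3) by simp
      qed
      ultimately have "germ_rel \<phi> (r - 2 ^ j) (frac (r - 2 ^ j))" using less(1)[of "r - 2 ^ j"] pos by blast
      then show ?thesis using r1 germ_rel_trans by (simp add: fr)
    qed
  qed
  have "uniform_from m" unfolding uniform_from_def
  proof (intro ballI impI)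
    fix r r' assume "r \<in> dyadic" "r' \<in> dyadic" and r: "0 < r \<and> 0 < r' \<and> r \<notin> grid (int m) \<and> r' - r \<in> \<int>"
    have "r' - r \<in> grid (int m)" using r grid_mono[of 0 "int m" "r' - r"] by (simp add: grid_zero)
    then have "r' \<notin> grid (int m)" using r grid_add_iff[of "r' - r" "int m" r] by simp
    moreover have "frac r' = frac r"
    proof -
      obtain i where "r' = r + of_int i" using r by (auto elim!: Ints_cases simp: algebra_simps)
      then show ?thesis by (simp add: frac_def)
    qed
    ultimately show "germ_rel \<phi> r r'" using frac[of r] frac[of r'] r germ_rel_sym germ_rel_trans by metis
  qed
  then show ?thesis ..
qed

text \<open>Every positive dyadic number is a power of two times half an odd integer, so for
  \<open>m = 0\<close> all germs are in the class of the one at 1/2 and \<open>A\<close> has no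
  break on the positive half line. Affine with \<open>A 0 = \<phi> 1\<close> and
  \<open>A (\<phi> 1) = 2 * \<phi> 1\<close>, it is a translation there. Hence
  \<open>\<phi> (x + 1) = \<phi> x + \<phi> 1\<close>, and scaling and density do the rest.\<close>

lemma uniform_linear:
  assumes u: "uniform_from 0" and x: "x \<ge> 0" shows "\<phi> x = \<phi> 1 * x"
proof -
  have half: "germ_rel \<phi> (1 / 2) x" if x: "x \<in> dyadic" "x > 0" for x
  proof -
    define z where "z = tp (level x - 1) * x"
    have "z \<in> grid 1" "z \<notin> grid (1 - 1)" using level[of x] x by (auto simp: z_def grid_scale)
    moreover have "tp 1 * (1 / 2) = of_int 1" by simp
    then have h: "1 / 2 \<in> grid 1" "1 / 2 \<notin> grid (1 - 1)" using grid_pred[of 1 "1 / 2" 1] by (auto simp: grid_def)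
    ultimately have "z - 1 / 2 \<in> \<int>" using grid_odd(2)[of z 1 "1 / 2"] by (simp add: grid_zero)
    moreover have "z \<in> dyadic" "z > 0" using x by (auto simp: z_def)
    moreover have "1 / 2 \<in> dyadic" by (rule dyadic_pow2) simp
    ultimately have "germ_rel \<phi> (1 / 2) z" using u h unfolding uniform_from_def by simp
    moreover have "germ_rel \<phi> x z" unfolding z_def by (rule germ_rel_scale) auto
    ultimately show ?thesis using germ_rel_sym germ_rel_trans by blast
  qed
  have nb: "y \<notin> breakpoints A" if y: "y > 0" for y
  proof
    assume b: "y \<in> breakpoints A"
    have "\<psi> y \<in> dyadic" using broken_dyadic[OF b] normalizes_dyadic[OF normalizes_inv[OF normalizes]] by blast
    moreover have "\<psi> y > 0" using pos_iff[of "\<psi> y"] bij y by simp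
    ultimately have "germ_rel \<phi> (\<psi> y) (\<psi> y + 1)"
      using half[of "\<psi> y"] half[of "\<psi> y + 1"] germ_rel_sym germ_rel_trans by (metis add_pos_pos dyadic_1 dyadic_add zero_less_one)
    then have "\<phi> (\<psi> y) \<notin> breakpoints A" using germ_rel_unbroken \<open>\<psi> y \<in> dyadic\<close> by blast
    then show False using b bij by simp
  qed
  let ?b = "\<phi> 1"
  have b: "?b > 0" using pos_iff by simp
  have A0: "A 0 = ?b" using A_eq[of 0] by simp
  have shift: "\<phi> (x + 1) = \<phi> x + ?b" if x: "x \<ge> 0" for x
  proof -
    have "\<phi> x \<ge> 0" using normalizes_le_iff[OF normalizes, of 0 x] x by simp
    have "{0<..<max (\<phi> x) ?b} \<inter> breakpoints A = {}" using nb by auto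
    moreover have "0 < max (\<phi> x) ?b" using b by simp
    ultimately have "\<exists>m\<in>pow2. \<forall>t. 0 \<le> t \<and> t \<le> max (\<phi> x) ?b \<longrightarrow> A t = A 0 + m * (t - 0)"
      using P_plus_affine_piece[OF A_P_plus] by blast
    then obtain m where m: "\<And>t. 0 \<le> t \<Longrightarrow> t \<le> max (\<phi> x) ?b \<Longrightarrow> A t = A 0 + m * t"
      by (metis diff_zero)
    have "A ?b = ?b + m * ?b" using m[of ?b] b A0 by simp
    moreover have "A ?b = 2 * ?b" using A_eq[of 1] dbl[of 1] by simp
    ultimately have "m = 1" using b by simp
    then show ?thesis using m[of "\<phi> x"] \<open>\<phi> x \<ge> 0\<close> A0 A_eq by simp
  qed
  have nat: "\<phi> (real j) = real j * ?b" for j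
  proof (induct j)
    case (Suc j)
    have "\<phi> (real j + 1) = real j * ?b + ?b" using shift[of "real j"] Suc by simp
    then show ?case by (simp add: algebra_simps)
  qed simp
  have dy: "\<phi> y = ?b * y" if y: "y \<in> dyadic" "y \<ge> 0" for y
  proof -
    obtain n :: nat where n: "2 ^ n * y \<in> \<int>" using y by (auto simp: dyadic_iff)
    moreover have "2 ^ n * y \<ge> 0" using y by simp
    ultimately have "2 ^ n * y \<in> \<nat>" by (simp add: Nats_altdef2)
    then obtain j where j: "2 ^ n * y = real j" by (rule Nats_cases)
    have "2 ^ n * \<phi> y = real j * ?b" using scale[of "2 ^ n" y] nat[of j] by (simp add: j)
    then have "2 ^ n * \<phi> y = 2 ^ n * (?b * y)" by (simp add: j[symmetric])
    then show ?thesis by simp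
  qed
  show ?thesis
  proof (rule ccontr)
    assume ne: "\<phi> x \<noteq> ?b * x"
    then have x0: "x > 0" using x by (cases "x = 0") auto
    have "?b * (\<phi> x / ?b) = \<phi> x" using b by simp
    then have "\<phi> x / ?b \<noteq> x" using ne by metis
    then consider "\<phi> x / ?b < x" | "x < \<phi> x / ?b" by linarith
    then show False
    proof cases
      case 1
      then obtain y where y: "y \<in> dyadic" "\<phi> x / ?b < y" "y < x" using dyadic_dense by blast
      have "0 < \<phi> x / ?b" using b x0 pos_iff by simp
      then have "\<phi> y = ?b * y" using y by (intro dy) auto
      moreover have "\<phi> x < ?b * y" using y b by (simp add: field_simps)
      moreover have "\<phi> y < \<phi> x" using y normalizes_less_iff[OF normalizes] by blast
      ultimately show False by simp
    next
      case 2
      then obtain y where y: "y \<in> dyadic" "x < y" "y < \<phi> x / ?b" using dyadic_dense by blast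
      have "\<phi> y = ?b * y" using y x0 by (intro dy) auto
      moreover have "?b * y < \<phi> x" using y b by (simp add: field_simps)
      moreover have "\<phi> x < \<phi> y" using y normalizes_less_iff[OF normalizes] by blast
      ultimately show False by simp
    qed
  qed
qed

text \<open>Take \<open>m\<close> minimal. Failure at its predecessor is witnessed by
  \<open>r\<close> and \<open>r1\<close>, while shifts by even integers still preserve the class
  there; so \<open>r1 - r\<close> is odd, and the points congruent to \<open>r\<close> modulo 1 fall
  into two classes according to parity. An odd shift always changes the class, and scaling by
  \<open>tp k\<close> turns odd shifts into shifts of level exactly \<open>k\<close>.\<close>

lemma linear_or_defect:
  assumes "\<not> (\<forall>x\<ge>0. \<phi> x = \<phi> 1 * x)"
  obtains r where "r \<in> dyadic" "r > 0" "r \<notin> \<int>"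
    "\<And>k y s. y \<in> dyadic \<Longrightarrow> tp k * y - r \<in> \<int> \<Longrightarrow> s \<in> grid k \<Longrightarrow> s \<notin> grid (k - 1) \<Longrightarrow>
       0 < y \<Longrightarrow> 0 < y + s \<Longrightarrow> \<not> germ_rel \<phi> y (y + s)"
proof -
  define m where "m = (LEAST m. uniform_from m)"
  have um: "uniform_from m" unfolding m_def using uniform_exists by (rule LeastI_ex)
  have "m \<noteq> 0" using um uniform_linear assms by metis
  then obtain m' where m': "m = Suc m'" using not0_implies_Suc by blast
  then have "\<not> uniform_from m'" using not_less_Least[of m' uniform_from] by (simp add: m_def)
  then obtain r r1 where r: "r \<in> dyadic" "r1 \<in> dyadic" "0 < r" "0 < r1" "r \<notin> grid (int m')" "r1 - r \<in> \<int>" "\<not> germ_rel \<phi> r r1"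
    unfolding uniform_from_def by blast
  \<comment> \<open>An even shift of \<open>a\<close> is an integral shift of \<open>a / 2\<close>,
    which lies outside the grid of index \<open>m\<close> when \<open>a\<close> lies outside that of
    index \<open>m'\<close>.\<close>
  have even: "germ_rel \<phi> a b" if ab: "a \<in> dyadic" "b \<in> dyadic" "0 < a" "0 < b" "a \<notin> grid (int m')" "b - a \<in> grid (- 1)" for a b
  proof -
    have "a / 2 \<notin> grid (int m)" using ab(5) grid_scale[of "- 1" a "int m"] by (simp add: m' power_int_minus)
    moreover have "b / 2 - a / 2 \<in> \<int>" using ab(6) by (simp add: grid_def power_int_minus diff_divide_distrib)
    moreover have "a / 2 \<in> dyadic" "b / 2 \<in> dyadic" using ab by (auto intro: dyadic_divide_pow2)
    ultimately have "germ_rel \<phi> (1 / 2 * a) (1 / 2 * b)" using um ab unfolding uniform_from_def by simp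
    then show ?thesis by (simp only: germ_rel_scale_iff[OF pow2_half])
  qed
  have gm: "x \<in> grid (int m')" if "x \<in> \<int>" for x using grid_mono[of 0 "int m'" x] that by (simp add: grid_zero)
  have odd: "r1 - r \<notin> grid (- 1)" using even r by blast
  \<comment> \<open>Points at even distance from \<open>r\<close> are in the class of
    \<open>r\<close>, those at odd distance in the class of \<open>r1\<close>; as \<open>s\<close>
    is odd, \<open>y\<close> and \<open>y + s\<close> are separated.\<close>
  have base: "\<not> germ_rel \<phi> y (y + s)" if y: "y \<in> dyadic" "y - r \<in> \<int>" "s \<in> \<int>" "s \<notin> grid (- 1)" "0 < y" "0 < y + s" for y s
  proof
    assume yr: "germ_rel \<phi> y (y + s)"
    have sd: "y + s \<in> dyadic" using y(1,3) dyadic_Ints by blast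
    have yn: "y \<notin> grid (int m')" using grid_add_iff[OF gm[OF y(2)], of r] r(5) by simp
    have ysn: "y + s \<notin> grid (int m')" using grid_add_iff[OF gm[OF y(3)], of y] yn by simp
    show False
    proof (cases "y - r \<in> grid (- 1)")
      case True
      have "r1 - (y + s) = (r1 - r - s) - (y - r)" by simp
      moreover have "r1 - r - s \<in> grid (- 1)" using grid_odd(2)[of "r1 - r" 0 s] odd r(6) y(3,4) by (simp add: grid_zero)
      ultimately have "r1 - (y + s) \<in> grid (- 1)" using grid_diff True by metis
      then have "germ_rel \<phi> (y + s) r1" using even sd r ysn y by blast
      moreover have "germ_rel \<phi> r y" using even[of r y] True r y by blast
      ultimately show False using yr r(7) germ_rel_trans by blast
    next
      case False
      have "y + s - r = (y - r) + s" by simp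
      moreover have "(y - r) + s \<in> grid (- 1)" using grid_odd(1)[of "y - r" 0 s] False y by (simp add: grid_zero)
      ultimately have "germ_rel \<phi> r (y + s)" using even[of r "y + s"] r sd y by metis
      moreover have "r1 - y = (r1 - r) - (y - r)" by simp
      then have "r1 - y \<in> grid (- 1)" using grid_odd(2)[of "r1 - r" 0 "y - r"] odd False r(6) y(2) by (simp add: grid_zero)
      then have "germ_rel \<phi> y r1" using even[of y r1] y r yn by blast
      ultimately show False using yr r(7) germ_rel_trans germ_rel_sym by blast
    qed
  qed
  show thesis
  proof (rule that[OF r(1,3)])
    show "r \<notin> \<int>" using gm r(5) by blast
    fix k y s assume y: "y \<in> dyadic" "tp k * y - r \<in> \<int>" "s \<in> grid k" "s \<notin> grid (k - 1)" "0 < y" "0 < y + s"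
    have "\<not> germ_rel \<phi> (tp k * y) (tp k * y + tp k * s)"
    proof (rule base)
      show "tp k * y \<in> dyadic" using y by auto
      show "tp k * s \<in> \<int>" using y(3) by (simp add: grid_def)
      show "tp k * s \<notin> grid (- 1)" using y(4) by (simp add: grid_scale)
      have "0 < tp k * (y + s)" using y by simp
      then show "0 < tp k * y + tp k * s" by (simp add: distrib_left)
    qed (use y in auto)
    then show "\<not> germ_rel \<phi> y (y + s)" using germ_rel_scale_iff[OF pow2_powi, of k y "y + s"] by (simp add: distrib_left)
  qed
qed

end

text \<open>The right germ of \<open>A\<close> at 0 gives
  \<open>\<phi> (w + 1) = \<phi> 1 + a * \<phi> w\<close> for small positive \<open>w\<close>. With
  \<open>w = r / 2 ^ m\<close> and scaling,
  \<open>\<phi> (2 ^ m + r) = 2 ^ m * \<phi> 1 + a * \<phi> r\<close>, and for large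
  \<open>m\<close> the second term alone decides the level.\<close>

lemma (in dilation) eventually_constant_level:
  assumes r: "r \<in> dyadic" "r > 0"
  shows "\<exists>m0::nat. \<exists>l. \<forall>m\<ge>m0. level (\<phi> (2 ^ m + r)) = l"
proof -
  obtain a b where ab: "has_slopes A 0 a b" "a \<in> pow2" using P_plusE[OF A_P_plus, of 0] by metis
  obtain e where e: "e > 0" "\<And>u. 0 \<le> u \<Longrightarrow> u < e \<Longrightarrow> A (0 + u) = A 0 + a * u"
    using has_slopesE[OF ab(1)] by blast
  obtain d where d: "d > 0" "\<And>u. \<bar>u\<bar> < d \<Longrightarrow> \<bar>\<phi> u\<bar> < e"
    using normalizes_near[OF normalizes e(1), of 0] by auto
  obtain n :: nat where n: "1 / 2 ^ n < d / r" using pow2_small[of "d / r"] d(1) r(2) by auto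
  have eq: "\<phi> (2 ^ m + r) = 2 ^ m * \<phi> 1 + a * \<phi> r" if m: "m \<ge> n" for m
  proof -
    define w where "w = r / 2 ^ m"
    have "(2::real) ^ n \<le> 2 ^ m" using m by (intro power_increasing) auto
    then have "r / 2 ^ m \<le> r / 2 ^ n" using r(2) by (intro divide_left_mono) auto
    moreover have "r / 2 ^ n < d" using n r(2) by (simp add: field_simps)
    ultimately have w: "0 < w" "w < d" using r(2) by (auto simp: w_def)
    have "0 < \<phi> w" "\<phi> w < e" using w d(2)[of w] pos_iff by auto
    then have "A (\<phi> w) = A (\<phi> 0) + a * \<phi> w" using e(2)[of "\<phi> w"] by simp
    then have "\<phi> (w + 1) = \<phi> 1 + a * \<phi> w" by (simp only: A_eq) simp
    moreover have "\<phi> (2 ^ m * (w + 1)) = 2 ^ m * \<phi> (w + 1)" by (rule scale) simp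
    moreover have "\<phi> (2 ^ m * w) = 2 ^ m * \<phi> w" by (rule scale) simp
    ultimately show ?thesis by (simp add: w_def algebra_simps)
  qed
  define z where "z = a * \<phi> r"
  have z: "z \<in> dyadic" "z \<noteq> 0"
    using ab(2) pow2_pos[OF ab(2)] r normalizes_dyadic[OF normalizes] pos_iff[of r] by (auto simp: z_def)
  obtain k where k: "\<phi> 1 \<in> grid k" using normalizes_dyadic[OF normalizes dyadic_1] by (auto simp: dyadic_grid)
  have "level (\<phi> (2 ^ m + r)) = level z" if m: "m \<ge> max n (nat (k - level z + 1))" for m
  proof -
    have "\<phi> 1 \<in> grid (level z - 1 + int m)" by (rule grid_mono[OF _ k]) (use m in linarith)
    then have "tp (int m) * \<phi> 1 \<in> grid (level z - 1)" by (simp only: grid_scale)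
    then have "level (z + tp (int m) * \<phi> 1) = level z" by (rule level_add[OF z])
    moreover have "\<phi> (2 ^ m + r) = z + tp (int m) * \<phi> 1" using eq[of m] m by (simp add: z_def)
    ultimately show ?thesis by simp
  qed
  then show ?thesis by blast
qed

text \<open>If \<open>\<phi>\<close> were not linear then neither would be its inverse. The defect of the inverse limits
  the distance between consecutive breaks of \<open>A\<close>, which forces the levels of the breaks to grow
  in one direction, whereas the defect of \<open>\<phi>\<close> produces infinitely many breaks of the same level.\<close>

theorem (in dilation) linear: assumes "x \<ge> 0" shows "\<phi> x = \<phi> 1 * x"
proof (rule ccontr)
  assume "\<phi> x \<noteq> \<phi> 1 * x"
  then have nl: "\<not> (\<forall>x\<ge>0. \<phi> x = \<phi> 1 * x)" using assms by blast
  interpret inv: dilation \<psi> by (rule inverse_dilation)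
  have "\<not> (\<forall>x\<ge>0. \<psi> x = \<psi> 1 * x)"
  proof
    assume l: "\<forall>x\<ge>0. \<psi> x = \<psi> 1 * x"
    have "\<phi> t = t / \<psi> 1" if "t \<ge> 0" for t
    proof -
      have "\<phi> t \<ge> 0" using normalizes_le_iff[OF normalizes, of 0 t] that by simp
      then have "\<psi> (\<phi> t) = \<psi> 1 * \<phi> t" using l by blast
      moreover have "\<psi> 1 > 0" using inv.pos_iff by simp
      ultimately show ?thesis using bij by (simp add: field_simps)
    qed
    then show False using nl by simp
  qed
  then obtain r' where r': "r' \<in> dyadic" "r' > 0" "r' \<notin> \<int>"
    "\<And>k y s. y \<in> dyadic \<Longrightarrow> tp k * y - r' \<in> \<int> \<Longrightarrow> s \<in> grid k \<Longrightarrow> s \<notin> grid (k - 1) \<Longrightarrow>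
       0 < y \<Longrightarrow> 0 < y + s \<Longrightarrow> \<not> germ_rel \<psi> y (y + s)"
    using inv.linear_or_defect by blast
  obtain r where r: "r \<in> dyadic" "r > 0" "r \<notin> \<int>"
    "\<And>k y s. y \<in> dyadic \<Longrightarrow> tp k * y - r \<in> \<int> \<Longrightarrow> s \<in> grid k \<Longrightarrow> s \<notin> grid (k - 1) \<Longrightarrow>
       0 < y \<Longrightarrow> 0 < y + s \<Longrightarrow> \<not> germ_rel \<phi> y (y + s)"
    using linear_or_defect[OF nl] by blast
  have "\<exists>a b. has_slopes A y a b \<and> a \<in> pow2 \<and> b \<in> pow2" for y
    using P_plusE[OF A_P_plus, of y] by metis
  then obtain a b where ab: "\<And>y. has_slopes A y (a y) (b y)" "\<And>y. a y \<in> pow2" "\<And>y. b y \<in> pow2"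
    by metis
  have pos: "a y > 0" "b y > 0" for y using ab pow2_pos by auto
  \<comment> \<open>On an affine piece of slope \<open>m\<close> one has
    \<open>A x = m * (x + s)\<close> with a constant shift \<open>s\<close>. Here
    \<open>sR y\<close> is the shift to the right of \<open>y\<close> and \<open>sL y\<close> the
    one to the left, so both ends of a piece see the same value.\<close>
  define sR where "sR y = A y / a y - y" for y
  define sL where "sL y = A y / b y - y" for y
  let ?B = "breakpoints A"
  have Ady: "A y \<in> dyadic" if "y \<in> dyadic" for y using P_set_dyadic[OF P_plus_P_set[OF A_P_plus] that] .
  have Apos: "A y > 0" if "y > 0" for y
  proof -
    have "A 0 = \<phi> 1" using A_eq[of 0] by simp
    moreover have "\<phi> 1 > 0" by (simp add: pos_iff)
    ultimately show ?thesis using P_plus_less_iff[OF A_P_plus, of 0 y] that by linarith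
  qed
  have sdy: "sR y \<in> dyadic" "sL y \<in> dyadic" if "y \<in> dyadic" for y
    using that Ady[OF that] ab(2,3) by (auto simp: sR_def sL_def intro!: dyadic_diff intro: dyadic_divide_pow2)
  have piece: "\<exists>m\<in>pow2. a p = m \<and> b q = m \<and> sL q = sR p \<and> (\<forall>x. p \<le> x \<and> x \<le> q \<longrightarrow> A x = m * (x + sR p))"
    if pq: "p < q" "{p<..<q} \<inter> ?B = {}" for p q
  proof -
    obtain m where m: "m \<in> pow2" "\<And>x. p \<le> x \<Longrightarrow> x \<le> q \<Longrightarrow> A x = A p + m * (x - p)"
      using P_plus_affine_piece[OF A_P_plus pq] by blast
    have m0: "m > 0" using m(1) pow2_pos by blast
    obtain e where e: "e > 0" "\<And>u. 0 \<le> u \<Longrightarrow> u < e \<Longrightarrow> A (p + u) = A p + a p * u"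
      using has_slopesE[OF ab(1)] by metis
    obtain e' where e': "e' > 0" "\<And>u. 0 \<le> u \<Longrightarrow> u < e' \<Longrightarrow> A (q - u) = A q - b q * u"
      using has_slopesE[OF ab(1)] by metis
    define u where "u = min (min e e' / 2) (q - p)"
    have u: "u > 0" "u < e" "u < e'" "u \<le> q - p" using e(1) e'(1) pq(1) by (auto simp: u_def)
    have am: "a p = m" using e(2)[of u] m(2)[of "p + u"] u by simp
    have "b q * u = m * u" using e'(2)[of u] m(2)[of "q - u"] m(2)[of q] u pq(1) by (simp add: algebra_simps)
    then have bm: "b q = m" using u(1) by simp
    have s1: "sR p = A p / m - p" using am by (simp add: sR_def)
    have s2: "sL q = A p / m - p" using bm m(2)[of q] pq(1) m0 by (simp add: sL_def field_simps)
    have "A x = m * (x + sR p)" if "p \<le> x" "x \<le> q" for x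
    proof -
      have "m * (x + sR p) = m * x + m * (A p / m) - m * p" by (simp add: s1 right_diff_distrib distrib_left)
      also have "m * (A p / m) = A p" using m0 by simp
      finally show ?thesis using m(2)[OF that] by (simp add: algebra_simps)
    qed
    then show ?thesis using am bm s1 s2 m(1) by metis
  qed
  \<comment> \<open>Two points of \<open>grid k\<close> are at least \<open>tp (- k)\<close> apart,
    which leaves room for some \<open>y\<close> with \<open>tp k * y\<close> congruent to
    \<open>r'\<close> modulo 1. There \<open>A\<close> is unbroken, so the germs of
    \<open>\<psi>\<close> at \<open>y\<close> and \<open>y + sR p\<close> are related although the
    shift has level exactly \<open>k\<close>, against the defect of \<open>\<psi>\<close>.\<close>
  have gap: "\<not> (p \<in> grid k \<and> q \<in> grid k)"
    if pq: "0 < p" "p < q" "{p<..<q} \<inter> ?B = {}" and s: "sR p \<in> grid k" "sR p \<notin> grid (k - 1)" for p q k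
  proof
    assume g: "p \<in> grid k \<and> q \<in> grid k"
    obtain m where m: "m \<in> pow2" "\<And>x. p \<le> x \<Longrightarrow> x \<le> q \<Longrightarrow> A x = m * (x + sR p)"
      using piece[OF pq(2,3)] by blast
    have m0: "m > 0" using m(1) pow2_pos by blast
    have gp: "tp (- k) \<le> q - p" using grid_gap[of "q - p" k] grid_diff g pq(2) by auto
    \<comment> \<open>\<open>y\<close> is the least point above \<open>p\<close> in the residue
      class of \<open>r'\<close>; it differs from \<open>q\<close> because \<open>r'\<close> is not
      an integer.\<close>
    define t where "t = tp k * p - r'"
    define y where "y = tp (- k) * (of_int (\<lfloor>t\<rfloor> + 1) + r')"
    have yt: "tp k * y = of_int (\<lfloor>t\<rfloor> + 1) + r'" by (simp add: y_def)
    have "tp k * p < tp k * y" "tp k * y \<le> tp k * p + 1" unfolding yt t_def by linarith+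
    then have "p < y" and "tp k * y \<le> tp k * (p + tp (- k))" by (simp_all add: distrib_left tp_minus)
    then have y: "p < y" "y \<le> q" using gp by (simp_all)
    have ydy: "y \<in> dyadic" unfolding y_def using r'(1) by (intro dyadic_mult dyadic_add) auto
    have yr: "tp k * y - r' \<in> \<int>" unfolding yt by simp
    show False
    proof (cases "y = q")
      case True
      then have "tp k * y \<in> \<int>" using g by (simp add: grid_def)
      then have "tp k * y - (tp k * y - r') \<in> \<int>" using yr by (rule Ints_diff)
      then show False using r'(3) by simp
    next
      case False
      then have "y \<in> {p<..<q}" using y by simp
      then have nb: "y \<notin> ?B" using pq(3) by blast
      have eq: "a y = b y" using nb locally_PL_dyadic_breakpoint_iff[OF ab(1)] by blast
      have "{y<..<q} \<subseteq> {p<..<q}" using y(1) by auto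
      then have "{y<..<q} \<inter> ?B = {}" using pq(3) by blast
      then obtain m' where m': "a y = m'" "\<And>x. y \<le> x \<Longrightarrow> x \<le> q \<Longrightarrow> A x = m' * (x + sR y)"
        using piece[of y q] y False by (metis order_le_neq_trans)
      have "m' = m"
      proof -
        have "m' * (q + sR y) - m' * (y + sR y) = m * (q + sR p) - m * (y + sR p)"
          using m'(2)[of q] m'(2)[of y] m(2)[of q] m(2)[of y] y pq(2) by simp
        then have "m' * (q - y) = m * (q - y)" by (simp add: algebra_simps)
        then show ?thesis using False by simp
      qed
      have "has_slopes A y m m" using ab(1)[of y] eq m'(1) \<open>m' = m\<close> by simp
      then have "germ_rel \<psi> y (A y / m)" using m(1) by (rule unbroken_inverse_rel)
      moreover have Am: "A y / m = y + sR p" using m(2)[of y] y m0 by simp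
      moreover have "0 < y" using y pq by simp
      moreover have "0 < y + sR p" using Apos[OF \<open>0 < y\<close>] m0 unfolding Am[symmetric] by simp
      ultimately show False using r'(4)[OF ydy yr s] by simp
    qed
  qed
  \<comment> \<open>For a break \<open>y\<close> this compares levels: \<open>R y\<close> says that
    the level of \<open>y\<close> is at most that of the shift on its right, and \<open>L y\<close>
    refers to the left.\<close>
  define R where "R y \<longleftrightarrow> sR y \<noteq> 0 \<and> y \<in> grid (level (sR y))" for y
  define L where "L y \<longleftrightarrow> sL y \<noteq> 0 \<and> y \<in> grid (level (sL y))" for y
  \<comment> \<open>If both shifts had smaller level than \<open>y\<close>, then
    \<open>y + sR y\<close> and \<open>y + sL y\<close> would have the level of \<open>y\<close>.
    Both become \<open>A y\<close> after multiplication by a slope, so the two slopes would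
    agree.\<close>
  have RL: "R y \<or> L y" if y: "y > 0" "y \<in> ?B" for y
  proof (rule ccontr)
    assume n: "\<not> (R y \<or> L y)"
    have yd: "y \<in> dyadic" "y \<noteq> 0" using broken_dyadic y by auto
    have s: "s \<in> grid (level y - 1)" if "s = 0 \<or> y \<notin> grid (level s)" "s \<in> dyadic" for s
    proof (cases "s = 0")
      case False
      then have "y \<notin> grid (level s)" using that by blast
      then have "level s \<le> level y - 1" using grid_iff_level[OF yd] by simp
      then show ?thesis using level(1)[OF that(2) False] grid_mono by blast
    qed simp
    have "sR y \<in> grid (level y - 1)" "sL y \<in> grid (level y - 1)"
      using s sdy[OF yd(1)] n by (auto simp: R_def L_def)
    then have l: "level (y + sR y) = level y" "level (y + sL y) = level y" using level_add[OF yd] by auto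
    have e: "A y = a y * (y + sR y)" "A y = b y * (y + sL y)"
      using pos[of y] by (auto simp: sR_def sL_def)
    have d: "y + sR y \<in> dyadic" "y + sL y \<in> dyadic" using yd sdy by auto
    have nz: "y + sR y \<noteq> 0" "y + sL y \<noteq> 0" using e Apos[OF y(1)] by auto
    obtain i j where ij: "a y = tp i" "b y = tp j" using ab(2,3)[of y] by (auto simp: pow2_def)
    have "level (A y) = level y - i" using level_scale[OF d(1) nz(1), of i] e(1) ij l by simp
    moreover have "level (A y) = level y - j" using level_scale[OF d(2) nz(2), of j] e(2) ij l by simp
    ultimately have "a y = b y" using ij by simp
    then show False using y(2) locally_PL_dyadic_breakpoint_iff[OF ab(1)] by blast
  qed
  \<comment> \<open>\<open>p\<close> and \<open>q\<close> share the shift between them, and by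
    \<open>gap\<close> the next break \<open>q\<close> is not in its grid. So \<open>L q\<close>
    fails, \<open>R q\<close> holds, and the level has grown past that of the shift.\<close>
  have nextR: "R q \<and> level p < level q"
    if pq: "0 < p" "p < q" "{p<..<q} \<inter> ?B = {}" "p \<in> ?B" "q \<in> ?B" "R p" for p q
  proof -
    have d: "p \<in> dyadic" "p \<noteq> 0" "q \<in> dyadic" "q \<noteq> 0" using broken_dyadic pq by auto
    have s: "sR p \<noteq> 0" "p \<in> grid (level (sR p))" using pq(6) by (auto simp: R_def)
    have "q \<notin> grid (level (sR p))" using gap[OF pq(1-3) level[OF sdy(1)[OF d(1)] s(1)]] s(2) by blast
    moreover have "sL q = sR p" using piece[OF pq(2,3)] by blast
    ultimately have "\<not> L q" by (simp add: L_def)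
    then have "R q" using RL[of q] pq by auto
    moreover have "level p < level q"
      using s(2) \<open>q \<notin> grid (level (sR p))\<close> grid_iff_level[OF d(1,2)] grid_iff_level[OF d(3,4)] by auto
    ultimately show ?thesis ..
  qed
  have prevL: "L p \<and> level q < level p"
    if pq: "0 < p" "p < q" "{p<..<q} \<inter> ?B = {}" "p \<in> ?B" "q \<in> ?B" "L q" for p q
  proof -
    have d: "p \<in> dyadic" "p \<noteq> 0" "q \<in> dyadic" "q \<noteq> 0" using broken_dyadic pq by auto
    have sl: "sL q = sR p" using piece[OF pq(2,3)] by blast
    have s: "sR p \<noteq> 0" "q \<in> grid (level (sR p))" using pq(6) by (auto simp: L_def sl)
    have n: "p \<notin> grid (level (sR p))" using gap[OF pq(1-3) level[OF sdy(1)[OF d(1)] s(1)]] s(2) by blast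
    then have "\<not> R p" by (simp add: R_def)
    then have "L p" using RL[of p] pq by auto
    moreover have "level q < level p"
      using s(2) n grid_iff_level[OF d(1,2)] grid_iff_level[OF d(3,4)] by auto
    ultimately show ?thesis ..
  qed
  \<comment> \<open>Induction over the finitely many breaks between \<open>p\<close> and
    \<open>q\<close>, passing from each to the next.\<close>
  have up: "level p < level q" if "0 < p" "p < q" "p \<in> ?B" "q \<in> ?B" "R p" for p q
    using that
  proof (induct "card (?B \<inter> {p<..q})" arbitrary: p rule: less_induct)
    case less
    let ?S = "?B \<inter> {p<..q}"
    have fin: "finite ?S" using finite_breaks[of p q] by (rule finite_subset[rotated]) auto
    define y where "y = Min ?S"
    have qS: "q \<in> ?S" using less by auto
    have y: "y \<in> ?S" unfolding y_def by (rule Min_in[OF fin]) (use qS in blast)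
    have "y \<le> q" unfolding y_def by (rule Min_le[OF fin qS])
    note y = y this
    have "t \<ge> y" if "t \<in> ?S" for t using Min_le[OF fin that] by (simp add: y_def)
    then have "t \<notin> ?B" if "t \<in> {p<..<y}" for t using y(2) that by fastforce
    then have "{p<..<y} \<inter> ?B = {}" by blast
    then have n: "R y \<and> level p < level y" using nextR[of p y] less y by auto
    show ?case
    proof (cases "y = q")
      case False
      have "?B \<inter> {y<..q} \<subset> ?S" using y by auto
      then have "card (?B \<inter> {y<..q}) < card ?S" by (rule psubset_card_mono[OF fin])
      then have "level y < level q" using less(1)[of y] False y n less by auto
      then show ?thesis using n by simp
    qed (use n in simp)
  qed
  have down: "level q < level p" if "0 < p" "p < q" "p \<in> ?B" "q \<in> ?B" "L q" for p q
    using that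
  proof (induct "card (?B \<inter> {p..<q})" arbitrary: q rule: less_induct)
    case less
    let ?S = "?B \<inter> {p..<q}"
    have fin: "finite ?S" using finite_breaks[of p q] by (rule finite_subset[rotated]) auto
    define y where "y = Max ?S"
    have pS: "p \<in> ?S" using less by auto
    have y: "y \<in> ?S" unfolding y_def by (rule Max_in[OF fin]) (use pS in blast)
    have "p \<le> y" unfolding y_def by (rule Max_ge[OF fin pS])
    note y = y this
    have "t \<le> y" if "t \<in> ?S" for t using Max_ge[OF fin that] by (simp add: y_def)
    then have "t \<notin> ?B" if "t \<in> {y<..<q}" for t using y(2) that by fastforce
    then have "{y<..<q} \<inter> ?B = {}" by blast
    then have n: "L y \<and> level q < level y" using prevL[of y q] less y by auto
    show ?case
    proof (cases "y = p")
      case False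
      have "?B \<inter> {p..<y} \<subset> ?S" using y by auto
      then have "card (?B \<inter> {p..<y}) < card ?S" by (rule psubset_card_mono[OF fin])
      then have "level y < level p" using less(1)[of y] False y n less by auto
      then show ?thesis using n by simp
    qed (use n in simp)
  qed
  obtain m :: nat and l where ml: "\<And>n. n \<ge> m \<Longrightarrow> level (\<phi> (2 ^ n + r)) = l"
    using eventually_constant_level[OF r(1,2)] by blast
  \<comment> \<open>By the defect of \<open>\<phi>\<close> the points \<open>2 ^ n + r\<close>, all
    congruent to \<open>r\<close> modulo 1, give breaks of \<open>A\<close>; for large
    \<open>n\<close> these have one common level.\<close>
  define y where "y i = \<phi> (2 ^ (m + i) + r)" for i :: nat
  have yl: "level (y i) = l" for i using ml by (simp add: y_def)
  have yB: "y i \<in> ?B" for i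
  proof (rule ccontr)
    let ?x = "2 ^ (m + i) + r"
    assume "y i \<notin> ?B"
    then have "germ_rel \<phi> ?x (?x + 1)" unfolding y_def by (rule nonbreak_rel)
    moreover have "1 \<in> grid 0" "1 \<notin> grid (0 - 1)" using grid_pred[of 0 1 1] by (auto simp: grid_zero)
    moreover have "0 < ?x" using r(2) by (simp add: add_pos_pos)
    moreover have "?x \<in> dyadic" using r(1) by (intro dyadic_add) (auto intro: dyadic_pow2)
    moreover have "tp 0 * ?x - r \<in> \<int>" by simp
    ultimately show False using r(4)[of ?x 0 1] by simp
  qed
  have ypos: "y i > 0" for i unfolding y_def pos_iff using r(2) by (simp add: add_pos_pos)
  have yless: "y i < y (Suc i)" for i unfolding y_def normalizes_less_iff[OF normalizes] by simp
  \<comment> \<open>The middle one of three such breaks has a neighbour of equal level on either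
    side, whichever direction applies.\<close>
  consider "R (y 1)" | "L (y 1)" using RL[OF ypos yB] by blast
  then show False
  proof cases
    case 1
    then show False using up[OF ypos yless yB yB, of 1] yl by simp
  next
    case 2
    then show False using down[OF ypos yless yB yB, of 0] yl by simp
  qed
qed

section \<open>Normalizing homeomorphisms lie in \<open>P\<close>\<close>

lemma dyadic_unit_pow2:
  assumes "c > 0" "c \<in> dyadic" "1 / c \<in> dyadic" shows "c \<in> pow2"
proof -
  have nn: "\<exists>i n. 0 < i \<and> 2 ^ n * x = real i" if x: "x > 0" "x \<in> dyadic" for x
  proof -
    obtain n :: nat where n: "2 ^ n * x \<in> \<int>" using x by (auto simp: dyadic_iff)
    moreover have "2 ^ n * x > 0" using x by simp
    ultimately have "2 ^ n * x \<in> \<nat>" by (simp add: Nats_altdef2)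
    then obtain i where "2 ^ n * x = real i" by (auto elim: Nats_cases)
    then show ?thesis using \<open>2 ^ n * x > 0\<close> by (intro exI[of _ i] exI[of _ n]) auto
  qed
  obtain i n where i: "0 < i" "2 ^ n * c = real i" using nn assms by blast
  obtain j m where j: "2 ^ m * (1 / c) = real j" using nn[of "1 / c"] assms by auto
  have "real (i * j) = (2 ^ n * c) * (2 ^ m * (1 / c))" by (simp only: of_nat_mult i(2) j)
  also have "\<dots> = 2 ^ (n + m)" using assms(1) by (simp add: power_add)
  finally have "real (i * j) = real (2 ^ (n + m))" by simp
  then have "i * j = 2 ^ (n + m)" by (simp only: of_nat_eq_iff)
  then have "i dvd 2 ^ (n + m)" by (metis dvd_triv_left)
  then obtain k where "i = 2 ^ k" using divides_primepow_nat[of 2 i "n + m"] by auto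
  then have "c = 2 ^ k / 2 ^ n" using i(2) by (simp add: field_simps)
  then show ?thesis by auto
qed

text \<open>Dyadic translations move the germ at \<open>z\<close> to 0, where the blow-up is linear
  by \<open>linear\<close> and agrees with the rescaled map. Since \<open>\<phi> 1\<close> and its
  reciprocal \<open>\<psi> 1\<close> are both dyadic, the slope is a positive unit of the ring of
  dyadic numbers, hence a power of two.\<close>

lemma normalizes_right_affine:
  assumes h: "normalizes h" and z: "z \<in> dyadic"
  shows "\<exists>c\<in>pow2. \<exists>e>0. \<forall>u. 0 \<le> u \<and> u < e \<longrightarrow> h (z + u) = h z + c * u"
proof -
  define g where "g = (\<lambda>y. 1 * y + - h z) \<circ> h \<circ> (\<lambda>u. 1 * u + z)"
  have "normalizes (\<lambda>y. 1 * y + - h z)"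
    by (intro P_plus_nrm affine_in_P_plus dyadic_uminus normalizes_dyadic[OF h z] pow2_1)
  moreover have "normalizes (\<lambda>u. 1 * u + z)" by (intro P_plus_nrm affine_in_P_plus z pow2_1)
  ultimately have "normalizes g" unfolding g_def using h normalizes_comp by blast
  moreover have ge: "g u = h (z + u) - h z" for u by (simp add: g_def add.commute)
  then have "g 0 = 0" by simp
  ultimately obtain \<phi> where \<phi>: "normalizes \<phi>" "\<And>x. \<phi> (2 * x) = 2 * \<phi> x" "blowup_of g \<phi>"
    using blowup_exists by blast
  interpret dilation \<phi> using \<phi> by unfold_locales
  interpret inv: dilation \<psi> by (rule inverse_dilation)
  obtain n :: nat where n: "\<And>x. \<bar>x\<bar> \<le> 1 \<Longrightarrow> \<phi> x = 2 ^ n * g (x / 2 ^ n)"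
    using \<phi>(3) unfolding blowup_of_def by blast
  have c: "\<phi> 1 > 0" using pos_iff by simp
  have "\<psi> (\<phi> 1) = \<psi> 1 * \<phi> 1" using c by (intro inv.linear) simp
  then have "1 / \<phi> 1 = \<psi> 1" using bij c by (simp add: field_simps)
  then have "\<phi> 1 \<in> pow2"
    using normalizes_dyadic[OF normalizes dyadic_1] normalizes_dyadic[OF inv.normalizes dyadic_1] c by (intro dyadic_unit_pow2) auto
  moreover have "h (z + u) = h z + \<phi> 1 * u" if u: "0 \<le> u" "u < 1 / 2 ^ n" for u
  proof -
    have "\<bar>2 ^ n * u\<bar> \<le> 1" using u by (simp add: field_simps)
    then have "\<phi> (2 ^ n * u) = 2 ^ n * g u" using n[of "2 ^ n * u"] by simp
    moreover have "\<phi> (2 ^ n * u) = \<phi> 1 * (2 ^ n * u)" using u by (intro linear) simp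
    ultimately have "2 ^ n * g u = 2 ^ n * (\<phi> 1 * u)" by simp
    then have "g u = \<phi> 1 * u" by simp
    then show ?thesis using ge[of u] by simp
  qed
  ultimately show ?thesis by (intro bexI[of _ "\<phi> 1"] exI[of _ "1 / 2 ^ n"]) auto
qed

lemma normalizes_mir: assumes h: "normalizes h" shows "normalizes (reflect h)"
proof -
  have b: "bij h" using h by (rule normalizes_bij)
  have i: "finv (reflect h) = reflect (finv h)"
    by (rule inv_equality) (use b in \<open>auto simp: reflect_def\<close>)
  have sm: "strict_mono (reflect h)" by (rule strict_monoI) (simp add: reflect_def normalizes_less_iff[OF h])
  have "reflect (finv h) (reflect h x) = x" "reflect h (reflect (finv h) x) = x" for x using b by (auto simp: reflect_def)
  then have bm: "bij (reflect h)" by (intro o_bij[of "reflect (finv h)"]) (auto simp: fun_eq_iff)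
  have "reflect h \<circ> f \<circ> finv (reflect h) \<in> Fc" "finv (reflect h) \<circ> f \<circ> reflect h \<in> Fc" if f: "f \<in> Fc" for f
  proof -
    have "reflect (h \<circ> reflect f \<circ> finv h) \<in> Fc" "reflect (finv h \<circ> reflect f \<circ> h) \<in> Fc"
      using h reflect_Fc[OF f] by (auto intro!: reflect_Fc simp: normalizes_def)
    then show "reflect h \<circ> f \<circ> finv (reflect h) \<in> Fc" "finv (reflect h) \<circ> f \<circ> reflect h \<in> Fc"
      by (simp_all add: reflect_comp i)
  qed
  then show ?thesis using sm bm by (simp add: normalizes_def)
qed

lemma normalizes_slopes_dyadic:
  assumes h: "normalizes h" and z: "z \<in> dyadic"
  shows "\<exists>a\<in>pow2. \<exists>b\<in>pow2. has_slopes h z a b"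
proof -
  obtain a e where a: "a \<in> pow2" "e > 0" "\<And>u. 0 \<le> u \<Longrightarrow> u < e \<Longrightarrow> h (z + u) = h z + a * u"
    using normalizes_right_affine[OF h z] by blast
  obtain b e' where b: "b \<in> pow2" "e' > 0" "\<And>u. 0 \<le> u \<Longrightarrow> u < e' \<Longrightarrow> reflect h (- z + u) = reflect h (- z) + b * u"
    using normalizes_right_affine[OF normalizes_mir[OF h], of "- z"] z by auto
  have "h (z - u) = h z - b * u" if "0 \<le> u" "u < e'" for u
    using b(3)[OF that] by (simp add: reflect_def)
  then have "has_slopes h z a b" unfolding has_slopes_def
    using a b(2) by (intro exI[of _ "min e e'"]) auto
  then show ?thesis using a(1) b(1) by blast
qed

theorem normalizes_in_P_set: assumes h: "normalizes h" shows "h \<in> P_set"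
proof (rule P_setI)
  show bh: "bij h" using h by (rule normalizes_bij)
  show "h ` dyadic \<subseteq> dyadic" using normalizes_dyadic[OF h] by auto
  show "locally_PL_dyadic h" unfolding locally_PL_dyadic_def
  proof
    fix z
    show "\<exists>a b. has_slopes h z a b \<and> \<bar>a\<bar> \<in> pow2 \<and> \<bar>b\<bar> \<in> pow2 \<and> (z \<notin> dyadic \<longrightarrow> a = b)"
    proof (cases "z \<in> dyadic")
      case True
      then obtain a b where "a \<in> pow2" "b \<in> pow2" "has_slopes h z a b" using normalizes_slopes_dyadic[OF h] by blast
      then show ?thesis using True pow2_pos[of a] pow2_pos[of b] by (intro exI[of _ a] exI[of _ b]) auto
    next
      case False
      obtain a e where a: "a \<in> pow2" "e > 0" "\<And>u. 0 \<le> u \<Longrightarrow> u < e \<Longrightarrow> h (0 + u) = h 0 + a * u"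
        using normalizes_right_affine[OF h dyadic_0] by blast
      \<comment> \<open>\<open>t\<close> is dyadic so that \<open>w\<close> remains non-dyadic: then
        \<open>g\<close> has a single slope at \<open>h w\<close>, and \<open>z\<close> is not a
        break of \<open>h\<close>.\<close>
      obtain t where t: "t \<in> dyadic" "- z < t" "t < e - z" using dyadic_dense[of "- z" "e - z"] a(2) by auto
      define w where "w = z + t"
      have w: "0 < w" "w < e" using t by (auto simp: w_def)
      have hw: "has_slopes h w a a" unfolding has_slopes_def
      proof (intro exI[of _ "min w (e - w)"] conjI allI impI)
        fix u assume u: "0 \<le> u \<and> u < min w (e - w)"
        show "h (w + u) = h w + a * u" using a(3)[of "w + u"] a(3)[of w] u w by (simp add: algebra_simps)
        show "h (w - u) = h w - a * u" using a(3)[of "w - u"] a(3)[of w] u w by (simp add: algebra_simps)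
      qed (use w in auto)
      obtain p q where pq: "p \<in> dyadic" "p < z" "q \<in> dyadic" "z < q"
        using dyadic_dense[of "z - 1" z] dyadic_dense[of z "z + 1"] by auto
      have "(\<lambda>x. 1 * x + t) \<in> P_plus" using t by (intro affine_in_P_plus) auto
      then obtain f where f: "f \<in> Fc" "\<And>x. p \<le> x \<Longrightarrow> x \<le> q \<Longrightarrow> f x = x + t"
        using Fc_extension[of "\<lambda>x. 1 * x + t" p q] pq by force
      have fs: "has_slopes f z 1 1" unfolding has_slopes_def
        by (intro exI[of _ "min (z - p) (q - z)"]) (use f(2) pq in auto)
      have fz: "f z = w" using f(2)[of z] pq by (simp add: w_def)
      define g where "g = finv (h \<circ> f \<circ> finv h)"
      have g: "g \<in> Fc" unfolding g_def using Fc_inv normalizes_conj[OF h f(1)] by blast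
      have bf: "bij f" using f(1) by (rule Fc_bij)
      have eq: "h = g \<circ> (h \<circ> f)" using bh bf by (simp add: g_def finv_comp bij_comp comp_assoc)
      have "w \<notin> dyadic" using dyadic_add_iff[OF t(1), of z] False by (simp add: w_def)
      then have "h w \<notin> dyadic" using normalizes_dyadic_iff[OF h] by simp
      then obtain c where c: "has_slopes g (h w) c c" "c \<in> pow2"
        using P_plusE[OF Fc_P_plus[OF g], of "h w"] by metis
      have "has_slopes (h \<circ> f) z (a * 1) (a * 1)"
        by (rule has_slopes_comp_pos[OF fs]) (use hw fz in auto)
      then have s: "has_slopes (h \<circ> f) z a a" by simp
      have "has_slopes (g \<circ> (h \<circ> f)) z (c * a) (c * a)"
        by (rule has_slopes_comp_pos[OF s]) (use c fz pow2_pos[OF a(1)] in auto)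
      then have "has_slopes h z (c * a) (c * a)" using eq by simp
      moreover have "c * a \<in> pow2" using a c by blast
      ultimately show ?thesis using pow2_pos[of "c * a"] by (intro exI[of _ "c * a"]) auto
    qed
  qed
qed

text \<open>A decreasing \<open>h\<close> is composed with \<open>uminus\<close>, which lies in
  \<open>P_set\<close> and normalizes \<open>Fc\<close>.\<close>

theorem normalizer_in_P_set:
  assumes bh: "bij h" and cont: "continuous_on UNIV h"
    and conj: "\<And>f. f \<in> Fc \<Longrightarrow> h \<circ> f \<circ> finv h \<in> Fc" "\<And>f. f \<in> Fc \<Longrightarrow> finv h \<circ> f \<circ> h \<in> Fc"
  shows "h \<in> P_set"
  using continuous_inj_cases[OF cont bij_is_inj[OF bh]]
proof
  assume "strict_mono h"
  then show ?thesis using bh conj by (intro normalizes_in_P_set) (simp add: normalizes_def)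
next
  assume anti: "strict_antimono_on UNIV h"
  let ?u = "uminus :: real \<Rightarrow> real"
  have bu: "bij ?u" using P_set_bij[OF uminus_in_P_set] .
  define k where "k = ?u \<circ> h"
  have "strict_mono k" using anti by (auto simp: strict_mono_def monotone_on_def k_def)
  moreover have bk: "bij k" unfolding k_def using bh bu by (rule bij_comp)
  moreover have ik: "finv k = finv h \<circ> ?u" unfolding k_def using finv_comp[OF bu bh] finv_uminus by simp
  moreover have "k \<circ> f \<circ> finv k \<in> Fc" if f: "f \<in> Fc" for f
    using Fc_conj[OF conj(1)[OF f] uminus_in_P_set] by (simp add: ik finv_uminus comp_assoc) (simp add: k_def comp_assoc)
  moreover have "finv k \<circ> f \<circ> k \<in> Fc" if f: "f \<in> Fc" for f
    using conj(2)[OF Fc_conj[OF f uminus_in_P_set]] by (simp add: ik finv_uminus comp_assoc) (simp add: k_def comp_assoc)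
  ultimately have "k \<in> P_set" by (intro normalizes_in_P_set) (simp add: normalizes_def)
  then have "?u \<circ> k \<in> P_set" by (rule P_set_comp[OF _ uminus_in_P_set])
  moreover have "?u \<circ> k = h" by (simp add: k_def fun_eq_iff)
  ultimately show ?thesis by simp
qed

section \<open>Commensurations\<close>

definition conj_by :: "(real \<Rightarrow> real) \<Rightarrow> (real \<Rightarrow> real) \<Rightarrow> real \<Rightarrow> real" where
  "conj_by h f = h \<circ> f \<circ> finv h"

lemma conj_by_comp: "bij h \<Longrightarrow> conj_by h (f \<circ> g) = conj_by h f \<circ> conj_by h g"
  by (simp add: conj_by_def comp_assoc)

lemma conj_by_cj: "bij h \<Longrightarrow> bij k \<Longrightarrow> conj_by k (conj_by h f) = conj_by (k \<circ> h) f"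
  by (simp add: conj_by_def finv_comp comp_assoc)

lemma conj_by_id [simp]: "conj_by id f = f"
  by (simp add: conj_by_def)

lemma conj_by_finv_left [simp]: "bij h \<Longrightarrow> conj_by (finv h) (conj_by h f) = f"
  by (simp add: conj_by_cj)

lemma conj_by_finv_right [simp]: "bij h \<Longrightarrow> conj_by h (conj_by (finv h) f) = f"
  by (simp add: conj_by_cj)

lemma conj_by_inv: "bij h \<Longrightarrow> bij f \<Longrightarrow> conj_by h (finv f) = finv (conj_by h f)"
  by (simp add: conj_by_def finv_comp bij_comp comp_assoc)

lemma conj_by_of_id [simp]: "bij h \<Longrightarrow> conj_by h id = id"
  by (simp add: conj_by_def)

lemma conj_by_P_set: "h \<in> P_set \<Longrightarrow> f \<in> P_set \<Longrightarrow> conj_by h f \<in> P_set"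
  unfolding conj_by_def by (intro P_set_comp P_set_inv)

lemma conj_by_Fc: "h \<in> P_set \<Longrightarrow> f \<in> Fc \<Longrightarrow> conj_by h f \<in> Fc"
  unfolding conj_by_def by (rule Fc_conj)

lemma conj_by_P_plus: assumes h: "h \<in> P_set" and f: "f \<in> P_plus" shows "conj_by h f \<in> P_plus"
proof -
  have bh: "bij h" using h by (rule P_set_bij)
  have f_less: "f x < f y \<longleftrightarrow> x < y" for x y using P_plus_less_iff[OF f] .
  have "strict_mono (conj_by h f)"
    using P_set_cases[OF h]
  proof
    assume m: "strict_mono h"
    then have "strict_mono (finv h)" using strict_mono_inv bh by blast
    then show ?thesis using m f_less by (simp add: strict_mono_def conj_by_def)
  next
    assume "strict_antimono_on UNIV h"
    then have a: "x < y \<Longrightarrow> h y < h x" for x y by (simp add: monotone_on_def)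
    have "finv h y < finv h x" if "x < y" for x y
      using a[of "finv h x" "finv h y"] that finv_right[OF bh, of x] finv_right[OF bh, of y] by (cases "finv h x" "finv h y" rule: linorder_cases) auto
    then show ?thesis using a f_less by (simp add: strict_mono_def conj_by_def)
  qed
  then show ?thesis using conj_by_P_set[OF h P_plus_P_set[OF f]] by (simp add: P_plus_def)
qed

lemma P_subgroup_cj: assumes A: "P_subgroup A" and h: "h \<in> P_set" shows "P_subgroup (conj_by h ` A)"
proof -
  have bh: "bij h" using h by (rule P_set_bij)
  show ?thesis unfolding P_subgroup_def
  proof (intro conjI ballI)
    show "conj_by h ` A \<subseteq> P_set" using conj_by_P_set[OF h] P_subgroup_P_set[OF A] by auto
    show "id \<in> conj_by h ` A" using P_subgroup_id[OF A] bh by (intro image_eqI[of _ _ id]) auto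
    fix f assume "f \<in> conj_by h ` A"
    then obtain x where x: "x \<in> A" "f = conj_by h x" by auto
    have "finv f = conj_by h (finv x)" using conj_by_inv[OF bh P_subgroup_bij[OF A x(1)]] x(2) by simp
    then show "finv f \<in> conj_by h ` A" using P_subgroup_inv[OF A x(1)] by (rule image_eqI)
    fix g assume "g \<in> conj_by h ` A"
    then obtain y where y: "y \<in> A" "g = conj_by h y" by auto
    have "f \<circ> g = conj_by h (x \<circ> y)" using conj_by_comp[OF bh] x(2) y(2) by simp
    then show "f \<circ> g \<in> conj_by h ` A" using P_subgroup_comp[OF A x(1) y(1)] by (rule image_eqI)
  qed
qed

lemma finite_index_cj: assumes G: "P_subgroup G" and A: "finite_index G A" and h: "h \<in> P_set" shows "finite_index (conj_by h ` G) (conj_by h ` A)"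
proof -
  have bh: "bij h" using h by (rule P_set_bij)
  obtain S where S: "finite S" "S \<subseteq> G" "\<And>g. g \<in> G \<Longrightarrow> \<exists>s\<in>S. g \<circ> finv s \<in> A"
    using A by (auto simp: finite_index_def)
  have "\<exists>s\<in>conj_by h ` S. g \<circ> finv s \<in> conj_by h ` A" if g: "g \<in> conj_by h ` G" for g
  proof -
    obtain x where x: "x \<in> G" "g = conj_by h x" using g by auto
    obtain s where s: "s \<in> S" "x \<circ> finv s \<in> A" using S(3)[OF x(1)] by blast
    have "conj_by h (x \<circ> finv s) = g \<circ> finv (conj_by h s)"
      using conj_by_comp[OF bh] conj_by_inv[OF bh, of s] P_subgroup_bij[OF G, of s] s(1) S(2) x(2) by auto
    then show ?thesis using s by (metis image_eqI)
  qed
  moreover have "finite (conj_by h ` S)" "conj_by h ` S \<subseteq> conj_by h ` G" using S(1,2) by auto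
  moreover have "conj_by h ` A \<subseteq> conj_by h ` G" using finite_index_subset[OF A] by auto
  ultimately show ?thesis using P_subgroup_cj[OF finite_index_psub[OF A] h] unfolding finite_index_def by blast
qed

text \<open>Elements with the same value of \<open>c\<close> lie in one coset, so one element chosen
  for each value yields the representatives.\<close>

lemma finite_index_by_class:
  assumes G: "P_subgroup G" and A: "P_subgroup A" "A \<subseteq> G" and fin: "finite (c ` G)"
    and c: "\<And>g g'. g \<in> G \<Longrightarrow> g' \<in> G \<Longrightarrow> c g = c g' \<Longrightarrow> g \<circ> finv g' \<in> A"
  shows "finite_index G A"
proof -
  define r where "r i = (SOME g. g \<in> G \<and> c g = i)" for i
  have r: "r (c g) \<in> G \<and> c (r (c g)) = c g" if "g \<in> G" for g
    unfolding r_def by (rule someI[of "\<lambda>x. x \<in> G \<and> c x = c g" g]) (use that in simp)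
  have "\<exists>s\<in>r ` c ` G. g \<circ> finv s \<in> A" if "g \<in> G" for g
    using r[OF that] c[OF that, of "r (c g)"] that by (intro bexI[of _ "r (c g)"]) auto
  moreover have "finite (r ` c ` G)" "r ` c ` G \<subseteq> G" using fin r by auto
  ultimately show ?thesis using A unfolding finite_index_def by blast
qed

section \<open>Shifts at the two ends and congruence subgroups\<close>

definition right_shift :: "(real \<Rightarrow> real) \<Rightarrow> int" where
  "right_shift f = (THE k. \<exists>M. \<forall>t>M. f t = t + of_int k)"

definition left_shift :: "(real \<Rightarrow> real) \<Rightarrow> int" where
  "left_shift f = (THE k. \<exists>M. \<forall>t<M. f t = t + of_int k)"

lemma right_shift_eq: assumes "\<And>t. t > M \<Longrightarrow> f t = t + of_int k" shows "right_shift f = k"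
  unfolding right_shift_def
proof (rule the_equality)
  show "\<exists>M. \<forall>t>M. f t = t + of_int k" using assms by blast
  fix j assume "\<exists>M. \<forall>t>M. f t = t + of_int j"
  then obtain N where N: "\<And>t. t > N \<Longrightarrow> f t = t + of_int j" by blast
  have "f (max M N + 1) = (max M N + 1) + of_int j" by (rule N) simp
  moreover have "f (max M N + 1) = (max M N + 1) + of_int k" by (rule assms) simp
  ultimately show "j = k" by simp
qed

lemma left_shift_eq: assumes "\<And>t. t < M \<Longrightarrow> f t = t + of_int k" shows "left_shift f = k"
  unfolding left_shift_def
proof (rule the_equality)
  show "\<exists>M. \<forall>t<M. f t = t + of_int k" using assms by blast
  fix j assume "\<exists>M. \<forall>t<M. f t = t + of_int j"
  then obtain N where N: "\<And>t. t < N \<Longrightarrow> f t = t + of_int j" by blast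
  have "f (min M N - 1) = (min M N - 1) + of_int j" by (rule N) simp
  moreover have "f (min M N - 1) = (min M N - 1) + of_int k" by (rule assms) simp
  ultimately show "j = k" by simp
qed

lemma thompson_F_shifts:
  assumes "f \<in> thompson_F"
  obtains M where "\<And>t. t > M \<Longrightarrow> f t = t + of_int (right_shift f)" "\<And>t. t < - M \<Longrightarrow> f t = t + of_int (left_shift f)"
proof -
  obtain l r M where f: "\<And>t. t > M \<Longrightarrow> f t = t + of_int r" "\<And>t. t < - M \<Longrightarrow> f t = t + of_int l"
    using thompson_FE[OF assms] by metis
  have "right_shift f = r" using f(1) by (rule right_shift_eq)
  moreover have "left_shift f = l" using f(2) by (rule left_shift_eq)
  ultimately show thesis using that f by blast
qed

lemma shift_comp: assumes f: "f \<in> thompson_F" and g: "g \<in> thompson_F"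
  shows "right_shift (f \<circ> g) = right_shift f + right_shift g" "left_shift (f \<circ> g) = left_shift f + left_shift g"
proof -
  obtain M where M: "\<And>t. t > M \<Longrightarrow> f t = t + of_int (right_shift f)" "\<And>t. t < - M \<Longrightarrow> f t = t + of_int (left_shift f)"
    using thompson_F_shifts[OF f] by blast
  obtain N where N: "\<And>t. t > N \<Longrightarrow> g t = t + of_int (right_shift g)" "\<And>t. t < - N \<Longrightarrow> g t = t + of_int (left_shift g)"
    using thompson_F_shifts[OF g] by blast
  show "right_shift (f \<circ> g) = right_shift f + right_shift g"
  proof (rule right_shift_eq)
    fix t assume t: "t > max N (M - of_int (right_shift g))"
    then show "(f \<circ> g) t = t + of_int (right_shift f + right_shift g)"
      using N(1)[of t] M(1)[of "t + of_int (right_shift g)"] by simp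
  qed
  show "left_shift (f \<circ> g) = left_shift f + left_shift g"
  proof (rule left_shift_eq)
    fix t assume t: "t < min (- N) (- M - of_int (left_shift g))"
    then show "(f \<circ> g) t = t + of_int (left_shift f + left_shift g)"
      using N(2)[of t] M(2)[of "t + of_int (left_shift g)"] by simp
  qed
qed

lemma shift_id [simp]: "right_shift id = 0" "left_shift id = 0"
  by (rule right_shift_eq[of 0] left_shift_eq[of 0]; simp)+

lemma shift_inv: assumes f: "f \<in> thompson_F" shows "right_shift (finv f) = - right_shift f" "left_shift (finv f) = - left_shift f"
  using shift_comp[OF f thompson_F_inv[OF f]] P_subgroup_bij[OF P_subgroup_thompson_F f] by auto

text \<open>Congruence subgroups for the two shift homomorphisms from \<open>thompson_F\<close> to
  the integers. Their index is finite because residues are, and together they cut out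
  \<open>Fc\<close>.\<close>

definition Fdiv :: "int \<Rightarrow> int \<Rightarrow> (real \<Rightarrow> real) set" where
  "Fdiv p p' = {f \<in> thompson_F. p dvd right_shift f \<and> p' dvd left_shift f}"

lemma finite_index_Fdiv: assumes "p \<noteq> 0" "p' \<noteq> 0" shows "finite_index thompson_F (Fdiv p p')"
proof (rule finite_index_by_class[of _ _ "\<lambda>f. (right_shift f mod \<bar>p\<bar>, left_shift f mod \<bar>p'\<bar>)"])
  show "P_subgroup (Fdiv p p')" unfolding P_subgroup_def
    using P_subgroup_thompson_F by (auto simp: P_subgroup_def Fdiv_def shift_comp shift_inv)
  have "(\<lambda>f. (right_shift f mod \<bar>p\<bar>, left_shift f mod \<bar>p'\<bar>)) ` thompson_F \<subseteq> {0..<\<bar>p\<bar>} \<times> {0..<\<bar>p'\<bar>}"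
    using assms by auto
  then show "finite ((\<lambda>f. (right_shift f mod \<bar>p\<bar>, left_shift f mod \<bar>p'\<bar>)) ` thompson_F)"
    by (rule finite_subset) simp
  fix g g' assume g: "g \<in> thompson_F" "g' \<in> thompson_F"
    "(right_shift g mod \<bar>p\<bar>, left_shift g mod \<bar>p'\<bar>) = (right_shift g' mod \<bar>p\<bar>, left_shift g' mod \<bar>p'\<bar>)"
  then have "\<bar>p\<bar> dvd right_shift g - right_shift g'" "\<bar>p'\<bar> dvd left_shift g - left_shift g'" by (simp_all add: mod_eq_dvd_iff)
  then show "g \<circ> finv g' \<in> Fdiv p p'"
    using g thompson_F_comp thompson_F_inv by (simp add: Fdiv_def shift_comp shift_inv)
qed (auto simp: P_subgroup_thompson_F Fdiv_def)

lemma Fc_eq_inter: assumes "f \<in> thompson_F" "\<And>p. p > 0 \<Longrightarrow> f \<in> Fdiv p p" shows "f \<in> Fc"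
proof -
  obtain M where M: "\<And>t. t > M \<Longrightarrow> f t = t + of_int (right_shift f)" "\<And>t. t < - M \<Longrightarrow> f t = t + of_int (left_shift f)"
    using thompson_F_shifts[OF assms(1)] by blast
  \<comment> \<open>This modulus exceeds both shifts in absolute value, so divisibility forces them
    to vanish.\<close>
  let ?p = "\<bar>right_shift f\<bar> + \<bar>left_shift f\<bar> + 1"
  have "?p dvd right_shift f" "?p dvd left_shift f" using assms(2)[of ?p] by (auto simp: Fdiv_def)
  then have "right_shift f = 0" "left_shift f = 0" using zdvd_imp_le[of ?p "\<bar>right_shift f\<bar>"] zdvd_imp_le[of ?p "\<bar>left_shift f\<bar>"] by force+
  then have "f t = t" if "\<bar>t\<bar> > \<bar>M\<bar>" for t using M[of t] that by (cases "t \<ge> 0") auto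
  then show ?thesis using thompson_F_P_plus[OF assms(1)] by (rule FcI[rotated])
qed

text \<open>If \<open>c\<close> moves \<open>x\<close>, a bump that moves \<open>x\<close> and fixes
  \<open>c x\<close> contradicts commutation.\<close>

lemma centralizer_Fc_trivial:
  assumes b: "bij c" and comm: "\<And>f. f \<in> Fc \<Longrightarrow> c \<circ> f = f \<circ> c" shows "c = id"
proof (rule ccontr)
  assume "c \<noteq> id"
  then obtain x where x: "c x \<noteq> x" by (auto simp: fun_eq_iff)
  obtain u v where uv: "u < x" "x < v" "c x \<le> u \<or> v \<le> c x"
  proof (cases "c x < x")
    case True
    then show ?thesis using that[of "c x" "x + 1"] by auto
  next
    case False
    then show ?thesis using that[of "x - 1" "c x"] x by auto
  qed
  obtain a d where ad: "a \<in> dyadic" "u < a" "a < x" "d \<in> dyadic" "x < d" "d < v"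
    using dyadic_dense[OF uv(1)] dyadic_dense[OF uv(2)] by blast
  then obtain f where f: "f \<in> Fc" "\<And>t. a < t \<Longrightarrow> t < d \<Longrightarrow> t < f t" "\<And>t. t \<le> a \<or> d \<le> t \<Longrightarrow> f t = t"
    using bump_exists[OF ad(1,4)] by auto
  have "f (c x) = c x" using f(3)[of "c x"] uv(3) ad by auto
  then have "c (f x) = c x" using comm_apply[OF comm[OF f(1)], of x] by simp
  then have "f x = x" using b by (metis finv_left)
  then show False using f(2)[of x] ad by simp
qed

lemma conj_by_eq_imp_eq:
  assumes h: "bij h" and k: "bij k" and eq: "\<And>f. f \<in> Fc \<Longrightarrow> conj_by h f = conj_by k f" shows "h = k"
proof -
  have "finv k \<circ> h = id"
  proof (rule centralizer_Fc_trivial)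
    show "bij (finv k \<circ> h)" using h k by (simp add: bij_comp)
    fix f assume f: "f \<in> Fc"
    have "finv k \<circ> (h \<circ> f \<circ> finv h) \<circ> h = finv k \<circ> (k \<circ> f \<circ> finv k) \<circ> h"
      using eq[OF f] by (simp add: conj_by_def)
    then show "finv k \<circ> h \<circ> f = f \<circ> (finv k \<circ> h)" using h k by (simp add: comp_assoc)
  qed
  then have "k \<circ> (finv k \<circ> h) = k" by simp
  then show ?thesis using k by simp
qed

theorem commensuration_is_conjugation:
  assumes A: "finite_index thompson_F A" and B: "finite_index thompson_F B" and bij: "bij_betw \<alpha> A B"
    and hom: "\<And>x y. x \<in> A \<Longrightarrow> y \<in> A \<Longrightarrow> \<alpha> (x \<circ> y) = \<alpha> x \<circ> \<alpha> y"
  shows "\<exists>h\<in>P_set. \<forall>x\<in>A. \<alpha> x = conj_by h x"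
proof -
  \<comment> \<open>The preimage under \<open>\<beta>\<close> of each \<open>Fdiv p p\<close> has
    finite index in \<open>thompson_F\<close> and so contains \<open>Fc\<close>. Hence
    \<open>\<beta>\<close> maps \<open>Fc\<close> into the intersection of all
    \<open>Fdiv p p\<close>, which is \<open>Fc\<close>.\<close>
  have into_Fc: "\<beta> ` Fc \<subseteq> Fc"
    if C: "finite_index thompson_F C" "finite_index thompson_F D" "\<And>x. x \<in> C \<Longrightarrow> \<beta> x \<in> D"
      "\<And>x y. x \<in> C \<Longrightarrow> y \<in> C \<Longrightarrow> \<beta> (x \<circ> y) = \<beta> x \<circ> \<beta> y" for C D \<beta>
  proof
    fix y assume "y \<in> \<beta> ` Fc"
    then obtain x where x: "x \<in> Fc" "y = \<beta> x" by auto
    have D: "\<beta> x \<in> thompson_F" if "x \<in> C" for x using C(3)[OF that] finite_index_subset[OF C(2)] by auto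
    have xC: "x \<in> C" using Fc_subset_finite_index[OF C(1)] x(1) by auto
    show "y \<in> Fc"
    proof (rule Fc_eq_inter)
      show "y \<in> thompson_F" using D xC x(2) by simp
      fix p :: int assume "p > 0"
      then have "finite_index thompson_F (Fdiv p p)" by (intro finite_index_Fdiv) auto
      then have "finite_index C {x \<in> C. \<beta> x \<in> Fdiv p p}"
        by (rule finite_index_vimage[OF finite_index_psub[OF C(1)] P_subgroup_thompson_F _ D C(4)])
      then have "finite_index thompson_F {x \<in> C. \<beta> x \<in> Fdiv p p}" by (rule finite_index_trans[OF P_subgroup_thompson_F C(1)])
      then have "x \<in> {x \<in> C. \<beta> x \<in> Fdiv p p}" using Fc_subset_finite_index x(1) by blast
      then show "y \<in> Fdiv p p" using x(2) by simp
    qed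
  qed
  have FcA: "Fc \<subseteq> A" and FcB: "Fc \<subseteq> B" using A B Fc_subset_finite_index by auto
  have pA: "P_subgroup A" and pB: "P_subgroup B" using A B by (auto simp: finite_index_psub)
  have \<alpha>B: "\<alpha> x \<in> B" if "x \<in> A" for x using bij that by (auto simp: bij_betw_def)
  have inj: "inj_on \<alpha> A" using bij by (simp add: bij_betw_def)
  define \<gamma> where "\<gamma> = the_inv_into A \<alpha>"
  have \<gamma>: "\<gamma> y \<in> A \<and> \<alpha> (\<gamma> y) = y" if "y \<in> B" for y
    using bij that f_the_inv_into_f_bij_betw[OF bij] the_inv_into_into[OF inj, of y A]
    by (auto simp: \<gamma>_def bij_betw_def)
  have \<gamma>\<alpha>: "\<gamma> (\<alpha> x) = x" if "x \<in> A" for x using the_inv_into_f_f[OF inj that] by (simp add: \<gamma>_def)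
  have \<gamma>hom: "\<gamma> (x \<circ> y) = \<gamma> x \<circ> \<gamma> y" if "x \<in> B" "y \<in> B" for x y
  proof -
    have "\<alpha> (\<gamma> x \<circ> \<gamma> y) = x \<circ> y" using hom \<gamma> that by simp
    moreover have "\<gamma> x \<circ> \<gamma> y \<in> A" using \<gamma> that P_subgroup_comp[OF pA] by simp
    ultimately show ?thesis using \<gamma>\<alpha> by metis
  qed
  have f1: "\<alpha> ` Fc \<subseteq> Fc" by (rule into_Fc[OF A B \<alpha>B hom])
  have f2: "\<gamma> ` Fc \<subseteq> Fc" by (rule into_Fc[OF B A _ \<gamma>hom]) (use \<gamma> in blast)
  have "Fc \<subseteq> \<alpha> ` Fc"
  proof
    fix y assume y: "y \<in> Fc"
    then have "\<gamma> y \<in> Fc" "\<alpha> (\<gamma> y) = y" using f2 \<gamma> FcB by auto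
    then show "y \<in> \<alpha> ` Fc" by (metis image_eqI)
  qed
  then have surj: "\<alpha> ` Fc = Fc" using f1 by blast
  then have "bij_betw \<alpha> Fc Fc" using inj_on_subset[OF inj FcA] by (simp add: bij_betw_def)
  then obtain h where h: "bij h" "continuous_on UNIV h" "\<And>f. f \<in> Fc \<Longrightarrow> \<alpha> f = conj_by h f"
    using automorphism_is_conjugation[of \<alpha>] hom FcA unfolding conj_by_def by (metis subsetD)
  have hP: "h \<in> P_set"
  proof (rule normalizer_in_P_set[OF h(1,2)])
    show "h \<circ> f \<circ> finv h \<in> Fc" if "f \<in> Fc" for f using h(3)[OF that] f1 that by (auto simp: conj_by_def)
    show "finv h \<circ> f \<circ> h \<in> Fc" if f: "f \<in> Fc" for f
    proof -
      obtain g where g: "g \<in> Fc" "f = \<alpha> g" using f surj by auto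
      then have "conj_by (finv h) f = g" using h by simp
      then show ?thesis using g(1) h(1) by (simp add: conj_by_def)
    qed
  qed
  \<comment> \<open>For \<open>g\<close> in \<open>Fc\<close>, conjugation by either side sends
    \<open>\<alpha> g\<close> to \<open>\<alpha> (conj_by x g)\<close>, and a bijection is
    determined by its conjugation action on \<open>Fc\<close>.\<close>
  have "\<alpha> x = conj_by h x" if x: "x \<in> A" for x
  proof (rule conj_by_eq_imp_eq)
    have bx: "bij x" using x P_subgroup_bij[OF pA] by blast
    have xP: "x \<in> P_set" using x P_subgroup_P_set[OF pA] by blast
    show b1: "bij (\<alpha> x)" using \<alpha>B[OF x] P_subgroup_bij[OF pB] by blast
    show "bij (conj_by h x)" using h(1) bx by (simp add: conj_by_def bij_comp)
    fix f assume f: "f \<in> Fc"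
    obtain g where g: "g \<in> Fc" "f = \<alpha> g" using f surj by auto
    have gA: "g \<in> A" using g FcA by auto
    have ix: "finv x \<in> A" using x P_subgroup_inv[OF pA] by blast
    have "\<alpha> id = id" using h(3)[OF id_in_Fc] h(1) by simp
    then have "\<alpha> x \<circ> \<alpha> (finv x) = id" using hom[OF x ix] bx by simp
    then have "finv (\<alpha> x) \<circ> (\<alpha> x \<circ> \<alpha> (finv x)) = finv (\<alpha> x)" by simp
    then have i: "\<alpha> (finv x) = finv (\<alpha> x)" using b1 by simp
    have "conj_by (\<alpha> x) f = \<alpha> (conj_by x g)"
      using hom[OF x gA] hom[OF P_subgroup_comp[OF pA x gA] ix] by (simp add: conj_by_def g(2) i)
    also have "\<dots> = conj_by h (conj_by x g)" using h(3) conj_by_Fc[OF xP g(1)] by blast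
    also have "\<dots> = conj_by (conj_by h x) (conj_by h g)"
      using h(1) bx by (simp add: conj_by_def finv_comp bij_comp comp_assoc)
    finally show "conj_by (\<alpha> x) f = conj_by (conj_by h x) f" using h(3) g by simp
  qed
  then show ?thesis using hP by blast
qed

section \<open>The relative commensurator and periodicity near the ends\<close>

abbreviation "relcomm \<equiv> relative_commensurator P_group thompson_F"

lemma conj_subgroup_eq: "h \<in> P_set \<Longrightarrow> conj_subgroup P_group A h = conj_by (finv h) ` A"
  using P_set_bij[of h] by (simp add: conj_subgroup_def P_group_inv conj_by_def)

lemma relcomm_iff:
  "h \<in> relcomm \<longleftrightarrow> h \<in> P_set \<and> finite_index thompson_F (thompson_F \<inter> conj_by (finv h) ` thompson_F) \<and>
     finite_index (conj_by (finv h) ` thompson_F) (thompson_F \<inter> conj_by (finv h) ` thompson_F)"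
proof (cases "h \<in> P_set")
  case True
  then show ?thesis
    using finite_index_iff[OF P_subgroup_thompson_F] finite_index_iff[OF P_subgroup_cj[OF P_subgroup_thompson_F P_set_inv[OF True]]]
    by (simp add: relative_commensurator_def conj_subgroup_eq)
qed (simp add: relative_commensurator_def)

lemma relcomm_P_set: "h \<in> relcomm \<Longrightarrow> h \<in> P_set"
  by (simp add: relcomm_iff)

lemma conj_by_image_inverse: "bij h \<Longrightarrow> conj_by (finv h) ` conj_by h ` A = A"
  by (simp add: image_comp comp_def)

text \<open>Together with \<open>relcommD\<close> this gives a description suited to
  commensurations: conjugation by \<open>h\<close> carries some subgroup of finite index onto
  another one. The conjugate of \<open>thompson_F\<close> in the definition is by the inverse of
  \<open>h\<close>, and it contains such an \<open>A\<close>.\<close>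

lemma relcommI:
  assumes h: "h \<in> P_set" and A: "finite_index thompson_F A" and B: "finite_index thompson_F (conj_by h ` A)"
  shows "h \<in> relcomm"
proof -
  let ?Fh = "conj_by (finv h) ` thompson_F"
  have bh: "bij h" using h by (rule P_set_bij)
  have pFh: "P_subgroup ?Fh" using P_subgroup_cj[OF P_subgroup_thompson_F P_set_inv[OF h]] .
  have "conj_by (finv h) ` conj_by h ` A \<subseteq> ?Fh" using finite_index_subset[OF B] by (rule image_mono)
  then have sub: "A \<subseteq> thompson_F \<inter> ?Fh" using finite_index_subset[OF A] conj_by_image_inverse[OF bh] by auto
  have p: "P_subgroup (thompson_F \<inter> ?Fh)" by (rule P_subgroup_inter[OF P_subgroup_thompson_F pFh])
  have "finite_index ?Fh A" using finite_index_cj[OF P_subgroup_thompson_F B P_set_inv[OF h]] conj_by_image_inverse[OF bh] by simp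
  then show ?thesis unfolding relcomm_iff
    using h finite_index_super[OF A sub _ p] finite_index_super[OF _ sub _ p] by blast
qed

lemma relcommD:
  assumes h: "h \<in> relcomm"
  obtains A where "finite_index thompson_F A" "finite_index thompson_F (conj_by h ` A)"
proof
  let ?Fh = "conj_by (finv h) ` thompson_F"
  have hP: "h \<in> P_set" using h by (rule relcomm_P_set)
  have bh: "bij h" using hP by (rule P_set_bij)
  show "finite_index thompson_F (thompson_F \<inter> ?Fh)" using h by (simp add: relcomm_iff)
  have "finite_index (conj_by h ` ?Fh) (conj_by h ` (thompson_F \<inter> ?Fh))"
    using h by (intro finite_index_cj hP P_subgroup_cj P_subgroup_thompson_F P_set_inv) (simp add: relcomm_iff)
  moreover have "conj_by h ` ?Fh = thompson_F" using conj_by_image_inverse[of "finv h"] bh by simp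
  ultimately show "finite_index thompson_F (conj_by h ` (thompson_F \<inter> ?Fh))" by simp
qed

text \<open>Single steps are legitimate only beyond \<open>M\<close>, so both end points have to lie
  there. A negative multiple is obtained by stepping forward from the other end, and a negative
  \<open>p\<close> by changing the signs of \<open>p\<close>, \<open>q\<close> and
  \<open>k\<close>.\<close>

lemma periodic_multiple:
  fixes h :: "real \<Rightarrow> real" and p q k :: int
  assumes per: "\<And>t. t > M \<Longrightarrow> h (t + of_int p) = h t + of_int q" and t: "t > M" "t + of_int p * of_int k > M"
  shows "h (t + of_int p * of_int k) = h t + of_int q * of_int k"
proof -
  have pos: "h (t + of_int p * real n) = h t + of_int q * real n"
    if per: "\<And>t. t > M \<Longrightarrow> h (t + of_int p) = h t + of_int q" and p: "p \<ge> 0" and t: "t > M"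
    for p q :: int and n t
  proof (induct n)
    case (Suc n)
    have "0 \<le> of_int p * real n" using p by simp
    then have "t + of_int p * real n > M" using t by linarith
    then have "h (t + of_int p * real n + of_int p) = h (t + of_int p * real n) + of_int q" by (rule per)
    then show ?case using Suc by (simp add: algebra_simps)
  qed simp
  have main: "h (t + of_int p * of_int k) = h t + of_int q * of_int k"
    if per: "\<And>t. t > M \<Longrightarrow> h (t + of_int p) = h t + of_int q" and p: "p \<ge> 0"
      and t: "t > M" "t + of_int p * of_int k > M" for p q k :: int and t
  proof (cases "k \<ge> 0")
    case True
    then show ?thesis using pos[OF per p t(1), of "nat k"] by simp
  next
    case False
    then have "h (t + of_int p * of_int k + of_int p * real (nat (- k))) =
        h (t + of_int p * of_int k) + of_int q * real (nat (- k))"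
      using pos[OF per p t(2)] by blast
    then show ?thesis using False by (simp add: algebra_simps)
  qed
  show ?thesis
  proof (cases "p \<ge> 0")
    case True
    then show ?thesis using main per t by blast
  next
    case False
    have "h (s + of_int (- p)) = h s + of_int (- q)" if "s > M" for s
    proof -
      have "s + of_int (- p) > M" using that False by simp
      then have "h (s + of_int (- p) + of_int p) = h (s + of_int (- p)) + of_int q" by (rule per)
      then show ?thesis by simp
    qed
    then show ?thesis using main[of "- p" "- q" t "- k"] False t by simp
  qed
qed

lemma periodic_multiple_left:
  fixes h :: "real \<Rightarrow> real" and p q k :: int
  assumes per: "\<And>t. t < - M \<Longrightarrow> h (t + of_int p) = h t + of_int q" and t: "t < - M" "t + of_int p * of_int k < - M"
  shows "h (t + of_int p * of_int k) = h t + of_int q * of_int k"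
proof -
  have "reflect h (- t + of_int (- p) * of_int k) = reflect h (- t) + of_int (- q) * of_int k"
  proof (rule periodic_multiple[of M])
    show "reflect h (s + of_int (- p)) = reflect h s + of_int (- q)" if "s > M" for s
      using per[of "- s"] that by (simp add: reflect_def)
  qed (use t in auto)
  then show ?thesis by (simp add: reflect_def add.commute)
qed

lemma P_set_ends:
  assumes h: "h \<in> P_set"
  shows "(\<forall>K. \<exists>M. \<forall>t. (t > M \<longrightarrow> h t > K) \<and> (t < - M \<longrightarrow> h t < - K)) \<or>
         (\<forall>K. \<exists>M. \<forall>t. (t > M \<longrightarrow> h t < - K) \<and> (t < - M \<longrightarrow> h t > K))"
  using P_set_cases[OF h]
proof
  have bh: "bij h" using h by (rule P_set_bij)
  assume m: "strict_mono h"
  have "(t > max (finv h K) (- finv h (- K)) \<longrightarrow> h t > K) \<and> (t < - max (finv h K) (- finv h (- K)) \<longrightarrow> h t < - K)" for t K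
    using strict_mono_less[OF m, of "finv h K" t] strict_mono_less[OF m, of t "finv h (- K)"] bh by auto
  then show ?thesis by blast
next
  have bh: "bij h" using h by (rule P_set_bij)
  assume "strict_antimono_on UNIV h"
  then have a: "x < y \<Longrightarrow> h y < h x" for x y by (simp add: monotone_on_def)
  have "(t > max (finv h (- K)) (- finv h K) \<longrightarrow> h t < - K) \<and> (t < - max (finv h (- K)) (- finv h K) \<longrightarrow> h t > K)" for t K
    using a[of "finv h (- K)" t] a[of t "finv h K"] bh by auto
  then show ?thesis by blast
qed

text \<open>Where \<open>f\<close> shifts by \<open>p * k\<close>, its conjugate shifts by the
  integer \<open>q * k\<close>. A decreasing \<open>h\<close> exchanges the two ends, hence the
  final case distinction.\<close>

lemma conj_by_Fdiv:
  fixes p q p' q' :: int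
  assumes h: "h \<in> P_set" and f: "f \<in> Fdiv p p'"
    and per: "\<And>t. t > M \<Longrightarrow> h (t + of_int p) = h t + of_int q"
      "\<And>t. t < - M \<Longrightarrow> h (t + of_int p') = h t + of_int q'"
  shows "conj_by h f \<in> thompson_F"
proof -
  have bh: "bij h" using h by (rule P_set_bij)
  have fF: "f \<in> thompson_F" using f by (simp add: Fdiv_def)
  obtain k k' where k: "right_shift f = p * k" "left_shift f = p' * k'" using f by (auto simp: Fdiv_def dvd_def)
  obtain N where N: "\<And>t. t > N \<Longrightarrow> f t = t + of_int (right_shift f)" "\<And>t. t < - N \<Longrightarrow> f t = t + of_int (left_shift f)"
    using thompson_F_shifts[OF fF] by blast
  define K where "K = \<bar>M\<bar> + \<bar>N\<bar> + \<bar>of_int (right_shift f)\<bar> + \<bar>of_int (left_shift f)\<bar>"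
  have R: "conj_by h f t = t + of_int (q * k)" if t: "finv h t > K" for t
  proof -
    let ?s = "finv h t"
    have s: "?s > N" "?s > M" "?s + of_int (right_shift f) > M" using t unfolding K_def by linarith+
    have "conj_by h f t = h (?s + of_int (right_shift f))" using N(1)[OF s(1)] by (simp add: conj_by_def)
    also have "\<dots> = h ?s + of_int q * of_int k"
      using periodic_multiple[of M h p q ?s k] per(1) s by (simp add: k)
    finally show ?thesis using bh by simp
  qed
  have L: "conj_by h f t = t + of_int (q' * k')" if t: "finv h t < - K" for t
  proof -
    let ?s = "finv h t"
    have s: "?s < - N" "?s < - M" "?s + of_int (left_shift f) < - M" using t unfolding K_def by linarith+
    have "conj_by h f t = h (?s + of_int (left_shift f))" using N(2)[OF s(1)] by (simp add: conj_by_def)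
    also have "\<dots> = h ?s + of_int q' * of_int k'"
      using periodic_multiple_left[of M h p' q' ?s k'] per(2) s by (simp add: k)
    finally show ?thesis using bh by simp
  qed
  have P: "conj_by h f \<in> P_plus" using conj_by_P_plus[OF h thompson_F_P_plus[OF fF]] .
  from P_set_ends[OF P_set_inv[OF h]] show ?thesis
  proof
    assume "\<forall>K. \<exists>M. \<forall>t. (t > M \<longrightarrow> finv h t > K) \<and> (t < - M \<longrightarrow> finv h t < - K)"
    then obtain M' where "\<And>t. t > M' \<Longrightarrow> finv h t > K" "\<And>t. t < - M' \<Longrightarrow> finv h t < - K" by blast
    then show ?thesis using R L by (intro thompson_FI[OF P, of M']) blast+
  next
    assume "\<forall>K. \<exists>M. \<forall>t. (t > M \<longrightarrow> finv h t < - K) \<and> (t < - M \<longrightarrow> finv h t > K)"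
    then obtain M' where "\<And>t. t > M' \<Longrightarrow> finv h t < - K" "\<And>t. t < - M' \<Longrightarrow> finv h t > K" by blast
    then show ?thesis using R L by (intro thompson_FI[OF P, of M']) blast+
  qed
qed

text \<open>Inversion exchanges periods and increments, and for a decreasing \<open>h\<close> also
  the two ends. This is where \<open>q\<close> and \<open>q'\<close> being non-zero enters.\<close>

lemma evt_periodic_inv:
  assumes h: "h \<in> P_set" and e: "eventually_integrally_periodically_affine h"
  shows "eventually_integrally_periodically_affine (finv h)"
proof -
  have bh: "bij h" using h by (rule P_set_bij)
  obtain p q p' q' :: int and M where M: "p \<noteq> 0" "q \<noteq> 0" "p' \<noteq> 0" "q' \<noteq> 0"
    "\<And>t. t > M \<Longrightarrow> h (t + of_int p) = h t + of_int q"
    "\<And>t. t < - M \<Longrightarrow> h (t + of_int p') = h t + of_int q'"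
    using e unfolding eventually_integrally_periodically_affine_def by blast
  have inv: "finv h (t + of_int b) = finv h t + of_int a"
    if "h (finv h t + of_int a) = h (finv h t) + of_int b" for t and a b :: int
  proof -
    have "finv h (h (finv h t + of_int a)) = finv h (t + of_int b)" using that bh by simp
    then show ?thesis using bh by simp
  qed
  from P_set_ends[OF P_set_inv[OF h]] show ?thesis
  proof
    assume "\<forall>K. \<exists>M. \<forall>t. (t > M \<longrightarrow> finv h t > K) \<and> (t < - M \<longrightarrow> finv h t < - K)"
    then obtain N where "\<And>t. t > N \<Longrightarrow> finv h t > M" "\<And>t. t < - N \<Longrightarrow> finv h t < - M" by blast
    then have "(\<forall>t>max N 1. finv h (t + of_int q) = finv h t + of_int p) \<and>
        (\<forall>t. t < - max N 1 \<longrightarrow> finv h (t + of_int q') = finv h t + of_int p')"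
      by (auto intro!: inv M(5,6))
    moreover have "max N 1 > 0" by simp
    ultimately show ?thesis unfolding eventually_integrally_periodically_affine_def using M(1-4) by blast
  next
    assume "\<forall>K. \<exists>M. \<forall>t. (t > M \<longrightarrow> finv h t < - K) \<and> (t < - M \<longrightarrow> finv h t > K)"
    then obtain N where "\<And>t. t > N \<Longrightarrow> finv h t < - M" "\<And>t. t < - N \<Longrightarrow> finv h t > M" by blast
    then have "(\<forall>t>max N 1. finv h (t + of_int q') = finv h t + of_int p') \<and>
        (\<forall>t. t < - max N 1 \<longrightarrow> finv h (t + of_int q) = finv h t + of_int p)"
      by (auto intro!: inv M(5,6))
    moreover have "max N 1 > 0" by simp
    ultimately show ?thesis unfolding eventually_integrally_periodically_affine_def using M(1-4) by blast
  qed
qed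

text \<open>A congruence subgroup is conjugated into \<open>thompson_F\<close> by \<open>h\<close>,
  and another one by the inverse of \<open>h\<close>; the second bounds the index on the side of the
  conjugate group.\<close>

lemma evt_periodic_relcomm:
  assumes h: "h \<in> P_set" and e: "eventually_integrally_periodically_affine h"
  shows "h \<in> relcomm"
proof -
  have ex: "\<exists>A. finite_index thompson_F A \<and> conj_by k ` A \<subseteq> thompson_F"
    if k: "k \<in> P_set" "eventually_integrally_periodically_affine k" for k
  proof -
    obtain p q p' q' :: int and M where M: "p \<noteq> 0" "p' \<noteq> 0"
      "\<And>t. t > M \<Longrightarrow> k (t + of_int p) = k t + of_int q"
      "\<And>t. t < - M \<Longrightarrow> k (t + of_int p') = k t + of_int q'"
      using k(2) unfolding eventually_integrally_periodically_affine_def by blast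
    then have "conj_by k ` Fdiv p p' \<subseteq> thompson_F" using conj_by_Fdiv[OF k(1)] by blast
    then show ?thesis using finite_index_Fdiv M(1,2) by blast
  qed
  have bh: "bij h" using h by (rule P_set_bij)
  obtain A where A: "finite_index thompson_F A" "conj_by h ` A \<subseteq> thompson_F" using ex[OF h e] by blast
  obtain B where B: "finite_index thompson_F B" "conj_by (finv h) ` B \<subseteq> thompson_F"
    using ex[OF P_set_inv[OF h] evt_periodic_inv[OF h e]] by blast
  let ?Fh = "conj_by (finv h) ` thompson_F"
  have pFh: "P_subgroup ?Fh" using P_subgroup_cj[OF P_subgroup_thompson_F P_set_inv[OF h]] .
  have p: "P_subgroup (thompson_F \<inter> ?Fh)" by (rule P_subgroup_inter[OF P_subgroup_thompson_F pFh])
  have "A \<subseteq> ?Fh" using image_mono[OF A(2), of "conj_by (finv h)"] conj_by_image_inverse[OF bh] by simp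
  then have "finite_index thompson_F (thompson_F \<inter> ?Fh)"
    using finite_index_super[OF A(1) _ _ p] finite_index_subset[OF A(1)] by blast
  moreover have "finite_index ?Fh (conj_by (finv h) ` B)" using finite_index_cj[OF P_subgroup_thompson_F B(1) P_set_inv[OF h]] .
  then have "finite_index ?Fh (thompson_F \<inter> ?Fh)"
    using finite_index_super[OF _ _ _ p] finite_index_subset B(2) by blast
  ultimately show ?thesis using h by (simp add: relcomm_iff)
qed

lemma relcomm_evt_periodic:
  assumes h: "h \<in> relcomm" shows "eventually_integrally_periodically_affine h"
proof -
  have hP: "h \<in> P_set" using h by (rule relcomm_P_set)
  have bh: "bij h" using hP by (rule P_set_bij)
  obtain A where A: "finite_index thompson_F A" "finite_index thompson_F (conj_by h ` A)" using relcommD[OF h] .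
  \<comment> \<open>The translation found here lies in \<open>A\<close>. Its length \<open>m\<close>
    serves as period at both ends, and the shifts of its conjugate by \<open>h\<close> are the
    increments.\<close>
  obtain n where n: "n > 0" "\<And>j x. x \<in> thompson_F \<Longrightarrow> x \<circ> translation (int n * j) \<circ> finv x \<in> A"
    using power_translation_in_core[OF A(1)] by blast
  define m where "m = int n"
  have m: "m \<noteq> 0" using n(1) by (simp add: m_def)
  have "translation m \<in> A" using n(2)[OF P_subgroup_id[OF P_subgroup_thompson_F], of 1] by (simp add: m_def)
  define g where "g = conj_by h (translation m)"
  have "g \<in> thompson_F" using \<open>translation m \<in> A\<close> finite_index_subset[OF A(2)] by (auto simp: g_def)
  then obtain M where M: "\<And>t. t > M \<Longrightarrow> g t = t + of_int (right_shift g)" "\<And>t. t < - M \<Longrightarrow> g t = t + of_int (left_shift g)"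
    using thompson_F_shifts by blast
  have gh: "h (t + of_int m) = g (h t)" for t using bh by (simp add: g_def conj_by_def translation_def)
  \<comment> \<open>\<open>h\<close> is injective, so adding \<open>m\<close> to the argument cannot
    leave the value unchanged.\<close>
  have nz: "r \<noteq> 0" if "h (t + of_int m) = h t + of_int r" for t and r :: int
  proof
    assume "r = 0"
    then have "h (t + of_int m) = h t" using that by simp
    then have "t + of_int m = t" using bh by (metis finv_left)
    then show False using m by simp
  qed
  have concl: ?thesis
    if N: "\<And>t. t > N \<Longrightarrow> h (t + of_int m) = h t + of_int r" "\<And>t. t < - N \<Longrightarrow> h (t + of_int m) = h t + of_int l"
    for N and r l :: int
  proof -
    have "r \<noteq> 0" "l \<noteq> 0" using nz[OF N(1)[of "N + 1"]] nz[OF N(2)[of "- N - 1"]] by simp_all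
    moreover have "(\<forall>t>max N 1. h (t + of_int m) = h t + of_int r) \<and>
        (\<forall>t. t < - max N 1 \<longrightarrow> h (t + of_int m) = h t + of_int l)"
      using N by simp
    moreover have "max N 1 > 0" by simp
    ultimately show ?thesis unfolding eventually_integrally_periodically_affine_def using m by blast
  qed
  from P_set_ends[OF hP] show ?thesis
  proof
    assume "\<forall>K. \<exists>M. \<forall>t. (t > M \<longrightarrow> h t > K) \<and> (t < - M \<longrightarrow> h t < - K)"
    then obtain N where "\<And>t. t > N \<Longrightarrow> h t > M" "\<And>t. t < - N \<Longrightarrow> h t < - M" by blast
    then show ?thesis by (intro concl[of N "right_shift g" "left_shift g"]) (simp_all add: gh M)
  next
    assume "\<forall>K. \<exists>M. \<forall>t. (t > M \<longrightarrow> h t < - K) \<and> (t < - M \<longrightarrow> h t > K)"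
    then obtain N where "\<And>t. t > N \<Longrightarrow> h t < - M" "\<And>t. t < - N \<Longrightarrow> h t > M" by blast
    then show ?thesis by (intro concl[of N "left_shift g" "right_shift g"]) (simp_all add: gh M)
  qed
qed

section \<open>The abstract commensurator\<close>

abbreviation "Fgrp \<equiv> P_group\<lparr>carrier := thompson_F\<rparr>"

lemma commensuration_iff:
  "(A, \<alpha>, B) \<in> commensurations Fgrp \<longleftrightarrow>
     finite_index thompson_F A \<and> finite_index thompson_F B \<and> (\<exists>h\<in>P_set. (\<forall>x\<in>A. \<alpha> x = conj_by h x) \<and> B = conj_by h ` A)"
proof -
  have iso: "\<alpha> \<in> iso (Fgrp\<lparr>carrier := A\<rparr>) (Fgrp\<lparr>carrier := B\<rparr>) \<longleftrightarrow>
      (\<forall>x\<in>A. \<forall>y\<in>A. \<alpha> (x \<circ> y) = \<alpha> x \<circ> \<alpha> y) \<and> bij_betw \<alpha> A B"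
    by (auto simp: iso_def hom_def bij_betw_def)
  have "(\<forall>x\<in>A. \<forall>y\<in>A. \<alpha> (x \<circ> y) = \<alpha> x \<circ> \<alpha> y) \<and> bij_betw \<alpha> A B \<longleftrightarrow>
      (\<exists>h\<in>P_set. (\<forall>x\<in>A. \<alpha> x = conj_by h x) \<and> B = conj_by h ` A)"
    if AB: "finite_index thompson_F A" "finite_index thompson_F B"
  proof
    assume a: "(\<forall>x\<in>A. \<forall>y\<in>A. \<alpha> (x \<circ> y) = \<alpha> x \<circ> \<alpha> y) \<and> bij_betw \<alpha> A B"
    then obtain h where h: "h \<in> P_set" "\<forall>x\<in>A. \<alpha> x = conj_by h x"
      using commensuration_is_conjugation[OF AB, of \<alpha>] by blast
    moreover have "B = \<alpha> ` A" using a by (simp add: bij_betw_def)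
    then have "B = conj_by h ` A" using h(2) by simp
    ultimately show "\<exists>h\<in>P_set. (\<forall>x\<in>A. \<alpha> x = conj_by h x) \<and> B = conj_by h ` A" by blast
  next
    assume "\<exists>h\<in>P_set. (\<forall>x\<in>A. \<alpha> x = conj_by h x) \<and> B = conj_by h ` A"
    then obtain h where h: "h \<in> P_set" "\<And>x. x \<in> A \<Longrightarrow> \<alpha> x = conj_by h x" "B = conj_by h ` A" by blast
    have bh: "bij h" using h(1) by (rule P_set_bij)
    have "inj_on \<alpha> A"
      by (rule inj_on_inverseI[of _ "conj_by (finv h)"]) (use h(2) bh in simp)
    moreover have "\<alpha> ` A = B" using h by simp
    moreover have "\<alpha> (x \<circ> y) = \<alpha> x \<circ> \<alpha> y" if "x \<in> A" "y \<in> A" for x y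
      using h(2) that P_subgroup_comp[OF finite_index_psub[OF AB(1)] that] conj_by_comp[OF bh] by simp
    ultimately show "(\<forall>x\<in>A. \<forall>y\<in>A. \<alpha> (x \<circ> y) = \<alpha> x \<circ> \<alpha> y) \<and> bij_betw \<alpha> A B"
      by (simp add: bij_betw_def)
  qed
  then show ?thesis unfolding commensurations_def using iso finite_index_iff[OF P_subgroup_thompson_F] by auto
qed

definition conjugator :: "(real \<Rightarrow> real) commensuration \<Rightarrow> real \<Rightarrow> real" where
  "conjugator c = (SOME h. h \<in> P_set \<and> (\<forall>x\<in>fst c. fst (snd c) x = conj_by h x))"

text \<open>Every subgroup of finite index contains \<open>Fc\<close>, and conjugation on
  \<open>Fc\<close> determines the element. Agreement on any such \<open>K\<close> is therefore
  enough, which is why equivalent commensurations share their conjugator.\<close>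

lemma conjugator_unique:
  assumes c: "(A, \<alpha>, B) \<in> commensurations Fgrp" and h: "h \<in> P_set"
    and K: "finite_index thompson_F K" "K \<subseteq> A" "\<And>x. x \<in> K \<Longrightarrow> \<alpha> x = conj_by h x"
  shows "conjugator (A, \<alpha>, B) = h"
proof -
  obtain k where "k \<in> P_set \<and> (\<forall>x\<in>A. \<alpha> x = conj_by k x)" using c by (auto simp: commensuration_iff)
  then have c: "conjugator (A, \<alpha>, B) \<in> P_set \<and> (\<forall>x\<in>A. \<alpha> x = conj_by (conjugator (A, \<alpha>, B)) x)"
    unfolding conjugator_def fst_conv snd_conv
    by (rule someI[of "\<lambda>h. h \<in> P_set \<and> (\<forall>x\<in>A. \<alpha> x = conj_by h x)"])
  show ?thesis
  proof (rule conj_by_eq_imp_eq)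
    show "bij (conjugator (A, \<alpha>, B))" "bij h" using c h P_set_bij by blast+
    fix f assume "f \<in> Fc"
    then have f: "f \<in> K" using Fc_subset_finite_index[OF K(1)] by blast
    then have "\<alpha> f = conj_by (conjugator (A, \<alpha>, B)) f" using c K(2) by blast
    then have "conj_by (conjugator (A, \<alpha>, B)) f = \<alpha> f" by (rule sym)
    also have "\<dots> = conj_by h f" using K(3)[OF f] .
    finally show "conj_by (conjugator (A, \<alpha>, B)) f = conj_by h f" .
  qed
qed

lemma conjugator:
  assumes c: "(A, \<alpha>, B) \<in> commensurations Fgrp"
  shows "conjugator (A, \<alpha>, B) \<in> relcomm" "\<And>x. x \<in> A \<Longrightarrow> \<alpha> x = conj_by (conjugator (A, \<alpha>, B)) x"
    "B = conj_by (conjugator (A, \<alpha>, B)) ` A"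
proof -
  obtain h where h: "finite_index thompson_F A" "finite_index thompson_F B" "h \<in> P_set" "\<And>x. x \<in> A \<Longrightarrow> \<alpha> x = conj_by h x" "B = conj_by h ` A"
    using c by (auto simp: commensuration_iff)
  have e: "conjugator (A, \<alpha>, B) = h" using conjugator_unique[OF c h(3,1) subset_refl h(4)] .
  show "conjugator (A, \<alpha>, B) \<in> relcomm" unfolding e using relcommI[OF h(3,1)] h(2,5) by simp
  show "\<And>x. x \<in> A \<Longrightarrow> \<alpha> x = conj_by (conjugator (A, \<alpha>, B)) x" "B = conj_by (conjugator (A, \<alpha>, B)) ` A"
    unfolding e using h by blast+
qed

lemma conjugator_surj:
  assumes h: "h \<in> relcomm" shows "\<exists>c\<in>commensurations Fgrp. conjugator c = h"
proof -
  obtain A where A: "finite_index thompson_F A" "finite_index thompson_F (conj_by h ` A)" using relcommD[OF h] .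
  have c: "(A, conj_by h, conj_by h ` A) \<in> commensurations Fgrp"
    using A relcomm_P_set[OF h] unfolding commensuration_iff by blast
  then have "conjugator (A, conj_by h, conj_by h ` A) = h"
    using conjugator_unique[OF c relcomm_P_set[OF h] A(1) subset_refl] by blast
  then show ?thesis using c by blast
qed

text \<open>One direction is \<open>conjugator_unique\<close>; in the other, the two maps agree on
  the intersection of their domains.\<close>

lemma commens_rel_iff:
  "(c, c') \<in> commens_rel Fgrp \<longleftrightarrow>
     c \<in> commensurations Fgrp \<and> c' \<in> commensurations Fgrp \<and> conjugator c = conjugator c'"
proof -
  obtain A \<alpha> B where c: "c = (A, \<alpha>, B)" by (metis prod_cases3)
  obtain A' \<alpha>' B' where c': "c' = (A', \<alpha>', B')" by (metis prod_cases3)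
  have "(\<exists>K. finite_index thompson_F K \<and> K \<subseteq> A \<inter> A' \<and> (\<forall>x\<in>K. \<alpha> x = \<alpha>' x)) \<longleftrightarrow> conjugator c = conjugator c'"
    if C: "(A, \<alpha>, B) \<in> commensurations Fgrp" "(A', \<alpha>', B') \<in> commensurations Fgrp"
  proof
    assume "\<exists>K. finite_index thompson_F K \<and> K \<subseteq> A \<inter> A' \<and> (\<forall>x\<in>K. \<alpha> x = \<alpha>' x)"
    then obtain K where K: "finite_index thompson_F K" "K \<subseteq> A" "K \<subseteq> A'" "\<And>x. x \<in> K \<Longrightarrow> \<alpha> x = \<alpha>' x" by blast
    show "conjugator c = conjugator c'" unfolding c
    proof (rule conjugator_unique[OF C(1) _ K(1,2)])
      show "conjugator c' \<in> P_set" unfolding c' using conjugator(1)[OF C(2)] by (rule relcomm_P_set)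
      show "\<alpha> x = conj_by (conjugator c') x" if "x \<in> K" for x
        unfolding c' using K(4)[OF that] conjugator(2)[OF C(2), of x] K(3) that by (metis subsetD)
    qed
  next
    assume e: "conjugator c = conjugator c'"
    have "finite_index thompson_F (A \<inter> A')" using C by (intro finite_index_inter P_subgroup_thompson_F) (auto simp: commensuration_iff)
    moreover have "\<alpha> x = \<alpha>' x" if "x \<in> A \<inter> A'" for x
      using conjugator(2)[OF C(1), of x] conjugator(2)[OF C(2), of x] that e by (simp add: c c')
    ultimately show "\<exists>K. finite_index thompson_F K \<and> K \<subseteq> A \<inter> A' \<and> (\<forall>x\<in>K. \<alpha> x = \<alpha>' x)" by blast
  qed
  then show ?thesis unfolding c c' commens_rel_def using finite_index_iff[OF P_subgroup_thompson_F] by auto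
qed

lemma commens_comp_conjugator:
  assumes a: "a \<in> commensurations Fgrp" and b: "b \<in> commensurations Fgrp"
  shows "commens_comp b a \<in> commensurations Fgrp" "conjugator (commens_comp b a) = conjugator b \<circ> conjugator a"
proof -
  obtain A \<alpha> B where a': "a = (A, \<alpha>, B)" by (metis prod_cases3)
  obtain C \<beta> D where b': "b = (C, \<beta>, D)" by (metis prod_cases3)
  define h where "h = conjugator a"
  define k where "k = conjugator b"
  have h: "h \<in> P_set" "\<And>x. x \<in> A \<Longrightarrow> \<alpha> x = conj_by h x" "B = conj_by h ` A"
    using conjugator[of A \<alpha> B] a relcomm_P_set by (auto simp: h_def a')
  have k: "k \<in> P_set" "\<And>x. x \<in> C \<Longrightarrow> \<beta> x = conj_by k x" "D = conj_by k ` C"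
    using conjugator[of C \<beta> D] b relcomm_P_set by (auto simp: k_def b')
  have bh: "bij h" and bk: "bij k" using h k by (auto simp: P_set_bij)
  have fi: "finite_index thompson_F A" "finite_index thompson_F B" "finite_index thompson_F C" "finite_index thompson_F D"
    using a b by (auto simp: a' b' commensuration_iff)
  let ?A = "{x \<in> A. \<alpha> x \<in> B \<inter> C}"
  have A: "?A = {x \<in> A. conj_by h x \<in> C}" using h by auto
  have "finite_index A {x \<in> A. conj_by h x \<in> C}"
    by (rule finite_index_vimage[OF finite_index_psub[OF fi(1)] P_subgroup_thompson_F fi(3)])
       (use h(3) finite_index_subset[OF fi(2)] conj_by_comp[OF bh] in auto)
  then have fA: "finite_index thompson_F ?A" unfolding A by (rule finite_index_trans[OF P_subgroup_thompson_F fi(1)])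
  \<comment> \<open>Rewriting the image as a preimage under conjugation by the inverse of
    \<open>k\<close> makes \<open>finite_index_vimage\<close> applicable.\<close>
  have "\<beta> ` (B \<inter> C) = {y \<in> D. conj_by (finv k) y \<in> B}"
  proof (intro equalityI subsetI)
    fix y assume "y \<in> \<beta> ` (B \<inter> C)"
    then obtain x where x: "x \<in> B" "x \<in> C" "y = \<beta> x" by auto
    then have "y = conj_by k x" using k(2) by simp
    then show "y \<in> {y \<in> D. conj_by (finv k) y \<in> B}" using x k(3) bk by simp
  next
    fix y assume "y \<in> {y \<in> D. conj_by (finv k) y \<in> B}"
    then obtain x where x: "x \<in> C" "y = conj_by k x" "conj_by (finv k) y \<in> B" using k(3) by auto
    then have "x \<in> B \<inter> C" using bk by simp
    moreover have "y = \<beta> x" using k(2) x by simp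
    ultimately show "y \<in> \<beta> ` (B \<inter> C)" by blast
  qed
  moreover have "finite_index D {y \<in> D. conj_by (finv k) y \<in> B}"
  proof (rule finite_index_vimage[OF finite_index_psub[OF fi(4)] P_subgroup_thompson_F fi(2)])
    show "conj_by (finv k) x \<in> thompson_F" if "x \<in> D" for x using that k(3) bk finite_index_subset[OF fi(3)] by auto
  qed (use conj_by_comp bk in simp)
  ultimately have fB: "finite_index thompson_F (\<beta> ` (B \<inter> C))" using finite_index_trans[OF P_subgroup_thompson_F fi(4)] by simp
  have kh: "k \<circ> h \<in> P_set" using h(1) k(1) by (rule P_set_comp)
  have eq: "(\<beta> \<circ> \<alpha>) x = conj_by (k \<circ> h) x" if "x \<in> ?A" for x
    using that h(2)[of x] k(2)[of "\<alpha> x"] conj_by_cj[OF bh bk] by simp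
  have "\<alpha> ` ?A = B \<inter> C" using h(2,3) by force
  then have im: "\<beta> ` (B \<inter> C) = conj_by (k \<circ> h) ` ?A" using eq by (metis (no_types, lifting) image_comp image_cong)
  have comp: "commens_comp b a = (?A, \<beta> \<circ> \<alpha>, \<beta> ` (B \<inter> C))" by (simp add: a' b')
  show c: "commens_comp b a \<in> commensurations Fgrp" unfolding comp commensuration_iff
    using fA fB kh eq im by blast
  show "conjugator (commens_comp b a) = conjugator b \<circ> conjugator a"
    using conjugator_unique[OF c[unfolded comp] kh fA subset_refl eq] by (simp only: comp h_def k_def)
qed

theorem abstract_commensurator_iso_relcomm:
  "abstract_commensurator Fgrp \<cong> P_group\<lparr>carrier := relcomm\<rparr>"
proof -
  let ?C = "commensurations Fgrp" and ?R = "commens_rel Fgrp"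
  \<comment> \<open>An arbitrary representative is picked; by \<open>commens_rel_iff\<close> all of
    them have the same conjugator.\<close>
  define \<Phi> where "\<Phi> Y = conjugator (SOME c. c \<in> Y)" for Y
  have cls: "?R `` {c} = {c' \<in> ?C. conjugator c' = conjugator c}" if "c \<in> ?C" for c
    using that by (auto simp: commens_rel_iff)
  have \<Phi>: "\<Phi> (?R `` {c}) = conjugator c" if c: "c \<in> ?C" for c
  proof -
    have "c \<in> ?R `` {c}" using c by (simp add: cls)
    then have "(SOME c'. c' \<in> ?R `` {c}) \<in> ?R `` {c}" by (rule someI)
    then show ?thesis using c by (simp add: \<Phi>_def cls)
  qed
  \<comment> \<open>All terms of the union coincide, because the class of a composite depends only
    on the two conjugators.\<close>
  have mult: "(\<Union>b\<in>?R `` {d}. \<Union>a\<in>?R `` {c}. ?R `` {commens_comp b a}) = ?R `` {commens_comp d c}"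
    if cd: "c \<in> ?C" "d \<in> ?C" for c d
  proof -
    have "?R `` {commens_comp b a} = ?R `` {commens_comp d c}" if "b \<in> ?R `` {d}" "a \<in> ?R `` {c}" for a b
      using that cd by (simp add: cls commens_comp_conjugator)
    moreover have "d \<in> ?R `` {d}" "c \<in> ?R `` {c}" using cd by (simp_all add: cls)
    ultimately show ?thesis by blast
  qed
  have "\<Phi> \<in> iso (abstract_commensurator Fgrp) (P_group\<lparr>carrier := relcomm\<rparr>)"
  proof (rule isoI)
    show "\<Phi> \<in> hom (abstract_commensurator Fgrp) (P_group\<lparr>carrier := relcomm\<rparr>)"
    proof (rule homI)
      fix X assume "X \<in> carrier (abstract_commensurator Fgrp)"
      then obtain c where c: "c \<in> ?C" "X = ?R `` {c}" by (auto simp: abstract_commensurator_def elim: quotientE)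
      obtain A \<alpha> B where "c = (A, \<alpha>, B)" by (metis prod_cases3)
      then show "\<Phi> X \<in> carrier (P_group\<lparr>carrier := relcomm\<rparr>)" using c \<Phi> conjugator(1) by simp
      fix Y assume "Y \<in> carrier (abstract_commensurator Fgrp)"
      then obtain d where d: "d \<in> ?C" "Y = ?R `` {d}" by (auto simp: abstract_commensurator_def elim: quotientE)
      have "X \<otimes>\<^bsub>abstract_commensurator Fgrp\<^esub> Y = ?R `` {commens_comp c d}"
        using mult[OF d(1) c(1)] c(2) d(2) by (simp add: abstract_commensurator_def)
      then show "\<Phi> (X \<otimes>\<^bsub>abstract_commensurator Fgrp\<^esub> Y) = \<Phi> X \<otimes>\<^bsub>P_group\<lparr>carrier := relcomm\<rparr>\<^esub> \<Phi> Y"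
        using c d commens_comp_conjugator[OF d(1) c(1)] by (simp add: \<Phi>)
    qed
    show "bij_betw \<Phi> (carrier (abstract_commensurator Fgrp)) (carrier (P_group\<lparr>carrier := relcomm\<rparr>))"
    proof (rule bij_betw_imageI)
      show "inj_on \<Phi> (carrier (abstract_commensurator Fgrp))"
      proof (rule inj_onI)
        fix X Y assume "X \<in> carrier (abstract_commensurator Fgrp)" "Y \<in> carrier (abstract_commensurator Fgrp)"
          and e: "\<Phi> X = \<Phi> Y"
        then obtain c d where cd: "c \<in> ?C" "X = ?R `` {c}" "d \<in> ?C" "Y = ?R `` {d}"
          by (auto simp: abstract_commensurator_def elim!: quotientE)
        then show "X = Y" using e by (simp add: \<Phi>) (simp add: cls)
      qed
      show "\<Phi> ` carrier (abstract_commensurator Fgrp) = carrier (P_group\<lparr>carrier := relcomm\<rparr>)"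
      proof (intro equalityI subsetI)
        fix h assume "h \<in> \<Phi> ` carrier (abstract_commensurator Fgrp)"
        then obtain c where c: "c \<in> ?C" "h = \<Phi> (?R `` {c})"
          by (auto simp: abstract_commensurator_def elim!: quotientE)
        obtain A \<alpha> B where "c = (A, \<alpha>, B)" by (metis prod_cases3)
        then show "h \<in> carrier (P_group\<lparr>carrier := relcomm\<rparr>)" using c \<Phi> conjugator(1) by simp
      next
        fix h assume "h \<in> carrier (P_group\<lparr>carrier := relcomm\<rparr>)"
        then have "h \<in> relcomm" by simp
        then obtain c where c: "c \<in> ?C" "conjugator c = h" using conjugator_surj by blast
        then have "?R `` {c} \<in> carrier (abstract_commensurator Fgrp)"
          by (simp add: abstract_commensurator_def quotientI)
        then show "h \<in> \<Phi> ` carrier (abstract_commensurator Fgrp)" using \<Phi>[OF c(1)] c(2) by (metis image_eqI)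
      qed
    qed
  qed
  then show ?thesis by (rule is_isoI)
qed

theorem theorem3p1:
  shows "abstract_commensurator (P_group\<lparr>carrier := thompson_F\<rparr>)
           \<cong> P_group\<lparr>carrier := relative_commensurator P_group thompson_F\<rparr>
       \<and> relative_commensurator P_group thompson_F
           = {f \<in> P_set. eventually_integrally_periodically_affine f}"
  using abstract_commensurator_iso_relcomm relcomm_evt_periodic evt_periodic_relcomm relcomm_P_set
  by blast

end
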